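(* Let $W$ be a finite irreducible Coxeter group of rank $n\geq 2$ with set of fundamental reflections $R=\{r_1,r_2,\ldots,r_n\}$ and longest element $w_0$, and let $\mathcal{P}(W)$ be the set of pendant elements of $W$. (i) Suppose $w_0\in \mathrm{Z}(W)$. (This occurs if and only if $W$ is of type $\mathrm{B}_n$, type $\mathrm{D}_n$ with $n$ even, type $\mathrm{F}_4$, $\mathrm{H}_3$, $\mathrm{H}_4$, $\mathrm{E}_7$ or $\mathrm{E}_8$, or type $\mathrm{I}_2(m)$ with $m$ even.) Then $\mathcal{P}(W)=\{w_0r \mid r\in R\}$. (ii) If $W$ is of type $\mathrm{A}_n$ with $n\geq 2$, then, setting $J=\{1,2,\ldots,\lceil n/2\rceil\}$, \[\mathcal{P}(W)=\big\{w_0[i\nearrow (n+1-i)],\; w_0[(n+1-i)\searrow i] \;\big|\; i\in J\big\}.\] (iii) If $W$ is of type $\mathrm{D}_n$ with $n$ odd, then \[\mathcal{P}(W)=\big\{w_0r_i,\; w_0r_nr_{n-2}r_{n-1},\; w_0r_{n-1}r_{n-2}r_n \;\big|\; i\in\{1,\dots,n-2\}\big\}.\] (iv) If $W$ is of type $\mathrm{E}_6$, then \[\mathcal{P}(W)=\{w_0r_2,\; w_0r_4,\; w_0r_5r_4r_3,\; w_0r_3r_4r_5,\; w_0r_6r_5r_4r_3r_1,\; w_0r_1r_3r_4r_5r_6\}.\] (v) If $W$ is of type $\mathrm{I}_2(m)$ with $m$ odd and $m\geq 5$, then $\mathcal{P}(W)=\{w_0r_1r_2,\; w_0r_2r_1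\}$.
   Context: $\ell$ is the length function of $W$ with respect to $R$; $\mathcal{I}(W)$ is the set of elements of $W$ of order exactly $2$; $\mathrm{Z}(W)$ is the centre of $W$. For $x\in\mathcal{I}(W)$, $\Delta_1(x)=\{y\in\mathcal{I}(W) : \ell(xy)=\ell(x)+\ell(y)\}$ (the neighbours of $x$ in the excess zero graph). A pendant element is a $w\in\mathcal{I}(W)$ with $|\Delta_1(w)|=1$; $\mathcal{P}(W)$ is the set of these. For $i\le j$, $[i\nearrow j]=r_ir_{i+1}\cdots r_{j-1}r_j$ and $[j\searrow i]=r_jr_{j-1}\cdots r_{i+1}r_i$. Labelling of diagrams: in type $\mathrm{A}_n$ the nodes $1,2,\ldots,n$ form a path in this order. In type $\mathrm{D}_n$ the nodes $1,2,\ldots,n-2$ form a path in this order, and nodes $n-1$ and $n$ are each joined to node $n-2$ (and to no other node). In type $\mathrm{E}_6$ the nodes $1,3,4,5,6$ form a path in this order and node $2$ is joined to node $4$ only. All edges in these three types have $m_{ij}=3$. In type $\mathrm{I}_2(m)$, $R=\{r_1,r_2\}$ with $r_1r_2$ of order $m$. *)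

theory Defs
  imports Complex_Main "HOL-Algebra.Algebra"
begin

definition word_prod :: "('a, 'b) monoid_scheme \<Rightarrow> 'a list \<Rightarrow> 'a" where
  "word_prod W ws = foldr (\<otimes>\<^bsub>W\<^esub>) ws \<one>\<^bsub>W\<^esub>"

text \<open>
  The congruence on words over \<open>R\<close> generated by \<open>(st)^m(s,t) = 1\<close> for \<open>s, t \<in> R\<close>, where
  \<open>m(s,t)\<close> is the order of \<open>st\<close> in \<open>W\<close>. For \<open>s = t\<close> this is \<open>ss = 1\<close>, so every letter is its own
  inverse and words without formal inverses suffice for a group presentation. The library's
  \<^const>\<open>group.ord\<close> is 0 for elements of infinite order, and then the relation is void, as it
  should be.
\<close>

inductive coxeter_equiv ::
    "('a, 'b) monoid_scheme \<Rightarrow> 'a set \<Rightarrow> 'a list \<Rightarrow> 'a list \<Rightarrow> bool" for W R where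
  refl: "us \<in> lists R \<Longrightarrow> coxeter_equiv W R us us"
| sym: "coxeter_equiv W R us vs \<Longrightarrow> coxeter_equiv W R vs us"
| trans: "coxeter_equiv W R us vs \<Longrightarrow> coxeter_equiv W R vs ws \<Longrightarrow> coxeter_equiv W R us ws"
| rel: "us \<in> lists R \<Longrightarrow> vs \<in> lists R \<Longrightarrow> s \<in> R \<Longrightarrow> t \<in> R \<Longrightarrow>
    coxeter_equiv W R (us @ concat (replicate (group.ord W (s \<otimes>\<^bsub>W\<^esub> t)) [s, t]) @ vs) (us @ vs)"

text \<open>
  \<open>W\<close> is a Coxeter group with set \<open>R\<close> of fundamental reflections: \<open>R\<close> is a generating set of
  elements of order 2, and the relations \<open>(st)^m(s,t) = 1\<close> form a presentation of \<open>W\<close>.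
\<close>

definition coxeter_system :: "('a, 'b) monoid_scheme \<Rightarrow> 'a set \<Rightarrow> bool" where
  "coxeter_system W R \<longleftrightarrow>
     group W \<and> R \<subseteq> carrier W \<and> (\<forall>s\<in>R. group.ord W s = 2) \<and> generate W R = carrier W \<and>
     (\<forall>us\<in>lists R. \<forall>vs\<in>lists R. word_prod W us = word_prod W vs \<longleftrightarrow> coxeter_equiv W R us vs)"

text \<open>
  The edges of the Coxeter graph join distinct \<open>s, t \<in> R\<close> with \<open>m(s,t) \<noteq> 2\<close>; a Coxeter system is
  irreducible if this graph is connected.
\<close>

definition coxeter_edges :: "('a, 'b) monoid_scheme \<Rightarrow> 'a set \<Rightarrow> ('a \<times> 'a) set" where
  "coxeter_edges W R = {(s, t). s \<in> R \<and> t \<in> R \<and> s \<noteq> t \<and> group.ord W (s \<otimes>\<^bsub>W\<^esub> t) \<noteq> 2}"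

definition irreducible_coxeter :: "('a, 'b) monoid_scheme \<Rightarrow> 'a set \<Rightarrow> bool" where
  "irreducible_coxeter W R \<longleftrightarrow> R \<noteq> {} \<and> (\<forall>s\<in>R. \<forall>t\<in>R. (s, t) \<in> (coxeter_edges W R)\<^sup>*)"

definition cox_length :: "('a, 'b) monoid_scheme \<Rightarrow> 'a set \<Rightarrow> 'a \<Rightarrow> nat" where
  "cox_length W R w = (LEAST k. \<exists>ws\<in>lists R. length ws = k \<and> word_prod W ws = w)"

definition longest_element :: "('a, 'b) monoid_scheme \<Rightarrow> 'a set \<Rightarrow> 'a \<Rightarrow> bool" where
  "longest_element W R w0 \<longleftrightarrow>
     w0 \<in> carrier W \<and> (\<forall>w\<in>carrier W. cox_length W R w \<le> cox_length W R w0)"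

definition center :: "('a, 'b) monoid_scheme \<Rightarrow> 'a set" where
  "center W = {z \<in> carrier W. \<forall>w\<in>carrier W. z \<otimes>\<^bsub>W\<^esub> w = w \<otimes>\<^bsub>W\<^esub> z}"

definition involutions :: "('a, 'b) monoid_scheme \<Rightarrow> 'a set" where
  "involutions W = {x \<in> carrier W. group.ord W x = 2}"

definition neighbours :: "('a, 'b) monoid_scheme \<Rightarrow> 'a set \<Rightarrow> 'a \<Rightarrow> 'a set" where
  "neighbours W R x =
     {y \<in> involutions W. cox_length W R (x \<otimes>\<^bsub>W\<^esub> y) = cox_length W R x + cox_length W R y}"

definition pendants :: "('a, 'b) monoid_scheme \<Rightarrow> 'a set \<Rightarrow> 'a set" where
  "pendants W R = {w \<in> involutions W. card (neighbours W R w) = 1}"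

text \<open>
  A diagram on the nodes \<open>1, ..., n\<close> is given by its matrix. The matrices below are defined for all
  indices and used only on \<open>{1..n}\<close>; \<open>sym_matrix f\<close> takes the label of \<open>i < j\<close> from \<open>f i j\<close>.
\<close>

definition sym_matrix :: "(nat \<Rightarrow> nat \<Rightarrow> nat) \<Rightarrow> nat \<Rightarrow> nat \<Rightarrow> nat" where
  "sym_matrix f i j = (if i = j then 1 else f (min i j) (max i j))"

definition type_A :: "nat \<Rightarrow> nat \<Rightarrow> nat" where
  "type_A = sym_matrix (\<lambda>i j. if j = i + 1 then 3 else 2)"

definition type_B :: "nat \<Rightarrow> nat \<Rightarrow> nat \<Rightarrow> nat" where
  "type_B n = sym_matrix (\<lambda>i j. if j = i + 1 then (if j = n then 4 else 3) else 2)"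

definition type_D :: "nat \<Rightarrow> nat \<Rightarrow> nat \<Rightarrow> nat" where
  "type_D n = sym_matrix (\<lambda>i j.
     if (j = i + 1 \<and> j \<le> n - 1) \<or> (i = n - 2 \<and> j = n) then 3 else 2)"

text \<open>Restricting to the nodes \<open>1, ..., n\<close> with \<open>n = 6, 7, 8\<close> gives \<open>E_6\<close>, \<open>E_7\<close>, \<open>E_8\<close>.\<close>

definition type_E :: "nat \<Rightarrow> nat \<Rightarrow> nat" where
  "type_E = sym_matrix (\<lambda>i j.
     if (i, j) \<in> {(1, 3), (2, 4), (3, 4), (4, 5), (5, 6), (6, 7), (7, 8)} then 3 else 2)"

definition type_F :: "nat \<Rightarrow> nat \<Rightarrow> nat" where
  "type_F = sym_matrix (\<lambda>i j. if j = i + 1 then (if i = 2 then 4 else 3) else 2)"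

definition type_H :: "nat \<Rightarrow> nat \<Rightarrow> nat" where
  "type_H = sym_matrix (\<lambda>i j. if j = i + 1 then (if i = 1 then 5 else 3) else 2)"

definition type_I2 :: "nat \<Rightarrow> nat \<Rightarrow> nat \<Rightarrow> nat" where
  "type_I2 m = sym_matrix (\<lambda>i j. m)"

text \<open>
  \<open>labelled_type\<close> says that the given labelling \<open>r 1, ..., r n\<close> of the fundamental reflections is
  that of the diagram, \<open>has_type\<close> that some labelling is.
\<close>

definition labelled_type ::
    "('a, 'b) monoid_scheme \<Rightarrow> (nat \<Rightarrow> 'a) \<Rightarrow> nat \<Rightarrow> (nat \<Rightarrow> nat \<Rightarrow> nat) \<Rightarrow> bool" where
  "labelled_type W r n M \<longleftrightarrow>
     (\<forall>i\<in>{1..n}. \<forall>j\<in>{1..n}. group.ord W (r i \<otimes>\<^bsub>W\<^esub> r j) = M i j)"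

definition has_type ::
    "('a, 'b) monoid_scheme \<Rightarrow> 'a set \<Rightarrow> nat \<Rightarrow> (nat \<Rightarrow> nat \<Rightarrow> nat) \<Rightarrow> bool" where
  "has_type W R n M \<longleftrightarrow> (\<exists>q. bij_betw q {1..n} R \<and> labelled_type W q n M)"

definition ascending :: "('a, 'b) monoid_scheme \<Rightarrow> (nat \<Rightarrow> 'a) \<Rightarrow> nat \<Rightarrow> nat \<Rightarrow> 'a" where
  "ascending W r i j = word_prod W (map r [i..<Suc j])"

definition descending :: "('a, 'b) monoid_scheme \<Rightarrow> (nat \<Rightarrow> 'a) \<Rightarrow> nat \<Rightarrow> nat \<Rightarrow> 'a" where
  "descending W r j i = word_prod W (map r (rev [i..<Suc j]))"

end

theory Submission
  imports Defs
begin

text \<open>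
  Multiplication by \<open>w\<^sub>0\<close> turns a neighbour of \<open>w\<close> into an involutory prefix (in the weak order) of
  \<open>x = ww\<^sub>0\<close>. So \<open>w\<close> is pendant iff \<open>x\<close> has exactly one such prefix, necessarily a fundamental
  reflection \<open>a\<close>, and \<open>w\<close> being an involution means that conjugation by \<open>w\<^sub>0\<close>, a diagram automorphism
  \<open>\<delta>\<close>, maps \<open>x\<close> to its inverse. If \<open>\<delta>\<close> is trivial, \<open>x\<close> is itself an involution, hence \<open>x = a\<close>.
  Otherwise one grows \<open>x\<close> letter by letter: no letter commuting with \<open>a\<close> can be moved to the front and
  \<open>a\<close> cannot recur, which leaves few words, and the last letter of \<open>x\<close> must be \<open>\<delta> a\<close>. The diagrams that
  occur are found with the positive definite form of the geometric representation.
\<close>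

section \<open>Words, length and exchange\<close>

text \<open>The group is known only through its presentation, so the exchange condition, the
  reflection representations over the reals and over the integers, and the parity characters all
  come from one device: the letters act on a set, and every \<open>(st)^m\<close> is checked to act
  trivially. The diagram alone does not determine \<delta>: types A, D and E6 have symmetries, and
  whether \<delta> is one of them is a matter of arithmetic. In simply laced types w0 acts as
  -\<delta> on the root lattice, while W acts trivially on weights modulo roots, so an integer
  vector annihilated by the Cartan matrix modulo k yields a congruence for \<delta>. Where even
  labels separate the nodes, a parity character serves instead. The listed words do have a single
  involutory prefix because their letters are distinct and neighbouring letters do not commute: such
  a word is the only reduced word of its element, its prefixes are initial segments, and an
  involutory one would be a palindrome of distinct letters.\<close>

lemma (in monoid) word_prod_Nil [simp]: "word_prod G [] = \<one>"
  by (simp add: word_prod_def)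

lemma (in monoid) word_prod_Cons [simp]: "word_prod G (s # ws) = s \<otimes> word_prod G ws"
  by (simp add: word_prod_def)

lemma (in monoid) word_prod_closed [simp]: "set ws \<subseteq> carrier G \<Longrightarrow> word_prod G ws \<in> carrier G"
  by (induction ws) auto

lemma (in monoid) word_prod_append:
  "set us \<subseteq> carrier G \<Longrightarrow> set vs \<subseteq> carrier G \<Longrightarrow>
    word_prod G (us @ vs) = word_prod G us \<otimes> word_prod G vs"
  by (induction us) (auto simp: m_assoc)

locale coxeter =
  fixes W :: "('a, 'b) monoid_scheme" (structure) and R :: "'a set"
  assumes cox: "coxeter_system W R"
begin

sublocale group W
  using cox by (simp add: coxeter_system_def)

abbreviation wp :: "'a list \<Rightarrow> 'a" where "wp \<equiv> word_prod W"
abbreviation len :: "'a \<Rightarrow> nat" where "len \<equiv> cox_length W R"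

lemma R_sub: "R \<subseteq> carrier W"
  using cox by (simp add: coxeter_system_def)

lemma R_closed [simp]: "s \<in> R \<Longrightarrow> s \<in> carrier W"
  using R_sub by auto

lemma lists_closed: "set ws \<subseteq> R \<Longrightarrow> set ws \<subseteq> carrier W"
  using R_sub by auto

lemma wp_closed [simp]: "set ws \<subseteq> R \<Longrightarrow> wp ws \<in> carrier W"
  by (rule word_prod_closed[OF lists_closed])

lemma wp_append [simp]: "set us \<subseteq> R \<Longrightarrow> set vs \<subseteq> R \<Longrightarrow> wp (us @ vs) = wp us \<otimes> wp vs"
  by (rule word_prod_append[OF lists_closed lists_closed])

lemma wp_single [simp]: "s \<in> R \<Longrightarrow> wp [s] = s"
  by simp

lemma ord_R: "s \<in> R \<Longrightarrow> ord s = 2"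
  using cox by (simp add: coxeter_system_def)

lemma R_sq [simp]: "s \<in> R \<Longrightarrow> s \<otimes> s = \<one>"
proof -
  assume s: "s \<in> R"
  then have "s [^] (2::nat) = \<one>"
    using pow_ord_eq_1[of s] ord_R[of s] by simp
  with s show ?thesis by (simp add: numeral_2_eq_2)
qed

lemma R_sq' [simp]: "s \<in> R \<Longrightarrow> x \<in> carrier W \<Longrightarrow> s \<otimes> (s \<otimes> x) = x"
  by (simp flip: m_assoc)

lemma R_sq'' [simp]: "s \<in> R \<Longrightarrow> x \<in> carrier W \<Longrightarrow> x \<otimes> s \<otimes> s = x"
  by (simp add: m_assoc)

lemma inv_R [simp]: "s \<in> R \<Longrightarrow> inv s = s"
  by (simp add: inv_equality)

lemma l_inv' [simp]: "x \<in> carrier W \<Longrightarrow> y \<in> carrier W \<Longrightarrow> inv x \<otimes> (x \<otimes> y) = y"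
  by (simp flip: m_assoc)

lemma r_inv' [simp]: "x \<in> carrier W \<Longrightarrow> y \<in> carrier W \<Longrightarrow> x \<otimes> (inv x \<otimes> y) = y"
  by (simp flip: m_assoc)

lemma one_notin_R: "\<one> \<notin> R"
  using ord_R[of \<one>] by auto

lemma R_neq_one [simp]: "s \<in> R \<Longrightarrow> s \<noteq> \<one>"
  using one_notin_R by auto

lemma wp_rev: "set ws \<subseteq> R \<Longrightarrow> wp (rev ws) = inv (wp ws)"
  by (induction ws) (auto simp: inv_mult_group)

lemma ex_word: "w \<in> carrier W \<Longrightarrow> \<exists>ws. set ws \<subseteq> R \<and> wp ws = w"
proof -
  assume "w \<in> carrier W"
  then have "w \<in> generate W R"
    using cox by (simp add: coxeter_system_def)
  then show ?thesis
  proof (induction rule: generate.induct)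
    case one
    then show ?case by (intro exI[of _ "[]"]) auto
  next
    case (incl h)
    then show ?case by (intro exI[of _ "[h]"]) auto
  next
    case (inv h)
    then show ?case by (intro exI[of _ "[h]"]) auto
  next
    case (eng h1 h2)
    then obtain us vs where "set us \<subseteq> R" "set vs \<subseteq> R" "wp us = h1" "wp vs = h2" by auto
    then show ?case by (intro exI[of _ "us @ vs"]) auto
  qed
qed

lemma equiv_iff:
  "set us \<subseteq> R \<Longrightarrow> set vs \<subseteq> R \<Longrightarrow> wp us = wp vs \<longleftrightarrow> coxeter_equiv W R us vs"
  using cox by (simp add: coxeter_system_def lists_eq_set)

text \<open>The universal property of the presentation, for actions on a set.\<close>

lemma foldr_action_eq:
  fixes f :: "'a \<Rightarrow> 'x \<Rightarrow> 'x"
  assumes maps: "\<And>s x. s \<in> R \<Longrightarrow> x \<in> S \<Longrightarrow> f s x \<in> S"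
    and rel: "\<And>s t x. s \<in> R \<Longrightarrow> t \<in> R \<Longrightarrow> x \<in> S \<Longrightarrow> ((f s \<circ> f t) ^^ ord (s \<otimes> t)) x = x"
    and us: "set us \<subseteq> R" and vs: "set vs \<subseteq> R" and eq: "wp us = wp vs" and x: "x \<in> S"
  shows "foldr f us x = foldr f vs x"
proof -
  have maps': "set ws \<subseteq> R \<Longrightarrow> x \<in> S \<Longrightarrow> foldr f ws x \<in> S" for ws x
    by (induction ws) (auto intro: maps)
  have conc: "foldr f (concat (replicate k [s, t])) = (f s \<circ> f t) ^^ k" for k s t
    by (induction k) (auto simp: fun_eq_iff)
  have "coxeter_equiv W R us vs"
    using us vs eq by (simp add: equiv_iff)
  then show ?thesis
    using x
  proof (induction arbitrary: x rule: coxeter_equiv.induct)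
    case (rel us vs s t)
    then show ?case
      using assms(2)[of s t "foldr f vs x"] maps'[of vs x] by (simp add: conc lists_eq_set)
  qed auto
qed

lemma ex_reduced:
  assumes "w \<in> carrier W"
  shows "\<exists>ws. set ws \<subseteq> R \<and> wp ws = w \<and> length ws = len w"
proof -
  have "\<exists>k. \<exists>ws. set ws \<subseteq> R \<and> length ws = k \<and> wp ws = w"
    using ex_word[OF assms] by blast
  from LeastI_ex[OF this] show ?thesis
    by (auto simp: cox_length_def lists_eq_set Bex_def)
qed

lemma len_le: "set ws \<subseteq> R \<Longrightarrow> len (wp ws) \<le> length ws"
  unfolding cox_length_def lists_eq_set by (rule Least_le) auto

lemma len_one [simp]: "len \<one> = 0"
  using len_le[of "[]"] by simp

lemma len_eq_0_iff [simp]: "w \<in> carrier W \<Longrightarrow> len w = 0 \<longleftrightarrow> w = \<one>"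
  using ex_reduced[of w] by auto

lemma len_R [simp]: "s \<in> R \<Longrightarrow> len s = 1"
  using len_le[of "[s]"] len_eq_0_iff[of s] by (cases "len s") auto

lemma len_eq_1: "w \<in> carrier W \<Longrightarrow> len w = 1 \<Longrightarrow> w \<in> R"
  using ex_reduced[of w] by (auto simp: length_Suc_conv)

lemma len_inv [simp]: "w \<in> carrier W \<Longrightarrow> len (inv w) = len w"
proof -
  have le: "len (inv w) \<le> len w" if w: "w \<in> carrier W" for w
  proof -
    obtain ws where "set ws \<subseteq> R" "wp ws = w" "length ws = len w"
      using ex_reduced[OF w] by auto
    then show ?thesis
      using len_le[of "rev ws"] by (auto simp: wp_rev)
  qed
  assume "w \<in> carrier W"
  then show ?thesis
    using le[of w] le[of "inv w"] by simp
qed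

lemma len_mult_le: "x \<in> carrier W \<Longrightarrow> y \<in> carrier W \<Longrightarrow> len (x \<otimes> y) \<le> len x + len y"
proof -
  assume "x \<in> carrier W" "y \<in> carrier W"
  then obtain us vs where "set us \<subseteq> R" "wp us = x" "length us = len x"
      "set vs \<subseteq> R" "wp vs = y" "length vs = len y"
    using ex_reduced[of x] ex_reduced[of y] by blast
  then show ?thesis
    using len_le[of "us @ vs"] by simp
qed

subsection \<open>Inversions and the exchange condition\<close>

text \<open>
  Bourbaki's action of \<open>W\<close> on signed elements. The sign acquired by \<open>t\<close> under the action of \<open>w\<close>
  tells whether the reflection \<open>t\<close> satisfies \<open>\<ell>(wt) < \<ell>(w)\<close>.
\<close>

definition signed_conj :: "'a \<Rightarrow> 'a \<times> bool \<Rightarrow> 'a \<times> bool" where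
  "signed_conj s = (\<lambda>(t, e). (s \<otimes> t \<otimes> s, e \<noteq> (t = s)))"

lemma signed_conj_apply: "signed_conj s (t, e) = (s \<otimes> t \<otimes> s, e \<noteq> (t = s))"
  by (simp add: signed_conj_def)

definition inversion :: "'a \<Rightarrow> 'a \<Rightarrow> bool" where
  "inversion w t \<longleftrightarrow> snd (foldr signed_conj (SOME ws. set ws \<subseteq> R \<and> wp ws = w) (t, False))"

text \<open>The letters of \<open>(st)^k\<close> act from the right. The letter in position j,
  counted from 0, flips the sign exactly when the conjugate reached so far equals that letter, which
  unwinds to u being the dihedral reflection \<open>t (st)^j\<close>. The sign thus records the
  parity of the number of occurrences of u in the list t, tst, tstst, ... of length 2k.\<close>

lemma signed_conj_power:
  assumes s: "s \<in> R" and t: "t \<in> R" and u: "u \<in> carrier W"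
  shows "((signed_conj s \<circ> signed_conj t) ^^ k) (u, e) =
    ((s \<otimes> t) [^] k \<otimes> u \<otimes> inv ((s \<otimes> t) [^] k),
     e \<noteq> odd (card {j. j < 2 * k \<and> u = t \<otimes> (s \<otimes> t) [^] j}))"
proof (induction k)
  case 0
  then show ?case using u by simp
next
  case (Suc k)
  define p where "p = s \<otimes> t"
  have p: "p \<in> carrier W" using s t by (simp add: p_def)
  define g where "g = p [^] k"
  have g: "g \<in> carrier W" using p by (simp add: g_def)
  \<comment> \<open>Conjugation by t inverts the rotation p; this is what turns an alternating
    palindrome into t times a power of p.\<close>
  have tg: "t \<otimes> p [^] j = inv (p [^] j) \<otimes> t" for j :: nat
  proof (induction j)
    case (Suc j)
    have inv_p: "inv p = t \<otimes> s" using s t by (simp add: p_def inv_mult_group)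
    have "t \<otimes> p [^] Suc j = (t \<otimes> p [^] j) \<otimes> p" using p t by (simp add: m_assoc)
    also have "\<dots> = inv (p [^] j) \<otimes> (t \<otimes> (s \<otimes> t))" using p t s Suc by (simp add: m_assoc p_def)
    also have "\<dots> = inv (p [^] j) \<otimes> inv p \<otimes> t" using p t s by (simp add: m_assoc inv_p)
    also have "inv (p [^] j) \<otimes> inv p = inv (p [^] Suc j)"
      using p by (metis inv_mult_group nat_pow_Suc2 nat_pow_closed)
    finally show ?case .
  qed (use t in simp)
  have conj_iff: "g \<otimes> u \<otimes> inv g = v \<longleftrightarrow> u = inv g \<otimes> v \<otimes> g" if "v \<in> carrier W" for v
    using u g that by (metis inv_closed inv_solve_left inv_solve_right m_assoc m_closed)
  \<comment> \<open>\<open>e1\<close> and \<open>e2\<close> translate the conditions for the two new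
    letters, in positions 2k and 2k + 1, into the corresponding entries of the list.\<close>
  have e1: "g \<otimes> u \<otimes> inv g = t \<longleftrightarrow> u = t \<otimes> p [^] (2 * k)"
  proof -
    have "inv g \<otimes> t \<otimes> g = t \<otimes> g \<otimes> g" using tg[of k] by (simp add: g_def)
    also have "\<dots> = t \<otimes> p [^] (2 * k)"
      using p t by (simp add: g_def m_assoc nat_pow_mult mult_2)
    finally show ?thesis using conj_iff[of t] t by simp
  qed
  have e2: "t \<otimes> (g \<otimes> u \<otimes> inv g) \<otimes> t = s \<longleftrightarrow> u = t \<otimes> p [^] (2 * k + 1)"
  proof -
    have "t \<otimes> (g \<otimes> u \<otimes> inv g) \<otimes> t = s \<longleftrightarrow> g \<otimes> u \<otimes> inv g = t \<otimes> s \<otimes> t"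
    proof
      assume "t \<otimes> (g \<otimes> u \<otimes> inv g) \<otimes> t = s"
      then have "t \<otimes> s \<otimes> t = t \<otimes> (t \<otimes> (g \<otimes> u \<otimes> inv g) \<otimes> t) \<otimes> t" by simp
      then show "g \<otimes> u \<otimes> inv g = t \<otimes> s \<otimes> t" using t u g by (simp add: m_assoc)
    next
      assume "g \<otimes> u \<otimes> inv g = t \<otimes> s \<otimes> t"
      then show "t \<otimes> (g \<otimes> u \<otimes> inv g) \<otimes> t = s" using s t u g by (simp add: m_assoc)
    qed
    also have "\<dots> \<longleftrightarrow> u = inv g \<otimes> (t \<otimes> p) \<otimes> g"
      using conj_iff[of "t \<otimes> s \<otimes> t"] s t by (simp add: p_def m_assoc)
    also have "inv g \<otimes> (t \<otimes> p) \<otimes> g = (inv g \<otimes> t) \<otimes> (p \<otimes> g)" using g p t by (simp add: m_assoc)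
    also have "\<dots> = t \<otimes> g \<otimes> (p \<otimes> g)" using tg[of k] by (simp add: g_def)
    also have "\<dots> = t \<otimes> p [^] (2 * k + 1)"
    proof -
      have "g \<otimes> (p \<otimes> g) = g \<otimes> g \<otimes> p"
        using p by (simp add: g_def m_assoc flip: nat_pow_Suc2)
      also have "\<dots> = p [^] (2 * k + 1)" using p by (simp add: g_def nat_pow_mult mult_2)
      finally show ?thesis using t p g by (simp add: m_assoc mult_2)
    qed
    finally show ?thesis .
  qed
  have "{j. j < 2 * Suc k \<and> u = t \<otimes> p [^] j} = {j. j < 2 * k \<and> u = t \<otimes> p [^] j} \<union>
     {j. j = 2 * k \<and> u = t \<otimes> p [^] j} \<union> {j. j = 2 * k + 1 \<and> u = t \<otimes> p [^] j}"
    by (auto simp: less_Suc_eq)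
  then have "card {j. j < 2 * Suc k \<and> u = t \<otimes> p [^] j} = card {j. j < 2 * k \<and> u = t \<otimes> p [^] j} +
     card {j. j = 2 * k \<and> u = t \<otimes> p [^] j} + card {j. j = 2 * k + 1 \<and> u = t \<otimes> p [^] j}"
    by (simp only:, subst card_Un_disjoint, simp, simp, force, subst card_Un_disjoint) auto
  also have "{j. j = 2 * k \<and> u = t \<otimes> p [^] j} = (if u = t \<otimes> p [^] (2 * k) then {2 * k} else {})" by auto
  also have "{j. j = 2 * k + 1 \<and> u = t \<otimes> p [^] j} =
      (if u = t \<otimes> p [^] (2 * k + 1) then {2 * k + 1} else {})" by auto
  finally have card: "odd (card {j. j < 2 * Suc k \<and> u = t \<otimes> p [^] j}) \<longleftrightarrow>
      (odd (card {j. j < 2 * k \<and> u = t \<otimes> p [^] j}) \<noteq> (g \<otimes> u \<otimes> inv g = t)) \<noteq>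
      (t \<otimes> (g \<otimes> u \<otimes> inv g) \<otimes> t = s)"
    unfolding e1 e2 by (auto simp del: nat_pow_Suc)
  have fstp: "s \<otimes> (t \<otimes> (g \<otimes> u \<otimes> inv g) \<otimes> t) \<otimes> s = p [^] Suc k \<otimes> u \<otimes> inv (p [^] Suc k)"
  proof -
    have "p [^] Suc k = p \<otimes> g" using p by (simp add: g_def flip: nat_pow_Suc2)
    then show ?thesis using s t u g by (simp add: p_def inv_mult_group m_assoc)
  qed
  have step: "((signed_conj s \<circ> signed_conj t) ^^ Suc k) (u, e) =
      signed_conj s (signed_conj t (((signed_conj s \<circ> signed_conj t) ^^ k) (u, e)))" by simp
  show ?case
    unfolding step Suc signed_conj_apply prod.inject p_def[symmetric] g_def[symmetric]
    using fstp card by argo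
qed

text \<open>With p = st and \<open>p [^] m = \<one>\<close>, the entry \<open>t p^j\<close> has
  period m in j. The list of 2m reflections therefore runs twice through the same values: every u is
  met an even number of times and no sign survives.\<close>

lemma foldr_signed_conj_eq:
  assumes "set us \<subseteq> R" "set vs \<subseteq> R" "wp us = wp vs" "t \<in> carrier W"
  shows "foldr signed_conj us (t, e) = foldr signed_conj vs (t, e)"
proof (rule foldr_action_eq[where S = "carrier W \<times> UNIV", OF _ _ assms(1-3)])
  fix s t :: 'a and x :: "'a \<times> bool"
  assume st: "s \<in> R" "t \<in> R" "x \<in> carrier W \<times> UNIV"
  obtain u e where x: "x = (u, e)" "u \<in> carrier W" using st by auto
  define m where "m = ord (s \<otimes> t)"
  define p where "p = s \<otimes> t"
  have p: "p \<in> carrier W" "p [^] m = \<one>" using st by (auto simp: p_def m_def)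
  have "{j. j < 2 * m \<and> u = t \<otimes> p [^] j} =
      {j. j < m \<and> u = t \<otimes> p [^] j} \<union> (\<lambda>j. j + m) ` {j. j < m \<and> u = t \<otimes> p [^] j}"
  proof (intro equalityI subsetI)
    fix j assume j: "j \<in> {j. j < 2 * m \<and> u = t \<otimes> p [^] j}"
    show "j \<in> {j. j < m \<and> u = t \<otimes> p [^] j} \<union> (\<lambda>j. j + m) ` {j. j < m \<and> u = t \<otimes> p [^] j}"
    proof (cases "j < m")
      case False
      then have "p [^] j = p [^] (j - m) \<otimes> p [^] m"
        using nat_pow_mult[OF p(1), of "j - m" m] by simp
      then have "p [^] j = p [^] (j - m)" using p by simp
      then have "j = (j - m) + m \<and> j - m < m \<and> u = t \<otimes> p [^] (j - m)" using j False by auto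
      then show ?thesis by blast
    qed (use j in auto)
  next
    fix j assume j: "j \<in> {j. j < m \<and> u = t \<otimes> p [^] j} \<union> (\<lambda>j. j + m) ` {j. j < m \<and> u = t \<otimes> p [^] j}"
    have "p [^] (i + m) = p [^] i" for i
      using nat_pow_mult[OF p(1), of i m] p by simp
    then show "j \<in> {j. j < 2 * m \<and> u = t \<otimes> p [^] j}"
      using j by auto
  qed
  then have "card {j. j < 2 * m \<and> u = t \<otimes> p [^] j} = card {j. j < m \<and> u = t \<otimes> p [^] j} +
      card ((\<lambda>j. j + m) ` {j. j < m \<and> u = t \<otimes> p [^] j})"
    by (simp only:, subst card_Un_disjoint) auto
  then have "even (card {j. j < 2 * m \<and> u = t \<otimes> p [^] j})"
    by (simp add: card_image)
  then show "((signed_conj s \<circ> signed_conj t) ^^ ord (s \<otimes> t)) x = x"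
    using signed_conj_power[OF st(1,2) x(2), of "ord (s \<otimes> t)" e] p x
    by (simp add: p_def m_def)
qed (use assms in \<open>auto simp: signed_conj_def\<close>)

text \<open>The accumulated sign change P is independent of the initial sign, and by
  \<open>foldr_signed_conj_eq\<close> it depends only on the product of the word; hence the choice
  of a word in \<open>inversion\<close> does not matter.\<close>

lemma foldr_signed_conj:
  assumes "set ws \<subseteq> R" "t \<in> carrier W"
  shows "foldr signed_conj ws (t, e) = (wp ws \<otimes> t \<otimes> inv (wp ws), e \<noteq> inversion (wp ws) t)"
proof -
  have "\<exists>P. \<forall>e. foldr signed_conj ws (t, e) = (wp ws \<otimes> t \<otimes> inv (wp ws), e \<noteq> P)"
    using assms(1)
  proof (induction ws)
    case (Cons s ws)
    then obtain P where P: "foldr signed_conj ws (t, e) = (wp ws \<otimes> t \<otimes> inv (wp ws), e \<noteq> P)" for e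
      by auto
    have c: "s \<otimes> (wp ws \<otimes> t \<otimes> inv (wp ws)) \<otimes> s = wp (s # ws) \<otimes> t \<otimes> inv (wp (s # ws))"
      using Cons.prems assms(2) by (simp add: inv_mult_group m_assoc)
    have "foldr signed_conj (s # ws) (t, e) = (wp (s # ws) \<otimes> t \<otimes> inv (wp (s # ws)),
        e \<noteq> (P \<noteq> (wp ws \<otimes> t \<otimes> inv (wp ws) = s)))" for e
      unfolding c[symmetric] by (simp add: P signed_conj_apply) argo
    then show ?case by blast
  qed (use assms(2) in auto)
  then obtain P where P: "foldr signed_conj ws (t, e) = (wp ws \<otimes> t \<otimes> inv (wp ws), e \<noteq> P)" for e
    by auto
  define ws0 where "ws0 = (SOME ws'. set ws' \<subseteq> R \<and> wp ws' = wp ws)"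
  have ws0: "set ws0 \<subseteq> R \<and> wp ws0 = wp ws"
    unfolding ws0_def by (rule someI[of _ ws]) (use assms in auto)
  have "inversion (wp ws) t = snd (foldr signed_conj ws0 (t, False))"
    by (simp only: inversion_def ws0_def)
  also have "foldr signed_conj ws0 (t, False) = foldr signed_conj ws (t, False)"
    using foldr_signed_conj_eq[of ws0 ws t False] ws0 assms by blast
  finally show ?thesis by (simp add: P)
qed

text \<open>The cocycle rule for inversion sets: the letters of y act first and carry t to its
  conjugate, on which the letters of x then act.\<close>

lemma inversion_mult:
  assumes "x \<in> carrier W" "y \<in> carrier W" "t \<in> carrier W"
  shows "inversion (x \<otimes> y) t \<longleftrightarrow> inversion y t \<noteq> inversion x (y \<otimes> t \<otimes> inv y)"
proof -
  obtain us vs where *: "set us \<subseteq> R" "wp us = x" "set vs \<subseteq> R" "wp vs = y"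
    using ex_word[OF assms(1)] ex_word[OF assms(2)] by blast
  have "foldr signed_conj (us @ vs) (t, False) = foldr signed_conj us (foldr signed_conj vs (t, False))"
    by simp
  also have "\<dots> = foldr signed_conj us (y \<otimes> t \<otimes> inv y, inversion y t)"
    using foldr_signed_conj[of vs t False] * assms by simp
  also have "\<dots> = (x \<otimes> (y \<otimes> t \<otimes> inv y) \<otimes> inv x, inversion y t \<noteq> inversion x (y \<otimes> t \<otimes> inv y))"
    using foldr_signed_conj[of us "y \<otimes> t \<otimes> inv y" "inversion y t"] * assms by simp
  finally show ?thesis
    using foldr_signed_conj[of "us @ vs" t False] * assms by simp
qed

lemma inversion_one [simp]: "t \<in> carrier W \<Longrightarrow> \<not> inversion \<one> t"
  using foldr_signed_conj[of "[]" t False] by simp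

lemma inversion_R [simp]: "s \<in> R \<Longrightarrow> t \<in> carrier W \<Longrightarrow> inversion s t \<longleftrightarrow> t = s"
  using foldr_signed_conj[of "[s]" t False] by (simp add: signed_conj_def)

text \<open>Strong exchange. If t is no inversion of the tail but becomes one when s is put in
  front, the cocycle rule forces the conjugate of t by the tail to be s, and multiplication by t on
  the right erases s. Otherwise the letter to erase is found in the tail.\<close>

lemma exchange_inversion:
  assumes "set ws \<subseteq> R" "t \<in> carrier W" "inversion (wp ws) t"
  shows "\<exists>us s vs. ws = us @ s # vs \<and> wp ws \<otimes> t = wp (us @ vs)"
  using assms
proof (induction ws)
  case (Cons s ws)
  have s: "s \<in> R" "set ws \<subseteq> R" using Cons.prems by auto
  show ?case
  proof (cases "inversion (wp ws) t")
    case True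
    then obtain us s' vs where *: "ws = us @ s' # vs" "wp ws \<otimes> t = wp (us @ vs)"
      using Cons s by blast
    then have "s # ws = (s # us) @ s' # vs \<and> wp (s # ws) \<otimes> t = wp ((s # us) @ vs)"
      using s Cons.prems by (auto simp: m_assoc)
    then show ?thesis by blast
  next
    case False
    then have "wp ws \<otimes> t \<otimes> inv (wp ws) = s"
      using Cons.prems s by (simp add: inversion_mult)
    then have "wp ws \<otimes> t = s \<otimes> wp ws"
      using s Cons.prems by (metis inv_solve_right m_closed wp_closed R_closed)
    then have "s # ws = [] @ s # ws \<and> wp (s # ws) \<otimes> t = wp ([] @ ws)"
      using s Cons.prems by (simp add: m_assoc)
    then show ?thesis by blast
  qed
qed auto

lemma inversion_imp_shorter:
  assumes "w \<in> carrier W" "t \<in> carrier W" "inversion w t"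
  shows "len (w \<otimes> t) < len w"
proof -
  obtain ws where ws: "set ws \<subseteq> R" "wp ws = w" "length ws = len w"
    using ex_reduced assms by blast
  then obtain us s vs where *: "ws = us @ s # vs" "w \<otimes> t = wp (us @ vs)"
    using exchange_inversion[of ws t] assms by auto
  then have "len (w \<otimes> t) \<le> length (us @ vs)" using len_le[of "us @ vs"] ws by simp
  with * ws show ?thesis by simp
qed

definition reflections :: "'a set" where
  "reflections = {x \<otimes> s \<otimes> inv x | x s. x \<in> carrier W \<and> s \<in> R}"

lemma R_reflection: "s \<in> R \<Longrightarrow> s \<in> reflections"
  unfolding reflections_def using one_closed by force

lemma reflection_conj:
  assumes "t \<in> reflections" "y \<in> carrier W"
  shows "y \<otimes> t \<otimes> inv y \<in> reflections"
proof -
  obtain x s where xs: "t = x \<otimes> s \<otimes> inv x" "x \<in> carrier W" "s \<in> R"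
    using assms by (auto simp: reflections_def)
  then have "y \<otimes> t \<otimes> inv y = (y \<otimes> x) \<otimes> s \<otimes> inv (y \<otimes> x)"
    using assms by (simp add: inv_mult_group m_assoc)
  with xs assms show ?thesis by (auto simp: reflections_def)
qed

lemma reflection_closed: "t \<in> reflections \<Longrightarrow> t \<in> carrier W"
  by (auto simp: reflections_def)

lemma reflection_sq: "t \<in> reflections \<Longrightarrow> t \<otimes> t = \<one>"
proof -
  assume "t \<in> reflections"
  then obtain x s where xs: "t = x \<otimes> s \<otimes> inv x" "x \<in> carrier W" "s \<in> R"
    by (auto simp: reflections_def)
  then show ?thesis by (simp add: m_assoc)
qed

text \<open>Write t as \<open>x s x^-1\<close>. By the cocycle rule the contributions of x and of
  its inverse agree and cancel; what remains is the sign change caused by s at itself.\<close>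

lemma inversion_self: "t \<in> reflections \<Longrightarrow> inversion t t"
proof -
  assume "t \<in> reflections"
  then obtain x s where xs: "t = x \<otimes> s \<otimes> inv x" "x \<in> carrier W" "s \<in> R"
    by (auto simp: reflections_def)
  have t: "t \<in> carrier W" using xs by simp
  have c: "inv x \<otimes> t \<otimes> inv (inv x) = s"
    using xs by (simp add: m_assoc)
  have "inversion (x \<otimes> inv x) t \<longleftrightarrow> inversion (inv x) t \<noteq> inversion x s"
    using inversion_mult[of x "inv x" t] xs(2) t by (simp only: c inv_closed)
  then have 1: "inversion (inv x) t = inversion x s" using xs t by simp
  have 2: "inversion (x \<otimes> s) s \<longleftrightarrow> \<not> inversion x s"
    using xs by (simp add: inversion_mult)
  have "inversion (x \<otimes> s \<otimes> inv x) t \<longleftrightarrow> inversion (inv x) t \<noteq> inversion (x \<otimes> s) s"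
    using inversion_mult[of "x \<otimes> s" "inv x" t] xs(2,3) t by (simp only: c inv_closed m_closed R_closed)
  then show ?thesis using 1 2 xs(1) by simp
qed

lemma inversion_iff:
  assumes "w \<in> carrier W" "t \<in> reflections"
  shows "inversion w t \<longleftrightarrow> len (w \<otimes> t) < len w"
proof
  have t: "t \<in> carrier W" using assms by (simp add: reflection_closed)
  assume "len (w \<otimes> t) < len w"
  show "inversion w t"
  proof (rule ccontr)
    assume "\<not> inversion w t"
    then have "inversion (w \<otimes> t) t"
      using assms t inversion_self[OF assms(2)] reflection_sq[OF assms(2)] reflection_closed[OF assms(2)]
      by (simp add: inversion_mult inv_equality)
    then have "len (w \<otimes> t \<otimes> t) < len (w \<otimes> t)" using assms t by (simp add: inversion_imp_shorter)
    then show False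
      using \<open>len (w \<otimes> t) < len w\<close> assms t reflection_sq by (simp add: m_assoc)
  qed
qed (use assms inversion_imp_shorter reflection_closed in blast)

text \<open>Since t inverts itself, t is an inversion of \<open>w t\<close> when it is none of w, so
  the shortening statement applies to \<open>w t\<close>.\<close>

lemma not_inversion_longer:
  assumes "w \<in> carrier W" "t \<in> reflections" "\<not> inversion w t"
  shows "len w < len (w \<otimes> t)"
proof -
  have t: "t \<in> carrier W" using assms by (simp add: reflection_closed)
  have "inversion (w \<otimes> t) t"
    using assms t inversion_self[OF assms(2)] reflection_sq[OF assms(2)]
    by (simp add: inversion_mult inv_equality)
  then show ?thesis
    using inversion_imp_shorter[of "w \<otimes> t" t] assms t reflection_sq[of t] by (simp add: m_assoc)
qed

lemma len_mult_R:
  assumes "w \<in> carrier W" "s \<in> R"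
  shows "inversion w s \<and> len w = len (w \<otimes> s) + 1 \<or> \<not> inversion w s \<and> len (w \<otimes> s) = len w + 1"
proof -
  have a: "len (w \<otimes> s) \<le> len w + 1" using len_mult_le[of w s] assms by simp
  have b: "len w \<le> len (w \<otimes> s) + 1" using len_mult_le[of "w \<otimes> s" s] assms by simp
  show ?thesis
    using a b inversion_imp_shorter[of w s] not_inversion_longer[of w s] assms R_reflection[of s]
    by (cases "inversion w s") auto
qed

lemma right_exchange:
  assumes "set ws \<subseteq> R" "s \<in> R" "len (wp ws \<otimes> s) < len (wp ws)"
  shows "\<exists>us u vs. ws = us @ u # vs \<and> wp ws \<otimes> s = wp (us @ vs)"
  using exchange_inversion[of ws s] len_mult_R[of "wp ws" s] assms by auto

text \<open>Read the word from the left: each letter either lengthens the element or, by exchange,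
  erases an earlier letter. Neither step introduces a letter outside J.\<close>

lemma ex_reduced_subword:
  assumes "set ws \<subseteq> J" "J \<subseteq> R"
  shows "\<exists>vs. set vs \<subseteq> J \<and> wp vs = wp ws \<and> length vs = len (wp ws)"
  using assms(1)
proof (induction ws rule: rev_induct)
  case (snoc s ws)
  then obtain vs where vs: "set vs \<subseteq> J" "wp vs = wp ws" "length vs = len (wp ws)" by auto
  have s: "s \<in> J" "s \<in> R" "set ws \<subseteq> R" "set vs \<subseteq> R" using snoc vs assms by auto
  show ?case
  proof (cases "len (wp ws \<otimes> s) < len (wp ws)")
    case True
    then obtain us u ys where *: "vs = us @ u # ys" "wp vs \<otimes> s = wp (us @ ys)"
      using right_exchange[of vs s] vs s by auto
    then show ?thesis
      using vs s True len_mult_R[of "wp ws" s] inversion_iff[OF _ R_reflection[OF s(2)], of "wp ws"]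
      by (intro exI[of _ "us @ ys"]) auto
  next
    case False
    then show ?thesis
      using vs s len_mult_R[of "wp ws" s]
      by (intro exI[of _ "vs @ [s]"]) auto
  qed
qed auto

text \<open>A generator has length one, so the shortened word over J is a single letter.\<close>

lemma R_in_parabolic:
  assumes "set ws \<subseteq> J" "J \<subseteq> R" "wp ws \<in> R"
  shows "wp ws \<in> J"
proof -
  obtain vs where "set vs \<subseteq> J" "wp vs = wp ws" "length vs = 1"
    using ex_reduced_subword[OF assms(1,2)] assms(3) by auto
  then show ?thesis using assms by (auto simp: length_Suc_conv)
qed

text \<open>Exchange applied to the word over J expresses the last letter of the reduced word as a
  product over J, so this letter lies in J by \<open>R_in_parabolic\<close>; it is stripped off and
  the argument repeated.\<close>

lemma reduced_support:
  assumes "set js \<subseteq> J" "J \<subseteq> R" "set ws \<subseteq> R" "wp ws = wp js" "length ws = len (wp ws)"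
  shows "set ws \<subseteq> J"
  using assms(1,3-)
proof (induction ws arbitrary: js rule: rev_induct)
  case (snoc s ws)
  have R: "s \<in> R" "set ws \<subseteq> R" "set js \<subseteq> R" using snoc.prems assms(2) by auto
  have e: "wp (ws @ [s]) \<otimes> s = wp ws" using R by (simp add: m_assoc)
  have l: "len (wp ws) \<le> length ws" using R by (simp add: len_le)
  then have lt: "len (wp js \<otimes> s) < len (wp js)" using e snoc.prems by simp
  then obtain us u vs where *: "js = us @ u # vs" "wp js \<otimes> s = wp (us @ vs)"
    using right_exchange[of js s] R by auto
  have us: "set us \<subseteq> J" "set vs \<subseteq> J" "set us \<subseteq> R" "set vs \<subseteq> R" using * snoc.prems assms(2) by auto
  have "s = inv (wp js) \<otimes> wp (us @ vs)"
    unfolding *(2)[symmetric] using R by (simp flip: m_assoc)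
  then have "s = wp (rev js @ us @ vs)" using R us by (simp add: wp_rev)
  moreover have "set (rev js @ us @ vs) \<subseteq> J" using us snoc.prems by auto
  ultimately have s: "s \<in> J" using R_in_parabolic[of "rev js @ us @ vs" J] assms(2) R by auto
  have "length ws = len (wp ws)"
    using l snoc.prems R len_mult_le[of "wp ws" s] by simp
  moreover have "wp ws = wp (us @ vs)" using e * snoc.prems by simp
  ultimately have "set ws \<subseteq> J" using snoc.IH[of "us @ vs"] us R by auto
  with s show ?case by auto
qed auto

lemma in_parabolic_of_reduced:
  assumes "set js \<subseteq> J" "J \<subseteq> R" "set ws \<subseteq> R" "wp ws = wp js" "length ws = len (wp ws)"
  shows "set ws \<subseteq> J"
  using reduced_support[OF assms] by auto

end

section \<open>Orders of products of two generators\<close>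

context coxeter
begin

lemma ord_commute: "s \<in> R \<Longrightarrow> t \<in> R \<Longrightarrow> ord (s \<otimes> t) = ord (t \<otimes> s)"
proof -
  assume st: "s \<in> R" "t \<in> R"
  have "t \<otimes> s = inv (s \<otimes> t)" using st by (simp add: inv_mult_group)
  then show ?thesis using st ord_inv[of "s \<otimes> t"] by simp
qed

lemma ord_eq_1_R: "s \<in> R \<Longrightarrow> t \<in> R \<Longrightarrow> ord (s \<otimes> t) = 1 \<longleftrightarrow> s = t"
proof -
  assume st: "s \<in> R" "t \<in> R"
  have "ord (s \<otimes> t) = 1 \<longleftrightarrow> s \<otimes> t = \<one>" using st ord_eq_1[of "s \<otimes> t"] by auto
  also have "\<dots> \<longleftrightarrow> s = t" using st by (metis R_sq R_sq'' R_closed l_one)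
  finally show ?thesis .
qed

lemma ord_2_commute:
  assumes "s \<in> R" "t \<in> R" "ord (s \<otimes> t) = 2"
  shows "s \<otimes> t = t \<otimes> s"
proof -
  have "(s \<otimes> t) [^] (2::nat) = \<one>" using pow_ord_eq_1[of "s \<otimes> t"] assms by simp
  then have "s \<otimes> t \<otimes> (s \<otimes> t) = \<one>" using assms by (simp add: numeral_2_eq_2)
  then have "s \<otimes> t = inv (s \<otimes> t)" using assms inv_equality[of "s \<otimes> t" "s \<otimes> t"] by simp
  then show ?thesis using assms by (simp add: inv_mult_group)
qed

lemma ord_3_braid:
  assumes "s \<in> R" "t \<in> R" "ord (s \<otimes> t) = 3"
  shows "s \<otimes> (t \<otimes> s) = t \<otimes> (s \<otimes> t)"
proof -
  have "(s \<otimes> t) [^] (3::nat) = \<one>" using pow_ord_eq_1[of "s \<otimes> t"] assms by simp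
  then have "(s \<otimes> (t \<otimes> s)) \<otimes> (t \<otimes> (s \<otimes> t)) = \<one>" using assms by (simp add: numeral_3_eq_3 m_assoc)
  then have "inv (t \<otimes> (s \<otimes> t)) = s \<otimes> (t \<otimes> s)" using assms by (intro inv_equality) simp_all
  then show ?thesis using assms by (simp add: inv_mult_group m_assoc)
qed

lemma ord_commuting_R:
  assumes "s \<in> R" "t \<in> R" "s \<noteq> t" "s \<otimes> t = t \<otimes> s"
  shows "ord (s \<otimes> t) = 2"
proof -
  have "(s \<otimes> t) [^] (2::nat) = s \<otimes> t \<otimes> (s \<otimes> t)" using assms(1,2) by (simp add: numeral_2_eq_2)
  also have "\<dots> = s \<otimes> t \<otimes> (t \<otimes> s)" by (simp only: assms(4))
  also have "\<dots> = \<one>" using assms(1,2) by (simp add: m_assoc)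
  finally have "ord (s \<otimes> t) dvd 2" using assms pow_eq_id[of "s \<otimes> t" 2] by simp
  then have "ord (s \<otimes> t) = 1 \<or> ord (s \<otimes> t) = 2" using prime_nat_iff two_is_prime_nat by blast
  then show ?thesis using ord_eq_1_R[of s t] assms by auto
qed

end

section \<open>The longest element and conjugation by it\<close>

locale finite_coxeter = coxeter +
  fixes w0 :: 'a
  assumes finite_W: "finite (carrier W)" and w0: "longest_element W R w0"
begin

lemma finite_R: "finite R"
  using finite_subset[OF R_sub finite_W] .

lemma w0_closed [simp]: "w0 \<in> carrier W"
  using w0 by (simp add: longest_element_def)

lemma len_le_w0: "x \<in> carrier W \<Longrightarrow> len x \<le> len w0"
  using w0 by (simp add: longest_element_def)

lemma w0_inversion: "t \<in> reflections \<Longrightarrow> inversion w0 t"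
  using not_inversion_longer[of w0 t] len_le_w0[of "w0 \<otimes> t"] reflection_closed[of t] by fastforce

text \<open>Along a reduced word of x each letter s lengthens the prefix v, so s is no inversion of
  v, while the reflection \<open>v s v^-1\<close> is an inversion of w0. By the cocycle rule s is an
  inversion of \<open>w0 v\<close>, so every letter shortens.\<close>

lemma len_w0_mult:
  assumes "x \<in> carrier W"
  shows "len (w0 \<otimes> x) + len x = len w0"
proof -
  have "len (w0 \<otimes> wp ws) + length ws = len w0" if "set ws \<subseteq> R" "length ws = len (wp ws)" for ws
    using that
  proof (induction ws rule: rev_induct)
    case (snoc s ws)
    have R: "s \<in> R" "set ws \<subseteq> R" using snoc by auto
    have l: "length ws = len (wp ws)"
      using len_le[of ws] len_mult_le[of "wp ws" s] snoc.prems R by simp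
    then have "\<not> inversion (wp ws) s"
      using len_mult_R[of "wp ws" s] snoc.prems R by auto
    then have "inversion (w0 \<otimes> wp ws) s"
      using R w0_inversion[OF reflection_conj[OF R_reflection[OF R(1)], of "wp ws"]]
      by (simp add: inversion_mult)
    then have "len (w0 \<otimes> wp ws) = len (w0 \<otimes> wp ws \<otimes> s) + 1"
      using len_mult_R[of "w0 \<otimes> wp ws" s] R by auto
    then show ?case using snoc.IH l R by (simp add: m_assoc)
  qed simp
  then show ?thesis using ex_reduced[OF assms] by metis
qed

text \<open>The length formula with x = w0 gives length 0.\<close>

lemma w0_sq [simp]: "w0 \<otimes> w0 = \<one>"
  using len_w0_mult[of w0] len_eq_0_iff[of "w0 \<otimes> w0"] by simp

lemma w0_sq' [simp]: "x \<in> carrier W \<Longrightarrow> w0 \<otimes> (w0 \<otimes> x) = x"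
  by (simp flip: m_assoc)

lemma inv_w0 [simp]: "inv w0 = w0"
  by (simp add: inv_equality)

lemma len_mult_w0: "x \<in> carrier W \<Longrightarrow> len (x \<otimes> w0) + len x = len w0"
  using len_w0_mult[of "inv x"] len_inv[of "w0 \<otimes> inv x"] by (simp add: inv_mult_group)

definition w0_conj :: "'a \<Rightarrow> 'a" ("\<delta>") where
  "\<delta> x = w0 \<otimes> x \<otimes> w0"

lemma w0_conj_closed [simp]: "x \<in> carrier W \<Longrightarrow> \<delta> x \<in> carrier W"
  by (simp add: w0_conj_def)

lemma w0_conj_mult: "x \<in> carrier W \<Longrightarrow> y \<in> carrier W \<Longrightarrow> \<delta> (x \<otimes> y) = \<delta> x \<otimes> \<delta> y"
  by (simp add: w0_conj_def m_assoc)

lemma w0_conj_one [simp]: "\<delta> \<one> = \<one>"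
  by (simp add: w0_conj_def)

lemma w0_conj_w0_conj [simp]: "x \<in> carrier W \<Longrightarrow> \<delta> (\<delta> x) = x"
  by (simp add: w0_conj_def m_assoc)

lemma len_w0_conj [simp]: "x \<in> carrier W \<Longrightarrow> len (\<delta> x) = len x"
  using len_mult_w0[of "w0 \<otimes> x"] len_w0_mult[of x] by (simp add: w0_conj_def)

text \<open>Conjugation by w0 preserves lengths and so permutes the elements of length one: it is an
  automorphism of the diagram.\<close>

lemma w0_conj_R [simp]: "s \<in> R \<Longrightarrow> \<delta> s \<in> R"
  using len_eq_1[of "\<delta> s"] by simp

lemma w0_conj_eq_iff: "x \<in> carrier W \<Longrightarrow> y \<in> carrier W \<Longrightarrow> \<delta> x = \<delta> y \<longleftrightarrow> x = y"
  by (metis w0_conj_w0_conj)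

lemma w0_conj_inv: "x \<in> carrier W \<Longrightarrow> \<delta> (inv x) = inv (\<delta> x)"
  by (simp add: w0_conj_def inv_mult_group m_assoc)

lemma w0_conj_wp: "set ws \<subseteq> R \<Longrightarrow> \<delta> (wp ws) = wp (map \<delta> ws)"
  by (induction ws) (auto simp: w0_conj_mult)

lemma ord_w0_conj: "x \<in> carrier W \<Longrightarrow> ord (\<delta> x) = ord x"
proof -
  have pow: "\<delta> x [^] k = \<delta> (x [^] k)" if "x \<in> carrier W" for x and k :: nat
    using that by (induction k) (auto simp: w0_conj_mult)
  have dvd: "ord (\<delta> x) dvd ord x" if "x \<in> carrier W" for x
    using pow[of x "ord x"] that pow_eq_id[of "\<delta> x" "ord x"] by simp
  assume "x \<in> carrier W"
  then show ?thesis using dvd[of x] dvd[of "\<delta> x"] by (simp add: dvd_antisym)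
qed

lemma ord_w0_conj_R: "s \<in> R \<Longrightarrow> t \<in> R \<Longrightarrow> ord (\<delta> s \<otimes> \<delta> t) = ord (s \<otimes> t)"
  using ord_w0_conj[of "s \<otimes> t"] by (simp add: w0_conj_mult)

lemma ord_ge_1: "x \<in> carrier W \<Longrightarrow> ord x \<ge> 1"
  using ord_ge_1[OF finite_W] by simp

lemma ord_ge_2: "s \<in> R \<Longrightarrow> t \<in> R \<Longrightarrow> s \<noteq> t \<Longrightarrow> ord (s \<otimes> t) \<ge> 2"
  using ord_ge_1[of "s \<otimes> t"] ord_eq_1_R[of s t] by (cases "ord (s \<otimes> t)") auto

lemma w0_central_iff: "w0 \<in> center W \<longleftrightarrow> (\<forall>s\<in>R. \<delta> s = s)"
proof
  assume "w0 \<in> center W"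
  then show "\<forall>s\<in>R. \<delta> s = s" by (auto simp: center_def w0_conj_def m_assoc)
next
  assume *: "\<forall>s\<in>R. \<delta> s = s"
  have "\<delta> x = x" if x: "x \<in> carrier W" for x
  proof -
    obtain ws where ws: "set ws \<subseteq> R" "wp ws = x" using ex_word[OF x] by blast
    then have "map \<delta> ws = ws" using * by (auto intro: map_idI)
    then show ?thesis using w0_conj_wp[of ws] ws by simp
  qed
  then have "w0 \<otimes> x = x \<otimes> w0" if "x \<in> carrier W" for x
    using that by (metis w0_conj_def w0_closed m_assoc m_closed r_one w0_sq)
  then show "w0 \<in> center W" by (simp add: center_def)
qed

end

text \<open>A vector is given by its coordinates f in the simple roots, and \<open>K s t\<close> is
  the pairing of the root of t with the coroot of s; hence the reflection in s alters only the
  coordinate at s. The coefficient ring is left open because both the real cosine form and the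
  integral Cartan matrix are used.\<close>

definition refl_act :: "('a \<Rightarrow> 'a \<Rightarrow> 'b::comm_ring_1) \<Rightarrow> 'a set \<Rightarrow> 'a \<Rightarrow> ('a \<Rightarrow> 'b) \<Rightarrow> 'a \<Rightarrow> 'b" where
  "refl_act K R s f = f(s := f s - (\<Sum>t\<in>R. K s t * f t))"

text \<open>The Chebyshev recurrence with arbitrary initial values. It produces the pairings that
  occur when the reflections in t and s are applied in turn.\<close>

fun alternating :: "'b::comm_ring_1 \<Rightarrow> 'b \<Rightarrow> 'b \<Rightarrow> nat \<Rightarrow> 'b" where
  "alternating c a b 0 = a"
| "alternating c a b (Suc 0) = b"
| "alternating c a b (Suc (Suc i)) = c * alternating c a b (Suc i) - alternating c a b i"

lemma refl_act_apply: "refl_act K R s f u = f u - (if u = s then \<Sum>t\<in>R. K s t * f t else 0)"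
  by (simp add: refl_act_def)

lemma sum_single:
  fixes g :: "'a \<Rightarrow> 'b::comm_ring_1"
  assumes "finite R" "s \<in> R"
  shows "(\<Sum>t\<in>R. g t * (if t = s then x else 0)) = g s * x"
proof -
  have "(\<Sum>t\<in>R. g t * (if t = s then x else 0)) = (\<Sum>t\<in>R. if t = s then g t * x else 0)"
    by (intro sum.cong) auto
  also have "\<dots> = g s * x" using assms by (simp add: sum.delta)
  finally show ?thesis .
qed

text \<open>Only the coordinates at s and t change. Up to signs absorbed into d, each new pairing is
  c times the last one minus the one before, so the amounts subtracted at t and at s are the odd and
  the even terms of one Chebyshev sequence.\<close>

lemma refl_act_power:
  fixes K :: "'a \<Rightarrow> 'a \<Rightarrow> 'b::comm_ring_1" and f :: "'a \<Rightarrow> 'b"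
  assumes "finite R" "s \<in> R" "t \<in> R" "s \<noteq> t" "K s s = 2" "K t t = 2" "K s t = - c" "K t s = - c"
  defines "P \<equiv> \<lambda>s g. \<Sum>u\<in>R. K s u * g u"
  defines "d \<equiv> alternating c (- P s f) (P t f)"
  shows "((refl_act K R s \<circ> refl_act K R t) ^^ k) f =
    (\<lambda>u. f u - (if u = t then \<Sum>i<k. d (2 * i + 1) else 0) - (if u = s then \<Sum>i<k. d (2 * i + 2) else 0))"
    (is "?g k = ?h k")
proof -
  have P_upd: "P v (\<lambda>u. g u - (if u = w then x else 0)) = P v g - K v w * x"
    if "w \<in> R" for v g w x
    using that assms(1) by (simp add: P_def sum_subtractf sum_single right_diff_distrib)
  have act: "refl_act K R w g = (\<lambda>u. g u - (if u = w then P w g else 0))" for w g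
    by (simp add: fun_eq_iff refl_act_apply P_def)
  \<comment> \<open>The pairings with t and s are carried along, because the amounts subtracted by
    the next two reflections are computed from them.\<close>
  have "?g k = ?h k \<and> P t (?g k) = d (2 * k + 1) \<and> P s (?g k) = - d (2 * k)"
  proof (induction k)
    case 0
    then show ?case by (simp add: d_def fun_eq_iff)
  next
    case (Suc k)
    define g where "g = ?g k"
    define g' where "g' = refl_act K R t g"
    have g'': "?g (Suc k) = refl_act K R s g'" by (simp add: g_def g'_def)
    have pt: "P t g = d (2 * k + 1)" and ps: "P s g = - d (2 * k)" and g: "g = ?h k"
      using Suc by (auto simp: g_def)
    have d2: "d (2 * k + 2) = c * d (2 * k + 1) - d (2 * k)" by (simp add: d_def)
    have pt': "P t g' = - d (2 * k + 1)" and ps': "P s g' = d (2 * k + 2)"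
      using assms(1-8) d2 by (simp_all add: g'_def act P_upd pt ps)
    have d3: "d (2 * k + 3) = c * d (2 * k + 2) - d (2 * k + 1)"
      by (simp add: d_def numeral_3_eq_3)
    have gS: "?g (Suc k) = (\<lambda>u. g' u - (if u = s then P s g' else 0))"
      unfolding g'' by (rule act)
    have "P v (?g (Suc k)) = P v g' - K v s * P s g'" for v
      unfolding gS by (rule P_upd[OF assms(2)])
    then have "P t (?g (Suc k)) = d (2 * k + 3)" "P s (?g (Suc k)) = - d (2 * k + 2)"
      using assms(5-8) by (simp_all only: pt' ps' d3) (simp_all add: algebra_simps)
    moreover have "?g (Suc k) = ?h (Suc k)"
      unfolding gS ps' unfolding g'_def act[of t] pt unfolding g
      using assms(4) by (auto simp: fun_eq_iff)
    ultimately show ?case by (simp add: numeral_3_eq_3)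
  qed
  then show ?thesis by blast
qed

text \<open>\<open>K_rel\<close> states numerically that the total corrections made by
  \<open>(st)^m\<close> at the coordinates t and s vanish for all initial pairings a and b, that is,
  that the relation acts trivially.\<close>

locale coxeter_rep = coxeter +
  fixes K :: "'a \<Rightarrow> 'a \<Rightarrow> 'c::comm_ring_1"
  assumes finR: "finite R"
    and K_diag: "s \<in> R \<Longrightarrow> K s s = 2"
    and K_sym: "s \<in> R \<Longrightarrow> t \<in> R \<Longrightarrow> K s t = K t s"
    and K_rel: "s \<in> R \<Longrightarrow> t \<in> R \<Longrightarrow> s \<noteq> t \<Longrightarrow>
      (\<Sum>i < ord (s \<otimes> t). alternating (- K s t) a b (2 * i + 1)) = 0 \<and>
      (\<Sum>i < ord (s \<otimes> t). alternating (- K s t) a b (2 * i + 2)) = 0"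
begin

abbreviation pair :: "'a \<Rightarrow> ('a \<Rightarrow> 'c) \<Rightarrow> 'c" where
  "pair s f \<equiv> \<Sum>t\<in>R. K s t * f t"

definition rho :: "'a \<Rightarrow> ('a \<Rightarrow> 'c) \<Rightarrow> 'a \<Rightarrow> 'c" where
  "rho w = foldr (refl_act K R) (SOME ws. set ws \<subseteq> R \<and> wp ws = w)"

lemma foldr_refl_act_eq:
  assumes "set us \<subseteq> R" "set vs \<subseteq> R" "wp us = wp vs"
  shows "foldr (refl_act K R) us = foldr (refl_act K R) vs"
proof
  fix f
  show "foldr (refl_act K R) us f = foldr (refl_act K R) vs f"
  proof (rule foldr_action_eq[where S = UNIV, OF _ _ assms])
    fix s t :: 'a and f :: "'a \<Rightarrow> 'c"
    assume st: "s \<in> R" "t \<in> R"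
    show "((refl_act K R s \<circ> refl_act K R t) ^^ ord (s \<otimes> t)) f = f"
    proof (cases "s = t")
      case True
      then have o: "ord (s \<otimes> t) = 1" using st by simp
      have "pair s (refl_act K R s f) = pair s f - K s s * pair s f"
        using st finR by (simp add: refl_act_apply right_diff_distrib sum_subtractf sum_single)
      then have p: "pair s (refl_act K R s f) = - pair s f" using st K_diag by simp
      have "refl_act K R s (refl_act K R s f) u = f u" for u
        unfolding refl_act_apply[of K R s "refl_act K R s f"] p by (simp add: refl_act_apply)
      then show ?thesis unfolding o using True by (simp add: fun_eq_iff)
    next
      case False
      have z: "(\<Sum>i < ord (s \<otimes> t). alternating (- K s t) (- pair s f) (pair t f) (2 * i + 1)) = 0"
        "(\<Sum>i < ord (s \<otimes> t). alternating (- K s t) (- pair s f) (pair t f) (2 * i + 2)) = 0"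
        using K_rel[OF st False, of "- pair s f" "pair t f"] by blast+
      have "K t s = - (- K s t)" using K_sym[OF st] by simp
      from refl_act_power[OF finR st False K_diag[OF st(1)] K_diag[OF st(2)] _ this, of "ord (s \<otimes> t)" f]
      show ?thesis by (simp only: z minus_minus) simp
    qed
  qed auto
qed

lemma rho_wp: "set ws \<subseteq> R \<Longrightarrow> rho (wp ws) = foldr (refl_act K R) ws"
proof -
  assume ws: "set ws \<subseteq> R"
  define ws0 where "ws0 = (SOME ws'. set ws' \<subseteq> R \<and> wp ws' = wp ws)"
  have ws0: "set ws0 \<subseteq> R \<and> wp ws0 = wp ws"
    unfolding ws0_def by (rule someI[of _ ws]) (use ws in auto)
  have "rho (wp ws) = foldr (refl_act K R) ws0" by (simp only: rho_def ws0_def)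
  then show ?thesis
    using foldr_refl_act_eq[of ws0 ws] ws ws0 by simp
qed

lemma rho_one [simp]: "rho \<one> = id"
  using rho_wp[of "[]"] by (simp add: fun_eq_iff)

lemma rho_R: "s \<in> R \<Longrightarrow> rho s = refl_act K R s"
  using rho_wp[of "[s]"] by (simp add: fun_eq_iff)

lemma rho_mult:
  assumes "x \<in> carrier W" "y \<in> carrier W"
  shows "rho (x \<otimes> y) f = rho x (rho y f)"
proof -
  obtain us vs where "set us \<subseteq> R" "wp us = x" "set vs \<subseteq> R" "wp vs = y"
    using ex_word[OF assms(1)] ex_word[OF assms(2)] by blast
  then show ?thesis using rho_wp[of "us @ vs"] rho_wp[of us] rho_wp[of vs] by simp
qed

lemma refl_act_linear:
  "refl_act K R s (\<lambda>u. a * f u + b * g u) = (\<lambda>u. a * refl_act K R s f u + b * refl_act K R s g u)"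
proof -
  have "(\<Sum>t\<in>R. K s t * (a * f t + b * g t)) = (\<Sum>t\<in>R. a * (K s t * f t) + b * (K s t * g t))"
    by (intro sum.cong) (auto simp: algebra_simps)
  also have "\<dots> = a * pair s f + b * pair s g"
    by (simp add: sum.distrib sum_distrib_left)
  finally show ?thesis
    by (auto simp: fun_eq_iff refl_act_apply algebra_simps)
qed

lemma rho_linear:
  assumes "w \<in> carrier W"
  shows "rho w (\<lambda>u. a * f u + b * g u) = (\<lambda>u. a * rho w f u + b * rho w g u)"
proof -
  obtain ws where ws: "set ws \<subseteq> R" "wp ws = w" using ex_word[OF assms] by blast
  have "foldr (refl_act K R) ws (\<lambda>u. a * f u + b * g u) =
      (\<lambda>u. a * foldr (refl_act K R) ws f u + b * foldr (refl_act K R) ws g u)" for ws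
    by (induction ws) (auto simp: refl_act_linear)
  then show ?thesis using rho_wp[OF ws(1)] ws(2) by simp
qed

lemma rho_scale: "w \<in> carrier W \<Longrightarrow> rho w (\<lambda>u. a * f u) = (\<lambda>u. a * rho w f u)"
  using rho_linear[of w a f 0 f] by simp

lemma rho_sum:
  assumes "w \<in> carrier W" "finite A"
  shows "rho w (\<lambda>u. \<Sum>i\<in>A. a i * f i u) = (\<lambda>u. \<Sum>i\<in>A. a i * rho w (f i) u)"
  using assms(2)
proof (induction A rule: finite_induct)
  case empty
  then show ?case using rho_scale[OF assms(1), of 0 "\<lambda>_. 0"] by simp
next
  case (insert i A)
  then show ?case using rho_linear[OF assms(1), of "a i" "f i" 1 "\<lambda>u. \<Sum>i\<in>A. a i * f i u"] by simp
qed

definition simple_root :: "'a \<Rightarrow> 'a \<Rightarrow> 'c" where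
  "simple_root s = (\<lambda>u. if u = s then 1 else 0)"

lemma pair_root: "t \<in> R \<Longrightarrow> pair s (simple_root t) = K s t"
  using sum_single[OF finR, of t "K s" 1] by (simp add: simple_root_def)

lemma rho_R_root: "s \<in> R \<Longrightarrow> t \<in> R \<Longrightarrow> rho s (simple_root t) = (\<lambda>u. simple_root t u - K s t * simple_root s u)"
  by (rule ext) (simp only: rho_R refl_act_apply pair_root, simp add: simple_root_def)

lemma rho_R_self: "s \<in> R \<Longrightarrow> rho s (simple_root s) = (\<lambda>u. - simple_root s u)"
  by (simp add: rho_R_root K_diag fun_eq_iff)

lemma rho_R_apply: "s \<in> R \<Longrightarrow> rho s f = (\<lambda>u. f u - pair s f * simple_root s u)"
  by (auto simp: rho_R fun_eq_iff refl_act_apply simple_root_def)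

end

section \<open>The geometric representation\<close>

text \<open>The recurrence is the addition formula
  \<open>sin (y + x) = 2 cos x sin y - sin (y - x)\<close>; the factor \<open>sin x\<close> on the
  left avoids a division.\<close>

lemma alternating_eq_sin:
  fixes a b x :: real
  shows "sin x * alternating (2 * cos x) a b i = b * sin (of_nat i * x) - a * sin ((of_nat i - 1) * x)"
proof (induction "2 * cos x" a b i rule: alternating.induct)
  case (3 a b i)
  have rec: "sin (y + x) = 2 * cos x * sin y - sin (y - x)" for y
    by (simp add: sin_add sin_diff)
  have "sin x * alternating (2 * cos x) a b (Suc (Suc i)) =
      2 * cos x * (sin x * alternating (2 * cos x) a b (Suc i)) - sin x * alternating (2 * cos x) a b i"
    by (simp add: algebra_simps)
  also have "\<dots> = b * (2 * cos x * sin (of_nat (Suc i) * x) - sin (of_nat i * x)) -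
      a * (2 * cos x * sin (of_nat i * x) - sin ((of_nat i - 1) * x))"
    unfolding 3 by (simp add: algebra_simps)
  also have "2 * cos x * sin (of_nat (Suc i) * x) - sin (of_nat i * x) = sin (of_nat (Suc (Suc i)) * x)"
    using rec[of "of_nat (Suc i) * x"] by (simp add: algebra_simps)
  also have "2 * cos x * sin (of_nat i * x) - sin ((of_nat i - 1) * x) = sin ((of_nat (Suc (Suc i)) - 1) * x)"
    using rec[of "of_nat i * x"] by (simp add: algebra_simps)
  finally show ?case .
qed auto

text \<open>The sequence has period 2m, as the angle then advances by a full turn. Summing the
  recurrence over each parity of indices gives 2A = cB and 2B = cA, hence
  \<open>(4 - c^2) A = 0\<close>, and \<open>4 - c^2\<close> equals \<open>4 sin^2 x\<close>, which
  is positive.\<close>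

lemma alternating_sums_zero:
  fixes a b :: real
  assumes m: "m \<ge> 2"
  defines "d \<equiv> alternating (2 * cos (pi / of_nat m)) a b"
  shows "(\<Sum>i<m. d (2 * i + 1)) = 0 \<and> (\<Sum>i<m. d (2 * i + 2)) = 0"
proof -
  define x where "x = pi / of_nat m"
  define c where "c = 2 * cos x"
  have mx: "real m * x = pi" using m by (simp add: x_def)
  have "0 < x" "x < pi" using m by (auto simp: x_def field_simps)
  then have sin: "sin x > 0" by (rule sin_gt_zero)
  have sd: "sin x * d i = b * sin (real i * x) - a * sin ((real i - 1) * x)" for i
    unfolding d_def x_def[symmetric] by (rule alternating_eq_sin)
  have "sin x * d (i + 2 * m) = sin x * d i" for i
  proof -
    have "real (i + 2 * m) * x = real i * x + 2 * pi"
      "(real (i + 2 * m) - 1) * x = (real i - 1) * x + 2 * pi"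
      using mx by (simp_all add: algebra_simps)
    then show ?thesis unfolding sd by simp
  qed
  then have per: "d (i + 2 * m) = d i" for i using sin by simp
  have rec: "d (Suc (Suc i)) + d i = c * d (Suc i)" for i
    by (simp add: d_def c_def x_def)
  define A where "A = (\<Sum>i<m. d (2 * i + 1))"
  define B where "B = (\<Sum>i<m. d (2 * i + 2))"
  have "(\<Sum>i<m. d (2 * Suc i + 1)) = A"
    using sum.lessThan_Suc_shift[of "\<lambda>i. d (2 * i + 1)" m] per[of 1] by (simp add: A_def add.commute)
  moreover have "(\<Sum>i<m. d (2 * Suc i + 1) + d (2 * i + 1)) = c * B"
    unfolding B_def sum_distrib_left using rec[of "2 * i + 1" for i] by (intro sum.cong) auto
  ultimately have 1: "2 * A = c * B" by (simp add: sum.distrib A_def)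
  have "(\<Sum>i<m. d (2 * i)) = B"
    using sum.lessThan_Suc_shift[of "\<lambda>i. d (2 * i)" m] per[of 0] by (simp add: B_def)
  moreover have "(\<Sum>i<m. d (2 * i + 2) + d (2 * i)) = c * A"
    unfolding A_def sum_distrib_left using rec[of "2 * i" for i] by (intro sum.cong) auto
  ultimately have 2: "2 * B = c * A" by (simp add: sum.distrib B_def)
  have c2: "4 - c^2 = 4 * (sin x)^2"
    using sin_squared_eq[of x] by (simp add: c_def power_mult_distrib)
  have "(4 - c^2) * A = 2 * (2 * A) - c * (c * A)" by (simp add: power2_eq_square algebra_simps)
  also have "\<dots> = 0" unfolding 1 2[symmetric] by simp
  finally have "A = 0" using c2 sin by simp
  then show ?thesis using 2 by (simp add: A_def B_def)
qed

text \<open>Twice the standard form, so that the diagonal entry, where the order is 1, is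
  \<open>- 2 cos pi = 2\<close> as in a Cartan matrix.\<close>

definition cos_form :: "('a, 'b) monoid_scheme \<Rightarrow> 'a \<Rightarrow> 'a \<Rightarrow> real" where
  "cos_form W s t = - 2 * cos (pi / of_nat (group.ord W (s \<otimes>\<^bsub>W\<^esub> t)))"

context finite_coxeter
begin

lemma coxeter_rep_cos_form: "coxeter_rep W R (cos_form W)"
proof
  fix s t :: 'a and a b :: real
  assume st: "s \<in> R" "t \<in> R"
  show "cos_form W s t = cos_form W t s" using st by (simp add: cos_form_def ord_commute)
  assume "s \<noteq> t"
  have c: "- cos_form W s t = 2 * cos (pi / of_nat (ord (s \<otimes> t)))" by (simp add: cos_form_def)
  show "(\<Sum>i < ord (s \<otimes> t). alternating (- cos_form W s t) a b (2 * i + 1)) = 0 \<and>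
      (\<Sum>i < ord (s \<otimes> t). alternating (- cos_form W s t) a b (2 * i + 2)) = 0"
    unfolding c using alternating_sums_zero[OF ord_ge_2[OF st \<open>s \<noteq> t\<close>]] .
qed (auto simp: finite_R cos_form_def)

text \<open>
  Averaging gives a \<open>W\<close>-invariant inner product. Each generator is an orthogonal reflection for it, so
  its Gram matrix on the simple roots is the cosine matrix up to the norms of the simple roots,
  and these agree along edges.
\<close>

lemma cos_form_positive:
  assumes irr: "irreducible_coxeter W R" and f: "r \<in> R" "f r \<noteq> 0"
  shows "0 < (\<Sum>s\<in>R. \<Sum>t\<in>R. cos_form W s t * f s * f t)"
proof -
  interpret coxeter_rep W R "cos_form W" by (rule coxeter_rep_cos_form)
  define ip where "ip f g = (\<Sum>w\<in>carrier W. \<Sum>u\<in>R. rho w f u * rho w g u)" for f g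
  have ip_comm: "ip f g = ip g f" for f g by (simp add: ip_def mult.commute)
  have ip_lin: "ip f (\<lambda>u. a * g u + b * h u) = a * ip f g + b * ip f h" for f g h a b
    by (simp add: ip_def rho_linear sum_distrib_left sum.distrib algebra_simps)
  have ip_neg: "ip (\<lambda>u. - f u) h = - ip f h" for f h
    using ip_lin[of h "- 1" f 0 f] ip_comm[of "\<lambda>u. - f u" h] ip_comm[of f h] by simp
  have ip_sum: "ip f (\<lambda>u. \<Sum>i\<in>A. a i * g i u) = (\<Sum>i\<in>A. a i * ip f (g i))" if "finite A" for f A a g
    using that
  proof (induction A rule: finite_induct)
    case empty
    then show ?case using ip_lin[of f 0 f 0 f] by simp
  next
    case (insert i A)
    then show ?case using ip_lin[of f "a i" "g i" 1 "\<lambda>u. \<Sum>i\<in>A. a i * g i u"] by simp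
  qed
  have ip_inv: "ip (rho s f) (rho s g) = ip f g" if s: "s \<in> R" for s f g
  proof -
    have "ip (rho s f) (rho s g) = (\<Sum>w\<in>carrier W. \<Sum>u\<in>R. rho (w \<otimes> s) f u * rho (w \<otimes> s) g u)"
      using s by (simp add: ip_def rho_mult)
    also have "\<dots> = ip f g" unfolding ip_def
      by (rule sum.reindex_bij_witness[where i = "\<lambda>w. w \<otimes> s" and j = "\<lambda>w. w \<otimes> s"]) (use s in auto)
    finally show ?thesis .
  qed
  define N where "N s = ip (simple_root s) (simple_root s)" for s
  \<comment> \<open>The reflection s is an isometry that negates its own root; applying it to both
    arguments expresses the inner product with this root through the pairing and the norm.\<close>
  have root: "2 * ip (simple_root s) g = pair s g * N s" if s: "s \<in> R" for s g
  proof -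
    have "ip (simple_root s) g = ip (rho s (simple_root s)) (rho s g)" using ip_inv[OF s] by simp
    also have "\<dots> = ip (\<lambda>u. - simple_root s u) (\<lambda>u. g u - pair s g * simple_root s u)"
      by (simp only: rho_R_self[OF s] rho_R_apply[OF s, of g])
    also have "\<dots> = - ip (simple_root s) (\<lambda>u. 1 * g u + (- pair s g) * simple_root s u)"
      unfolding ip_neg by simp
    also have "\<dots> = - (1 * ip (simple_root s) g + (- pair s g) * ip (simple_root s) (simple_root s))"
      by (simp only: ip_lin)
    finally show ?thesis by (simp add: N_def)
  qed
  \<comment> \<open>The summand of the identity element is already a sum of squares with a nonzero
    term.\<close>
  have pos: "ip g g > 0" if g: "u \<in> R" "g u \<noteq> 0" for g u
  proof -
    have "0 < (\<Sum>u\<in>R. g u * g u)"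
      by (rule sum_pos2[of _ u]) (use g finite_R zero_less_mult_iff[of "g u" "g u"] in auto)
    also have "\<dots> \<le> ip g g" unfolding ip_def
      using member_le_sum[of \<one> "carrier W" "\<lambda>w. \<Sum>u\<in>R. rho w g u * rho w g u"] finite_W
      by (simp add: sum_nonneg)
    finally show ?thesis .
  qed
  have Npos: "N s > 0" if "s \<in> R" for s
    unfolding N_def by (rule pos[of s]) (use that in \<open>auto simp: simple_root_def\<close>)
  \<comment> \<open>The cosine entry is symmetric and nonzero on an edge, so comparing
    \<open>root\<close> for s and for t equates the two norms.\<close>
  have edge: "N s = N t" if "(s, t) \<in> coxeter_edges W R" for s t
  proof -
    have st: "s \<in> R" "t \<in> R" "s \<noteq> t" "ord (s \<otimes> t) \<noteq> 2" using that by (auto simp: coxeter_edges_def)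
    then have o: "ord (s \<otimes> t) \<ge> 3" using ord_ge_2[of s t] by simp
    then have "cos (pi / of_nat (ord (s \<otimes> t))) > 0"
      by (intro cos_gt_zero_pi) (auto simp: field_simps intro: order_less_le_trans[of _ 0])
    then have "cos_form W s t \<noteq> 0" by (simp add: cos_form_def)
    moreover have "cos_form W s t * N s = cos_form W s t * N t"
      using root[OF st(1), of "simple_root t"] root[OF st(2), of "simple_root s"] K_sym[OF st(1,2)]
      ip_comm[of "simple_root t" "simple_root s"]
      unfolding pair_root[OF st(1)] pair_root[OF st(2)] by simp
    ultimately show ?thesis by simp
  qed
  have const: "N s = N r" if "s \<in> R" for s
  proof -
    have "(s, r) \<in> (coxeter_edges W R)\<^sup>*" using irr f that by (simp add: irreducible_coxeter_def)
    then show ?thesis by (induction rule: rtrancl_induct) (auto simp: edge)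
  qed
  \<comment> \<open>Values of f outside R are discarded: g is the combination of simple roots with
    the same coordinates on R.\<close>
  define g where "g = (\<lambda>u. \<Sum>s\<in>R. f s * simple_root s u)"
  have gu: "g u = f u" if "u \<in> R" for u
  proof -
    have "g u = (\<Sum>s\<in>R. f s * (if s = u then 1 else 0))"
      unfolding g_def simple_root_def by (intro sum.cong) auto
    then show ?thesis using sum_single[OF finite_R that, of f 1] by simp
  qed
  have "0 < 2 * ip g g" using pos[of r g] f gu[of r] by simp
  also have "ip g g = (\<Sum>s\<in>R. f s * ip g (simple_root s))"
    using ip_sum[OF finite_R, of g f simple_root] by (simp only: g_def[symmetric])
  also have "\<dots> = (\<Sum>s\<in>R. f s * ip (simple_root s) g)"
    by (rule sum.cong) (simp_all add: ip_comm[of g "simple_root _"])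
  also have "2 * \<dots> = (\<Sum>s\<in>R. f s * (2 * ip (simple_root s) g))"
    by (simp add: sum_distrib_left algebra_simps)
  also have "\<dots> = (\<Sum>s\<in>R. f s * (pair s g * N s))"
    by (intro sum.cong) (auto simp: root)
  also have "\<dots> = (\<Sum>s\<in>R. f s * (pair s f * N r))"
    by (intro sum.cong) (auto simp: const gu)
  also have "\<dots> = N r * (\<Sum>s\<in>R. \<Sum>t\<in>R. cos_form W s t * f s * f t)"
    by (simp add: sum_distrib_left algebra_simps)
  finally show ?thesis using Npos[OF f(1)] by (simp add: zero_less_mult_iff)
qed

end

section \<open>Simply laced groups: the action on the root lattice\<close>

locale simply_laced = finite_coxeter +
  assumes laced: "s \<in> R \<Longrightarrow> t \<in> R \<Longrightarrow> s \<noteq> t \<Longrightarrow> ord (s \<otimes> t) = 2 \<or> ord (s \<otimes> t) = 3"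
begin

definition cartan :: "'a \<Rightarrow> 'a \<Rightarrow> int" where
  "cartan s t = (if s = t then 2 else if ord (s \<otimes> t) = 3 then - 1 else 0)"

sublocale coxeter_rep W R cartan
proof
  fix s t :: 'a and a b :: int
  assume st: "s \<in> R" "t \<in> R"
  show "cartan s t = cartan t s" using st by (simp add: cartan_def ord_commute)
  assume "s \<noteq> t"
  then show "(\<Sum>i < ord (s \<otimes> t). alternating (- cartan s t) a b (2 * i + 1)) = 0 \<and>
      (\<Sum>i < ord (s \<otimes> t). alternating (- cartan s t) a b (2 * i + 2)) = 0"
    using laced[OF st \<open>s \<noteq> t\<close>] by (auto simp: cartan_def eval_nat_numeral)
qed (auto simp: finite_R cartan_def)

text \<open>The classical positivity of roots, by induction on the length. The last letter t of w is
  stripped off, and s as well when it shortens further. With labels 2 and 3 only, t sends the root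
  of s to itself or to the sum of both roots, so few cases arise and the coordinates stay
  integral.\<close>

lemma rho_root_nonneg:
  "w \<in> carrier W \<Longrightarrow> s \<in> R \<Longrightarrow> len w < len (w \<otimes> s) \<Longrightarrow> 0 \<le> rho w (simple_root s) u"
proof (induction "len w" arbitrary: w s rule: less_induct)
  case less
  note w = less.prems(1) and s = less.prems(2)
  show ?case
  proof (cases "w = \<one>")
    case True
    then show ?thesis by (simp add: simple_root_def)
  next
    case False
    obtain ws where ws: "set ws \<subseteq> R" "wp ws = w" "length ws = len w" using ex_reduced[OF w] by blast
    with False obtain ws' t where "ws = ws' @ [t]" by (cases ws rule: rev_cases) auto
    define v where "v = w \<otimes> t"
    have t: "t \<in> R" and v: "v \<in> carrier W" and wv: "w = v \<otimes> t" and vws: "v = wp ws'"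
      using ws \<open>ws = ws' @ [t]\<close> by (auto simp: v_def m_assoc)
    have lv: "len w = len v + 1"
      using len_le[of ws'] len_mult_le[OF v, of t] t ws \<open>ws = ws' @ [t]\<close> by (auto simp: vws wv)
    have ts: "t \<noteq> s" using less.prems lv v t by (auto simp: wv m_assoc)
    have lws: "len (w \<otimes> s) = len v + 2" using len_mult_R[OF w s] less.prems lv by auto
    have IH: "0 \<le> rho x (simple_root y) u" if "len x < len w" "x \<in> carrier W" "y \<in> R" "len x < len (x \<otimes> y)"
      for x y using less.hyps[of x y] that by simp
    have rw: "rho w (simple_root s) = rho v (rho t (simple_root s))" unfolding wv using v t by (simp add: rho_mult)
    from laced[OF t s ts] show ?thesis
    proof
      assume 2: "ord (t \<otimes> s) = 2"
      then have "rho t (simple_root s) = simple_root s" using t s ts by (simp add: rho_R_root cartan_def)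
      moreover have "w \<otimes> s = v \<otimes> s \<otimes> t"
        using ord_2_commute[OF t s 2] v s t by (simp add: wv m_assoc)
      then have "len v < len (v \<otimes> s)"
        using lws len_mult_le[of "v \<otimes> s" t] v s t by simp
      ultimately show ?thesis using rw IH[of v s] v s lv by simp
    next
      assume 3: "ord (t \<otimes> s) = 3"
      then have "rho t (simple_root s) = (\<lambda>u. 1 * simple_root s u + 1 * simple_root t u)"
        using t s ts by (simp add: rho_R_root cartan_def)
      then have sum: "rho w (simple_root s) = (\<lambda>u. rho v (simple_root s) u + rho v (simple_root t) u)"
        unfolding rw using rho_linear[OF v, of 1 "simple_root s" 1 "simple_root t"] by simp
      have vt: "0 \<le> rho v (simple_root t) u" using IH[of v t] v t lv wv by simp
      show ?thesis
      proof (cases "len v < len (v \<otimes> s)")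
        case True
        then show ?thesis using IH[of v s] v s lv vt sum by simp
      next
        case False
        define x where "x = v \<otimes> s"
        have x: "x \<in> carrier W" and vx: "v = x \<otimes> s" using v s by (auto simp: x_def)
        have lx: "len v = len x + 1" using len_mult_R[OF v s] False by (auto simp: x_def)
        have "rho v (\<lambda>u. 1 * simple_root s u + 1 * simple_root t u) = rho x (simple_root t)"
        proof -
          have "cartan s t = - 1" using 3 ts ord_commute[OF s t] by (simp add: cartan_def)
          then have "rho s (\<lambda>u. 1 * simple_root s u + 1 * simple_root t u) = simple_root t"
            unfolding rho_linear[OF R_closed[OF s]] rho_R_self[OF s] rho_R_root[OF s t] by simp
          then show ?thesis using x s by (simp add: vx rho_mult)
        qed
        then have eq: "rho w (simple_root s) = rho x (simple_root t)"
          unfolding sum using rho_linear[OF v, of 1 "simple_root s" 1 "simple_root t"] by simp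
        \<comment> \<open>If t shortened x too, the product ws would be y followed by t s t s, and
          the braid relation would contract these four letters to two, against the length of
          ws.\<close>
        have "len x < len (x \<otimes> t)"
        proof (rule ccontr)
          assume *: "\<not> len x < len (x \<otimes> t)"
          define y where "y = x \<otimes> t"
          have y: "y \<in> carrier W" and xy: "x = y \<otimes> t" using x t by (auto simp: y_def)
          have ly: "len x = len y + 1" using len_mult_R[OF x t] * by (auto simp: y_def)
          have "w \<otimes> s = y \<otimes> (t \<otimes> (s \<otimes> t)) \<otimes> s" using y s t by (simp add: wv vx xy m_assoc)
          also have "\<dots> = y \<otimes> s \<otimes> t" using ord_3_braid[OF t s 3] y s t by (simp add: m_assoc)
          finally have "len (w \<otimes> s) \<le> len y + 2"
            using len_mult_le[of "y \<otimes> s" t] len_mult_le[of y s] y s t by simp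
          then show False using lws ly lx by simp
        qed
        then show ?thesis using IH[of x t] x t lx lv eq by simp
      qed
    qed
  qed
qed

lemma rho_root_nonpos:
  assumes "w \<in> carrier W" "s \<in> R" "len (w \<otimes> s) < len w"
  shows "rho w (simple_root s) u \<le> 0"
proof -
  have "rho w (simple_root s) = rho (w \<otimes> s) (rho s (simple_root s))"
    using assms by (simp flip: rho_mult)
  also have "\<dots> = (\<lambda>u. - rho (w \<otimes> s) (simple_root s) u)"
    using rho_scale[of "w \<otimes> s" "- 1" "simple_root s"] assms by (simp add: rho_R_self)
  finally show ?thesis using rho_root_nonneg[of "w \<otimes> s" s u] assms by simp
qed

text \<open>Since \<open>\<delta> s\<close> times w0 equals w0 times s, the image of the root of s
  is negated by the reflection \<open>\<delta> s\<close>; so it is a multiple of the root of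
  \<open>\<delta> s\<close>, and a nonpositive one because s shortens w0. As w0 squares to 1, two
  such integer factors have product 1, so both are -1.\<close>

lemma rho_w0_root:
  assumes s: "s \<in> R"
  shows "rho w0 (simple_root s) = (\<lambda>u. - simple_root (\<delta> s) u)"
proof -
  have ex: "\<exists>c\<le>0. rho w0 (simple_root s) = (\<lambda>u. c * simple_root (\<delta> s) u)" if s: "s \<in> R" for s
  proof -
    define g where "g = rho w0 (simple_root s)"
    have "\<delta> s \<otimes> w0 = w0 \<otimes> s" using s by (simp add: w0_conj_def m_assoc)
    then have "rho (\<delta> s) g = rho w0 (rho s (simple_root s))"
      unfolding g_def using s by (simp flip: rho_mult)
    also have "\<dots> = (\<lambda>u. - g u)"
      using rho_scale[of w0 "- 1" "simple_root s"] s by (simp add: rho_R_self g_def)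
    finally have "(\<lambda>u. g u - pair (\<delta> s) g * simple_root (\<delta> s) u) = (\<lambda>u. - g u)"
      using rho_R_apply[of "\<delta> s" g] s by simp
    then have eq: "g u - pair (\<delta> s) g * simple_root (\<delta> s) u = - g u" for u by (rule fun_cong)
    have "g u = 0" if "u \<noteq> \<delta> s" for u
      using eq[of u] that by (simp add: simple_root_def)
    then have "g = (\<lambda>u. g (\<delta> s) * simple_root (\<delta> s) u)" by (auto simp: simple_root_def fun_eq_iff)
    moreover have "g (\<delta> s) \<le> 0" unfolding g_def
      by (rule rho_root_nonpos) (use s len_w0_mult[of s] in auto)
    ultimately show ?thesis unfolding g_def[symmetric] by blast
  qed
  obtain c where c: "c \<le> 0" "rho w0 (simple_root s) = (\<lambda>u. c * simple_root (\<delta> s) u)" using ex[OF s] by blast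
  obtain d where d: "d \<le> 0" "rho w0 (simple_root (\<delta> s)) = (\<lambda>u. d * simple_root s u)"
    using ex[of "\<delta> s"] s by auto
  have "simple_root s = rho w0 (rho w0 (simple_root s))" by (simp flip: rho_mult)
  also have "\<dots> = (\<lambda>u. c * (d * simple_root s u))"
    unfolding c(2) using rho_scale[of w0 c "simple_root (\<delta> s)"] d by simp
  finally have "simple_root s s = c * (d * simple_root s s)" by meson
  then have "c * d = 1" by (simp add: simple_root_def)
  then have "c = - 1" using c(1) d(1) by (simp add: zmult_eq_1_iff)
  then show ?thesis using c by simp
qed

text \<open>
  A vector \<open>x\<close> in the radical of the Cartan matrix modulo \<open>k\<close> represents \<open>k\<close> times a weight.
  It is fixed by \<open>W\<close> modulo \<open>k\<close>, while \<open>w\<^sub>0\<close> acts on roots as \<open>-\<delta>\<close>.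
\<close>

lemma dvd_w0_conj:
  fixes x :: "'a \<Rightarrow> int"
  assumes rad: "\<And>s. s \<in> R \<Longrightarrow> k dvd pair s x" and supp: "\<And>u. u \<notin> R \<Longrightarrow> x u = 0" and u: "u \<in> R"
  shows "k dvd x (\<delta> u) + x u"
proof -
  have "\<exists>h. foldr (refl_act cartan R) ws x = (\<lambda>u. 1 * x u + k * h u)" if "set ws \<subseteq> R" for ws
    using that
  proof (induction ws)
    case Nil
    then show ?case by (intro exI[of _ "\<lambda>_. 0"]) simp
  next
    case (Cons s ws)
    then obtain h where h: "foldr (refl_act cartan R) ws x = (\<lambda>u. 1 * x u + k * h u)"
      by (metis (no_types) set_subset_Cons subset_trans)
    have s: "s \<in> R" using Cons by simp
    obtain q where q: "pair s x = k * q" using rad[OF s] by blast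
    have "foldr (refl_act cartan R) (s # ws) x = rho s (\<lambda>u. 1 * x u + k * h u)"
      using h s by (simp add: rho_R)
    also have "\<dots> = (\<lambda>u. 1 * rho s x u + k * rho s h u)" using s by (simp only: rho_linear[OF R_closed[OF s]])
    also have "\<dots> = (\<lambda>u. 1 * x u + k * (rho s h u - q * simple_root s u))"
      unfolding rho_R_apply[OF s, of x] q by (simp add: algebra_simps)
    finally have eq: "foldr (refl_act cartan R) (s # ws) x =
        (\<lambda>u. 1 * x u + k * (rho s h u - q * simple_root s u))" .
    show ?case by (rule exI[of _ "\<lambda>u. rho s h u - q * simple_root s u"], rule eq)
  qed
  moreover obtain ws where ws: "set ws \<subseteq> R" "wp ws = w0" using ex_word[OF w0_closed] by blast
  ultimately obtain h where h: "rho w0 x = (\<lambda>u. 1 * x u + k * h u)"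
    using rho_wp[OF ws(1)] by (metis (no_types))
  \<comment> \<open>Having support in R, x is the combination of simple roots with its own values as
    coefficients, so the action of w0 on the roots determines \<open>rho w0 x\<close>.\<close>
  have "x = (\<lambda>u. \<Sum>s\<in>R. x s * simple_root s u)"
  proof
    fix u
    have "(\<Sum>s\<in>R. x s * simple_root s u) = (\<Sum>s\<in>R. x s * (if s = u then 1 else 0))"
      unfolding simple_root_def by (intro sum.cong) auto
    also have "\<dots> = x u"
    proof (cases "u \<in> R")
      case True
      then show ?thesis using sum_single[OF finite_R True, of x 1] by simp
    next
      case False
      then have "(\<Sum>s\<in>R. x s * (if s = u then 1 else 0)) = 0" by (intro sum.neutral) auto
      then show ?thesis using supp[OF False] by simp
    qed
    finally show "x u = (\<Sum>s\<in>R. x s * simple_root s u)" by simp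
  qed
  then have "rho w0 x = (\<lambda>v. \<Sum>s\<in>R. x s * rho w0 (simple_root s) v)"
    using rho_sum[OF w0_closed finite_R, of x simple_root] by simp
  also have "\<dots> = (\<lambda>v. \<Sum>s\<in>R. x s * - simple_root (\<delta> s) v)"
    by (intro ext sum.cong) (auto simp: rho_w0_root)
  finally have "rho w0 x (\<delta> u) = (\<Sum>s\<in>R. x s * - simple_root (\<delta> s) (\<delta> u))" by simp
  also have "\<dots> = (\<Sum>s\<in>R. x s * (if s = u then - 1 else 0))"
    using u by (intro sum.cong) (auto simp: simple_root_def w0_conj_eq_iff)
  also have "\<dots> = - x u" using sum_single[OF finite_R u, of x "- 1"] by simp
  finally have "x (\<delta> u) + x u = k * (- h (\<delta> u))" using h by (simp add: algebra_simps)
  then show ?thesis by simp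
qed

end

section \<open>Positive definite diagrams\<close>

lemma cos_pi_div_mono:
  assumes "1 \<le> k" "k \<le> n"
  shows "cos (pi / real k) \<le> cos (pi / real n)"
  by (rule cos_monotone_0_pi_le) (use assms in \<open>auto simp: field_simps intro!: frac_le\<close>)

text \<open>From \<open>cos 3y = - cos 2y\<close> at y = pi/5 the value x satisfies
  \<open>4 x^2 - 2 x - 1 = 0\<close>. The rational bound 4/5 is good enough for the estimates 8/5
  and 5/2 used for edges with label at least 5.\<close>

lemma cos_pi_5: "4/5 \<le> cos (pi / 5)"
proof -
  define x where "x = cos (pi / 5)"
  have x: "x > 0" unfolding x_def by (rule cos_gt_zero_pi) (auto intro: order_less_trans[of _ 0])
  have "3 * (pi / 5) = pi - 2 * (pi / 5)" by simp
  then have "cos (3 * (pi / 5)) = - cos (2 * (pi / 5))"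
    using cos_pi_minus[of "2 * (pi / 5)"] by simp
  then have "4 * x^3 - 3 * x = 1 - 2 * x^2"
    unfolding cos_treble_cos cos_double_cos x_def by simp
  then have "(x + 1) * (4 * x^2 - 2 * x - 1) = 0"
    by (simp add: algebra_simps power2_eq_square power3_eq_cube)
  then have q: "4 * x^2 - 2 * x - 1 = 0" using x by simp
  show ?thesis
  proof (rule ccontr)
    assume "\<not> 4/5 \<le> cos (pi / 5)"
    then have "x < 4/5" by (simp add: x_def)
    \<comment> \<open>The product is the quadratic plus 1/25, hence equal to 1/25 at its root
      x.\<close>
    then have "(x - 4/5) * (4 * x + 6/5) < 0" using x by (intro mult_neg_pos) auto
    moreover have "(x - 4/5) * (4 * x + 6/5) = 1/25"
      using q by (simp add: power2_eq_square algebra_simps)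
    ultimately show False by simp
  qed
qed

text \<open>What the classification of diagrams takes from the group: the matrix of labels,
  connectedness, and positivity of the cosine matrix.\<close>

locale positive_coxeter_graph =
  fixes R :: "'a set" and m :: "'a \<Rightarrow> 'a \<Rightarrow> nat"
  assumes fin: "finite R" and ne: "R \<noteq> {}"
    and m_diag [simp]: "s \<in> R \<Longrightarrow> m s s = 1"
    and m_sym: "s \<in> R \<Longrightarrow> t \<in> R \<Longrightarrow> m s t = m t s"
    and m_ge: "s \<in> R \<Longrightarrow> t \<in> R \<Longrightarrow> s \<noteq> t \<Longrightarrow> m s t \<ge> 2"
    and conn: "s \<in> R \<Longrightarrow> t \<in> R \<Longrightarrow> (s, t) \<in> {(s, t). s \<in> R \<and> t \<in> R \<and> s \<noteq> t \<and> m s t \<noteq> 2}\<^sup>*"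
    and pos: "r \<in> R \<Longrightarrow> f r \<noteq> 0 \<Longrightarrow> 0 < (\<Sum>s\<in>R. \<Sum>t\<in>R. - 2 * cos (pi / of_nat (m s t)) * f s * f t)"
begin

text \<open>The negated cosine entry, so that edges carry positive weights; on the diagonal its
  value is -2.\<close>

definition c :: "'a \<Rightarrow> 'a \<Rightarrow> real" where "c s t = 2 * cos (pi / of_nat (m s t))"

definition adj :: "'a \<Rightarrow> 'a \<Rightarrow> bool" where
  "adj s t \<longleftrightarrow> s \<in> R \<and> t \<in> R \<and> s \<noteq> t \<and> m s t \<noteq> 2"

lemma c_sym: "s \<in> R \<Longrightarrow> t \<in> R \<Longrightarrow> c s t = c t s"
  by (simp add: c_def m_sym)

lemma adj_sym: "adj s t \<longleftrightarrow> adj t s"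
  by (auto simp: adj_def m_sym)

lemma adj_irrefl [simp]: "\<not> adj s s"
  by (simp add: adj_def)

lemma adj_R: "adj s t \<Longrightarrow> s \<in> R" "adj s t \<Longrightarrow> t \<in> R"
  by (auto simp: adj_def)

lemma adj_ge3: "adj s t \<Longrightarrow> m s t \<ge> 3"
  using m_ge[of s t] by (auto simp: adj_def)

lemma c_ge0: "s \<in> R \<Longrightarrow> t \<in> R \<Longrightarrow> s \<noteq> t \<Longrightarrow> 0 \<le> c s t"
  using cos_pi_div_mono[of 2 "m s t"] m_ge[of s t] by (simp add: c_def)

lemma c_ge1: "adj s t \<Longrightarrow> 1 \<le> c s t"
  using cos_pi_div_mono[of 3 "m s t"] adj_ge3[of s t] by (simp add: c_def cos_60)

lemma c_sq4: "adj s t \<Longrightarrow> m s t \<ge> 4 \<Longrightarrow> 2 \<le> c s t * c s t"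
proof -
  assume a: "adj s t" "m s t \<ge> 4"
  then have "sqrt 2 \<le> c s t"
    using cos_pi_div_mono[of 4 "m s t"] by (simp add: c_def cos_45)
  then have "sqrt 2 * sqrt 2 \<le> c s t * c s t" using c_ge1[OF a(1)] by (intro mult_mono) auto
  then show ?thesis by simp
qed

lemma c_ge5: "adj s t \<Longrightarrow> m s t \<ge> 5 \<Longrightarrow> 8/5 \<le> c s t"
  using cos_pi_div_mono[of 5 "m s t"] cos_pi_5 by (simp add: c_def)

lemma c_sq5: "adj s t \<Longrightarrow> m s t \<ge> 5 \<Longrightarrow> 5/2 \<le> c s t * c s t"
  using mult_mono[OF c_ge5[of s t] c_ge5[of s t]] c_ge1[of s t] by simp

lemma c_sq6: "adj s t \<Longrightarrow> m s t \<ge> 6 \<Longrightarrow> 3 \<le> c s t * c s t"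
proof -
  assume a: "adj s t" "m s t \<ge> 6"
  then have "sqrt 3 \<le> c s t"
    using cos_pi_div_mono[of 6 "m s t"] by (simp add: c_def cos_30)
  then have "sqrt 3 * sqrt 3 \<le> c s t * c s t" using c_ge1[OF a(1)] by (intro mult_mono) auto
  then show ?thesis by simp
qed

text \<open>
  A nonnegative vector on which the cosine matrix is nonpositive at each node of its support
  contradicts positivity. All exclusions below exhibit such a vector.
\<close>

lemma no_subharmonic:
  assumes f: "\<And>u. u \<in> R \<Longrightarrow> 0 \<le> f u" and r: "r \<in> R" "f r > 0"
    and sub: "\<And>u. u \<in> R \<Longrightarrow> 0 < f u \<Longrightarrow> \<exists>N\<subseteq>R - {u}. 2 * f u \<le> (\<Sum>v\<in>N. c u v * f v)"
  shows False
proof -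
  have "(\<Sum>s\<in>R. \<Sum>t\<in>R. - 2 * cos (pi / of_nat (m s t)) * f s * f t) = (\<Sum>s\<in>R. f s * (\<Sum>t\<in>R. - c s t * f t))"
    by (simp add: c_def sum_distrib_left algebra_simps)
  also have "\<dots> \<le> 0"
  proof (rule sum_nonpos)
    fix s assume s: "s \<in> R"
    show "f s * (\<Sum>t\<in>R. - c s t * f t) \<le> 0"
    proof (cases "f s = 0")
      case False
      then have fs: "f s > 0" using f[OF s] by simp
      obtain N where N: "N \<subseteq> R - {s}" "2 * f s \<le> (\<Sum>v\<in>N. c s v * f v)" using sub[OF s fs] by blast
      have "(\<Sum>v\<in>N. c s v * f v) \<le> (\<Sum>v\<in>R - {s}. c s v * f v)"
        using N(1) fin s by (intro sum_mono2) (auto intro!: mult_nonneg_nonneg c_ge0 f)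
      moreover have "(\<Sum>t\<in>R. c s t * f t) = c s s * f s + (\<Sum>v\<in>R - {s}. c s v * f v)"
        using fin s by (rule sum.remove)
      moreover have "c s s = - 2" using s by (simp add: c_def)
      ultimately have "(\<Sum>t\<in>R. c s t * f t) \<ge> 0" using N(2) by simp
      then have "(\<Sum>t\<in>R. - c s t * f t) \<le> 0" by (simp add: sum_negf)
      then show ?thesis using fs by (simp add: mult_nonneg_nonpos)
    qed simp
  qed
  finally show False using pos[of r f] r by simp
qed

text \<open>The form suited to explicit diagrams: \<open>J i\<close> names the neighbours that are
  counted. Omitted ones could only enlarge the right-hand side.\<close>

lemma no_subharmonic_indexed:
  fixes v :: "nat \<Rightarrow> 'a" and g :: "nat \<Rightarrow> real"
  assumes inj: "inj_on v {..<n}" and R: "v ` {..<n} \<subseteq> R" and n: "0 < n" and g: "\<And>i. i < n \<Longrightarrow> 0 < g i"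
    and sub: "\<And>i. i < n \<Longrightarrow> J i \<subseteq> {..<n} - {i} \<and> 2 * g i \<le> (\<Sum>j\<in>J i. c (v i) (v j) * g j)"
  shows False
proof -
  define f where "f u = (if u \<in> v ` {..<n} then g (the_inv_into {..<n} v u) else 0)" for u
  have fv: "f (v i) = g i" if "i < n" for i
    using that inj by (simp add: f_def the_inv_into_f_f)
  show False
  proof (rule no_subharmonic[of f "v 0"])
    fix u assume "u \<in> R" "0 < f u"
    then obtain i where i: "u = v i" "i < n" by (auto simp: f_def split: if_splits)
    have "v ` J i \<subseteq> R - {u}" using sub[OF i(2)] R inj i by (auto dest: inj_onD)
    moreover have "(\<Sum>w\<in>v ` J i. c u w * f w) = (\<Sum>j\<in>J i. c (v i) (v j) * f (v j))"
      using sub[OF i(2)] inj i by (subst sum.reindex) (auto intro: inj_on_subset)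
    moreover have "\<dots> = (\<Sum>j\<in>J i. c (v i) (v j) * g j)"
      using sub[OF i(2)] by (intro sum.cong) (auto simp: fv)
    ultimately show "\<exists>N\<subseteq>R - {u}. 2 * f u \<le> (\<Sum>v\<in>N. c u v * f v)"
      using sub[OF i(2)] i fv by (intro exI[of _ "v ` J i"]) simp
  next
    fix u assume "u \<in> R"
    show "0 \<le> f u"
    proof (cases "u \<in> v ` {..<n}")
      case True
      then obtain i where "u = v i" "i < n" by auto
      then show ?thesis using fv[of i] g[of i] by simp
    qed (simp add: f_def)
  qed (use R n fv[of 0] g[of 0] in auto)
qed

text \<open>Excludes the affine diagrams of types B, C and D, and whatever contains them, at one
  stroke. The path gets weight 2, and a node hanging on an end gets the weight c of its edge. A sum
  of squares at least 2 at an end, from one edge with label at least 4 or from two plain edges,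
  makes up for the missing path neighbour there.\<close>

lemma no_two_ended:
  fixes q :: "nat \<Rightarrow> 'a"
  assumes inj: "inj_on q {..k}" and q: "\<And>i. i < k \<Longrightarrow> adj (q i) (q (Suc i))" "q 0 \<in> R"
    and L: "L \<subseteq> R - q ` {..k}" "M \<subseteq> R - q ` {..k}" "L \<inter> M = {}"
    and Ls: "2 \<le> (\<Sum>v\<in>L. c (q 0) v * c (q 0) v)" and Ms: "2 \<le> (\<Sum>v\<in>M. c (q k) v * c (q k) v)"
  shows False
proof -
  have fLM: "finite L" "finite M" using L fin by (auto intro: finite_subset[of _ R])
  have qR: "q i \<in> R" if "i \<le> k" for i
    using q(1)[of "i - 1"] q(2) that by (cases i) (auto simp: adj_def)
  define f where "f u = (if u \<in> q ` {..k} then 2 else if u \<in> L then c (q 0) u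
      else if u \<in> M then c (q k) u else 0)" for u
  have fq: "f (q i) = 2" if "i \<le> k" for i using that by (simp add: f_def)
  have fL: "f u = c (q 0) u" if "u \<in> L" for u using that L by (auto simp: f_def)
  have fM: "f u = c (q k) u" if "u \<in> M" for u using that L by (auto simp: f_def)
  have qL: "q i \<notin> L" "q i \<notin> M" if "i \<le> k" for i using L that by auto
  have sL: "2 \<le> (\<Sum>v\<in>L. c (q 0) v * f v)" using Ls by (simp add: fL)
  have sM: "2 \<le> (\<Sum>v\<in>M. c (q k) v * f v)" using Ms by (simp add: fM)
  have qi: "q i = q j \<longleftrightarrow> i = j" if "i \<le> k" "j \<le> k" for i j using inj that by (auto dest: inj_onD)
  have c1: "1 \<le> c (q i) (q (Suc i))" "1 \<le> c (q (Suc i)) (q i)" if "i < k" for i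
    using c_ge1[OF q(1)[OF that]] that c_sym[OF qR[of i] qR[of "Suc i"]] by auto
  show False
  proof (rule no_subharmonic[of f "q 0"])
    fix u assume u: "u \<in> R" "0 < f u"
    then consider i where "i \<le> k" "u = q i" | "u \<in> L" | "u \<in> M" by (auto simp: f_def split: if_splits)
    then show "\<exists>N\<subseteq>R - {u}. 2 * f u \<le> (\<Sum>v\<in>N. c u v * f v)"
    proof cases
      case 1
      consider "k = 0" | "i = 0" "0 < k" | "i = k" "0 < k" | "0 < i" "i < k" using 1 by linarith
      then show ?thesis
      proof cases
        case a: 1
        have "(\<Sum>v\<in>L \<union> M. c u v * f v) = (\<Sum>v\<in>L. c u v * f v) + (\<Sum>v\<in>M. c u v * f v)"
          using fLM L by (intro sum.union_disjoint) auto
        moreover have "u = q 0" "u = q k" using 1 a by auto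
        ultimately have "2 * f u \<le> (\<Sum>v\<in>L \<union> M. c u v * f v)" using sL sM 1 fq by simp
        then show ?thesis using L \<open>u = q 0\<close> by (intro exI[of _ "L \<union> M"]) auto
      next
        case a: 2
        have "(\<Sum>v\<in>insert (q 1) L. c u v * f v) = c u (q 1) * f (q 1) + (\<Sum>v\<in>L. c u v * f v)"
          using fLM qL[of 1] a by (intro sum.insert) auto
        then have "2 * f u \<le> (\<Sum>v\<in>insert (q 1) L. c u v * f v)"
          using sL 1 a fq[of 0] fq[of 1] c1[of 0] by simp
        then show ?thesis using L 1 a qR[of 1] qi[of 0 1] by (intro exI[of _ "insert (q 1) L"]) auto
      next
        case a: 3
        define j where "j = k - 1"
        have j: "k = Suc j" using a by (simp add: j_def)
        have "(\<Sum>v\<in>insert (q j) M. c u v * f v) = c u (q j) * f (q j) + (\<Sum>v\<in>M. c u v * f v)"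
          using fLM qL[of j] j by (intro sum.insert) auto
        then have "2 * f u \<le> (\<Sum>v\<in>insert (q j) M. c u v * f v)"
          using sM 1 a fq[of k] fq[of j] c1[of j] j by simp
        then show ?thesis using L 1 a j qR[of j] qi[of j k] by (intro exI[of _ "insert (q j) M"]) auto
      next
        case a: 4
        define j where "j = i - 1"
        have j: "i = Suc j" using a by (simp add: j_def)
        have ne: "q j \<noteq> q (Suc i)" using qi[of j "Suc i"] a j by simp
        have "2 * f u \<le> (\<Sum>v\<in>{q j, q (Suc i)}. c u v * f v)"
          using ne a 1 j fq[of i] fq[of j] fq[of "Suc i"] c1[of j] c1[of i] by simp
        then show ?thesis using a 1 j qR[of j] qR[of "Suc i"] qi[of j i] qi[of "Suc i" i]
          by (intro exI[of _ "{q j, q (Suc i)}"]) auto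
      qed
    next
      case 2
      then have "2 * f u \<le> (\<Sum>v\<in>{q 0}. c u v * f v)" "q 0 \<noteq> u"
        using fq[of 0] fL[of u] c_sym[of u "q 0"] u q(2) qL[of 0] by auto
      then show ?thesis using q(2) by (intro exI[of _ "{q 0}"]) auto
    next
      case 3
      then have "2 * f u \<le> (\<Sum>v\<in>{q k}. c u v * f v)" "q k \<noteq> u"
        using fq[of k] fM[of u] c_sym[of u "q k"] u qR[of k] qL[of k] by auto
      then show ?thesis using qR[of k] by (intro exI[of _ "{q k}"]) auto
    qed
  next
    fix u assume "u \<in> R"
    then show "0 \<le> f u" using q(2) qR[of k] L by (auto simp: f_def intro!: c_ge0)
  qed (use q(2) fq[of 0] in auto)
qed

lemma sum_c_two:
  assumes "adj u v" "adj u w" "v \<noteq> w"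
  shows "2 \<le> (\<Sum>x\<in>{v, w}. c u x * c u x)"
proof -
  have "1 * 1 \<le> c u v * c u v" "1 * 1 \<le> c u w * c u w"
    using c_ge1[OF assms(1)] c_ge1[OF assms(2)] by (intro mult_mono; simp)+
  then show ?thesis using assms(3) by simp
qed

text \<open>Ordered pairs, so every edge is counted twice.\<close>

definition edges :: "'a set \<Rightarrow> ('a \<times> 'a) set" where
  "edges C = {(s, t) \<in> C \<times> C. adj s t}"

text \<open>The form at the indicator vector of C is at most 2 |C| minus the number of ordered
  edges, since an edge has weight at least 1. In graph terms, there are no cycles.\<close>

lemma card_edges_less:
  assumes C: "C \<subseteq> R" "C \<noteq> {}"
  shows "card (edges C) < 2 * card C"
proof -
  have fC: "finite C" using C fin finite_subset by blast
  obtain r where r: "r \<in> C" using C by blast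
  define f where "f u = (if u \<in> C then 1 else 0 :: real)" for u
  have "0 < (\<Sum>s\<in>R. \<Sum>t\<in>R. - 2 * cos (pi / of_nat (m s t)) * f s * f t)"
    using pos[of r f] r C by (auto simp: f_def)
  also have "\<dots> = (\<Sum>(s, t)\<in>R \<times> R. - c s t * f s * f t)"
    by (simp add: sum.cartesian_product c_def)
  also have "\<dots> = (\<Sum>(s, t)\<in>C \<times> C. - c s t)"
    using C fin by (intro sum.mono_neutral_cong_right) (auto simp: f_def split: if_splits)
  also have "\<dots> \<le> (\<Sum>(s, t)\<in>C \<times> C. (if s = t then 2 else 0) - (if adj s t then 1 else 0))"
  proof -
    have "- c s t \<le> (if s = t then 2 else 0) - (if adj s t then 1 else 0)" if "s \<in> C" "t \<in> C" for s t
    proof (cases "s = t")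
      case True
      then show ?thesis using that C by (auto simp: adj_def c_def)
    next
      case False
      then show ?thesis using that C c_ge0[of s t] c_ge1[of s t] by auto
    qed
    then show ?thesis by (intro sum_mono) auto
  qed
  also have "\<dots> = (\<Sum>(s, t)\<in>C \<times> C. if s = t then 2 else 0) - (\<Sum>(s, t)\<in>C \<times> C. if adj s t then 1 else 0)"
    by (simp add: sum_subtractf case_prod_beta)
  also have "(\<Sum>(s, t)\<in>C \<times> C. if s = t then 2 else 0 :: real) = 2 * card C"
    using fC by (simp add: sum.cartesian_product[symmetric] sum.delta)
  also have "(\<Sum>(s, t)\<in>C \<times> C. if adj s t then 1 else 0 :: real) = card (edges C)"
  proof -
    have "C \<times> C \<inter> {p. p \<in> edges C} = edges C" by (auto simp: edges_def)
    then have "(\<Sum>p\<in>C \<times> C. if p \<in> edges C then 1 else 0 :: real) = card (edges C)"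
      using fC by (simp add: sum.If_cases)
    moreover have "(\<Sum>(s, t)\<in>C \<times> C. if adj s t then 1 else 0 :: real) =
        (\<Sum>p\<in>C \<times> C. if p \<in> edges C then 1 else 0)"
      by (intro sum.cong) (auto simp: edges_def split: if_splits)
    ultimately show ?thesis by simp
  qed
  finally show ?thesis by linarith
qed

text \<open>At least |C| - 1 undirected edges, the largest number that
  \<open>card_edges_less\<close> allows; this count stands in for being a subtree.\<close>

definition treelike :: "'a set \<Rightarrow> bool" where
  "treelike C \<longleftrightarrow> C \<subseteq> R \<and> C \<noteq> {} \<and> 2 * card C \<le> card (edges C) + 2"

lemma treelike_single: "u \<in> R \<Longrightarrow> treelike {u}"
  by (simp add: treelike_def)

text \<open>Every neighbour of x in C adds two ordered edges. One neighbour is given, and the bound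
  on the number of edges leaves no room for a second.\<close>

lemma treelike_insert:
  assumes C: "treelike C" and x: "x \<in> R" "x \<notin> C" and u: "u \<in> C" "adj x u"
  shows "treelike (insert x C)" and "\<And>v. v \<in> C \<Longrightarrow> adj x v \<Longrightarrow> v = u"
proof -
  have CR: "C \<subseteq> R" using C by (simp add: treelike_def)
  then have fC: "finite C" using fin finite_subset by blast
  define N where "N = {v \<in> C. adj x v}"
  have fN: "finite N" using fC by (simp add: N_def)
  have e: "edges (insert x C) = edges C \<union> Pair x ` N \<union> (\<lambda>v. (v, x)) ` N"
    by (auto simp: edges_def N_def adj_irrefl intro: adj_sym[THEN iffD1])
  have fE: "finite (edges C)" using fC by (auto simp: edges_def intro: finite_subset[of _ "C \<times> C"])
  have "card (edges (insert x C)) = card (edges C \<union> Pair x ` N) + card ((\<lambda>v. (v, x)) ` N)"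
    unfolding e using fE fN x by (intro card_Un_disjoint) (auto simp: edges_def N_def)
  also have "card (edges C \<union> Pair x ` N) = card (edges C) + card (Pair x ` N)"
    using fE fN x by (intro card_Un_disjoint) (auto simp: edges_def N_def)
  finally have card: "card (edges (insert x C)) = card (edges C) + 2 * card N"
    by (simp add: card_image inj_on_def)
  have uN: "u \<in> N" using u by (simp add: N_def)
  then have N1: "card N \<ge> 1" using fN by (metis One_nat_def Suc_leI card_gt_0_iff empty_iff)
  show "treelike (insert x C)" using C card N1 x fC by (simp add: treelike_def)
  have "card (edges (insert x C)) < 2 * card (insert x C)" using card_edges_less[of "insert x C"] CR x by simp
  then have "card N \<le> 1" using C card x fC by (simp add: treelike_def)
  then show "v = u" if "v \<in> C" "adj x v" for v
    using uN that fN by (auto simp: N_def card_le_Suc0_iff_eq)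
qed

lemma connected_step:
  assumes "C \<subseteq> R" "C \<noteq> {}" "C \<noteq> R"
  shows "\<exists>u\<in>C. \<exists>x\<in>R - C. adj x u"
proof (rule ccontr)
  assume no: "\<not> ?thesis"
  obtain u y where uy: "u \<in> C" "y \<in> R" "y \<notin> C" using assms by blast
  have "(u, y) \<in> {(s, t). s \<in> R \<and> t \<in> R \<and> s \<noteq> t \<and> m s t \<noteq> 2}\<^sup>*" using conn[of u y] uy assms by auto
  then have "y \<in> C"
  proof (induction rule: rtrancl_induct)
    case (step a b)
    then have "adj b a" by (auto simp: adj_def m_sym)
    then show ?case using no step adj_R by blast
  qed (use uy in simp)
  with uy show False by simp
qed

end

section \<open>Unbranched diagrams\<close>

context positive_coxeter_graph
begin

definition graph_type :: "nat \<Rightarrow> (nat \<Rightarrow> nat \<Rightarrow> nat) \<Rightarrow> bool" where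
  "graph_type n M \<longleftrightarrow> (\<exists>q. bij_betw q {1..n} R \<and> (\<forall>i\<in>{1..n}. \<forall>j\<in>{1..n}. m (q i) (q j) = M i j))"

definition ipath :: "'a list \<Rightarrow> bool" where
  "ipath p \<longleftrightarrow> distinct p \<and> set p \<subseteq> R \<and>
     (\<forall>i j. i < j \<longrightarrow> j < length p \<longrightarrow> (adj (p ! i) (p ! j) \<longleftrightarrow> j = Suc i))"

lemma ipath_rev:
  assumes "ipath p"
  shows "ipath (rev p)"
proof -
  have "adj (rev p ! i) (rev p ! j) \<longleftrightarrow> j = Suc i" if "i < j" "j < length p" for i j
  proof -
    have "adj (p ! (length p - Suc j)) (p ! (length p - Suc i)) \<longleftrightarrow> length p - Suc i = Suc (length p - Suc j)"
      using assms that by (simp add: ipath_def)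
    also have "\<dots> \<longleftrightarrow> j = Suc i" using that by auto
    finally show ?thesis using that adj_sym by (simp add: rev_nth)
  qed
  then show ?thesis using assms by (simp add: ipath_def)
qed

lemma ipath_snoc:
  assumes p: "ipath p" "treelike (set p)" "p \<noteq> []" and x: "x \<in> R" "x \<notin> set p" "adj x (last p)"
  shows "ipath (p @ [x]) \<and> treelike (set (p @ [x]))"
proof -
  have l: "last p \<in> set p" using p by simp
  have uniq: "v = last p" if "v \<in> set p" "adj x v" for v
    using treelike_insert(2)[OF p(2) x(1,2) l x(3)] that by simp
  have "adj ((p @ [x]) ! i) ((p @ [x]) ! j) \<longleftrightarrow> j = Suc i" if ij: "i < j" "j < Suc (length p)" for i j
  proof (cases "j = length p")
    case True
    have "adj x (p ! i) \<longleftrightarrow> p ! i = last p" using uniq[of "p ! i"] x(3) ij by auto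
    also have "\<dots> \<longleftrightarrow> p ! i = p ! (length p - 1)" using p by (simp add: last_conv_nth)
    also have "\<dots> \<longleftrightarrow> j = Suc i"
      using p ij True by (subst nth_eq_iff_index_eq) (auto simp: ipath_def)
    finally show ?thesis using True ij adj_sym by (simp add: nth_append)
  next
    case False
    then show ?thesis using p ij by (simp add: nth_append ipath_def)
  qed
  moreover have "treelike (set (p @ [x]))"
    using treelike_insert(1)[OF p(2) x(1,2) l x(3)] by simp
  ultimately show ?thesis using p x by (simp add: ipath_def)
qed

text \<open>Take a longest induced treelike path. If it misses a node, connectedness supplies a
  missed node adjacent to it: at an end this would lengthen the path, at an inner node it would
  create a branch.\<close>

lemma path_cover:
  assumes no_branch: "\<And>u a b d. adj u a \<Longrightarrow> adj u b \<Longrightarrow> adj u d \<Longrightarrow> distinct [a, b, d] \<Longrightarrow> False"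
  shows "\<exists>p. ipath p \<and> set p = R"
proof -
  define P where "P p \<longleftrightarrow> ipath p \<and> treelike (set p) \<and> p \<noteq> []" for p
  obtain r where r: "r \<in> R" using ne by blast
  have "P [r]" using r by (simp add: P_def ipath_def treelike_single)
  moreover have "length p < card R + 1" if "P p" for p
    using that card_mono[OF fin, of "set p"] distinct_card[of p] by (simp add: P_def ipath_def)
  ultimately obtain p where p: "P p" and max: "\<And>p'. P p' \<Longrightarrow> length p' \<le> length p"
    using ex_has_greatest_nat[of P "[r]" length "card R + 1"] by blast
  have pr: "P (rev p)" using p ipath_rev[of p] by (simp add: P_def)
  have "set p = R"
  proof (rule ccontr)
    assume "set p \<noteq> R"
    then obtain u x where ux: "u \<in> set p" "x \<in> R" "x \<notin> set p" "adj x u"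
      using connected_step[of "set p"] p by (auto simp: P_def ipath_def)
    obtain i where i: "u = p ! i" "i < length p" using ux by (auto simp: in_set_conv_nth)
    consider "i = 0" | "Suc i = length p" | "0 < i" "Suc i < length p" using i by linarith
    then show False
    proof cases
      case 1
      then have "P (rev p @ [x])"
        using ipath_snoc[of "rev p" x] pr ux i by (simp add: P_def last_rev hd_conv_nth)
      then show False using max[of "rev p @ [x]"] by simp
    next
      case 2
      then have "i = length p - 1" by simp
      then have "P (p @ [x])"
        using ipath_snoc[of p x] p ux i by (simp add: P_def last_conv_nth)
      then show False using max[of "p @ [x]"] by simp
    next
      case 3
      have d: "distinct p" and a: "\<And>i j. i < j \<Longrightarrow> j < length p \<Longrightarrow> adj (p ! i) (p ! j) \<longleftrightarrow> j = Suc i"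
        using p by (auto simp: P_def ipath_def)
      have "adj u (p ! (i - 1))" using a[of "i - 1" i] 3 i adj_sym by simp
      moreover have "adj u (p ! Suc i)" using a[of i "Suc i"] 3 i by simp
      moreover have "adj u x" using ux adj_sym by simp
      moreover have "distinct [p ! (i - 1), p ! Suc i, x]"
        using d 3 ux i by (auto simp: nth_eq_iff_index_eq)
      ultimately show False using no_branch by blast
    qed
  qed
  then show ?thesis using p by (auto simp: P_def)
qed

lemma ipath_nth_R: "ipath p \<Longrightarrow> i < length p \<Longrightarrow> p ! i \<in> R"
  by (auto simp: ipath_def)

lemma ipath_adj: "ipath p \<Longrightarrow> Suc i < length p \<Longrightarrow> adj (p ! i) (p ! Suc i)"
  by (auto simp: ipath_def)

text \<open>Two edges with label at least 4 serve as the two ends in \<open>no_two_ended\<close>,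
  with the stretch between them as the path.\<close>

lemma at_most_one_heavy:
  assumes p: "ipath p" "i < j" "Suc j < length p"
    and h: "m (p ! i) (p ! Suc i) \<ge> 4" "m (p ! j) (p ! Suc j) \<ge> 4"
  shows False
proof (rule no_two_ended[of "\<lambda>l. p ! (Suc i + l)" "j - Suc i" "{p ! i}" "{p ! Suc j}"])
  have d: "distinct p" using p by (simp add: ipath_def)
  have adj: "adj (p ! i) (p ! Suc i)" "adj (p ! j) (p ! Suc j)" using ipath_adj[OF p(1)] p by auto
  show "inj_on (\<lambda>l. p ! (Suc i + l)) {..j - Suc i}"
    using d p by (auto simp: inj_on_def nth_eq_iff_index_eq)
  show "{p ! i} \<subseteq> R - (\<lambda>l. p ! (Suc i + l)) ` {..j - Suc i}"
    using d p ipath_nth_R[OF p(1), of i] by (auto simp: nth_eq_iff_index_eq)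
  show "{p ! Suc j} \<subseteq> R - (\<lambda>l. p ! (Suc i + l)) ` {..j - Suc i}"
    using d p ipath_nth_R[OF p(1), of "Suc j"] by (auto simp: nth_eq_iff_index_eq)
  show "{p ! i} \<inter> {p ! Suc j} = {}" using d p by (auto simp: nth_eq_iff_index_eq)
  have "c (p ! i) (p ! Suc i) = c (p ! Suc i) (p ! i)" using adj(1) by (auto simp: adj_def intro: c_sym)
  then show "2 \<le> (\<Sum>v\<in>{p ! i}. c (p ! (Suc i + 0)) v * c (p ! (Suc i + 0)) v)"
    using c_sq4[OF adj(1) h(1)] by simp
  have "Suc i + (j - Suc i) = j" using p by simp
  then show "2 \<le> (\<Sum>v\<in>{p ! Suc j}. c (p ! (Suc i + (j - Suc i))) v * c (p ! (Suc i + (j - Suc i))) v)"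
    using c_sq4[OF adj(2) h(2)] by simp
  show "adj (p ! (Suc i + l)) (p ! (Suc i + Suc l))" if "l < j - Suc i" for l
    using ipath_adj[OF p(1), of "Suc i + l"] that p by simp
  show "p ! (Suc i + 0) \<in> R" using ipath_nth_R[OF p(1)] p by simp
qed

lemma path_no_subharmonic:
  fixes g :: "nat \<Rightarrow> real"
  assumes p: "ipath p" "a + n \<le> length p" "0 < n" and g: "\<And>k. k < n \<Longrightarrow> 0 < g k"
    and sub: "\<And>k. k < n \<Longrightarrow> 2 * g k \<le> (if k = 0 then 0 else c (p ! (a + (k - 1))) (p ! (a + k)) * g (k - 1))
      + (if Suc k < n then c (p ! (a + k)) (p ! (a + Suc k)) * g (Suc k) else 0)"
  shows False
proof -
  have d: "distinct p" using p by (simp add: ipath_def)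
  define J where "J k = (if k = 0 then {} else {k - 1}) \<union> (if Suc k < n then {Suc k} else {})" for k
  show False
  proof (rule no_subharmonic_indexed[of "\<lambda>k. p ! (a + k)" n g J])
    show "inj_on (\<lambda>k. p ! (a + k)) {..<n}" using d p by (auto simp: inj_on_def nth_eq_iff_index_eq)
    show "(\<lambda>k. p ! (a + k)) ` {..<n} \<subseteq> R" using ipath_nth_R[OF p(1)] p by auto
    fix k assume k: "k < n"
    have "c (p ! (a + (k - 1))) (p ! (a + k)) = c (p ! (a + k)) (p ! (a + (k - 1)))"
      using ipath_nth_R[OF p(1)] p k by (intro c_sym) auto
    then show "J k \<subseteq> {..<n} - {k} \<and> 2 * g k \<le> (\<Sum>j\<in>J k. c (p ! (a + k)) (p ! (a + j)) * g j)"
      using sub[OF k] k by (cases k) (auto simp: J_def)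
  qed (use p g in auto)
qed

text \<open>The weights 1, 2, \<open>sqrt 3\<close> form the null vector of the affine diagram of
  type G2; w is the actual weight of the edge.\<close>

lemma heavy6_excluded:
  assumes p: "ipath p" "1 \<le> i" "Suc i < length p" and h: "m (p ! i) (p ! Suc i) \<ge> 6"
  shows False
proof -
  define w where "w = c (p ! i) (p ! Suc i)"
  obtain a where a: "i = Suc a" using p by (cases i) auto
  have hw: "c (p ! Suc a) (p ! Suc (Suc a)) = w" by (simp add: w_def a)
  have ad: "adj (p ! a) (p ! Suc a)" "adj (p ! i) (p ! Suc i)" using ipath_adj[OF p(1)] p a by auto
  have w: "1 \<le> w" "3 \<le> w * w" using c_ge1[OF ad(2)] c_sq6[OF ad(2) h] by (auto simp: w_def)
  show False
    by (rule path_no_subharmonic[of p a 3 "\<lambda>k. [1, 2, w] ! k"])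
      (use p a w c_ge1[OF ad(1)] in \<open>auto simp: hw less_Suc_eq numeral_3_eq_3\<close>)
qed

text \<open>At the inner nodes the weights 1, 2, 2, 1 require 4 <= 1 + 2w, and w is at least
  8/5.\<close>

lemma heavy5_inner_excluded:
  assumes p: "ipath p" "1 \<le> i" "i + 2 < length p" and h: "m (p ! i) (p ! Suc i) \<ge> 5"
  shows False
proof -
  define w where "w = c (p ! i) (p ! Suc i)"
  obtain a where a: "i = Suc a" using p by (cases i) auto
  have hw: "c (p ! Suc a) (p ! Suc (Suc a)) = w" by (simp add: w_def a)
  have ad: "adj (p ! a) (p ! Suc a)" "adj (p ! i) (p ! Suc i)" "adj (p ! Suc i) (p ! Suc (Suc i))"
    using ipath_adj[OF p(1)] p a by auto
  have w: "8/5 \<le> w" using c_ge5[OF ad(2) h] by (auto simp: w_def)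
  show False
    by (rule path_no_subharmonic[of p a 4 "\<lambda>k. [1, 2, 2, 1] ! k"])
      (use p a w c_ge1[OF ad(1)] c_ge1[OF ad(3)] in
        \<open>auto simp: hw less_Suc_eq eval_nat_numeral\<close>)
qed

text \<open>Rules out a type H5. The weights 1, 2, 3, 4, 2w require \<open>8 <= 3 + 2 w^2\<close> at
  the fourth node, which the bound 5/2 for \<open>w^2\<close> meets exactly.\<close>

lemma heavy5_long_excluded:
  assumes p: "ipath p" "3 \<le> i" "Suc i < length p" and h: "m (p ! i) (p ! Suc i) \<ge> 5"
  shows False
proof -
  define w where "w = c (p ! i) (p ! Suc i)"
  obtain a where a: "i = Suc (Suc (Suc a))" using p by (metis Suc_le_D Suc_le_mono numeral_3_eq_3)
  have hw: "c (p ! Suc (Suc (Suc a))) (p ! Suc (Suc (Suc (Suc a)))) = w" by (simp add: w_def a)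
  have ad: "adj (p ! a) (p ! Suc a)" "adj (p ! Suc a) (p ! Suc (Suc a))" "adj (p ! Suc (Suc a)) (p ! i)"
    "adj (p ! i) (p ! Suc i)"
    using ipath_adj[OF p(1)] p a by auto
  have w: "1 \<le> w" "5/2 \<le> w * w" using c_ge1[OF ad(4)] c_sq5[OF ad(4) h] by (auto simp: w_def)
  show False
    by (rule path_no_subharmonic[of p a 5 "\<lambda>k. [1, 2, 3, 4, 2 * w] ! k"])
      (use p a w c_ge1[OF ad(1)] c_ge1[OF ad(2)] c_ge1[OF ad(3)] in
        \<open>auto simp: hw less_Suc_eq eval_nat_numeral\<close>)
qed

text \<open>For w = \<open>sqrt 2\<close> the weights 1, 2, 3, 2w, w form the null vector of the
  affine diagram of type F4.\<close>

lemma heavy4_inner_excluded: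
  assumes p: "ipath p" "2 \<le> i" "i + 2 < length p" and h: "m (p ! i) (p ! Suc i) \<ge> 4"
  shows False
proof -
  define w where "w = c (p ! i) (p ! Suc i)"
  obtain a where a: "i = Suc (Suc a)" using p by (metis Suc_le_D Suc_le_mono numeral_2_eq_2)
  have hw: "c (p ! Suc (Suc a)) (p ! Suc (Suc (Suc a))) = w" by (simp add: w_def a)
  have ad: "adj (p ! a) (p ! Suc a)" "adj (p ! Suc a) (p ! i)" "adj (p ! i) (p ! Suc i)"
    "adj (p ! Suc i) (p ! Suc (Suc i))"
    using ipath_adj[OF p(1)] p a by auto
  have w: "1 \<le> w" "2 \<le> w * w" using c_ge1[OF ad(3)] c_sq4[OF ad(3) h] by (auto simp: w_def)
  have "w \<le> c (p ! Suc i) (p ! Suc (Suc i)) * w" using c_ge1[OF ad(4)] w by simp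
  then show False
    by (intro path_no_subharmonic[of p a 5 "\<lambda>k. [1, 2, 3, 2 * w, w] ! k"])
      (use p a w c_ge1[OF ad(1)] c_ge1[OF ad(2)] in
        \<open>auto simp: hw less_Suc_eq eval_nat_numeral\<close>)
qed

lemma path_type:
  assumes p: "ipath p" "set p = R"
    and f: "\<And>i j. 1 \<le> i \<Longrightarrow> i < j \<Longrightarrow> j \<le> length p \<Longrightarrow>
      f i j = (if j = i + 1 then m (p ! (i - 1)) (p ! i) else 2)"
  shows "graph_type (length p) (sym_matrix f)"
proof -
  define q where "q i = p ! (i - 1)" for i
  have d: "distinct p" using p by (simp add: ipath_def)
  have qR: "q i \<in> R" if "i \<in> {1..length p}" for i
    using that ipath_nth_R[OF p(1), of "i - 1"] by (auto simp: q_def)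
  have "bij_betw q {1..length p} R"
  proof (rule bij_betw_imageI)
    show "inj_on q {1..length p}" using d by (auto simp: q_def inj_on_def nth_eq_iff_index_eq)
    have "x \<in> q ` {1..length p}" if "x \<in> set p" for x
    proof -
      obtain i where "x = p ! i" "i < length p" using \<open>x \<in> set p\<close> by (auto simp: in_set_conv_nth)
      then have "x = q (Suc i)" "Suc i \<in> {1..length p}" by (auto simp: q_def)
      then show ?thesis by blast
    qed
    then show "q ` {1..length p} = R" using qR p(2) by auto
  qed
  moreover have lt: "m (q i) (q j) = f i j" if "1 \<le> i" "i < j" "j \<le> length p" for i j
  proof (cases "j = i + 1")
    case True
    then show ?thesis using f[OF that] by (simp add: q_def)
  next
    case False
    have "\<not> adj (q i) (q j)" using p(1) that False by (auto simp: ipath_def q_def)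
    moreover have "q i \<noteq> q j" using d that by (auto simp: q_def nth_eq_iff_index_eq)
    ultimately show ?thesis using f[OF that] False qR[of i] qR[of j] that by (auto simp: adj_def)
  qed
  have "m (q i) (q j) = sym_matrix f i j" if ij: "i \<in> {1..length p}" "j \<in> {1..length p}" for i j
  proof -
    consider "i = j" | "i < j" | "j < i" by linarith
    then show ?thesis
      using lt[of i j] lt[of j i] ij qR[OF ij(1)] qR[OF ij(2)] m_sym[OF qR[OF ij(1)] qR[OF ij(2)]]
      by cases (auto simp: sym_matrix_def)
  qed
  ultimately show ?thesis by (auto simp: graph_type_def)
qed

lemma path_classification:
  assumes p: "ipath p" "set p = R"
  defines "n \<equiv> length p"
  shows "graph_type n type_A \<or> graph_type n (type_B n) \<or> (n = 4 \<and> graph_type n type_F) \<or>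
    ((n = 3 \<or> n = 4) \<and> graph_type n type_H) \<or> (n = 2 \<and> (\<exists>k\<ge>3. graph_type n (type_I2 k)))"
proof -
  have ge3: "m (p ! i) (p ! Suc i) \<ge> 3" if "Suc i < n" for i
    using adj_ge3[OF ipath_adj[OF p(1)]] that by (simp add: n_def)
  show ?thesis
  proof (cases "\<exists>i. Suc i < n \<and> m (p ! i) (p ! Suc i) \<ge> 4")
    case False
    then have l: "m (p ! (i - 1)) (p ! i) = 3" if "1 \<le> i" "i < n" for i
      using ge3[of "i - 1"] that by (cases i) (force simp: not_le)+
    have "graph_type n type_A"
      unfolding n_def type_A_def by (rule path_type[OF p]) (use l in \<open>auto simp: n_def\<close>)
    then show ?thesis by blast
  next
    case True
    \<comment> \<open>The heavy edge is assumed to lie in the middle or in the second half of the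
      path; reversing the path gives the other case.\<close>
    have main: ?thesis
      if q: "ipath q" "set q = R" "length q = n" and i: "Suc i < n" "n \<le> 2 * i + 2"
        and h: "m (q ! i) (q ! Suc i) \<ge> 4" for q i
    proof -
      have ge3: "m (q ! i) (q ! Suc i) \<ge> 3" if "Suc i < n" for i
        using adj_ge3[OF ipath_adj[OF q(1)]] that q by simp
      have light: "m (q ! j) (q ! Suc j) = 3" if j: "Suc j < n" "j \<noteq> i" for j
      proof -
        have "\<not> 4 \<le> m (q ! j) (q ! Suc j)"
          using at_most_one_heavy[OF q(1), of i j] at_most_one_heavy[OF q(1), of j i] j h i q(3)
          by (cases "i < j") auto
        then show ?thesis using ge3[OF j(1)] by linarith
      qed
      have light': "m (q ! (k - 1)) (q ! k) = 3" if "1 \<le> k" "k < n" "k \<noteq> Suc i" for k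
        using light[of "k - 1"] that by auto
      define l where "l = m (q ! i) (q ! Suc i)"
      show ?thesis
      proof (cases "n = 2")
        case True
        then have "i = 0" using i by simp
        have "graph_type (length q) (type_I2 l)"
          unfolding type_I2_def
          by (rule path_type[OF q(1,2)]) (use True q(3) \<open>i = 0\<close> in \<open>auto simp: l_def numeral_2_eq_2 le_Suc_eq less_Suc_eq\<close>)
        then show ?thesis using True q h by (auto simp: l_def intro!: exI[of _ l])
      next
        case False
        then have i1: "1 \<le> i" using i by auto
        have l6: "\<not> 6 \<le> l" using heavy6_excluded[OF q(1) i1] i(1) q(3) by (auto simp: l_def)
        show ?thesis
        proof (cases "l = 5")
          case True
          have "\<not> i + 2 < n" using heavy5_inner_excluded[OF q(1) i1] q True by (auto simp: l_def)
          then have in2: "i = n - 2" using i by auto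
          have "\<not> 3 \<le> i" using heavy5_long_excluded[OF q(1), of i] q(3) i(1) True by (auto simp: l_def)
          then have n34: "n = 3 \<or> n = 4" using in2 i1 i by auto
          \<comment> \<open>\<open>type_H\<close> has the label 5 on the first edge, whereas here it
            is on the last one.\<close>
          have "graph_type (length (rev q)) type_H"
            unfolding type_H_def
          proof (rule path_type)
            fix a b assume ab: "1 \<le> a" "a < b" "b \<le> length (rev q)"
            show "(if b = a + 1 then if a = 1 then 5 else 3 else 2) =
                (if b = a + 1 then m (rev q ! (a - 1)) (rev q ! a) else 2)"
            proof (cases "b = a + 1")
              case b: True
              have e: "rev q ! (a - 1) = q ! (n - a)" "rev q ! a = q ! (n - a - 1)"
                using ab b q by (auto simp: rev_nth)
              have "m (rev q ! (a - 1)) (rev q ! a) = m (q ! (n - a - 1)) (q ! (n - a))"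
                unfolding e using ab b q ipath_nth_R[OF q(1)] by (intro m_sym) auto
              also have "\<dots> = (if a = 1 then 5 else 3)"
              proof (cases "a = 1")
                case a: True
                then have "n - a - 1 = i" "n - a = Suc i" using in2 n34 by auto
                then show ?thesis using True a by (simp add: l_def)
              next
                case False
                then show ?thesis using light'[of "n - a"] ab b q in2 n34 by auto
              qed
              finally show ?thesis using b by simp
            qed simp
          qed (use q ipath_rev in auto)
          then show ?thesis using n34 q by auto
        next
          case False
          then have l4: "l = 4" using l6 h by (simp add: l_def)
          show ?thesis
          proof (cases "i + 2 < n")
            case True
            then have "\<not> 2 \<le> i" using heavy4_inner_excluded[OF q(1), of i] q(3) h by auto
            then have i1: "i = 1" and n4: "n = 4" using i1 True i by auto
            have "graph_type (length q) type_F"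
              unfolding type_F_def
            proof (rule path_type[OF q(1,2)])
              fix a b assume ab: "1 \<le> a" "a < b" "b \<le> length q"
              show "(if b = a + 1 then if a = 2 then 4 else 3 else 2) =
                  (if b = a + 1 then m (q ! (a - 1)) (q ! a) else 2)"
                using light'[of a] l4 ab q n4 i1 by (auto simp: l_def numeral_2_eq_2)
            qed
            then show ?thesis using q n4 by auto
          next
            case False
            then have in2: "Suc (Suc i) = n" using i by simp
            have "graph_type (length q) (type_B n)"
              unfolding type_B_def
            proof (rule path_type[OF q(1,2)])
              fix a b assume ab: "1 \<le> a" "a < b" "b \<le> length q"
              show "(if b = a + 1 then if b = n then 4 else 3 else 2) =
                  (if b = a + 1 then m (q ! (a - 1)) (q ! a) else 2)"
                using light'[of a] l4 ab q in2 by (cases "a = Suc i") (auto simp: l_def)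
            qed
            then show ?thesis using q by auto
          qed
        qed
      qed
    qed
    obtain i where i: "Suc i < n" "m (p ! i) (p ! Suc i) \<ge> 4" using True by blast
    show ?thesis
    proof (cases "n \<le> 2 * i + 2")
      case True
      then show ?thesis using main[OF p _ i(1) _ i(2)] n_def by simp
    next
      case False
      \<comment> \<open>The position of the same edge in the reversed path.\<close>
      define j where "j = n - 2 - i"
      have j: "Suc j < n" "n \<le> 2 * j + 2" using i False by (auto simp: j_def)
      have e: "rev p ! j = p ! Suc i" "rev p ! Suc j = p ! i"
        using i j by (auto simp: j_def n_def rev_nth intro!: arg_cong[where f = "(!) p"])
      have "m (rev p ! j) (rev p ! Suc j) \<ge> 4"
        unfolding e using i m_sym[of "p ! i" "p ! Suc i"] ipath_nth_R[OF p(1)] by (simp add: n_def)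
      then show ?thesis using main[of "rev p" j] ipath_rev[OF p(1)] p j n_def by simp
    qed
  qed
qed

end

section \<open>Diagrams with a branch node\<close>

context positive_coxeter_graph
begin

definition node :: "'a \<Rightarrow> (nat \<Rightarrow> 'a list) \<Rightarrow> nat \<Rightarrow> nat \<Rightarrow> 'a" where
  "node z B k i = (z # B k) ! i"

text \<open>The last two disjuncts do not compare the arms, as index 0 denotes the common centre on
  every arm.\<close>

definition tree_adj :: "nat \<Rightarrow> nat \<Rightarrow> nat \<Rightarrow> nat \<Rightarrow> bool" where
  "tree_adj k i l j \<longleftrightarrow> k = l \<and> (i = Suc j \<or> j = Suc i) \<or> i = 0 \<and> j = 1 \<or> i = 1 \<and> j = 0"

text \<open>Three arms, given as lists of nodes starting next to the central node \<open>z\<close>.\<close>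

definition spider :: "'a \<Rightarrow> (nat \<Rightarrow> 'a list) \<Rightarrow> bool" where
  "spider z B \<longleftrightarrow> (\<forall>k<3. B k \<noteq> []) \<and>
     (\<forall>k<3. \<forall>i\<le>length (B k). node z B k i \<in> R) \<and>
     (\<forall>k<3. \<forall>l<3. \<forall>i\<le>length (B k). \<forall>j\<le>length (B l).
        (node z B k i = node z B l j \<longleftrightarrow> i = j \<and> (k = l \<or> i = 0)) \<and>
        (adj (node z B k i) (node z B l j) \<longleftrightarrow> tree_adj k i l j))"

definition spider_set :: "'a \<Rightarrow> (nat \<Rightarrow> 'a list) \<Rightarrow> 'a set" where
  "spider_set z B = {node z B k i | k i. k < 3 \<and> i \<le> length (B k)}"

lemma node_0 [simp]: "node z B k 0 = z"
  by (simp add: node_def)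

lemma spiderD:
  assumes "spider z B" "k < 3" "l < 3" "i \<le> length (B k)" "j \<le> length (B l)"
  shows "node z B k i \<in> R" "node z B k i = node z B l j \<longleftrightarrow> i = j \<and> (k = l \<or> i = 0)"
    "adj (node z B k i) (node z B l j) \<longleftrightarrow> tree_adj k i l j"
  using assms by (simp_all add: spider_def)

lemma spider_len: "spider z B \<Longrightarrow> k < 3 \<Longrightarrow> Suc 0 \<le> length (B k)"
  by (auto simp: spider_def Suc_le_eq)

lemma other_arms:
  assumes "k < (3::nat)"
  obtains k1 k2 where "k1 < 3" "k2 < 3" "k1 \<noteq> k" "k2 \<noteq> k" "k1 \<noteq> k2"
proof -
  consider "k = 0" | "k = 1" | "k = 2" using assms by linarith
  then show ?thesis using that[of 1 2] that[of 0 2] that[of 0 1] by cases simp_all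
qed

lemma spider_notin:
  assumes "spider z B" "k < 3" "i < length (B k)"
  shows "node z B k (Suc i) \<notin> node z B k ` {..i}"
    and "l < 3 \<Longrightarrow> l \<noteq> k \<Longrightarrow> node z B l 1 \<notin> node z B k ` {..i}"
proof -
  have "node z B k (Suc i) \<noteq> node z B k j" if "j \<le> i" for j
    using spiderD(2)[OF assms(1,2,2), of "Suc i" j] assms that by simp
  then show "node z B k (Suc i) \<notin> node z B k ` {..i}" by blast
  have "node z B l 1 \<noteq> node z B k j" if "j \<le> i" "l < 3" "l \<noteq> k" for j
    using spiderD(2)[OF assms(1) that(2) assms(2), of 1 j] spider_len[OF assms(1) that(2)] assms that by simp
  then show "node z B l 1 \<notin> node z B k ` {..i}" if "l < 3" "l \<noteq> k" using that by blast
qed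

text \<open>The first nodes of the other two arms form one end in \<open>no_two_ended\<close> and M
  the other; the path leads from the centre along arm k to node i.\<close>

lemma spider_no_extra:
  assumes sp: "spider z B" and k: "k < 3" "i < length (B k)"
    and M: "M \<subseteq> R - node z B k ` {..i}" "2 \<le> (\<Sum>v\<in>M. c (node z B k i) v * c (node z B k i) v)"
    and disj: "\<And>l. l < 3 \<Longrightarrow> l \<noteq> k \<Longrightarrow> node z B l 1 \<notin> M"
  shows False
proof -
  obtain k1 k2 where o: "k1 < 3" "k2 < 3" "k1 \<noteq> k" "k2 \<noteq> k" "k1 \<noteq> k2" using other_arms[OF k(1)] by blast
  have len: "1 \<le> length (B l)" if "l < 3" for l using spider_len[OF sp that] by simp
  note D = spiderD[OF sp]
  show False
  proof (rule no_two_ended[of "node z B k" i "{node z B k1 1, node z B k2 1}" M])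
    show "inj_on (node z B k) {..i}" using D(2)[OF k(1) k(1)] k by (auto simp: inj_on_def)
    show "node z B k 0 \<in> R" using D(1)[OF k(1) k(1), of 0 0] by simp
    show "adj (node z B k j) (node z B k (Suc j))" if "j < i" for j
      using D(3)[OF k(1) k(1), of j "Suc j"] k that by (simp add: tree_adj_def)
    have in1: "node z B l 1 \<in> R - node z B k ` {..i}" if "l < 3" "l \<noteq> k" for l
      using D(1)[OF that(1) that(1) len[OF that(1)] len[OF that(1)]] spider_notin(2)[OF sp k that] by blast
    show "{node z B k1 1, node z B k2 1} \<subseteq> R - node z B k ` {..i}"
      by (rule insert_subsetI[OF in1[OF o(1,3)] insert_subsetI[OF in1[OF o(2,4)] empty_subsetI]])
    show "{node z B k1 1, node z B k2 1} \<inter> M = {}" using disj[OF o(1,3)] disj[OF o(2,4)] by blast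
    have a: "adj z (node z B l 1)" if "l < 3" for l
      using D(3)[OF that that, of 0 1] len[OF that] by (simp add: tree_adj_def)
    have "node z B k1 1 \<noteq> node z B k2 1" using D(2)[OF o(1,2), of 1 1] len o by simp
    then show "2 \<le> (\<Sum>v\<in>{node z B k1 1, node z B k2 1}. c (node z B k 0) v * c (node z B k 0) v)"
      using sum_c_two[OF a[OF o(1)] a[OF o(2)]] by simp
  qed (use M in auto)
qed

lemma spider_light:
  assumes sp: "spider z B" and k: "k < 3" "i < length (B k)"
  shows "m (node z B k i) (node z B k (Suc i)) = 3"
proof -
  note D = spiderD[OF sp]
  have adj: "adj (node z B k i) (node z B k (Suc i))"
    using D(3)[OF k(1) k(1), of i "Suc i"] k by (simp add: tree_adj_def)
  have "\<not> 4 \<le> m (node z B k i) (node z B k (Suc i))"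
  proof
    assume h: "4 \<le> m (node z B k i) (node z B k (Suc i))"
    show False
    proof (rule spider_no_extra[OF sp k, of "{node z B k (Suc i)}"])
      show "{node z B k (Suc i)} \<subseteq> R - node z B k ` {..i}"
        using D(1)[OF k(1) k(1), of "Suc i" 0] spider_notin(1)[OF sp k] k by auto
      show "node z B l 1 \<notin> {node z B k (Suc i)}" if "l < 3" "l \<noteq> k" for l
        using D(2)[OF that(1) k(1), of 1 "Suc i"] spider_len[OF sp that(1)] k that by simp
    qed (use c_sq4[OF adj h] in simp)
  qed
  then show ?thesis using adj_ge3[OF adj] by linarith
qed

lemma spider_m:
  assumes sp: "spider z B" and k: "k < 3" "l < 3" "i \<le> length (B k)" "j \<le> length (B l)"
  shows "m (node z B k i) (node z B l j) =
    (if i = j \<and> (k = l \<or> i = 0) then 1 else if tree_adj k i l j then 3 else 2)"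
proof -
  note D = spiderD[OF sp]
  have R: "node z B k i \<in> R" "node z B l j \<in> R" using D(1)[OF k] D(1)[OF k(2,1,4,3)] by auto
  show ?thesis
  proof (cases "tree_adj k i l j")
    case True
    have zero: "node z B k 0 = node z B l 0" by simp
    consider "k = l" "i = Suc j" | "k = l" "j = Suc i" | "i = 0" "j = 1" | "i = 1" "j = 0"
      using True by (auto simp: tree_adj_def)
    then have "m (node z B k i) (node z B l j) = 3"
    proof cases
      case 1
      then show ?thesis using spider_light[OF sp k(1), of j] k m_sym[OF R] by simp
    next
      case 2
      then show ?thesis using spider_light[OF sp k(1), of i] k by simp
    next
      case 3
      have "m (node z B l 0) (node z B l (Suc 0)) = 3"
        by (rule spider_light[OF sp k(2)]) (use k 3 in linarith)
      then show ?thesis using 3 by simp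
    next
      case 4
      have "m (node z B k 0) (node z B k (Suc 0)) = 3"
        by (rule spider_light[OF sp k(1)]) (use k 4 in linarith)
      then show ?thesis using 4 m_sym[OF R] by simp
    qed
    then show ?thesis using True by (auto simp: tree_adj_def)
  next
    case False
    then show ?thesis using D(2,3)[OF k] R by (auto simp: adj_def)
  qed
qed

text \<open>The weight decreases linearly along each arm, from 1 at the centre to 0 one step past
  the tip, so on the arms each weight is the mean of its two neighbours. At the centre the
  inequality needed is exactly the failure of the claim, the familiar 1/p + 1/q + 1/r > 1.\<close>

lemma spider_bound:
  assumes sp: "spider z B"
  shows "1 < (\<Sum>k<3. 1 / (real (length (B k)) + 1))"
proof (rule ccontr)
  assume no: "\<not> ?thesis"
  note D = spiderD[OF sp]
  define g where "g k i = (real (length (B k)) + 1 - real i) / (real (length (B k)) + 1)" for k i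
  \<comment> \<open>The choice among descriptions (k, i) of a node is harmless: only the centre has
    several, and \<open>g k 0\<close> is 1 on every arm.\<close>
  define f where "f u = (if u \<in> spider_set z B then
      (let (k, i) = (SOME (k, i). k < 3 \<and> i \<le> length (B k) \<and> u = node z B k i) in g k i) else 0)" for u
  have fn: "f (node z B k i) = g k i" if k: "k < 3" "i \<le> length (B k)" for k i
  proof -
    define p where "p = (SOME (k', i'). k' < 3 \<and> i' \<le> length (B k') \<and> node z B k i = node z B k' i')"
    have "case p of (k', i') \<Rightarrow> k' < 3 \<and> i' \<le> length (B k') \<and> node z B k i = node z B k' i'"
      unfolding p_def by (rule someI[of _ "(k, i)"]) (use k in simp)
    then obtain k' i' where p: "p = (k', i')" "k' < 3" "i' \<le> length (B k')" "node z B k i = node z B k' i'"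
      by (cases p) auto
    have "f (node z B k i) = (case p of (k, i) \<Rightarrow> g k i)"
      using k by (auto simp: f_def p_def spider_set_def)
    moreover have "i = i' \<and> (k = k' \<or> i = 0)" using iffD1[OF D(2)[OF k(1) p(2) k(2) p(3)] p(4)] .
    ultimately show ?thesis using p by (auto simp: g_def)
  qed
  have c1: "1 \<le> c (node z B k i) (node z B l j)"
    if "k < 3" "l < 3" "i \<le> length (B k)" "j \<le> length (B l)" "tree_adj k i l j" for k l i j
    using c_ge1 D(3)[OF that(1-4)] that(5) by simp
  have gpos: "0 < g k i" if "i \<le> length (B k)" for k i using that by (simp add: g_def)
  have gstep: "g k (Suc i) = g k i - 1 / (real (length (B k)) + 1)" for k i
  proof -
    have "real (length (B k)) + 1 - real (Suc i) = (real (length (B k)) + 1 - real i) - 1" by simp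
    then show ?thesis unfolding g_def by (simp only: diff_divide_distrib)
  qed
  have g0: "g k 0 = 1" for k by (simp add: g_def)
  have gend: "g k (Suc (length (B k))) = 0" for k by (simp add: g_def)
  have zR: "z \<in> R" using D(1)[of 0 0 0 0] by simp
  show False
  proof (rule no_subharmonic[of f z])
    fix u assume u: "u \<in> R" "0 < f u"
    then obtain k i where ki: "u = node z B k i" "k < 3" "i \<le> length (B k)"
      by (auto simp: f_def spider_set_def split: if_splits)
    show "\<exists>N\<subseteq>R - {u}. 2 * f u \<le> (\<Sum>v\<in>N. c u v * f v)"
    proof (cases i)
      case 0
      have uz: "u = z" using ki 0 by simp
      have inj: "inj_on (\<lambda>l. node z B l 1) {..<3}"
        using D(2)[of _ _ 1 1] spider_len[OF sp] by (auto simp: inj_on_def)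
      have "(\<Sum>l<3. g l 1) \<le> (\<Sum>l<3. c z (node z B l 1) * f (node z B l 1))"
      proof (rule sum_mono)
        fix l :: nat assume "l \<in> {..<3}"
        then have l: "l < 3" "1 \<le> length (B l)" using spider_len[OF sp] by auto
        show "g l 1 \<le> c z (node z B l 1) * f (node z B l 1)"
          using c1[of l l 0 1] fn[of l 1] l gpos[of 1 l] by (simp add: tree_adj_def mult_le_cancel_right1)
      qed
      also have "\<dots> = (\<Sum>v\<in>(\<lambda>l. node z B l 1) ` {..<3}. c z v * f v)"
        using inj by (simp add: sum.reindex)
      finally have "(\<Sum>l<3. g l 1) \<le> (\<Sum>v\<in>(\<lambda>l. node z B l 1) ` {..<3}. c z v * f v)" .
      moreover have "(\<Sum>l<3. g l 1) = 3 - (\<Sum>l<3. 1 / (real (length (B l)) + 1))"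
        using gstep[of _ 0] g0 by (simp add: sum_subtractf)
      moreover have "f u = 1" using fn[of k i] ki 0 g0 by simp
      ultimately have "2 * f u \<le> (\<Sum>v\<in>(\<lambda>l. node z B l 1) ` {..<3}. c u v * f v)"
        using no uz by simp
      moreover have "node z B l 1 \<in> R - {u}" if "l < 3" for l
        using D(1)[of l l 1 1] D(2)[of l l 1 0] spider_len[OF sp that] that uz by simp
      ultimately show ?thesis by (intro exI[of _ "(\<lambda>l. node z B l 1) ` {..<3}"]) auto
    next
      case (Suc j)
      have prev: "node z B k j \<in> R - {u}" "g k j \<le> c u (node z B k j) * f (node z B k j)"
        using D(1)[of k k j j] D(2)[of k k j i] ki Suc c1[of k k i j] fn[of k j] gpos[of j k]
        by (auto simp: tree_adj_def mult_le_cancel_right1)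
      have fu: "2 * f u = g k j + g k (Suc i)" using fn[of k i] ki gstep[of k j] gstep[of k i] Suc by simp
      show ?thesis
      proof (cases "i = length (B k)")
        case True
        then have "2 * f u \<le> (\<Sum>v\<in>{node z B k j}. c u v * f v)" using prev(2) fu gend[of k] by simp
        then show ?thesis using prev(1) by (intro exI[of _ "{node z B k j}"]) auto
      next
        case False
        then have nx: "node z B k (Suc i) \<in> R - {u}"
          "g k (Suc i) \<le> c u (node z B k (Suc i)) * f (node z B k (Suc i))"
          using D(1)[of k k "Suc i" 0] D(2)[of k k "Suc i" i] ki c1[of k k i "Suc i"] fn[of k "Suc i"]
            gpos[of "Suc i" k]
          by (auto simp: tree_adj_def mult_le_cancel_right1)
        have "node z B k j \<noteq> node z B k (Suc i)" using D(2)[of k k j "Suc i"] ki Suc False by simp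
        then have "2 * f u \<le> (\<Sum>v\<in>{node z B k j, node z B k (Suc i)}. c u v * f v)"
          using prev(2) nx(2) fu by simp
        then show ?thesis using prev(1) nx(1) by (intro exI[of _ "{node z B k j, node z B k (Suc i)}"]) auto
      qed
    qed
  next
    fix u assume "u \<in> R"
    show "0 \<le> f u"
    proof (cases "u \<in> spider_set z B")
      case True
      then obtain k i where "u = node z B k i" "k < 3" "i \<le> length (B k)" by (auto simp: spider_set_def)
      then show ?thesis using fn[of k i] gpos[of i k] by simp
    qed (simp add: f_def)
  next
    show "0 < f z" using fn[of 0 0] g0 by simp
  qed (rule zR)
qed

lemma node_extend:
  assumes "i \<le> length ((B(k := B k @ [x])) l)"
  shows "node z (B(k := B k @ [x])) l i = (if l = k \<and> i = Suc (length (B k)) then x else node z B l i)"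
  using assms by (auto simp: node_def nth_append nth_Cons split: nat.splits)

text \<open>The edge count behind \<open>treelike\<close> ensures that x has no neighbour in the
  spider besides the tip, so the pattern of adjacencies persists.\<close>

lemma spider_extend:
  assumes sp: "spider z B" and tr: "treelike (spider_set z B)" and k: "k < 3"
    and x: "x \<in> R" "x \<notin> spider_set z B" "adj x (node z B k (length (B k)))"
  shows "spider z (B(k := B k @ [x])) \<and> treelike (spider_set z (B(k := B k @ [x])))"
proof -
  note D = spiderD[OF sp]
  define n where "n = length (B k)"
  define B' where "B' = B(k := B k @ [x])"
  have n1: "1 \<le> n" using spider_len[OF sp k] by (simp add: n_def)
  have in_set: "node z B l i \<in> spider_set z B" if "l < 3" "i \<le> length (B l)" for l i
    using that by (auto simp: spider_set_def)
  have len: "length (B' l) = (if l = k then Suc n else length (B l))" for l by (simp add: B'_def n_def)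
  have nd: "node z B' l i = (if l = k \<and> i = Suc n then x else node z B l i)" if "i \<le> length (B' l)" for l i
    using node_extend[of i B k x l z] that by (simp add: B'_def n_def)
  have adj_x: "adj x (node z B l i) \<longleftrightarrow> l = k \<and> i = n" if l: "l < 3" "i \<le> length (B l)" for l i
  proof -
    have "adj x (node z B l i) \<longleftrightarrow> node z B l i = node z B k n"
      using treelike_insert(2)[OF tr x(1,2) in_set[OF k order_refl] x(3) in_set[OF l]] x(3)
      unfolding n_def by metis
    also have "\<dots> \<longleftrightarrow> l = k \<and> i = n" using D(2)[OF l(1) k l(2), of n] n1 by (auto simp: n_def)
    finally show ?thesis .
  qed
  have x_ne: "x \<noteq> node z B l i" if "l < 3" "i \<le> length (B l)" for l i using in_set[OF that] x(2) by auto
  have ok: "(node z B' l i = node z B' l' j \<longleftrightarrow> i = j \<and> (l = l' \<or> i = 0)) \<and>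
      (adj (node z B' l i) (node z B' l' j) \<longleftrightarrow> tree_adj l i l' j)"
    if l: "l < 3" "l' < 3" "i \<le> length (B' l)" "j \<le> length (B' l')" for l l' i j
  proof -
    consider "l = k \<and> i = Suc n" "l' = k \<and> j = Suc n" | "l = k \<and> i = Suc n" "\<not> (l' = k \<and> j = Suc n)"
      | "\<not> (l = k \<and> i = Suc n)" "l' = k \<and> j = Suc n" | "\<not> (l = k \<and> i = Suc n)" "\<not> (l' = k \<and> j = Suc n)"
      by blast
    then show ?thesis
    proof cases
      case 1
      then show ?thesis using nd[OF l(3)] nd[OF l(4)] by (simp add: tree_adj_def)
    next
      case 2
      then have j: "j \<le> length (B l')" using l len[of l'] by (auto split: if_splits simp: n_def)
      show ?thesis
        using 2 nd[OF l(3)] nd[OF l(4)] adj_x[OF l(2) j] x_ne[OF l(2) j] n1 j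
        by (auto simp: tree_adj_def n_def)
    next
      case 3
      then have i: "i \<le> length (B l)" using l len[of l] by (auto split: if_splits simp: n_def)
      show ?thesis
        using 3 nd[OF l(3)] nd[OF l(4)] adj_x[OF l(1) i] x_ne[OF l(1) i] n1 i adj_sym[of "node z B l i" x]
        by (auto simp: tree_adj_def n_def)
    next
      case 4
      then have i: "i \<le> length (B l)" "j \<le> length (B l')"
        using l len[of l] len[of l'] by (auto split: if_splits simp: n_def)
      show ?thesis using 4 nd[OF l(3)] nd[OF l(4)] D(2,3)[OF l(1,2) i] by auto
    qed
  qed
  have R': "node z B' l i \<in> R" if "l < 3" "i \<le> length (B' l)" for l i
  proof (cases "l = k \<and> i = Suc n")
    case False
    then have "i \<le> length (B l)" using that len[of l] by (auto split: if_splits simp: n_def)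
    then show ?thesis using nd[OF that(2)] False D(1)[OF that(1) that(1), of i i] by auto
  qed (use nd[OF that(2)] x in simp)
  have "spider z B'"
    unfolding spider_def using sp R' ok by (auto simp: B'_def spider_def)
  moreover have "spider_set z B' = insert x (spider_set z B)"
  proof (intro equalityI subsetI)
    fix u assume "u \<in> spider_set z B'"
    then obtain l i where li: "u = node z B' l i" "l < 3" "i \<le> length (B' l)" by (auto simp: spider_set_def)
    show "u \<in> insert x (spider_set z B)"
    proof (cases "l = k \<and> i = Suc n")
      case False
      then have "i \<le> length (B l)" using li len[of l] by (auto split: if_splits simp: n_def)
      then show ?thesis using nd[OF li(3)] False in_set[OF li(2)] li(1) by auto
    qed (use li nd[OF li(3)] in simp)
  next
    fix u assume "u \<in> insert x (spider_set z B)"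
    then consider "u = x" | l i where "u = node z B l i" "l < 3" "i \<le> length (B l)"
      by (auto simp: spider_set_def)
    then show "u \<in> spider_set z B'"
    proof cases
      case 1
      then have "u = node z B' k (Suc n)" using nd[of "Suc n" k] len[of k] by simp
      moreover have "Suc n \<le> length (B' k)" using len[of k] by simp
      ultimately show ?thesis using k unfolding spider_set_def by blast
    next
      case 2
      then have "i \<le> length (B' l)" "\<not> (l = k \<and> i = Suc n)" using len[of l] by (auto simp: n_def)
      then have "u = node z B' l i" using nd[of i l] 2 by auto
      then show ?thesis using 2 \<open>i \<le> length (B' l)\<close> by (auto simp: spider_set_def)
    qed
  qed
  ultimately show ?thesis
    using treelike_insert(1)[OF tr x(1,2) in_set[OF k, of n]] x(3) by (simp add: B'_def[symmetric] n_def)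
qed

text \<open>\<open>treelike_insert\<close> forbids edges among a, b and d, since each of them is
  already joined to z.\<close>

lemma spider_start:
  assumes a: "adj z a" "adj z b" "adj z d" "distinct [a, b, d]"
  defines "B \<equiv> (\<lambda>k. [[a], [b], [d]] ! k)"
  shows "spider z B \<and> treelike (spider_set z B)"
proof -
  have R: "z \<in> R" "a \<in> R" "b \<in> R" "d \<in> R" using a by (auto simp: adj_def)
  have ne: "z \<noteq> a" "z \<noteq> b" "z \<noteq> d" using a by (auto simp: adj_def)
  have az: "adj a z" "adj b z" "adj d z" using a(1-3) adj_sym by auto
  have 1: "treelike {a, z}" using treelike_insert(1)[OF treelike_single[OF R(1)], of a z] R ne az by simp
  have 2: "treelike {b, a, z}" using treelike_insert(1)[OF 1, of b z] R ne az a(4) by auto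
  have 3: "treelike {d, b, a, z}" using treelike_insert(1)[OF 2, of d z] R ne az a(4) by auto
  have nb: "\<not> adj b a" using treelike_insert(2)[OF 1, of b z a] R ne az a(4) by auto
  have nd: "\<not> adj d a" "\<not> adj d b" using treelike_insert(2)[OF 2, of d z] R ne az a(4) by auto
  have nadj: "\<not> adj a b" "\<not> adj a d" "\<not> adj b d" using nb nd adj_sym by blast+
  have dist: "b \<noteq> a" "d \<noteq> a" "d \<noteq> b" using a(4) by auto
  have all3: "(\<forall>k<3. P k) \<longleftrightarrow> P 0 \<and> P 1 \<and> P 2" for P :: "nat \<Rightarrow> bool"
    by (auto simp: less_Suc_eq numeral_3_eq_3 numeral_2_eq_2)
  have all1: "(\<forall>i\<le>Suc 0. P i) \<longleftrightarrow> P 0 \<and> P 1" for P :: "nat \<Rightarrow> bool"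
    by (auto simp: le_Suc_eq)
  have sp: "spider z B"
    unfolding spider_def all3 using a az ne nb nd nadj R dist
    by (simp add: B_def all1 node_def tree_adj_def)
  have "spider_set z B = {d, b, a, z}"
  proof -
    have "spider_set z B = {u. \<exists>k<3. \<exists>i\<le>length (B k). u = node z B k i}" by (auto simp: spider_set_def)
    also have "\<dots> = {u. \<not> (\<forall>k<3. \<forall>i\<le>length (B k). u \<noteq> node z B k i)}" by auto
    also have "\<dots> = {d, b, a, z}" unfolding all3 by (auto simp: B_def all1 node_def)
    finally show ?thesis .
  qed
  then show ?thesis using sp 3 by simp
qed

text \<open>Take a spider of greatest total length. A node outside it adjacent to a tip would
  lengthen an arm; adjacent elsewhere, it would together with the next node of the arm form the set
  M excluded by \<open>spider_no_extra\<close>.\<close>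

lemma spider_cover:
  assumes a: "adj z a" "adj z b" "adj z d" "distinct [a, b, d]"
  shows "\<exists>B. spider z B \<and> spider_set z B = R"
proof -
  define P where "P B \<longleftrightarrow> spider z B \<and> treelike (spider_set z B)" for B
  define f where "f B = (\<Sum>k<3. length (B k))" for B :: "nat \<Rightarrow> 'a list"
  have len: "length (B k) \<le> card R" if "P B" "k < 3" for B k
  proof -
    have sp: "spider z B" using that by (simp add: P_def)
    have "inj_on (node z B k) {..length (B k)}" "node z B k ` {..length (B k)} \<subseteq> R"
      using spiderD[OF sp that(2) that(2)] by (auto simp: inj_on_def)
    then have "card {..length (B k)} \<le> card R" using card_inj_on_le[OF _ _ fin] by blast
    then show ?thesis by simp
  qed
  have "f B < 3 * card R + 1" if "P B" for B
    using sum_mono[of "{..<3::nat}" "\<lambda>k. length (B k)" "\<lambda>_. card R"] len[OF that] by (simp add: f_def)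
  then obtain B where B: "P B" and max: "\<And>B'. P B' \<Longrightarrow> f B' \<le> f B"
    using ex_has_greatest_nat[of P "\<lambda>k. [[a], [b], [d]] ! k" f "3 * card R + 1"] spider_start[OF a]
    unfolding P_def by blast
  have sp: "spider z B" and tr: "treelike (spider_set z B)" using B by (auto simp: P_def)
  note D = spiderD[OF sp]
  have "spider_set z B = R"
  proof (rule ccontr)
    assume "spider_set z B \<noteq> R"
    then obtain u x where ux: "u \<in> spider_set z B" "x \<in> R" "x \<notin> spider_set z B" "adj x u"
      using connected_step[of "spider_set z B"] tr by (auto simp: treelike_def)
    then obtain k i where ki: "u = node z B k i" "k < 3" "i \<le> length (B k)" by (auto simp: spider_set_def)
    have in_set: "node z B l i \<in> spider_set z B" if "l < 3" "i \<le> length (B l)" for l i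
      using that by (auto simp: spider_set_def)
    show False
    proof (cases "i = length (B k)")
      case True
      then have "P (B(k := B k @ [x]))" using spider_extend[OF sp tr ki(2)] ux ki by (simp add: P_def)
      then have "f (B(k := B k @ [x])) \<le> f B" by (rule max)
      moreover have "f (B(k := B k @ [x])) = f B + 1"
        using ki(2) by (auto simp: f_def numeral_3_eq_3 less_Suc_eq)
      ultimately show False by simp
    next
      case False
      then have i: "i < length (B k)" using ki by simp
      define y where "y = node z B k (Suc i)"
      have uy: "adj u y" using D(3)[OF ki(2,2), of i "Suc i"] i ki by (simp add: y_def tree_adj_def)
      have "x \<noteq> y" using in_set[OF ki(2), of "Suc i"] ux i by (auto simp: y_def)
      show False
      proof (rule spider_no_extra[OF sp ki(2) i, of "{y, x}"])
        have "y \<in> R - node z B k ` {..i}"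
          using D(1)[OF ki(2,2), of "Suc i" 0] spider_notin(1)[OF sp ki(2) i] i by (auto simp: y_def)
        moreover have "x \<in> R - node z B k ` {..i}" using ux in_set[OF ki(2)] i by auto
        ultimately show "{y, x} \<subseteq> R - node z B k ` {..i}" by blast
        show "2 \<le> (\<Sum>v\<in>{y, x}. c (node z B k i) v * c (node z B k i) v)"
          using sum_c_two[OF uy _ \<open>x \<noteq> y\<close>[symmetric]] ux(4) adj_sym ki(1) by blast
        show "node z B l 1 \<notin> {y, x}" if "l < 3" "l \<noteq> k" for l
          using D(2)[OF that(1) ki(2), of 1 "Suc i"] spider_len[OF sp that(1)] i that in_set[OF that(1), of 1] ux
          by (auto simp: y_def)
      qed
    qed
  qed
  then show ?thesis using sp by blast
qed

end

section \<open>Arm lengths and types of branched diagrams\<close>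

context positive_coxeter_graph
begin

lemma spider_rearrange:
  assumes sp: "spider z B" and p: "\<And>k. k < 3 \<Longrightarrow> p k < 3" "\<And>k l. k < 3 \<Longrightarrow> l < 3 \<Longrightarrow> p k = p l \<Longrightarrow> k = l"
  shows "spider z (B \<circ> p) \<and> spider_set z (B \<circ> p) = spider_set z B"
proof -
  note D = spiderD[OF sp]
  have nd: "node z (B \<circ> p) k i = node z B (p k) i" for k i by (simp add: node_def)
  have eq: "p k = p l \<longleftrightarrow> k = l" if "k < 3" "l < 3" for k l using p(2)[OF that] by blast
  have "spider z (B \<circ> p)"
    unfolding spider_def nd
  proof (intro conjI allI impI)
    fix k :: nat assume k: "k < 3"
    show "(B \<circ> p) k \<noteq> []" using sp p(1)[OF k] by (simp add: spider_def)
    show "node z B (p k) i \<in> R" if "i \<le> length ((B \<circ> p) k)" for i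
      using D(1)[OF p(1)[OF k] p(1)[OF k], of i i] that by simp
    fix l i j :: nat assume l: "l < 3" and ij: "i \<le> length ((B \<circ> p) k)" "j \<le> length ((B \<circ> p) l)"
    show "node z B (p k) i = node z B (p l) j \<longleftrightarrow> i = j \<and> (k = l \<or> i = 0)"
      using D(2)[OF p(1)[OF k] p(1)[OF l]] ij eq[OF k l] by simp
    show "adj (node z B (p k) i) (node z B (p l) j) \<longleftrightarrow> tree_adj k i l j"
      using D(3)[OF p(1)[OF k] p(1)[OF l]] ij eq[OF k l] by (simp add: tree_adj_def)
  qed
  moreover have "p ` {..<3} = {..<3}"
    using p by (intro endo_inj_surj) (auto simp: inj_on_def)
  then have surj: "\<exists>k'<3. p k' = k" if "k < 3" for k
    using that by (metis (no_types, lifting) imageE lessThan_iff)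
  have "spider_set z (B \<circ> p) = spider_set z B"
  proof (intro equalityI subsetI)
    fix u assume "u \<in> spider_set z (B \<circ> p)"
    then obtain k i where "u = node z B (p k) i" "k < 3" "i \<le> length (B (p k))"
      by (auto simp: spider_set_def nd)
    then show "u \<in> spider_set z B" using p(1)[of k] by (auto simp: spider_set_def)
  next
    fix u assume "u \<in> spider_set z B"
    then obtain k i where ki: "u = node z B k i" "k < 3" "i \<le> length (B k)"
      by (auto simp: spider_set_def)
    obtain k' where "k' < 3" "p k' = k" using surj[OF ki(2)] by blast
    then show "u \<in> spider_set z (B \<circ> p)" using ki by (auto simp: spider_set_def nd)
  qed
  ultimately show ?thesis by blast
qed

lemma sort_three:
  fixes f :: "nat \<Rightarrow> nat"
  shows "\<exists>p::nat \<Rightarrow> nat. (\<forall>k<3. p k < 3) \<and> (\<forall>k<3. \<forall>l<3. p k = p l \<longrightarrow> k = l) \<and>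
    f (p 0) \<le> f (p 1) \<and> f (p 1) \<le> f (p 2)"
proof -
  have all3: "(\<forall>k<3. P k) \<longleftrightarrow> P 0 \<and> P 1 \<and> P 2" for P :: "nat \<Rightarrow> bool"
    by (auto simp: less_Suc_eq numeral_3_eq_3 numeral_2_eq_2)
  have get: ?thesis if "f x \<le> f y" "f y \<le> f w" "x < 3" "y < 3" "w < 3" "x \<noteq> y" "y \<noteq> w" "x \<noteq> w" for x y w
    unfolding all3 using that by (intro exI[of _ "\<lambda>k. [x, y, w] ! k"]) (auto simp: numeral_2_eq_2)
  consider "f 0 \<le> f 1" "f 1 \<le> f 2" | "f 0 \<le> f 2" "f 2 \<le> f 1" | "f 1 \<le> f 0" "f 0 \<le> f 2"
    | "f 1 \<le> f 2" "f 2 \<le> f 0" | "f 2 \<le> f 0" "f 0 \<le> f 1" | "f 2 \<le> f 1" "f 1 \<le> f 0"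
    by linarith
  then show ?thesis
  proof cases
    case 1 then show ?thesis by (rule get) auto
  next
    case 2 then show ?thesis by (rule get) auto
  next
    case 3 then show ?thesis by (rule get) auto
  next
    case 4 then show ?thesis by (rule get) auto
  next
    case 5 then show ?thesis by (rule get) auto
  next
    case 6 then show ?thesis by (rule get) auto
  qed
qed

text \<open>The labelling sends \<open>i\<close> to the node at distance \<open>\<iota> i\<close> from the centre on the arm \<open>\<kappa> i\<close>.\<close>

lemma spider_type:
  assumes sp: "spider z B" "spider_set z B = R"
    and ki: "\<And>i. i \<in> {1..n} \<Longrightarrow> \<kappa> i < 3 \<and> \<iota> i \<le> length (B (\<kappa> i))"
    and surj: "\<And>k i. k < 3 \<Longrightarrow> i \<le> length (B k) \<Longrightarrow> \<exists>j\<in>{1..n}. \<iota> j = i \<and> (\<kappa> j = k \<or> i = 0)"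
    and M: "\<And>i j. 1 \<le> i \<Longrightarrow> i < j \<Longrightarrow> j \<le> n \<Longrightarrow>
      \<not> (\<iota> i = \<iota> j \<and> (\<kappa> i = \<kappa> j \<or> \<iota> i = 0)) \<and>
      f i j = (if tree_adj (\<kappa> i) (\<iota> i) (\<kappa> j) (\<iota> j) then 3 else 2)"
  shows "graph_type n (sym_matrix f)"
proof -
  note D = spiderD[OF sp(1)]
  define q where "q i = node z B (\<kappa> i) (\<iota> i)" for i
  have qR: "q i \<in> R" if "i \<in> {1..n}" for i
    using ki[OF that] D(1)[of "\<kappa> i" "\<kappa> i" "\<iota> i" "\<iota> i"] by (simp add: q_def)
  have lt: "m (q i) (q j) = f i j \<and> q i \<noteq> q j" if ij: "1 \<le> i" "i < j" "j \<le> n" for i j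
    using spider_m[OF sp(1), of "\<kappa> i" "\<kappa> j" "\<iota> i" "\<iota> j"] D(2)[of "\<kappa> i" "\<kappa> j" "\<iota> i" "\<iota> j"]
      ki[of i] ki[of j] M[OF ij] ij by (simp add: q_def)
  have "bij_betw q {1..n} R"
  proof (rule bij_betw_imageI)
    show "inj_on q {1..n}"
    proof (rule inj_onI)
      fix i j assume "i \<in> {1..n}" "j \<in> {1..n}" "q i = q j"
      then show "i = j" using lt[of i j] lt[of j i] by (cases i j rule: linorder_cases) auto
    qed
    have "u \<in> q ` {1..n}" if u: "u \<in> R" for u
    proof -
      obtain k i where k: "u = node z B k i" "k < 3" "i \<le> length (B k)"
        using u sp(2) by (auto simp: spider_set_def)
      obtain j where j: "j \<in> {1..n}" "\<iota> j = i" "\<kappa> j = k \<or> i = 0" using surj[OF k(2,3)] by blast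
      have "u = q j" using k(1) j(2,3) by (auto simp: q_def)
      then show ?thesis using j(1) by blast
    qed
    then show "q ` {1..n} = R" using qR by blast
  qed
  moreover have "m (q i) (q j) = sym_matrix f i j" if ij: "i \<in> {1..n}" "j \<in> {1..n}" for i j
  proof -
    consider "i = j" | "i < j" | "j < i" by linarith
    then show ?thesis
      using lt[of i j] lt[of j i] ij qR[OF ij(1)] qR[OF ij(2)] m_sym[OF qR[OF ij(1)] qR[OF ij(2)]]
      by cases (auto simp: sym_matrix_def)
  qed
  ultimately show ?thesis by (auto simp: graph_type_def)
qed

lemma spider_type_D:
  assumes sp: "spider z B" "spider_set z B = R" and len: "length (B 0) = 1" "length (B 1) = 1"
  shows "graph_type (length (B 2) + 3) (type_D (length (B 2) + 3))"
proof -
  define r where "r = length (B 2)"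
  have r: "1 \<le> r" using spider_len[OF sp(1), of 2] by (simp add: r_def)
  have "graph_type (r + 3) (type_D (r + 3))"
    unfolding type_D_def
  \<comment> \<open>Labels 1, ..., r + 1 run along the long arm from its tip to the centre, and r +
    2, r + 3 are the short arms; with n = r + 3 the centre is n - 2, as type D requires.\<close>
  proof (rule spider_type[OF sp, of _ "\<lambda>i. if i = r + 3 then 1 else if i = r + 2 then 0 else 2"
        "\<lambda>i. if i \<le> r + 1 then r + 1 - i else 1"])
    fix i assume "i \<in> {1..r + 3}"
    then show "(if i = r + 3 then 1 else if i = r + 2 then 0 else 2) < (3::nat) \<and>
      (if i \<le> r + 1 then r + 1 - i else 1) \<le> length (B (if i = r + 3 then 1 else if i = r + 2 then 0 else 2))"
      using r len by (auto simp: r_def)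
  next
    fix k i :: nat assume k: "k < 3" "i \<le> length (B k)"
    consider "i = 0" | "i > 0" "k = 2" | "i = 1" "k = 0" | "i = 1" "k = 1"
      using k len by (auto simp: less_Suc_eq numeral_3_eq_3 numeral_2_eq_2 le_Suc_eq)
    then show "\<exists>j\<in>{1..r + 3}. (if j \<le> r + 1 then r + 1 - j else 1) = i \<and>
      ((if j = r + 3 then 1 else if j = r + 2 then 0 else 2) = k \<or> i = 0)"
    proof cases
      case 1 then show ?thesis by (intro bexI[of _ "r + 1"]) auto
    next
      case 2 then show ?thesis using k by (intro bexI[of _ "r + 1 - i"]) (auto simp: r_def)
    next
      case 3 then show ?thesis by (intro bexI[of _ "r + 2"]) auto
    next
      case 4 then show ?thesis by (intro bexI[of _ "r + 3"]) auto
    qed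
  next
    fix i j assume ij: "1 \<le> i" "i < j" "j \<le> r + 3"
    consider "j \<le> r + 1" | "j = r + 2" | "j = r + 3" using ij by linarith
    then show "\<not> ((if i \<le> r + 1 then r + 1 - i else 1) = (if j \<le> r + 1 then r + 1 - j else 1) \<and>
        ((if i = r + 3 then 1 else if i = r + 2 then 0 else 2) = (if j = r + 3 then 1 else if j = r + 2 then 0 else (2::nat)) \<or>
         (if i \<le> r + 1 then r + 1 - i else 1) = 0)) \<and>
      (if j = i + 1 \<and> j \<le> r + 3 - 1 \<or> i = r + 3 - 2 \<and> j = r + 3 then 3 else 2) =
      (if tree_adj (if i = r + 3 then 1 else if i = r + 2 then 0 else 2) (if i \<le> r + 1 then r + 1 - i else 1)
           (if j = r + 3 then 1 else if j = r + 2 then 0 else 2) (if j \<le> r + 1 then r + 1 - j else 1)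
       then 3 else 2)"
      using ij by cases (auto simp: tree_adj_def)
  qed
  then show ?thesis by (simp add: r_def)
qed

lemma spider_type_E:
  assumes sp: "spider z B" "spider_set z B = R" and len: "length (B 0) = 1" "length (B 1) = 2"
    and r: "length (B 2) \<in> {2, 3, 4}"
  shows "graph_type (length (B 2) + 4) type_E"
proof -
  define r where "r = length (B 2)"
  \<comment> \<open>Node 4 is the centre, node 2 the arm of length 1, nodes 3 and 1 the arm of
    length 2, and nodes 5, 6, ... the remaining arm.\<close>
  define \<kappa> :: "nat \<Rightarrow> nat" where "\<kappa> i = (if i = 2 then 0 else if i = 1 \<or> i = 3 then 1 else 2)" for i
  define \<iota> :: "nat \<Rightarrow> nat" where "\<iota> i = (if i = 1 then 2 else if i = 2 \<or> i = 3 then 1 else i - 4)" for i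
  have r: "r \<in> {2, 3, 4}" using r by (simp add: r_def)
  have "graph_type (r + 4) type_E"
    unfolding type_E_def
  proof (rule spider_type[OF sp, of _ \<kappa> \<iota>])
    fix i assume "i \<in> {1..r + 4}"
    then show "\<kappa> i < 3 \<and> \<iota> i \<le> length (B (\<kappa> i))" using len by (auto simp: \<kappa>_def \<iota>_def r_def)
  next
    fix k i :: nat assume k: "k < 3" "i \<le> length (B k)"
    consider "i = 0" | "i > 0" "k = 2" | "i = 1" "k = 0" | "i = 1" "k = 1" | "i = 2" "k = 1"
      using k len by (auto simp: less_Suc_eq numeral_3_eq_3 numeral_2_eq_2 le_Suc_eq)
    then show "\<exists>j\<in>{1..r + 4}. \<iota> j = i \<and> (\<kappa> j = k \<or> i = 0)"
    proof cases
      case 1 then show ?thesis by (intro bexI[of _ 4]) (auto simp: \<iota>_def)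
    next
      case 2 then show ?thesis using k by (intro bexI[of _ "i + 4"]) (auto simp: r_def \<kappa>_def \<iota>_def)
    next
      case 3 then show ?thesis by (intro bexI[of _ 2]) (auto simp: \<kappa>_def \<iota>_def)
    next
      case 4 then show ?thesis by (intro bexI[of _ 3]) (auto simp: \<kappa>_def \<iota>_def)
    next
      case 5 then show ?thesis by (intro bexI[of _ 1]) (auto simp: \<kappa>_def \<iota>_def)
    qed
  next
    fix i j assume ij: "1 \<le> i" "i < j" "j \<le> r + 4"
    then have "j \<le> 8" using r by auto
    then have "j = 2 \<or> j = 3 \<or> j = 4 \<or> j = 5 \<or> j = 6 \<or> j = 7 \<or> j = 8" using ij by linarith
    moreover have "i = 1 \<or> i = 2 \<or> i = 3 \<or> i = 4 \<or> i = 5 \<or> i = 6 \<or> i = 7" using ij \<open>j \<le> 8\<close> by linarith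
    ultimately show "\<not> (\<iota> i = \<iota> j \<and> (\<kappa> i = \<kappa> j \<or> \<iota> i = 0)) \<and>
      (if (i, j) \<in> {(1, 3), (2, 4), (3, 4), (4, 5), (5, 6), (6, 7), (7, 8)} then 3 else 2) =
      (if tree_adj (\<kappa> i) (\<iota> i) (\<kappa> j) (\<iota> j) then 3 else 2)"
      using ij(2) by (elim disjE) (simp_all add: \<kappa>_def \<iota>_def tree_adj_def)
  qed
  then show ?thesis by (simp add: r_def)
qed

lemma spider_classification:
  assumes sp: "spider z B" "spider_set z B = R"
  shows "(\<exists>n\<ge>4. graph_type n (type_D n)) \<or> (\<exists>n\<in>{6, 7, 8}. graph_type n type_E)"
proof -
  obtain p :: "nat \<Rightarrow> nat" where P1: "\<forall>k<3. p k < 3"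
    and P2: "\<forall>k<3. \<forall>l<3. p k = p l \<longrightarrow> k = l"
    and P3: "length (B (p 0)) \<le> length (B (p 1))" "length (B (p 1)) \<le> length (B (p 2))"
    using sort_three[of "\<lambda>k. length (B k)"] by (elim exE conjE) (rule that)
  have p: "p k < 3" if "k < 3" for k using P1[rule_format, OF that] .
  have p': "k = l" if "k < 3" "l < 3" "p k = p l" for k l using P2[rule_format, OF that] .
  have r: "spider z (B \<circ> p) \<and> spider_set z (B \<circ> p) = spider_set z B"
  proof (rule spider_rearrange[OF sp(1)])
    show "p k < 3" if "k < 3" for k using p[OF that] .
    show "k = l" if "k < 3" "l < 3" "p k = p l" for k l using p'[OF that] .
  qed
  define C where "C = B \<circ> p"
  have C: "spider z C" "spider_set z C = R" "length (C 0) \<le> length (C 1)" "length (C 1) \<le> length (C 2)"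
    using r P3 sp(2) by (simp_all add: C_def)
  define a b d where "a = length (C 0)" and "b = length (C 1)" and "d = length (C 2)"
  have abd: "1 \<le> a" "a \<le> b" "b \<le> d"
    using C(3,4) spider_len[OF C(1), of 0] by (auto simp: a_def b_def d_def)
  have bound: "1 < 1 / (real a + 1) + 1 / (real b + 1) + 1 / (real d + 1)"
  proof -
    have "(\<Sum>k<3. f k) = f 0 + f 1 + f 2" for f :: "nat \<Rightarrow> real"
      by (simp add: eval_nat_numeral)
    then show ?thesis using spider_bound[OF C(1)] unfolding a_def b_def d_def by (simp only:)
  qed
  have inv: "1 / (real x + 1) \<le> y" if "k \<le> x" "y = 1 / (real k + 1)" for x k :: nat and y
    unfolding that(2) using that(1) by (intro frac_le) auto
  \<comment> \<open>Arm lengths 2, 2, 2 belong to the affine diagram of type E6, where the three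
    fractions sum to exactly 1; the lengths 1, 3, 3 and 1, 2, 5 below do the same for E7 and
    E8.\<close>
  have a1: "a = 1"
  proof (rule ccontr)
    assume "a \<noteq> 1"
    then have "2 \<le> a" "2 \<le> b" "2 \<le> d" using abd by linarith+
    then have "1 / (real a + 1) \<le> 1 / 3" "1 / (real b + 1) \<le> 1 / 3" "1 / (real d + 1) \<le> 1 / 3"
      by (intro inv[of 2]; simp)+
    then show False using bound by linarith
  qed
  have b2: "b \<le> 2"
  proof (rule ccontr)
    assume "\<not> b \<le> 2"
    then have "3 \<le> b" "3 \<le> d" using abd by linarith+
    then have "1 / (real b + 1) \<le> 1 / 4" "1 / (real d + 1) \<le> 1 / 4" by (intro inv[of 3]; simp)+
    moreover have "1 / (real a + 1) = 1 / 2" using a1 by simp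
    ultimately show False using bound by linarith
  qed
  show ?thesis
  proof (cases "b = 1")
    case True
    then have "graph_type (d + 3) (type_D (d + 3))"
      using spider_type_D[OF C(1,2)] a1 by (simp add: a_def b_def d_def)
    moreover have "d + 3 \<ge> 4" using abd by simp
    ultimately show ?thesis by blast
  next
    case False
    then have b: "b = 2" using b2 abd by simp
    have "d \<le> 4"
    proof (rule ccontr)
      assume "\<not> d \<le> 4"
      then have "1 / (real d + 1) \<le> 1 / 6" by (intro inv[of 5]) simp_all
      moreover have "1 / (real a + 1) = 1 / 2" "1 / (real b + 1) = 1 / 3" using a1 b by simp_all
      ultimately show False using bound by linarith
    qed
    then have d: "d = 2 \<or> d = 3 \<or> d = 4" using abd b by auto
    then have "graph_type (d + 4) type_E"
      using spider_type_E[OF C(1,2)] a1 b by (simp add: a_def b_def d_def)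
    moreover have "d + 4 \<in> {6, 7, 8}" using d by auto
    ultimately show ?thesis by blast
  qed
qed

lemma graph_type_card: "graph_type n M \<Longrightarrow> n = card R"
  unfolding graph_type_def using bij_betw_same_card[of _ "{1..n}" R] by auto

theorem classification:
  defines "n \<equiv> card R"
  shows "graph_type n type_A \<or> graph_type n (type_B n) \<or> (n \<ge> 4 \<and> graph_type n (type_D n)) \<or>
    graph_type 4 type_F \<or> graph_type 3 type_H \<or> graph_type 4 type_H \<or>
    graph_type 6 type_E \<or> graph_type 7 type_E \<or> graph_type 8 type_E \<or>
    (\<exists>k\<ge>3. graph_type 2 (type_I2 k))"
proof (cases "\<exists>z a b d. adj z a \<and> adj z b \<and> adj z d \<and> distinct [a, b, d]")
  case True
  then obtain z B where "spider z B" "spider_set z B = R" using spider_cover by blast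
  then consider k where "k \<ge> 4" "graph_type k (type_D k)" | "graph_type 6 type_E"
    | "graph_type 7 type_E" | "graph_type 8 type_E"
    using spider_classification by blast
  then show ?thesis using graph_type_card unfolding n_def by cases blast+
next
  case False
  then obtain p where p: "ipath p" "set p = R" using path_cover by blast
  then have "length p = n" using distinct_card[of p] by (simp add: ipath_def n_def)
  then show ?thesis using path_classification[OF p] by auto
qed

end

section \<open>Conjugation by the longest element\<close>

context finite_coxeter
begin

lemma positive_graph: "irreducible_coxeter W R \<Longrightarrow> positive_coxeter_graph R (\<lambda>s t. ord (s \<otimes> t))"
proof
  assume irr: "irreducible_coxeter W R"
  show "finite R" by (rule finite_R)
  show "R \<noteq> {}" using irr by (simp add: irreducible_coxeter_def)
  show "ord (s \<otimes> s) = 1" if "s \<in> R" for s using that by simp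
  show "ord (s \<otimes> t) = ord (t \<otimes> s)" if "s \<in> R" "t \<in> R" for s t using ord_commute[OF that] .
  show "2 \<le> ord (s \<otimes> t)" if "s \<in> R" "t \<in> R" "s \<noteq> t" for s t using ord_ge_2[OF that] .
  show "(s, t) \<in> {(s, t). s \<in> R \<and> t \<in> R \<and> s \<noteq> t \<and> ord (s \<otimes> t) \<noteq> 2}\<^sup>*" if "s \<in> R" "t \<in> R" for s t
    using irr that by (simp add: irreducible_coxeter_def coxeter_edges_def)
  show "0 < (\<Sum>s\<in>R. \<Sum>t\<in>R. - 2 * cos (pi / real (ord (s \<otimes> t))) * f s * f t)"
    if "r \<in> R" "f r \<noteq> 0" for r and f :: "'a \<Rightarrow> real"
    using cos_form_positive[of r f, OF irr that] by (simp add: cos_form_def)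
qed

lemma has_type_cases:
  assumes "irreducible_coxeter W R"
  defines "n \<equiv> card R"
  shows "has_type W R n type_A \<or> has_type W R n (type_B n) \<or> (n \<ge> 4 \<and> has_type W R n (type_D n)) \<or>
    has_type W R 4 type_F \<or> has_type W R 3 type_H \<or> has_type W R 4 type_H \<or>
    has_type W R 6 type_E \<or> has_type W R 7 type_E \<or> has_type W R 8 type_E \<or>
    (\<exists>k\<ge>3. has_type W R 2 (type_I2 k))"
proof -
  interpret G: positive_coxeter_graph R "\<lambda>s t. ord (s \<otimes> t)" by (rule positive_graph[OF assms(1)])
  have "has_type W R n M = G.graph_type n M" for n M
    by (simp add: has_type_def labelled_type_def G.graph_type_def)
  then show ?thesis using G.classification unfolding n_def by simp
qed

text \<open>The hypothesis makes the parity of the number of letters from A a homomorphism to the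
  group of order 2. It takes equal values on conjugate elements, in particular on s and
  \<open>\<delta> s\<close>.\<close>

lemma two_coloring:
  assumes A: "\<And>s t. s \<in> A \<Longrightarrow> t \<in> R - A \<Longrightarrow> even (ord (s \<otimes> t))" and AR: "A \<subseteq> R" and s: "s \<in> R"
  shows "\<delta> s \<in> A \<longleftrightarrow> s \<in> A"
proof -
  define f where "f s b = (b \<noteq> (s \<in> A))" for s b
  have rel: "((f s \<circ> f t) ^^ ord (s \<otimes> t)) b = b" if st: "s \<in> R" "t \<in> R" for s t b
  proof (cases "s \<in> A \<longleftrightarrow> t \<in> A")
    case True
    then have "f s \<circ> f t = id" by (auto simp: f_def fun_eq_iff)
    then show ?thesis by simp
  next
    case False
    then have "even (ord (s \<otimes> t))"
      using A[of s t] A[of t s] st ord_commute[OF st] by auto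
    then obtain k where k: "ord (s \<otimes> t) = 2 * k" by blast
    have neg: "f s \<circ> f t = Not" using False by (auto simp: f_def fun_eq_iff)
    have "(Not ^^ (2 * k)) b = b" by (induction k) auto
    then show ?thesis unfolding neg k .
  qed
  obtain ws where ws: "set ws \<subseteq> R" "wp ws = w0" using ex_word[OF w0_closed] by blast
  have sum: "foldr f us b = (b \<noteq> foldr f us False)" for us b
    by (induction us) (auto simp: f_def)
  have "wp (\<delta> s # ws) = wp (ws @ [s])" using ws s by (simp add: w0_conj_def m_assoc)
  then have "foldr f (\<delta> s # ws) False = foldr f (ws @ [s]) False"
  proof (intro foldr_action_eq[where S = UNIV and f = f])
    show "((f s \<circ> f t) ^^ ord (s \<otimes> t)) x = x" if "s \<in> R" "t \<in> R" for s t x using rel[OF that] .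
  qed (use ws(1) s w0_conj_R[OF s] in simp_all)
  then show ?thesis
    using sum[of ws "f s False"] by (auto simp: f_def)
qed

end

locale labelled_coxeter = finite_coxeter +
  fixes r :: "nat \<Rightarrow> 'a" and n :: nat and M :: "nat \<Rightarrow> nat \<Rightarrow> nat"
  assumes bij: "bij_betw r {1..n} R" and lab: "labelled_type W r n M"
begin

lemma r_R [simp]: "i \<in> {1..n} \<Longrightarrow> r i \<in> R"
  by (rule bij_betw_apply[OF bij])

lemma r_eq_iff: "i \<in> {1..n} \<Longrightarrow> j \<in> {1..n} \<Longrightarrow> r i = r j \<longleftrightarrow> i = j"
  by (rule inj_on_eq_iff[OF bij_betw_imp_inj_on[OF bij]])

lemma R_eq: "R = r ` {1..n}"
  using bij_betw_imp_surj_on[OF bij] by (rule HOL.sym)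

lemma ord_r: "i \<in> {1..n} \<Longrightarrow> j \<in> {1..n} \<Longrightarrow> ord (r i \<otimes> r j) = M i j"
  using lab by (simp add: labelled_type_def)

definition e :: "nat \<Rightarrow> nat" where
  "e i = inv_into {1..n} r (\<delta> (r i))"

lemma e_in: "i \<in> {1..n} \<Longrightarrow> e i \<in> {1..n}" and r_e: "i \<in> {1..n} \<Longrightarrow> r (e i) = \<delta> (r i)"
proof -
  assume i: "i \<in> {1..n}"
  then have "\<delta> (r i) \<in> r ` {1..n}" using w0_conj_R[OF r_R[OF i]] R_eq by simp
  then show "e i \<in> {1..n}" "r (e i) = \<delta> (r i)"
    unfolding e_def by (rule inv_into_into, rule f_inv_into_f)
qed

lemma e_e:
  assumes i: "i \<in> {1..n}"
  shows "e (e i) = i"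
proof -
  have "r (e (e i)) = \<delta> (\<delta> (r i))" using r_e[OF e_in[OF i]] r_e[OF i] by (simp only:)
  also have "\<dots> = r i" by (rule w0_conj_w0_conj[OF R_closed[OF r_R[OF i]]])
  finally show ?thesis unfolding r_eq_iff[OF e_in[OF e_in[OF i]] i] .
qed

lemma e_inj:
  assumes "i \<in> {1..n}" "j \<in> {1..n}"
  shows "e i = e j \<longleftrightarrow> i = j"
  using e_e[OF assms(1)] e_e[OF assms(2)] by metis

lemma M_e:
  assumes "i \<in> {1..n}" "j \<in> {1..n}"
  shows "M (e i) (e j) = M i j"
  using ord_r[OF e_in[OF assms(1)] e_in[OF assms(2)]] ord_w0_conj_R[OF r_R[OF assms(1)] r_R[OF assms(2)]]
    ord_r[OF assms] r_e[OF assms(1)] r_e[OF assms(2)] by (simp only:)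

lemma fixed_iff:
  assumes i: "i \<in> {1..n}"
  shows "\<delta> (r i) = r i \<longleftrightarrow> e i = i"
  using r_eq_iff[OF e_in[OF i] i] r_e[OF i] by (simp only:)

lemma central_iff: "w0 \<in> center W \<longleftrightarrow> (\<forall>i\<in>{1..n}. e i = i)"
proof -
  have "w0 \<in> center W \<longleftrightarrow> (\<forall>i\<in>{1..n}. \<delta> (r i) = r i)"
    unfolding w0_central_iff by (subst R_eq) blast
  then show ?thesis using fixed_iff by blast
qed

text \<open>As \<open>e\<close> fixes u, it permutes the nodes joined to u with label k. All of
  these other than v are fixed, so v is fixed too.\<close>

lemma fixed_step:
  assumes u: "u \<in> {1..n}" "e u = u" and v: "v \<in> {1..n}" "M u v = k"
    and others: "\<And>x. x \<in> {1..n} \<Longrightarrow> M u x = k \<Longrightarrow> x \<noteq> v \<Longrightarrow> e x = x"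
  shows "e v = v"
proof (rule ccontr)
  assume ne: "e v \<noteq> v"
  have "M u (e v) = k" using M_e[OF u(1) v(1)] u v by simp
  then have "e (e v) = e v" using others[OF e_in[OF v(1)]] ne by simp
  then show False using e_e[OF v(1)] ne by simp
qed

text \<open>The label form of \<open>dvd_w0_conj\<close>: in a simply laced diagram a row of the
  Cartan matrix takes twice the value at the node minus the sum over its neighbours.\<close>

lemma dvd_e:
  fixes y :: "nat \<Rightarrow> int"
  assumes laced: "\<And>i j. i \<in> {1..n} \<Longrightarrow> j \<in> {1..n} \<Longrightarrow> i \<noteq> j \<Longrightarrow> M i j = 2 \<or> M i j = 3"
    and y: "\<And>i. i \<in> {1..n} \<Longrightarrow> k dvd 2 * y i - (\<Sum>j | j \<in> {1..n} \<and> M i j = 3. y j)" and i: "i \<in> {1..n}"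
  shows "k dvd y (e i) + y i"
proof -
  interpret simply_laced W R w0
  proof
    fix s t assume st: "s \<in> R" "t \<in> R" "s \<noteq> t"
    then obtain i j where "s = r i" "t = r j" "i \<in> {1..n}" "j \<in> {1..n}" using R_eq by auto
    then show "ord (s \<otimes> t) = 2 \<or> ord (s \<otimes> t) = 3" using laced[of i j] st ord_r[of i j] by auto
  qed
  define x where "x u = (if u \<in> R then y (inv_into {1..n} r u) else 0)" for u
  have inj: "inj_on r {1..n}" using bij by (simp add: bij_betw_def)
  have xr: "x (r j) = y j" if "j \<in> {1..n}" for j using that inj by (simp add: x_def inv_into_f_f)
  have diag: "M j j = 1" if "j \<in> {1..n}" for j using that ord_r[OF that that] by simp
  have "k dvd x (\<delta> (r i)) + x (r i)"
  proof (rule dvd_w0_conj)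
    fix s assume "s \<in> R"
    then obtain l where l: "s = r l" "l \<in> {1..n}" using R_eq by auto
    have "(\<Sum>t\<in>R. cartan s t * x t) = (\<Sum>j\<in>{1..n}. cartan (r l) (r j) * y j)"
      unfolding R_eq using inj xr l by (simp add: sum.reindex)
    also have "\<dots> = (\<Sum>j\<in>{1..n}. (if j = l then 2 * y l else 0) - (if M l j = 3 then y j else 0))"
      using l r_eq_iff[of l] ord_r[of l] diag[of l] by (intro sum.cong) (auto simp: cartan_def)
    also have "\<dots> = 2 * y l - (\<Sum>j | j \<in> {1..n} \<and> M l j = 3. y j)"
      using l sum.inter_filter[of "{1..n}" y "\<lambda>j. M l j = 3"] by (simp add: sum_subtractf)
    finally show "k dvd (\<Sum>t\<in>R. cartan s t * x t)" using y[OF l(2)] by simp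
  qed (use i in \<open>auto simp: x_def\<close>)
  then show ?thesis using r_e[OF i] xr[OF e_in[OF i]] xr[OF i] by simp
qed

end

section \<open>The permutation of the labels, type by type\<close>

lemma type_A_nbr: "type_A i j = 3 \<longleftrightarrow> j = Suc i \<or> i = Suc j"
  by (auto simp: type_A_def sym_matrix_def min_def max_def)

lemma type_A_laced: "i \<noteq> j \<Longrightarrow> type_A i j = 2 \<or> type_A i j = 3"
  by (simp add: type_A_def sym_matrix_def)

lemma type_D_laced: "i \<noteq> j \<Longrightarrow> type_D n i j = 2 \<or> type_D n i j = 3"
  by (simp add: type_D_def sym_matrix_def)

lemma type_D_nbr:
  assumes "n \<ge> 4" "i \<in> {1..n}"
  shows "{j. j \<in> {1..n} \<and> type_D n i j = 3} =
    (if i = n \<or> i = n - 1 then {n - 2} else if i = n - 2 then {n - 3, n - 1, n}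
     else if i = 1 then {2} else {i - 1, i + 1})"
proof -
  obtain k where k: "n = k + 4" using assms(1) by (metis add.commute le_Suc_ex)
  have iff: "type_D n i j = 3 \<longleftrightarrow> i < j \<and> (j = i + 1 \<and> j \<le> k + 3 \<or> i = k + 2 \<and> j = k + 4) \<or>
      j < i \<and> (i = j + 1 \<and> i \<le> k + 3 \<or> j = k + 2 \<and> i = k + 4)" for j
    by (cases i j rule: linorder_cases) (simp_all add: type_D_def sym_matrix_def k)
  have "j \<in> {1..n} \<and> type_D n i j = 3 \<longleftrightarrow>
      j \<in> (if i = n \<or> i = n - 1 then {n - 2} else if i = n - 2 then {n - 3, n - 1, n}
        else if i = 1 then {2} else {i - 1, i + 1})" for j
  proof -
    consider "i = k + 4" | "i = k + 3" | "i = k + 2" | "i = 1" "i < k + 2" | "1 < i" "i < k + 2"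
      using assms k by fastforce
    then show ?thesis
      unfolding iff unfolding k by cases auto
  qed
  then show ?thesis by blast
qed

lemma type_E_laced: "i \<noteq> j \<Longrightarrow> type_E i j = 2 \<or> type_E i j = 3"
  by (simp add: type_E_def sym_matrix_def)

lemma type_E_nbr:
  "type_E 1 y = 3 \<longleftrightarrow> y = 3" "type_E 2 y = 3 \<longleftrightarrow> y = 4" "type_E 3 y = 3 \<longleftrightarrow> y = 1 \<or> y = 4"
  "type_E 4 y = 3 \<longleftrightarrow> y = 2 \<or> y = 3 \<or> y = 5" "type_E 5 y = 3 \<longleftrightarrow> y = 4 \<or> y = 6"
  "type_E 6 y = 3 \<longleftrightarrow> y = 5 \<or> y = 7" "type_E 7 y = 3 \<longleftrightarrow> y = 6 \<or> y = 8" "type_E 8 y = 3 \<longleftrightarrow> y = 7"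
  by (auto simp: type_E_def sym_matrix_def min_def max_def split: if_splits)

lemma type_E_nbr1: "type_E (Suc 0) y = 3 \<longleftrightarrow> y = 3"
  using type_E_nbr(1) by simp

lemma interval_6: "x \<in> {1..6::nat} \<longleftrightarrow> x = 1 \<or> x = 2 \<or> x = 3 \<or> x = 4 \<or> x = 5 \<or> x = 6"
  by auto

context labelled_coxeter
begin

text \<open>The Cartan matrix annihilates the vector with entries i except at n, where the value is
  n + 1. So n + 1 divides \<open>e i + i\<close>, which lies between 2 and 2n.\<close>

lemma e_type_A:
  assumes M: "M = type_A" and i: "i \<in> {1..n}"
  shows "e i = n + 1 - i"
proof -
  have "int (n + 1) dvd int (e i) + int i"
  proof (rule dvd_e[OF _ _ i])
    fix i assume i: "i \<in> {1..n}"
    have nb: "{j. j \<in> {1..n} \<and> M i j = 3} = (if i = 1 then {} else {i - 1}) \<union> (if i = n then {} else {i + 1})"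
      unfolding M type_A_nbr using i by auto
    consider "i = 1" "i = n" | "i = 1" "i < n" | "1 < i" "i = n" | "1 < i" "i < n" using i by fastforce
    then show "int (n + 1) dvd 2 * int i - (\<Sum>j | j \<in> {1..n} \<and> M i j = 3. int j)"
      unfolding nb by cases (auto simp: of_nat_diff add.commute)
  qed (use M type_A_laced in blast)
  then have "n + 1 dvd e i + i" by (metis of_nat_add of_nat_dvd_iff)
  then obtain k where k: "e i + i = (n + 1) * k" by blast
  have ei: "1 \<le> e i" "e i \<le> n" "1 \<le> i" "i \<le> n" using e_in[OF i] i by auto
  have "k \<noteq> 0" using k ei by (intro notI) simp
  moreover have "\<not> 2 \<le> k"
  proof
    assume "2 \<le> k"
    then have "(n + 1) * 2 \<le> (n + 1) * k" by (intro mult_le_mono2)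
    then show False using k ei by simp
  qed
  ultimately have "k = 1" by linarith
  then show ?thesis using k by simp
qed

text \<open>The parity of y separates the nodes n - 1 and n from the others, and 4 does not divide
  2n for odd n, so these two nodes are swapped. The rest of the path is then fixed node by node from
  n - 2 downwards.\<close>

lemma e_type_D_odd:
  assumes M: "M = type_D n" and n: "n \<ge> 4" "odd n"
  shows "e (n - 1) = n" "e n = n - 1" "i \<in> {1..n - 2} \<Longrightarrow> e i = i"
proof -
  \<comment> \<open>Four times the half-spin weight of node n: the Cartan matrix annihilates y
    except for the value 4 at n.\<close>
  define y where "y i = (if i \<le> n - 2 then 2 * int i else if i = n - 1 then int n - 2 else int n)" for i
  have y: "4 dvd y (e i) + y i" if i: "i \<in> {1..n}" for i
  proof (rule dvd_e[OF _ _ i])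
    fix i assume i: "i \<in> {1..n}"
    consider "i = n \<or> i = n - 1" | "i = n - 2" | "i = 1" "i \<noteq> n - 2" | "1 < i" "i < n - 2"
      using i by fastforce
    then show "4 dvd 2 * y i - (\<Sum>j | j \<in> {1..n} \<and> M i j = 3. y j)"
    proof cases
      case 2
      obtain k where "n = k + 4" using n(1) by (metis add.commute le_Suc_ex)
      then show ?thesis unfolding M type_D_nbr[OF n(1) i] using 2 by (simp add: y_def algebra_simps)
    qed (unfold M type_D_nbr[OF n(1) i], use n(1) in \<open>auto simp: y_def of_nat_diff algebra_simps\<close>)
  qed (use M type_D_laced in blast)
  have yl: "even (y i)" if "i \<le> n - 2" for i using that by (simp add: y_def)
  have big: "e i \<in> {n - 1, n}" if i: "i \<in> {n - 1, n}" for i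
  proof -
    have iR: "i \<in> {1..n}" using i n by auto
    have "odd (y i)" using i n by (auto simp: y_def)
    moreover have "even (y (e i) + y i)" using y[OF iR] by (meson dvd_trans even_numeral)
    ultimately have "odd (y (e i))" by simp
    then have "\<not> e i \<le> n - 2" using yl by blast
    then show ?thesis using e_in[OF iR] by auto
  qed
  show en: "e n = n - 1"
  proof (rule ccontr)
    assume "e n \<noteq> n - 1"
    then have "e n = n" using big[of n] by simp
    have "\<not> n \<le> n - 2" "n \<noteq> n - 1" using n by auto
    then have "y n = int n" by (simp add: y_def)
    then have "4 dvd 2 * int n" using y[of n] n \<open>e n = n\<close> by simp
    then have "2 dvd int n" by presburger
    then show False using n by simp
  qed
  show en1: "e (n - 1) = n" using e_e[of n] en n by simp
  have small: "e i \<in> {1..n - 2}" if "i \<in> {1..n - 2}" for i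
  proof -
    have iR: "i \<in> {1..n}" and ne: "i \<noteq> n" "i \<noteq> n - 1" using that n by auto
    have nR: "n \<in> {1..n}" "n - 1 \<in> {1..n}" using n by auto
    have "e i \<noteq> n - 1" "e i \<noteq> n"
      using e_inj[OF iR nR(1)] e_inj[OF iR nR(2)] en en1 ne by simp_all
    then show ?thesis using e_in[OF iR] by auto
  qed
  have n2: "e (n - 2) = n - 2"
  proof -
    have "M n (n - 2) = 3" unfolding M using n by (simp add: type_D_def sym_matrix_def)
    then have "M (n - 1) (e (n - 2)) = 3" using M_e[of n "n - 2"] en n by simp
    moreover have "e (n - 2) \<in> {1..n}" using n by (intro e_in) auto
    ultimately have "e (n - 2) \<in> {j. j \<in> {1..n} \<and> type_D n (n - 1) j = 3}" using M by simp
    moreover have "{j. j \<in> {1..n} \<and> type_D n (n - 1) j = 3} = {n - 2}"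
      using type_D_nbr[OF n(1), of "n - 1"] n by simp
    ultimately show ?thesis by blast
  qed
  have desc: "e (n - 2 - k) = n - 2 - k" if "k < n - 2" for k
    using that
  proof (induction k rule: less_induct)
    case (less k)
    show ?case
    proof (cases k)
      case 0
      then show ?thesis using n2 by simp
    next
      case (Suc j)
      define u where "u = n - 2 - j"
      have u: "u \<in> {1..n}" "e u = u" "n - 2 - k = u - 1" "2 \<le> u" "u \<le> n - 2"
        using less Suc by (auto simp: u_def)
      have nb: "{x. x \<in> {1..n} \<and> type_D n u x = 3} = (if j = 0 then {n - 3, n - 1, n} else {u - 1, u + 1})"
      proof -
        have "u \<noteq> n" "u \<noteq> n - 1" "u \<noteq> 1" using u(4,5) n(1) by linarith+
        moreover have "u = n - 2 \<longleftrightarrow> j = 0" using less.prems Suc unfolding u_def by linarith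
        ultimately show ?thesis unfolding type_D_nbr[OF n(1) u(1)] by simp
      qed
      have u1: "u - 1 \<in> {1..n}" "u - 1 \<in> {1..n - 2}" using u by auto
      have "u - 1 \<in> {x. x \<in> {1..n} \<and> type_D n u x = 3}"
        unfolding nb using u by (auto simp: u_def)
      then have "M u (u - 1) = 3" using M by blast
      then have "M u (e (u - 1)) = 3" using M_e[OF u(1) u1(1)] u(2) by simp
      then have "e (u - 1) \<in> {x. x \<in> {1..n} \<and> type_D n u x = 3}"
        using e_in[OF u1(1)] M by blast
      then have *: "e (u - 1) \<in> (if j = 0 then {n - 3, n - 1, n} else {u - 1, u + 1})" unfolding nb .
      have le: "e (u - 1) \<le> n - 2" using small[OF u1(2)] by simp
      have "e (u - 1) = u - 1"
      proof (cases j)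
        case 0
        then have "e (u - 1) = n - 3" using * le n by auto
        then show ?thesis using 0 by (simp add: u_def)
      next
        case (Suc i)
        have "e (u + 1) = u + 1"
          using less.IH[of i] Suc \<open>k = Suc j\<close> less.prems by (simp add: u_def Suc_diff_Suc)
        moreover have "u + 1 \<in> {1..n}" using u by auto
        ultimately have "e (u - 1) \<noteq> u + 1" using e_inj[OF u1(1), of "u + 1"] by auto
        then show ?thesis using * Suc by simp
      qed
      then show ?thesis using u(3) by simp
    qed
  qed
  show "e i = i" if "i \<in> {1..n - 2}"
  proof -
    have "n - 2 - i < n - 2" "n - 2 - (n - 2 - i) = i" using that by auto
    then show ?thesis using desc[of "n - 2 - i"] by simp
  qed
qed

text \<open>Two vectors modulo 2 are used: v marks the nodes n - 1 and n and shows that they are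
  preserved as a pair; y has different parities on the two, which excludes a swap. The remaining
  nodes follow along the path.\<close>

lemma e_type_D_even:
  assumes M: "M = type_D n" and n: "n \<ge> 4" "even n" and i: "i \<in> {1..n}"
  shows "e i = i"
proof -
  define v where "v i = (if i = n - 1 \<or> i = n then 1 else 0 :: int)" for i
  have v: "2 dvd v (e i) + v i" if i: "i \<in> {1..n}" for i
  proof (rule dvd_e[OF _ _ i])
    fix i assume i: "i \<in> {1..n}"
    consider "i = n \<or> i = n - 1" | "i = n - 2" | "i = 1" "i \<noteq> n - 2" | "1 < i" "i < n - 2"
      using i by fastforce
    then show "2 dvd 2 * v i - (\<Sum>j | j \<in> {1..n} \<and> M i j = 3. v j)"
    proof cases
      case 2
      obtain k where "n = k + 4" using n(1) by (metis add.commute le_Suc_ex)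
      then show ?thesis unfolding M type_D_nbr[OF n(1) i] using 2 by (simp add: v_def)
    qed (unfold M type_D_nbr[OF n(1) i], use n(1) in \<open>auto simp: v_def\<close>)
  qed (use M type_D_laced in blast)
  define h where "h = n div 2"
  have h: "n = 2 * h" "h \<ge> 2" using n by (auto simp: h_def)
  \<comment> \<open>Modulo 2 this is twice the half-spin weight of node n; with n = 2h its last two
    entries are h - 1 and h.\<close>
  define y where "y i = (if i \<le> n - 2 then int (i mod 2) else if i = n - 1 then int h - 1 else int h)" for i
  have y: "2 dvd y (e i) + y i" if i: "i \<in> {1..n}" for i
  proof (rule dvd_e[OF _ _ i])
    fix i assume i: "i \<in> {1..n}"
    consider "i = n \<or> i = n - 1" | "i = n - 2" | "i = 1" "i \<noteq> n - 2" | "1 < i" "i < n - 2"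
      using i by fastforce
    then show "2 dvd 2 * y i - (\<Sum>j | j \<in> {1..n} \<and> M i j = 3. y j)"
    proof cases
      case 1
      then have nb: "{j. j \<in> {1..n} \<and> M i j = 3} = {n - 2}"
        unfolding M type_D_nbr[OF n(1) i] by auto
      have "(n - 2) mod 2 = 0" using n by simp
      then have "y (n - 2) = 0" by (simp add: y_def)
      then show ?thesis unfolding nb by simp
    next
      case 2
      obtain k where k: "n = k + 4" using n(1) by (metis add.commute le_Suc_ex)
      have nb: "{j. j \<in> {1..n} \<and> M i j = 3} = {k + 1, k + 3, k + 4}"
        unfolding M type_D_nbr[OF n(1) i] using 2 k by (simp add: add.commute)
      have "(k + 1) mod 2 = 1" using n(2) k by presburger
      then have "y (k + 1) = 1" "y (k + 3) = int h - 1" "y (k + 4) = int h"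
        using k by (simp_all add: y_def)
      then show ?thesis unfolding nb by simp
    next
      case 3
      then have nb: "{j. j \<in> {1..n} \<and> M i j = 3} = {2}"
        unfolding M type_D_nbr[OF n(1) i] using n(1) by simp
      have "y 2 = 0" using n(1) by (simp add: y_def)
      then show ?thesis unfolding nb by simp
    next
      case 4
      define l where "l = i - 1"
      have l: "i = Suc l" using 4 by (simp add: l_def)
      have nb: "{j. j \<in> {1..n} \<and> M i j = 3} = {l, Suc (Suc l)}"
        unfolding M type_D_nbr[OF n(1) i] using 4 n(1) l by auto
      have "even (int (l mod 2) + int (Suc (Suc l) mod 2))" by simp
      moreover have "y l = int (l mod 2)" "y (Suc (Suc l)) = int (Suc (Suc l) mod 2)"
        using 4 l by (simp_all add: y_def)
      ultimately show ?thesis unfolding nb by simp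
    qed
  qed (use M type_D_laced in blast)
  have big: "e i \<in> {n - 1, n}" if "i \<in> {n - 1, n}" for i
  proof -
    have iR: "i \<in> {1..n}" using that n by auto
    have "v i = 1" using that by (auto simp: v_def)
    then have "v (e i) \<noteq> 0" using v[OF iR] by auto
    then show ?thesis by (auto simp: v_def split: if_splits)
  qed
  have nR: "n \<in> {1..n}" "n - 1 \<in> {1..n}" using n by auto
  have "\<not> n \<le> n - 2" "\<not> n - 1 \<le> n - 2" "n \<noteq> n - 1" using n by auto
  then have yn: "y n = int h" "y (n - 1) = int h - 1" by (simp_all add: y_def)
  have en: "e n = n"
  proof (rule ccontr)
    assume "e n \<noteq> n"
    then have "e n = n - 1" using big[of n] by simp
    then have "2 dvd (int h - 1) + int h" using y[OF nR(1)] yn by simp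
    then show False by presburger
  qed
  have "e (n - 1) \<noteq> n" using e_inj[OF nR(2,1)] en n by auto
  then have en1: "e (n - 1) = n - 1" using big[of "n - 1"] by blast
  have n2: "e (n - 2) = n - 2"
  proof (rule fixed_step[OF _ en])
    have nb: "{j. j \<in> {1..n} \<and> M n j = 3} = {n - 2}"
      unfolding M by (subst type_D_nbr[OF n(1)]) (use n in auto)
    show "M n (n - 2) = 3" "\<And>x. x \<in> {1..n} \<Longrightarrow> M n x = 3 \<Longrightarrow> x \<noteq> n - 2 \<Longrightarrow> e x = x"
      using nb by blast+
  qed (use n in auto)
  have desc: "e (n - 2 - k) = n - 2 - k" if "k < n - 2" for k
    using that
  proof (induction k rule: less_induct)
    case (less k)
    show ?case
    proof (cases k)
      case 0
      then show ?thesis using n2 by simp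
    next
      case (Suc j)
      define u where "u = n - 2 - j"
      have u: "u \<in> {1..n}" "e u = u" "n - 2 - k = u - 1" "2 \<le> u" "u \<le> n - 2"
        using less Suc by (auto simp: u_def)
      have nb: "{x. x \<in> {1..n} \<and> type_D n u x = 3} = (if j = 0 then {n - 3, n - 1, n} else {u - 1, u + 1})"
      proof -
        have "u \<noteq> n" "u \<noteq> n - 1" "u \<noteq> 1" using u(4,5) n(1) by linarith+
        moreover have "u = n - 2 \<longleftrightarrow> j = 0" using less.prems Suc unfolding u_def by linarith
        ultimately show ?thesis unfolding type_D_nbr[OF n(1) u(1)] by simp
      qed
      have "e (u - 1) = u - 1"
      proof (rule fixed_step[OF u(1,2)])
        show "u - 1 \<in> {1..n}" using u by auto
        have "u - 1 \<in> {x. x \<in> {1..n} \<and> type_D n u x = 3}"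
          unfolding nb using u by (auto simp: u_def)
        then show "M u (u - 1) = 3" using M by blast
        fix x assume x: "x \<in> {1..n}" "M u x = 3" "x \<noteq> u - 1"
        then have "x \<in> {x. x \<in> {1..n} \<and> type_D n u x = 3}" using M by blast
        then have "x \<in> (if j = 0 then {n - 3, n - 1, n} else {u - 1, u + 1})" unfolding nb .
        then consider "x = n" | "x = n - 1" | "j \<noteq> 0" "x = u + 1"
          using x(3) by (auto simp: u_def split: if_splits)
        then show "e x = x"
        proof cases
          case 3
          then obtain l where "j = Suc l" by (cases j) auto
          then show ?thesis using less.IH[of l] Suc less.prems 3 by (simp add: u_def Suc_diff_Suc)
        qed (use en en1 in auto)
      qed
      then show ?thesis using u by simp
    qed
  qed
  have "e i = i" if "i \<le> n - 2"
  proof -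
    have "n - 2 - i < n - 2" "n - 2 - (n - 2 - i) = i" using that i n by auto
    then show ?thesis using desc[of "n - 2 - i"] by simp
  qed
  moreover have "i \<le> n - 2 \<or> i = n - 1 \<or> i = n" using i by auto
  ultimately show ?thesis using en en1 by auto
qed

text \<open>The vector y, whose entry at index 0 is a filler, is modulo 3 three times a weight:
  nodes 1 and 5 carry 1, nodes 3 and 6 carry 2, the others 0. As \<open>e\<close> changes the sign
  of y modulo 3, node 1 goes to 3 or 6, and 3 is not an end of the diagram.\<close>

lemma e_type_E6:
  assumes M: "M = type_E" and n: "n = 6"
  shows "e 1 = 6" "e 2 = 2" "e 3 = 5" "e 4 = 4" "e 5 = 3" "e 6 = 1"
proof -
  define y where "y i = [0, 1, 0, 2, 0, 1, 2 :: int] ! i" for i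
  have y: "3 dvd y (e i) + y i" if i: "i \<in> {1..n}" for i
  proof (rule dvd_e[OF _ _ i])
    fix i assume i: "i \<in> {1..n}"
    have nb: "{j. j \<in> {1..n} \<and> M 1 j = 3} = {3}" "{j. j \<in> {1..n} \<and> M 2 j = 3} = {4}"
      "{j. j \<in> {1..n} \<and> M 3 j = 3} = {1, 4}" "{j. j \<in> {1..n} \<and> M 4 j = 3} = {2, 3, 5}"
      "{j. j \<in> {1..n} \<and> M 5 j = 3} = {4, 6}" "{j. j \<in> {1..n} \<and> M 6 j = 3} = {5}"
      unfolding M type_E_nbr n by auto
    have "i = 1 \<or> i = 2 \<or> i = 3 \<or> i = 4 \<or> i = 5 \<or> i = 6" using i unfolding n interval_6 .
    then show "3 dvd 2 * y i - (\<Sum>j | j \<in> {1..n} \<and> M i j = 3. y j)"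
      by (elim disjE; hypsubst; subst nb; simp add: y_def)
  qed (use M type_E_laced in blast)
  have ei: "e i \<in> {1..6}" if "i \<in> {1..6}" for i using e_in[of i] that n by simp
  have adj: "type_E (e i) (e j) = type_E i j" if "i \<in> {1..6}" "j \<in> {1..6}" for i j
    using M_e[of i j] that M n by simp
  have inv: "e (e i) = i" if "i \<in> {1..6}" for i using e_e[of i] that n by simp
  have "e 1 = 3 \<or> e 1 = 6" using ei[of 1, unfolded interval_6] y[of 1] n by (auto simp: y_def)
  moreover have "e 1 \<noteq> 3"
  proof
    assume e1: "e 1 = 3"
    then have e3: "e 3 = 1" using inv[of 1] by simp
    have "type_E 1 (e 4) = 3" using adj[of 3 4] e3 type_E_nbr(3) by simp
    then have "e 4 = 3" by (simp add: type_E_nbr1)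
    then show False using inv[of 4] e3 by simp
  qed
  ultimately show e1: "e 1 = 6" by blast
  then show e6: "e 6 = 1" using inv[of 1] by simp
  have "type_E 6 (e 3) = 3" using adj[of 1 3] e1 type_E_nbr(1) by simp
  then show e3: "e 3 = 5" using ei[of 3] by (auto simp: type_E_nbr)
  then show e5: "e 5 = 3" using inv[of 3] by simp
  have "type_E 5 (e 4) = 3" using adj[of 3 4] e3 type_E_nbr(3) by simp
  then have "e 4 = 4 \<or> e 4 = 6" by (simp add: type_E_nbr)
  then show e4: "e 4 = 4" using inv[of 4] e6 by auto
  have "type_E 4 (e 2) = 3" using adj[of 4 2] e4 type_E_nbr(4) by simp
  then have "e 2 = 2 \<or> e 2 = 3 \<or> e 2 = 5" by (simp add: type_E_nbr)
  then show "e 2 = 2" using inv[of 2] e3 e5 by auto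
qed

text \<open>The diagram has no symmetry: the centre is the only node with three neighbours, and the
  three arms have the different lengths 1, 2 and at least 3.\<close>

lemma e_type_E78:
  assumes M: "M = type_E" and n: "n = 7 \<or> n = 8" and i: "i \<in> {1..n}"
  shows "e i = i"
proof -
  have in_n: "i \<in> {1..n}" if "i \<in> {1..7}" for i using that n by auto
  have adj: "type_E (e i) (e j) = type_E i j" if "i \<in> {1..7}" "j \<in> {1..7}" for i j
    using M_e[OF in_n[OF that(1)] in_n[OF that(2)]] M by simp
  have inv: "e (e i) = i" if "i \<in> {1..7}" for i using e_e[OF in_n[OF that]] .
  have e8: "e i \<in> {1..8}" if "i \<in> {1..7}" for i using e_in[OF in_n[OF that]] n by auto
  have n7: "7 \<le> n" using n by auto
  have center: "x = 4" if "x \<in> {1..8}" "type_E x a = 3" "type_E x b = 3" "type_E x c = 3" "distinct [a, b, c]" for x a b c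
  proof -
    have "x = 1 \<or> x = 2 \<or> x = 3 \<or> x = 4 \<or> x = 5 \<or> x = 6 \<or> x = 7 \<or> x = 8" using that(1) by auto
    then show ?thesis using that(2-5) by (elim disjE) (auto simp: type_E_nbr type_E_nbr1)
  qed
  have inj: "e i = e j \<longleftrightarrow> i = j" if "i \<in> {1..7}" "j \<in> {1..7}" for i j
    using e_inj[OF in_n[OF that(1)] in_n[OF that(2)]] .
  have e4: "e 4 = 4"
    by (rule center[of _ "e 2" "e 3" "e 5"]) (use e8[of 4] adj[of 4] inj in \<open>auto simp: type_E_nbr\<close>)
  have "type_E 4 (e 2) = 3" using adj[of 4 2] e4 type_E_nbr(4) by simp
  then have "e 2 = 2 \<or> e 2 = 3 \<or> e 2 = 5" by (simp add: type_E_nbr)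
  moreover have "e 2 \<noteq> 3"
  proof
    assume "e 2 = 3"
    then have "e 3 = 2" using inv[of 2] by simp
    then have "e 1 = 4" using adj[of 3 1] type_E_nbr(3)[of 1] type_E_nbr(2)[of "e 1"] by simp
    then show False using inj[of 1 4] e4 by simp
  qed
  moreover have "e 2 \<noteq> 5"
  proof
    assume "e 2 = 5"
    then have "e 5 = 2" using inv[of 2] by simp
    then have "e 6 = 4" using adj[of 5 6] type_E_nbr(5)[of 6] type_E_nbr(2)[of "e 6"] by simp
    then show False using inj[of 6 4] e4 by simp
  qed
  ultimately have e2: "e 2 = 2" by blast
  have "type_E 4 (e 3) = 3" using adj[of 4 3] e4 type_E_nbr(4) by simp
  then have "e 3 = 3 \<or> e 3 = 5" using inj[of 3 2] e2 by (auto simp: type_E_nbr)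
  moreover have "e 3 \<noteq> 5"
  proof
    assume "e 3 = 5"
    then have e5: "e 5 = 3" using inv[of 3] by simp
    have "type_E 3 (e 6) = 3" using adj[of 5 6] e5 type_E_nbr(5) by simp
    then have e6: "e 6 = 1" using inj[of 6 4] e4 by (auto simp: type_E_nbr)
    have "type_E 1 (e 7) = 3" using adj[of 6 7] e6 type_E_nbr(6) by simp
    then have "e 7 = 3" by (simp add: type_E_nbr1)
    then show False using inj[of 5 7] e5 by simp
  qed
  ultimately have e3: "e 3 = 3" by blast
  have e1: "e 1 = 1"
    by (rule fixed_step[OF _ e3, where k = 3]) (use M n7 e4 in \<open>auto simp: type_E_nbr\<close>)
  have e5: "e 5 = 5"
    by (rule fixed_step[OF _ e4, where k = 3]) (use M n7 e2 e3 in \<open>auto simp: type_E_nbr\<close>)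
  have e6: "e 6 = 6"
    by (rule fixed_step[OF _ e5, where k = 3]) (use M n7 e4 in \<open>auto simp: type_E_nbr\<close>)
  have e7: "e 7 = 7"
    by (rule fixed_step[OF _ e6, where k = 3]) (use M n7 e5 in \<open>auto simp: type_E_nbr\<close>)
  have "e 8 = 8" if "n = 8"
    by (rule fixed_step[OF _ e7, where k = 3]) (use M n7 e6 that in \<open>auto simp: type_E_nbr\<close>)
  moreover have "i = 1 \<or> i = 2 \<or> i = 3 \<or> i = 4 \<or> i = 5 \<or> i = 6 \<or> i = 7 \<or> i = 8 \<and> n = 8"
    using i n by auto
  ultimately show ?thesis using e1 e2 e3 e4 e5 e6 e7 by blast
qed

lemma e_coloring:
  assumes A: "A \<subseteq> {1..n}" "\<And>i j. i \<in> A \<Longrightarrow> j \<in> {1..n} - A \<Longrightarrow> even (M i j)" and i: "i \<in> {1..n}"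
  shows "e i \<in> A \<longleftrightarrow> i \<in> A"
proof -
  have in_A: "r j \<in> r ` A \<longleftrightarrow> j \<in> A" if "j \<in> {1..n}" for j using A(1) r_eq_iff[OF that] by blast
  have "\<delta> (r i) \<in> r ` A \<longleftrightarrow> r i \<in> r ` A"
  proof (rule two_coloring[OF _ _ r_R[OF i]])
    show "r ` A \<subseteq> R" using A(1) r_R by blast
    fix s t assume "s \<in> r ` A" "t \<in> R - r ` A"
    then obtain a b where "s = r a" "a \<in> A" "t = r b" "b \<in> {1..n}" "b \<notin> A" unfolding R_eq by blast
    then show "even (ord (s \<otimes> t))" using A ord_r[of a b] by auto
  qed
  then show ?thesis using in_A[OF i] in_A[OF e_in[OF i]] r_e[OF i] by simp
qed

text \<open>For n = 2 the diagram is symmetric, so node n is fixed by a parity character, all labels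
  at n off the diagonal being even; the path is then followed downwards.\<close>

lemma e_type_B:
  assumes M: "M = type_B n" and n: "n \<ge> 2" and i: "i \<in> {1..n}"
  shows "e i = i"
proof -
  have even: "even (M n j)" if "j \<in> {1..n} - {n}" for j
    using that unfolding M by (auto simp: type_B_def sym_matrix_def)
  have en: "e n = n"
    using e_coloring[of "{n}" n] even n by auto
  have "e (n - k) = n - k" if "k < n" for k
    using that
  proof (induction k rule: less_induct)
    case (less k)
    show ?case
    proof (cases k)
      case (Suc j)
      define u where "u = n - j"
      have u: "u \<in> {1..n}" "e u = u" "n - k = u - 1" "2 \<le> u" using less Suc by (auto simp: u_def)
      have "e (u - 1) = u - 1"
      proof (rule fixed_step[OF u(1,2) _ HOL.refl])
        show "u - 1 \<in> {1..n}" using u by auto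
        fix x assume x: "x \<in> {1..n}" "M u x = M u (u - 1)" "x \<noteq> u - 1"
        have "M u (u - 1) \<ge> 3" unfolding M using u by (auto simp: type_B_def sym_matrix_def)
        then have "x = u + 1" using x u unfolding M by (auto simp: type_B_def sym_matrix_def split: if_splits)
        then show "e x = x" using less.IH[of "j - 1"] Suc less.prems x en
          by (cases j) (auto simp: u_def Suc_diff_Suc)
      qed
      then show ?thesis using u by simp
    qed (use en in simp)
  qed
  from this[of "n - i"] show ?thesis using i by auto
qed

text \<open>The diagram can be reversed, but the label between 2 and 3 is even, and the resulting
  parity character keeps {1, 2} apart from {3, 4}.\<close>

lemma e_type_F:
  assumes M: "M = type_F" and n: "n = 4" and i: "i \<in> {1..n}"
  shows "e i = i"
proof -
  have c: "e i \<in> {1, 2} \<longleftrightarrow> i \<in> {1, 2}" if "i \<in> {1..4}" for i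
    by (rule e_coloring) (use n that in \<open>auto simp: M type_F_def sym_matrix_def\<close>)
  have "type_F (e 2) (e 3) = 4" using M_e[of 2 3] n M by (simp add: type_F_def sym_matrix_def)
  then have "e 2 = 2" "e 3 = 3"
    using c[of 2] c[of 3] e_in[of 3] n by (auto simp: type_F_def sym_matrix_def split: if_splits)
  moreover have "e 1 = 1" using c[of 1] e_inj[of 1 2] \<open>e 2 = 2\<close> n by auto
  moreover have "e 4 \<in> {1..4}" using e_in[of 4] n by simp
  then have "e 4 = 4" using c[of 4] e_inj[of 4 3] \<open>e 3 = 3\<close> n by auto
  moreover have "i = 1 \<or> i = 2 \<or> i = 3 \<or> i = 4" using i n by auto
  ultimately show ?thesis by blast
qed

text \<open>The only edge with label 5 is preserved, and its ends cannot be swapped because node 2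
  has a further neighbour and node 1 has none.\<close>

lemma e_type_H:
  assumes M: "M = type_H" and n: "n = 3 \<or> n = 4" and i: "i \<in> {1..n}"
  shows "e i = i"
proof -
  have H5: "type_H x y = 5 \<longleftrightarrow> x = 1 \<and> y = 2 \<or> x = 2 \<and> y = 1" for x y
    by (auto simp: type_H_def sym_matrix_def min_def max_def)
  have H3: "type_H 1 y \<noteq> 3 \<or> y = 0" "type_H 2 y = 3 \<longleftrightarrow> y = 3" "type_H 3 y = 3 \<longleftrightarrow> y = 2 \<or> y = 4" for y
    by (auto simp: type_H_def sym_matrix_def min_def max_def)
  have "type_H (e 1) (e 2) = 5" using M_e[of 1 2] n M H5[of 1 2] by auto
  moreover have "\<not> (e 1 = 2 \<and> e 2 = 1)"
  proof
    assume a: "e 1 = 2 \<and> e 2 = 1"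
    then have "type_H 1 (e 3) = 3" using M_e[of 2 3] n M H3(2)[of 3] by auto
    moreover have "e 3 \<noteq> 0" using e_in[of 3] n by auto
    ultimately show False using H3(1)[of "e 3"] by simp
  qed
  ultimately have e12: "e 1 = 1" "e 2 = 2" using H5 by auto
  have e3: "e 3 = 3"
    by (rule fixed_step[OF _ e12(2), where k = 3]) (use M n H3 in auto)
  have "e 4 = 4" if "n = 4"
    by (rule fixed_step[OF _ e3, where k = 3]) (use M n that H3 e12 in auto)
  moreover have "i = 1 \<or> i = 2 \<or> i = 3 \<or> i = 4 \<and> n = 4" using i n by auto
  ultimately show ?thesis using e12 e3 by blast
qed

lemma e_type_I2_even:
  assumes M: "M = type_I2 m" and n: "n = 2" and m: "even m" and i: "i \<in> {1..n}"
  shows "e i = i"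
proof -
  have c: "e i \<in> {1} \<longleftrightarrow> i \<in> {1}" if "i \<in> {1..2}" for i
    by (rule e_coloring) (use n that m in \<open>auto simp: M type_I2_def sym_matrix_def\<close>)
  have "e 1 = 1" using c[of 1] by simp
  moreover have "e 2 = 2" using c[of 2] e_in[of 2] n by auto
  moreover have "i = 1 \<or> i = 2" using i n by auto
  ultimately show ?thesis by blast
qed

text \<open>Every element is a power of the rotation p or such a power times s. If the involution w0
  commuted with s, oddness of m would reduce it to 1 or s, which is too short for a longest
  element.\<close>

lemma e_type_I2_odd:
  assumes M: "M = type_I2 m" and n: "n = 2" and m: "odd m" "m \<ge> 3"
  shows "e 1 = 2" "e 2 = 1"
proof -
  define s where "s = r 1"
  define t where "t = r 2"
  have st: "s \<in> R" "t \<in> R" "R = {s, t}" "ord (s \<otimes> t) = m"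
    using r_R[of 1] r_R[of 2] R_eq ord_r[of 1 2] n M
    by (auto simp: s_def t_def numeral_2_eq_2 atLeastAtMostSuc_conv type_I2_def sym_matrix_def)
  define p where "p = s \<otimes> t"
  have p: "p \<in> carrier W" "p [^] m = \<one>" using st by (auto simp: p_def simp flip: st(4))
  have sp: "s \<otimes> p [^] k = inv (p [^] k) \<otimes> s" for k :: nat
  proof (induction k)
    case (Suc k)
    have inv_p: "inv p = t \<otimes> s" using st by (simp add: p_def inv_mult_group)
    have "s \<otimes> p [^] Suc k = (s \<otimes> p [^] k) \<otimes> p" using p st by (simp add: m_assoc)
    also have "\<dots> = inv (p [^] k) \<otimes> (s \<otimes> (s \<otimes> t))" using p st Suc by (simp add: m_assoc p_def)
    also have "\<dots> = inv (p [^] k) \<otimes> inv p \<otimes> s" using p st by (simp add: m_assoc inv_p)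
    also have "inv (p [^] k) \<otimes> inv p = inv (p [^] Suc k)"
      using p by (metis inv_mult_group nat_pow_Suc2 nat_pow_closed)
    finally show ?case .
  qed (use st in simp)
  have inv_pow: "\<exists>l::nat. inv (p [^] k) = p [^] l" for k :: nat
  proof -
    have "p [^] (m * k - k) \<otimes> p [^] k = p [^] (m * k)" using p m by (simp add: nat_pow_mult)
    also have "\<dots> = \<one>" using p by (simp flip: nat_pow_pow)
    finally show ?thesis using p by (metis inv_equality nat_pow_closed)
  qed
  have form: "\<exists>k::nat. wp ws = p [^] k \<or> wp ws = p [^] k \<otimes> s" if "set ws \<subseteq> R" for ws
    using that
  proof (induction ws)
    case Nil
    then show ?case by (intro exI[of _ 0]) simp
  next
    case (Cons a ws)
    then obtain k :: nat where k: "wp ws = p [^] k \<or> wp ws = p [^] k \<otimes> s" by auto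
    obtain l :: nat where l: "inv (p [^] k) = p [^] l" using inv_pow by blast
    obtain l' :: nat where l': "inv (p [^] Suc k) = p [^] l'" using inv_pow by blast
    have sc: "s \<in> carrier W" "t \<in> carrier W" using st by auto
    have one: "a \<otimes> wp ws = p [^] j \<otimes> s \<or> a \<otimes> wp ws = p [^] j"
      if a: "a \<in> carrier W" "a \<otimes> p [^] k = p [^] j \<otimes> s" for a and j :: nat
    proof (rule disjE[OF k])
      assume "wp ws = p [^] k \<otimes> s"
      then have "a \<otimes> wp ws = a \<otimes> p [^] k \<otimes> s" using a(1) sc p by (simp add: m_assoc)
      also have "\<dots> = p [^] j" unfolding a(2) using st(1) p by simp
      finally show ?thesis by blast
    qed (use a(2) in simp)
    have tp: "t = inv p \<otimes> s" using st by (simp add: p_def inv_mult_group m_assoc)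
    have inv2: "inv p \<otimes> inv (p [^] k) = inv (p [^] Suc k)" using p by (simp add: inv_mult_group)
    have "t \<otimes> p [^] k = inv p \<otimes> (s \<otimes> p [^] k)" unfolding tp using p sc by (simp add: m_assoc)
    also have "\<dots> = inv p \<otimes> inv (p [^] k) \<otimes> s" unfolding sp using p sc by (simp add: m_assoc)
    also have "\<dots> = p [^] l' \<otimes> s" unfolding inv2 l' ..
    finally have tk: "t \<otimes> wp ws = p [^] l' \<otimes> s \<or> t \<otimes> wp ws = p [^] l'" using one sc by blast
    have sk: "s \<otimes> wp ws = p [^] l \<otimes> s \<or> s \<otimes> wp ws = p [^] l" using one[of s l] sp[of k] sc l by simp
    have "a = s \<or> a = t" using Cons.prems st(3) by simp
    then have "\<exists>j::nat. a \<otimes> wp ws = p [^] j \<or> a \<otimes> wp ws = p [^] j \<otimes> s" using sk tk by blast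
    then show ?case by simp
  qed
  \<comment> \<open>A cyclic group of odd order has no involution.\<close>
  have odd_ord: "p [^] k = \<one>" if "p [^] k \<otimes> p [^] k = \<one>" for k :: nat
  proof -
    have "p [^] (2 * k) = \<one>" using that p by (simp add: nat_pow_mult mult_2)
    then have "m dvd 2 * k" using pow_eq_id[OF p(1)] st(4) by (simp add: p_def)
    then have "m dvd k" using m by (simp add: coprime_dvd_mult_right_iff)
    then show ?thesis using pow_eq_id[OF p(1)] st(4) by (simp add: p_def)
  qed
  have "e 1 \<noteq> 1"
  proof
    assume "e 1 = 1"
    then have "\<delta> s = s" using fixed_iff[of 1] n by (simp add: s_def)
    then have comm: "s \<otimes> w0 = w0 \<otimes> s"
      using st by (metis R_closed m_assoc r_one w0_closed w0_conj_def w0_sq m_closed)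
    obtain k :: nat where "w0 = p [^] k \<or> w0 = p [^] k \<otimes> s"
      using form ex_word[OF w0_closed] by metis
    then show False
    proof
      assume w: "w0 = p [^] k"
      then have "w0 = \<one>" using odd_ord[of k] w0_sq by simp
      then have "len w0 = 0" using len_one by (simp only:)
      then show False using len_le_w0[OF R_closed[OF st(1)]] len_R[OF st(1)] by linarith
    next
      assume w: "w0 = p [^] k \<otimes> s"
      have "inv (p [^] k) = s \<otimes> p [^] k \<otimes> s" using sp[of k] st p by (simp add: m_assoc)
      also have "\<dots> = p [^] k" using comm w st p by (simp add: m_assoc)
      finally have "p [^] k \<otimes> p [^] k = \<one>" using p by (metis nat_pow_closed l_inv)
      then have "w0 = s" using odd_ord[of k] w st by simp
      then have "len w0 = 1" using len_R[OF st(1)] by (simp only:)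
      then have "len p \<le> 1" using len_le_w0[OF p(1)] by linarith
      then have "len p = 0 \<or> len p = 1" by linarith
      then show False
      proof
        assume "len p = 0"
        then have "p = \<one>" using p by simp
        then show False using st(4) m by (simp add: p_def)
      next
        assume "len p = 1"
        then have "p \<in> R" using len_eq_1 p by blast
        then have "ord p = 2" by (rule ord_R)
        then show False using st(4) m by (simp add: p_def)
      qed
    qed
  qed
  then show e1: "e 1 = 2" using e_in[of 1] n by auto
  show "e 2 = 1" using e_e[of 1] e1 n by simp
qed

end

section \<open>Elements with a single involutory prefix\<close>

context finite_coxeter
begin

lemma involution_iff: "x \<in> involutions W \<longleftrightarrow> x \<in> carrier W \<and> x \<noteq> \<one> \<and> x \<otimes> x = \<one>"
proof -
  have "ord x = 2" if x: "x \<in> carrier W" "x \<noteq> \<one>" "x \<otimes> x = \<one>"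
  proof -
    have "x [^] (2::nat) = \<one>" using x by (simp add: numeral_2_eq_2)
    then have "ord x dvd 2" using pow_eq_id[OF x(1)] by simp
    then have "ord x = 1 \<or> ord x = 2" using prime_nat_iff two_is_prime_nat by blast
    moreover have "ord x \<noteq> 1" using ord_eq_1[OF x(1)] x(2) by auto
    ultimately show ?thesis by blast
  qed
  moreover have "x \<otimes> x = \<one> \<and> x \<noteq> \<one>" if x: "x \<in> carrier W" "ord x = 2"
  proof -
    have "x [^] (2::nat) = \<one>" using pow_ord_eq_1[OF x(1)] x(2) by simp
    moreover have "ord \<one> = 1" by simp
    ultimately show ?thesis using x by (auto simp: numeral_2_eq_2)
  qed
  ultimately show ?thesis unfolding involutions_def by blast
qed

lemma R_involution: "s \<in> R \<Longrightarrow> s \<in> involutions W"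
  by (simp add: involution_iff)

text \<open>
  \<open>a\<close> is the only involution that is a prefix of \<open>x\<close> in the weak order. For a vertex \<open>w\<close> of the
  graph, the neighbours of \<open>w\<close> are the involutory prefixes of \<open>ww\<^sub>0\<close>.
\<close>

definition good :: "'a \<Rightarrow> 'a \<Rightarrow> bool" where
  "good a x \<longleftrightarrow> x \<in> carrier W \<and> (\<forall>y\<in>involutions W. len x = len y + len (y \<otimes> x) \<longleftrightarrow> y = a)"

lemma first_letter:
  assumes "x \<in> carrier W" "x \<noteq> \<one>"
  shows "\<exists>s\<in>R. len x = len s + len (s \<otimes> x)"
proof -
  obtain ws where ws: "set ws \<subseteq> R" "wp ws = x" "length ws = len x" using ex_reduced[OF assms(1)] by blast
  with assms obtain s vs where *: "ws = s # vs" by (cases ws) auto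
  then have s: "s \<in> R" "s \<otimes> x = wp vs" using ws by auto
  have "len (s \<otimes> x) \<le> length vs" unfolding s(2) using len_le[of vs] ws * by simp
  moreover have "len x \<le> len (s \<otimes> x) + 1" using len_mult_le[of s "s \<otimes> x"] s(1) assms(1) by simp
  ultimately show ?thesis using s(1) ws(3) * by (intro bexI[of _ s]) simp_all
qed

lemma good_neq_one: "good a x \<Longrightarrow> a \<in> R \<Longrightarrow> x \<noteq> \<one>"
proof
  assume "good a x" "a \<in> R" "x = \<one>"
  then have "len \<one> = len a + len (a \<otimes> \<one>)" using R_involution unfolding good_def by blast
  then show False using \<open>a \<in> R\<close> by simp
qed

text \<open>For w = \<open>w0 \<otimes> inv x\<close> the condition
  \<open>\<delta> x = inv x\<close> says that w squares to 1, and \<open>x \<noteq> w0\<close> that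
  w is not 1. Since w0 turns lengths into their complements, additivity of lengths for w and y
  becomes the prefix condition on x.\<close>

lemma pendants_eq:
  "pendants W R = {w0 \<otimes> inv x | x. x \<in> carrier W \<and> \<delta> x = inv x \<and> x \<noteq> w0 \<and> (\<exists>a\<in>R. good a x)}"
proof -
  have nb: "neighbours W R (w0 \<otimes> inv x) = {y \<in> involutions W. len x = len y + len (y \<otimes> x)}"
    if x: "x \<in> carrier W" for x
  proof -
    have "len (w0 \<otimes> inv x \<otimes> y) = len (w0 \<otimes> inv x) + len y \<longleftrightarrow> len x = len y + len (y \<otimes> x)"
      if y: "y \<in> involutions W" for y
    proof -
      have yc: "y \<in> carrier W" "inv y = y" using y by (auto simp: involution_iff inv_equality)
      have "len (inv x \<otimes> y) = len (y \<otimes> x)"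
        using len_inv[of "inv x \<otimes> y"] x yc by (simp add: inv_mult_group)
      then have "len (w0 \<otimes> inv x \<otimes> y) + len (y \<otimes> x) = len w0"
        using len_w0_mult[of "inv x \<otimes> y"] x yc by (simp add: m_assoc)
      moreover have "len (w0 \<otimes> inv x) + len x = len w0" using len_w0_mult[of "inv x"] x by simp
      ultimately show ?thesis by linarith
    qed
    then show ?thesis unfolding neighbours_def by blast
  qed
  show ?thesis
  proof (intro equalityI subsetI)
    fix w assume "w \<in> pendants W R"
    then have w: "w \<in> carrier W" "w \<noteq> \<one>" "w \<otimes> w = \<one>" "card (neighbours W R w) = 1"
      by (auto simp: pendants_def involution_iff)
    define x where "x = w \<otimes> w0"
    have inv_w: "inv w = w" using w by (simp add: inv_equality)
    have x: "x \<in> carrier W" using w by (simp add: x_def)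
    have inv_x: "inv x = w0 \<otimes> w" unfolding x_def by (simp only: inv_mult_group[OF w(1) w0_closed] inv_w inv_w0)
    have wx: "w = w0 \<otimes> inv x" unfolding inv_x using w by simp
    have "\<delta> x = inv x" unfolding inv_x unfolding x_def w0_conj_def using w by (simp add: m_assoc)
    moreover have "x \<noteq> w0"
    proof
      assume "x = w0"
      then have "w = \<one>" using wx by simp
      then show False using w by simp
    qed
    moreover obtain y where y: "neighbours W R w = {y}" using w(4) by (auto simp: card_1_singleton_iff)
    then have yy: "{y \<in> involutions W. len x = len y + len (y \<otimes> x)} = {y}" using nb[OF x] wx by simp
    have "x \<noteq> \<one>"
    proof
      assume "x = \<one>"
      moreover have "y \<in> {y \<in> involutions W. len x = len y + len (y \<otimes> x)}" using yy by blast
      ultimately have "len \<one> = len y + len (y \<otimes> \<one>)" "y \<in> involutions W" by auto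
      then show False by (auto simp: involution_iff)
    qed
    then obtain s where "s \<in> R" "len x = len s + len (s \<otimes> x)" using first_letter[OF x] by blast
    then have "s = y" using yy R_involution by blast
    then have "good s x" using yy x unfolding good_def by blast
    ultimately show "w \<in> {w0 \<otimes> inv x | x. x \<in> carrier W \<and> \<delta> x = inv x \<and> x \<noteq> w0 \<and> (\<exists>a\<in>R. good a x)}"
      using wx x \<open>s \<in> R\<close> by blast
  next
    fix w assume "w \<in> {w0 \<otimes> inv x | x. x \<in> carrier W \<and> \<delta> x = inv x \<and> x \<noteq> w0 \<and> (\<exists>a\<in>R. good a x)}"
    then obtain x a where x: "w = w0 \<otimes> inv x" "x \<in> carrier W" "\<delta> x = inv x" "x \<noteq> w0" "a \<in> R" "good a x"
      by blast
    have "{y \<in> involutions W. len x = len y + len (y \<otimes> x)} = {a}"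
      using x(5,6) R_involution unfolding good_def by blast
    then have "card (neighbours W R w) = 1" using nb[OF x(2)] x(1) by simp
    moreover have "w \<otimes> w = \<one>"
    proof -
      have "w \<otimes> w = \<delta> (inv x) \<otimes> inv x" using x(1,2) by (simp add: w0_conj_def m_assoc)
      also have "\<delta> (inv x) = x" unfolding w0_conj_inv[OF x(2)] x(3) using x(2) by simp
      finally show ?thesis using x(2) by simp
    qed
    moreover have "w \<noteq> \<one>"
    proof
      assume "w = \<one>"
      then have "w0 \<otimes> w = w0" by simp
      then have "inv x = w0" using x(1,2) by simp
      then have "inv (inv x) = inv w0" by simp
      then show False using x(2,4) by simp
    qed
    ultimately show "w \<in> pendants W R"
      using x(1,2) by (simp add: pendants_def involution_iff)
  qed
qed

lemma good_single:
  assumes s: "s \<in> R"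
  shows "good s s"
proof -
  have "y = s" if y: "y \<in> involutions W" "len s = len y + len (y \<otimes> s)" for y
  proof -
    have yc: "y \<in> carrier W" "y \<noteq> \<one>" using y(1) by (auto simp: involution_iff)
    then have "len y \<noteq> 0" by simp
    then have "len (y \<otimes> s) = 0" using y(2) s by simp
    then have "y \<otimes> s = \<one>" using yc s by simp
    then show ?thesis using yc s by (metis R_closed inv_R inv_equality)
  qed
  moreover have "len s = len s + len (s \<otimes> s)" using s by simp
  ultimately show ?thesis using R_closed[OF s] unfolding good_def by blast
qed

lemma R_neq_w0:
  assumes "s \<in> R" "t \<in> R" "s \<noteq> t"
  shows "s \<noteq> w0"
proof
  assume "s = w0"
  then have "len (s \<otimes> t) + 1 = 1" using len_w0_mult[of t] assms by simp
  then have "s \<otimes> t = \<one>" using assms by simp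
  then show False using assms by (metis R_closed inv_R inv_equality)
qed

lemma pendants_central:
  assumes "w0 \<in> center W" and two: "\<And>s. s \<in> R \<Longrightarrow> \<exists>t\<in>R. t \<noteq> s"
  shows "pendants W R = {w0 \<otimes> s | s. s \<in> R}"
proof -
  have d: "\<delta> x = x" if "x \<in> carrier W" for x
    using assms(1) that by (simp add: center_def w0_conj_def m_assoc)
  have "(x \<in> carrier W \<and> \<delta> x = inv x \<and> x \<noteq> w0 \<and> (\<exists>a\<in>R. good a x)) \<longleftrightarrow> x \<in> R" for x
  proof
    assume x: "x \<in> carrier W \<and> \<delta> x = inv x \<and> x \<noteq> w0 \<and> (\<exists>a\<in>R. good a x)"
    then obtain a where a: "a \<in> R" "good a x" by blast
    have "x \<otimes> x = \<one>" using x d[of x] by (metis r_inv)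
    moreover have "x \<noteq> \<one>" using good_neq_one a by blast
    ultimately have "x \<in> involutions W" "len x = len x + len (x \<otimes> x)" using x by (auto simp: involution_iff)
    then have "x = a" using a(2) unfolding good_def by blast
    then show "x \<in> R" using a(1) by simp
  next
    assume x: "x \<in> R"
    obtain t where "t \<in> R" "t \<noteq> x" using two[OF x] by blast
    then have "x \<noteq> w0" using R_neq_w0[OF x] by blast
    then show "x \<in> carrier W \<and> \<delta> x = inv x \<and> x \<noteq> w0 \<and> (\<exists>a\<in>R. good a x)"
      using d[of x] good_single[OF x] x by auto
  qed
  then have "pendants W R = {w0 \<otimes> inv x | x. x \<in> R}" unfolding pendants_eq by simp
  also have "\<dots> = {w0 \<otimes> s | s. s \<in> R}" by (intro Collect_cong ex_cong1) auto
  finally show ?thesis .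
qed

text \<open>Such a word admits neither commutations nor braid moves, so it is the only reduced word
  of its element.\<close>

definition chain :: "'a list \<Rightarrow> bool" where
  "chain ws \<longleftrightarrow> distinct ws \<and> set ws \<subseteq> R \<and> (\<forall>us s t vs. ws = us @ s # t # vs \<longrightarrow> s \<otimes> t \<noteq> t \<otimes> s)"

lemma chain_rev:
  assumes "chain ws"
  shows "chain (rev ws)"
proof -
  have "s \<otimes> t \<noteq> t \<otimes> s" if "rev ws = us @ s # t # vs" for us s t vs
  proof -
    have "ws = rev (us @ s # t # vs)" using that by (metis rev_rev_ident)
    then have "ws = rev vs @ t # s # rev us" by simp
    then have "t \<otimes> s \<noteq> s \<otimes> t" using assms unfolding chain_def by blast
    then show ?thesis by metis
  qed
  then show ?thesis using assms by (simp add: chain_def)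
qed

lemma chain_tl: "chain (s # ws) \<Longrightarrow> chain ws"
  unfolding chain_def by (metis append_Cons distinct.simps(2) set_subset_Cons subset_trans)

lemma chain_prefix:
  assumes "chain (us @ vs)"
  shows "chain us"
proof -
  have "s \<otimes> t \<noteq> t \<otimes> s" if "us = xs @ s # t # ys" for xs s t ys
  proof -
    have "us @ vs = xs @ s # t # (ys @ vs)" using that by simp
    then show ?thesis using assms unfolding chain_def by blast
  qed
  then show ?thesis using assms by (simp add: chain_def)
qed

text \<open>If the last letter shortened the product, exchange would express it through the earlier
  letters, and \<open>R_in_parabolic\<close> would make it one of them.\<close>

lemma distinct_reduced:
  assumes "distinct ws" "set ws \<subseteq> R"
  shows "len (wp ws) = length ws"
  using assms
proof (induction ws rule: rev_induct)
  case (snoc s ws)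
  have s: "s \<in> R" "set ws \<subseteq> R" "s \<notin> set ws" using snoc.prems by auto
  have "\<not> len (wp ws \<otimes> s) < len (wp ws)"
  proof
    assume "len (wp ws \<otimes> s) < len (wp ws)"
    then obtain us u vs where *: "ws = us @ u # vs" "wp ws \<otimes> s = wp (us @ vs)"
      using right_exchange[OF s(2,1)] by blast
    have sub: "set (us @ vs) \<subseteq> R" "set (us @ vs) \<subseteq> set ws" using * s by auto
    have "s = inv (wp ws) \<otimes> (wp ws \<otimes> s)" using s by simp
    also have "\<dots> = wp (rev ws @ (us @ vs))"
      unfolding *(2) using s sub(1) by (subst wp_append) (simp_all add: wp_rev del: wp_append)
    finally have "s = wp (rev ws @ (us @ vs))" .
    moreover have "set (rev ws @ (us @ vs)) \<subseteq> set ws" using sub by auto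
    ultimately have "s \<in> set ws"
      using R_in_parabolic[of "rev ws @ (us @ vs)" "set ws"] s by metis
    then show False using s by simp
  qed
  then show ?case using snoc.IH snoc.prems s len_mult_R[of "wp ws" s] by auto
qed simp

text \<open>Suppose t erases a letter u that is not the last, and let x be the product of the tail
  after u, so that xt = ux. Intersecting parabolic subgroups with R gives t = u, so u commutes with
  x. Then uvu, for v the letter after u, lies in the subgroup generated by the tail, which does not
  contain u; this forces uvu = v, against the definition of a chain.\<close>

lemma chain_right_descent:
  assumes c: "chain ws" and t: "t \<in> R" "len (wp ws \<otimes> t) < len (wp ws)"
  shows "ws \<noteq> [] \<and> t = last ws"
proof -
  have wsR: "set ws \<subseteq> R" "distinct ws" using c by (auto simp: chain_def)
  obtain us u vs where *: "ws = us @ u # vs" "wp ws \<otimes> t = wp (us @ vs)"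
    using right_exchange[OF wsR(1) t] by blast
  have R: "set us \<subseteq> R" "u \<in> R" "set vs \<subseteq> R" "u \<notin> set vs" using wsR * by auto
  define x where "x = wp vs"
  have x: "x \<in> carrier W" using R by (simp add: x_def)
  have "wp us \<otimes> (u \<otimes> x \<otimes> t) = wp us \<otimes> x"
    using * R t by (simp add: m_assoc x_def)
  then have uxt: "u \<otimes> x \<otimes> t = x" using R x t by (simp add: m_assoc)
  then have "u \<otimes> (u \<otimes> x \<otimes> t) = u \<otimes> x" by simp
  then have xt: "x \<otimes> t = u \<otimes> x" using R x t by (simp add: m_assoc)
  show ?thesis
  proof (cases vs)
    case Nil
    then have "t = u" using xt R t by (simp add: x_def)
    then show ?thesis using * Nil by simp
  next
    case (Cons v vs')
    have v: "v \<in> R" "v \<in> set vs" "v \<noteq> u" using R Cons by auto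
    have t_eq: "t = wp (rev vs @ [u] @ vs)"
    proof -
      have "t = inv x \<otimes> (x \<otimes> t)" using x t by simp
      also have "\<dots> = inv x \<otimes> (u \<otimes> x)" by (simp only: xt)
      finally show ?thesis using R by (simp add: wp_rev x_def)
    qed
    have "wp (rev vs @ [u] @ vs) \<in> insert u (set vs)"
      by (rule R_in_parabolic) (use R t t_eq in auto)
    then have "t = u \<or> t \<in> set vs" using t_eq by simp
    moreover have "t \<notin> set vs"
    proof
      assume tv: "t \<in> set vs"
      have "u = x \<otimes> t \<otimes> inv x" unfolding xt using R x by (simp add: m_assoc)
      also have "\<dots> = wp (vs @ [t] @ rev vs)" using R t by (simp add: wp_rev x_def m_assoc)
      finally have ue: "u = wp (vs @ [t] @ rev vs)" .
      have "wp (vs @ [t] @ rev vs) \<in> set vs"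
        by (rule R_in_parabolic) (use R tv ue in auto)
      then show False using ue R by simp
    qed
    ultimately have tu: "t = u" by blast
    have xu: "x \<otimes> u = u \<otimes> x" using xt tu by simp
    have ix: "inv x = u \<otimes> inv x \<otimes> u"
    proof -
      have "inv (x \<otimes> u) = inv (u \<otimes> x)" using xu by simp
      then have "u \<otimes> inv x = inv x \<otimes> u" using R x by (simp add: inv_mult_group)
      then show ?thesis using R x by (simp add: m_assoc)
    qed
    \<comment> \<open>The first letter v of the tail is an inversion of \<open>inv x\<close>. As
      conjugation by u leaves \<open>inv x\<close> unchanged, y is one as well, and exchange then
      writes y over the letters of the tail.\<close>
    define y where "y = u \<otimes> v \<otimes> u"
    have y: "y \<in> carrier W" using R v by (simp add: y_def)
    have "length vs = len x" using distinct_reduced[of vs] R wsR * by (simp add: x_def)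
    moreover have "v \<otimes> x = wp vs'" using Cons R by (simp add: x_def)
    then have "len (v \<otimes> x) \<le> length vs'" using len_le[of vs'] R Cons by simp
    ultimately have "len (inv x \<otimes> v) < len (inv x)"
      using len_inv[of "v \<otimes> x"] Cons v x by (simp add: inv_mult_group)
    then have i1: "inversion (inv x) v" using inversion_iff[OF _ R_reflection[OF v(1)], of "inv x"] x by simp
    have "inv x \<otimes> v \<otimes> x \<noteq> u"
    proof
      assume "inv x \<otimes> v \<otimes> x = u"
      then have "x \<otimes> (inv x \<otimes> v \<otimes> x) = x \<otimes> u" by simp
      then have "v \<otimes> x = u \<otimes> x" using xu x v by (simp add: m_assoc)
      then show False using x v R by simp
    qed
    then have i2: "inversion (u \<otimes> inv x) v"
      using inversion_mult[of u "inv x" v] i1 R x v by simp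
    have "u \<otimes> y \<otimes> u = v" using R v by (simp add: y_def m_assoc)
    moreover have "y \<noteq> u"
    proof
      assume "y = u"
      then have "u \<otimes> y \<otimes> u = u" using R by simp
      then show False using \<open>u \<otimes> y \<otimes> u = v\<close> v by simp
    qed
    ultimately have "inversion (u \<otimes> inv x \<otimes> u) y"
      using inversion_mult[of "u \<otimes> inv x" u y] i2 R x y by simp
    then have "inversion (wp (rev vs)) y" using ix R by (simp add: wp_rev x_def)
    then obtain us' s' ws' where d: "rev vs = us' @ s' # ws'" "wp (rev vs) \<otimes> y = wp (us' @ ws')"
      using exchange_inversion[of "rev vs" y] R y by auto
    have "set (rev vs) = set (us' @ s' # ws')" using d(1) by simp
    then have dR: "set (us' @ ws') \<subseteq> R" "set (us' @ ws') \<subseteq> set vs" using R by auto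
    have "y = x \<otimes> (inv x \<otimes> y)" using x y by simp
    also have "\<dots> = wp (vs @ (us' @ ws'))"
      using d(2) R dR by (subst wp_append) (simp_all add: wp_rev x_def del: wp_append)
    finally have yw: "y = wp (vs @ (us' @ ws'))" .
    have sub: "set (vs @ (us' @ ws')) \<subseteq> set vs" using dR by auto
    have y3: "y = wp [u, v, u]" using R v by (simp add: y_def m_assoc)
    have "len (u \<otimes> v) = 2" using distinct_reduced[of "[u, v]"] R v by simp
    then have "len y = 1 \<or> len y = 3" using len_mult_R[of "u \<otimes> v" u] R v by (auto simp: y_def)
    then show ?thesis
    proof
      assume "len y = 3"
      then have "set [u, v, u] \<subseteq> set vs"
        using in_parabolic_of_reduced[OF sub R(3), of "[u, v, u]"] y3 yw R v by simp
      then show ?thesis using R by simp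
    next
      assume "len y = 1"
      then have yR: "y \<in> R" using len_eq_1 y by blast
      have "wp [u, v, u] \<in> {u, v}" by (rule R_in_parabolic) (use R v y3 yR in auto)
      then have "y = v" using y3 \<open>y \<noteq> u\<close> by auto
      then have "v \<otimes> u = u \<otimes> v \<otimes> u \<otimes> u" by (simp add: y_def)
      then have "u \<otimes> v = v \<otimes> u" using R v by simp
      moreover have "ws = us @ u # v # vs'" using * Cons by simp
      then have "u \<otimes> v \<noteq> v \<otimes> u" using c unfolding chain_def by blast
      ultimately show ?thesis by blast
    qed
  qed
qed

lemma chain_left_descent:
  assumes c: "chain ws" and t: "t \<in> R" "len (t \<otimes> wp ws) < len (wp ws)"
  shows "ws \<noteq> [] \<and> t = hd ws"
proof -
  have wsR: "set ws \<subseteq> R" using c by (simp add: chain_def)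
  have "len (wp (rev ws) \<otimes> t) = len (t \<otimes> wp ws)"
    using len_inv[of "t \<otimes> wp ws"] wsR t by (simp add: wp_rev inv_mult_group)
  then have "len (wp (rev ws) \<otimes> t) < len (wp (rev ws))" using t wsR by (simp add: wp_rev)
  then show ?thesis using chain_right_descent[OF chain_rev[OF c] t(1)] by (simp add: last_rev)
qed

text \<open>The first letter is the only left descent, so any prefix other than 1 in the weak order
  starts with it; it is stripped off and the argument repeated.\<close>

lemma chain_prefixes:
  assumes "chain ws" "y \<in> carrier W" "len (wp ws) = len y + len (inv y \<otimes> wp ws)"
  shows "\<exists>us vs. ws = us @ vs \<and> y = wp us"
  using assms
proof (induction ws arbitrary: y)
  case Nil
  then have "len y = 0" by simp
  then have "y = wp []" using Nil.prems(2) by simp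
  then show ?case by blast
next
  case (Cons s ws)
  show ?case
  proof (cases "y = \<one>")
    case True
    then show ?thesis by (intro exI[of _ "[]"] exI[of _ "s # ws"]) simp
  next
    case False
    have R: "s \<in> R" "set ws \<subseteq> R" using Cons.prems by (auto simp: chain_def)
    define x where "x = wp (s # ws)"
    have x: "x \<in> carrier W" "s \<otimes> x = wp ws" using R by (simp_all add: x_def)
    obtain t where t: "t \<in> R" "len y = len t + len (t \<otimes> y)" using first_letter[OF Cons.prems(2) False] by blast
    define y' where "y' = t \<otimes> y"
    have y': "y' \<in> carrier W" "y = t \<otimes> y'" using t Cons.prems by (auto simp: y'_def)
    have iy: "inv y' \<otimes> (t \<otimes> x) = inv y \<otimes> x" using t y' x by (simp add: y'(2) inv_mult_group m_assoc)
    have tx: "len (t \<otimes> x) \<le> len y' + len (inv y \<otimes> x)"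
    proof -
      have "y' \<otimes> (inv y \<otimes> x) = t \<otimes> x" unfolding iy[symmetric] using R_closed[OF t(1)] x(1) y'(1) by simp
      then show ?thesis
        using len_mult_le[OF y'(1), of "inv y \<otimes> x"] Cons.prems(2) x(1) by simp
    qed
    have ly: "len y = 1 + len y'" using t by (simp add: y'_def)
    have lx: "len x = len y + len (inv y \<otimes> x)" using Cons.prems(3) by (simp only: x_def)
    have "len (t \<otimes> wp (s # ws)) < len (wp (s # ws))" using tx ly lx unfolding x_def by linarith
    then have ts: "t = s" using chain_left_descent[OF Cons.prems(1) t(1)] by simp
    have "len x \<le> 1 + len (t \<otimes> x)" using len_mult_le[of t "t \<otimes> x"] t x by simp
    then have "len (wp ws) = len y' + len (inv y' \<otimes> wp ws)" using tx ly lx iy ts x(2) by simp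
    then obtain us vs where "ws = us @ vs" "y' = wp us"
      using Cons.IH[OF chain_tl[OF Cons.prems(1)] y'(1)] by blast
    then have "s # ws = (s # us) @ vs \<and> y = wp (s # us)" using y'(2) ts by simp
    then show ?thesis by blast
  qed
qed

text \<open>An involutory prefix is an initial segment equal in the group to its reversal, so its
  last letter is a left descent and therefore its first letter. As the letters are distinct, the
  segment has length one.\<close>

lemma good_chain:
  assumes c: "chain (a # ws)"
  shows "good a (wp (a # ws))"
proof -
  define x where "x = wp (a # ws)"
  have R: "a \<in> R" "set ws \<subseteq> R" and dist: "distinct (a # ws)" using c by (auto simp: chain_def)
  have x: "x \<in> carrier W" using R by (simp add: x_def)
  have "len x = len y + len (y \<otimes> x) \<longleftrightarrow> y = a" if y: "y \<in> involutions W" for y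
  proof
    have yc: "y \<in> carrier W" "y \<noteq> \<one>" "inv y = y" using y by (auto simp: involution_iff inv_equality)
    assume "len x = len y + len (y \<otimes> x)"
    then have "len (wp (a # ws)) = len y + len (inv y \<otimes> wp (a # ws))" using yc by (simp only: x_def)
    then obtain us vs where uv: "a # ws = us @ vs" "y = wp us" using chain_prefixes[OF c yc(1)] by blast
    have cu: "chain us" using chain_prefix[of us vs] c uv by simp
    then have uR: "set us \<subseteq> R" "distinct us" by (auto simp: chain_def)
    have ne: "us \<noteq> []" using uv yc by auto
    then have hd: "hd us = a" using uv by (cases us) auto
    define l where "l = last us"
    have us: "us = butlast us @ [l]" using ne by (simp add: l_def)
    have bR: "set (butlast us) \<subseteq> R" "distinct (butlast us)" "l \<in> R"
      using uR ne by (auto simp: l_def dest: in_set_butlastD intro: distinct_butlast)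
    have "wp us = wp (rev us)" using uv(2) yc(3) uR by (simp add: wp_rev)
    also have "rev us = l # rev (butlast us)" by (subst us) simp
    finally have "l \<otimes> wp us = wp (rev (butlast us))" using bR by simp
    then have "len (l \<otimes> wp us) \<le> length us - 1"
      using len_le[of "rev (butlast us)"] bR(1) by simp
    moreover have "length us \<noteq> 0" using ne by simp
    moreover have "len (wp us) = length us" using distinct_reduced uR by blast
    ultimately have "len (l \<otimes> wp us) < len (wp us)" by linarith
    then have "l = hd us" using chain_left_descent[OF cu bR(3)] by simp
    then have "length us = 1"
      using uR(2) ne by (cases us) (auto simp: l_def split: if_splits)
    then have "us = [a]" using hd by (cases us) auto
    then show "y = a" using uv R by simp
  next
    assume "y = a"
    then have "y \<otimes> x = wp ws" using R by (simp add: x_def)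
    then show "len x = len y + len (y \<otimes> x)"
      using distinct_reduced[of "a # ws"] distinct_reduced[of ws] dist R \<open>y = a\<close> by (simp add: x_def)
  qed
  then show ?thesis using x unfolding good_def x_def by blast
qed

end

context finite_coxeter
begin

text \<open>By the triangle inequality for lengths an involutory prefix of x is one of xs as well.
  Good elements can therefore be grown letter by letter.\<close>

lemma good_prefix:
  assumes g: "good a (x \<otimes> s)" "len (x \<otimes> s) = len x + 1" and x: "x \<in> carrier W" "x \<noteq> \<one>" and s: "s \<in> R"
  shows "good a x"
proof -
  have up: "y = a" if y: "y \<in> involutions W" "len x = len y + len (y \<otimes> x)" for y
  proof -
    have yc: "y \<in> carrier W" "y \<otimes> y = \<one>" using y(1) by (auto simp: involution_iff)
    have "len (y \<otimes> (x \<otimes> s)) \<le> len (y \<otimes> x) + 1"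
      using len_mult_le[of "y \<otimes> x" s] yc x s by (simp add: m_assoc)
    moreover have "y \<otimes> (y \<otimes> (x \<otimes> s)) = x \<otimes> s" using yc x s by (simp flip: m_assoc)
    then have "len (x \<otimes> s) \<le> len y + len (y \<otimes> (x \<otimes> s))"
      using len_mult_le[of y "y \<otimes> (x \<otimes> s)"] yc x s by simp
    ultimately have "len (x \<otimes> s) = len y + len (y \<otimes> (x \<otimes> s))" using g(2) y(2) by linarith
    then show ?thesis using g(1) y(1) unfolding good_def by blast
  qed
  obtain t where t: "t \<in> R" "len x = len t + len (t \<otimes> x)" using first_letter[OF x] by blast
  then have "t = a" using up R_involution by blast
  then show ?thesis using up t x(1) unfolding good_def by blast
qed

text \<open>
  A strand family lists words for the minimal coset representatives that may follow the letter \<open>a\<close>: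
  appending a letter of \<open>J\<close> extends a word inside the family, fails to lengthen it, or pulls a letter
  commuting with \<open>a\<close> to the front. The last clause splits each word into an involution and a part
  commuting with \<open>a\<close>, so that appending \<open>a\<close> creates an involutory prefix.
\<close>

definition strands :: "'a \<Rightarrow> 'a set \<Rightarrow> 'a list set \<Rightarrow> bool" where
  "strands a J \<U> \<longleftrightarrow> J \<subseteq> R \<and> [] \<in> \<U> \<and> (\<forall>U\<in>\<U>. set U \<subseteq> J \<and>
     (\<forall>s\<in>J. (\<exists>V\<in>\<U>. length V = Suc (length U) \<and> wp V = wp U \<otimes> s) \<or>
        (\<exists>V. set V \<subseteq> J \<and> length V \<le> length U \<and> wp V = wp U \<otimes> s) \<or>
        (\<exists>s'\<in>J. s' \<otimes> a = a \<otimes> s' \<and> wp U \<otimes> s = s' \<otimes> wp U)) \<and>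
     (\<exists>U1 U2. set U1 \<subseteq> J \<and> set U2 \<subseteq> J \<and> length U1 + length U2 = length U \<and>
        wp U = wp U1 \<otimes> wp U2 \<and> wp U1 \<otimes> wp U1 = \<one> \<and> wp U2 \<otimes> a = a \<otimes> wp U2))"

text \<open>Remove the last letter s of a reduced word; what remains is good, hence of the form aU
  unless it is trivial. The splitting clause excludes s = a, and the clauses for s in J leave only
  extensions within the family.\<close>

lemma good_strands:
  assumes st: "strands a J \<U>" and R: "R = insert a J" "a \<notin> J"
  shows "good a x \<Longrightarrow> \<exists>U\<in>\<U>. x = wp (a # U) \<and> length (a # U) = len x"
proof (induction "len x" arbitrary: x rule: less_induct)
  case less
  have aR: "a \<in> R" using R by simp
  have x: "x \<in> carrier W" using less.prems by (simp add: good_def)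
  have x1: "x \<noteq> \<one>" using good_neq_one[OF less.prems aR] .
  have good: "y = a" if "y \<in> involutions W" "len x = len y + len (y \<otimes> x)" for y
    using less.prems that unfolding good_def by blast
  obtain ws where ws: "set ws \<subseteq> R" "wp ws = x" "length ws = len x" using ex_reduced[OF x] by blast
  with x1 obtain ws' s where *: "ws = ws' @ [s]" by (cases ws rule: rev_cases) auto
  have s: "s \<in> R" and ws'R: "set ws' \<subseteq> R" using ws * by auto
  define z where "z = wp ws'"
  have z: "z \<in> carrier W" "x = z \<otimes> s" using ws'R ws(2) * s by (auto simp: z_def)
  have "len z \<le> length ws'" unfolding z_def by (rule len_le[OF ws'R])
  moreover have "len x \<le> len z + 1" using len_mult_le[OF z(1), of s] s z(2) by simp
  ultimately have lz: "len x = len z + 1" using ws(3) * by simp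
  have nil: "[] \<in> \<U>" using st by (simp add: strands_def)
  show ?case
  proof (cases "z = \<one>")
    case True
    then have "x = s" using z s by simp
    then have "len x = len s + len (s \<otimes> x)" using s by simp
    then have "s = a" using good R_involution[OF s] by blast
    then show ?thesis using \<open>x = s\<close> nil s by (intro bexI[of _ "[]"]) simp_all
  next
    case False
    have "good a z" by (rule good_prefix[of a z s]) (use less.prems z lz False s in simp_all)
    then obtain U where U: "U \<in> \<U>" "z = wp (a # U)" "length (a # U) = len z"
      using less.hyps[of z] lz by auto
    have JR: "J \<subseteq> R" using R by blast
    have UJ: "set U \<subseteq> J" using st U(1) unfolding strands_def by blast
    then have UR: "set U \<subseteq> R" using JR by blast
    have "s = a \<or> s \<in> J" using s R by blast
    then show ?thesis
    proof
      assume sa: "s = a"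
      obtain U1 U2 where u: "set U1 \<subseteq> J" "set U2 \<subseteq> J" "length U1 + length U2 = length U"
          "wp U = wp U1 \<otimes> wp U2" "wp U1 \<otimes> wp U1 = \<one>" "wp U2 \<otimes> a = a \<otimes> wp U2"
        using st U(1) unfolding strands_def by blast
      have uR: "set U1 \<subseteq> R" "set U2 \<subseteq> R" using u JR by auto
      \<comment> \<open>As \<open>wp U2\<close> commutes with a, x is y followed by
        \<open>wp U2\<close>, and y is an involution of length at least 2: a second involutory
        prefix besides a.\<close>
      define y where "y = a \<otimes> wp U1 \<otimes> a"
      have y: "y \<in> carrier W" using aR uR by (simp add: y_def)
      have "y \<otimes> y = a \<otimes> (wp U1 \<otimes> wp U1) \<otimes> a" using aR uR by (simp add: y_def m_assoc)
      then have yy: "y \<otimes> y = \<one>" using aR by (simp add: u(5))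
      have "x = a \<otimes> wp U1 \<otimes> (wp U2 \<otimes> a)" using z(2) U(2) u(4) sa aR uR by (simp add: m_assoc)
      then have xy: "x = y \<otimes> wp U2" unfolding u(6) using aR uR by (simp add: y_def m_assoc)
      then have "y \<otimes> x = (y \<otimes> y) \<otimes> wp U2" using y uR by (simp add: m_assoc)
      then have yx: "y \<otimes> x = wp U2" using uR by (simp add: yy)
      have ly: "len y \<le> length U1 + 2"
        using len_le[of "a # U1 @ [a]"] aR uR by (simp add: y_def m_assoc)
      have lu: "len (wp U2) \<le> length U2" by (rule len_le[OF uR(2)])
      have lx: "len x = length U + 2" using lz U(3) by simp
      have "len x \<le> len y + len (wp U2)" using len_mult_le[OF y, of "wp U2"] uR xy by simp
      then have eq: "len x = len y + len (y \<otimes> x)" "len y = length U1 + 2" using yx lx ly lu u(3) by simp_all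
      then have "y \<noteq> \<one>" using y by auto
      then have "y = a" using good eq(1) y yy by (auto simp: involution_iff)
      then show ?thesis using eq(2) aR by simp
    next
      assume sJ: "s \<in> J"
      then consider V where "V \<in> \<U>" "length V = Suc (length U)" "wp V = wp U \<otimes> s"
        | V where "set V \<subseteq> J" "length V \<le> length U" "wp V = wp U \<otimes> s"
        | s' where "s' \<in> J" "s' \<otimes> a = a \<otimes> s'" "wp U \<otimes> s = s' \<otimes> wp U"
        using st U(1) unfolding strands_def by blast
      then show ?thesis
      proof cases
        case 1
        have "x = wp (a # V)" using z(2) U(2) 1(3) aR UR s by (simp add: m_assoc)
        then show ?thesis using 1(1,2) lz U(3) by (intro bexI[of _ V]) simp_all
      next
        case 2
        have VR: "set V \<subseteq> R" using 2(1) JR by blast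
        have "x = wp (a # V)" using z(2) U(2) 2(3) aR UR s by (simp add: m_assoc)
        then have "len x \<le> Suc (length V)" using len_le[of "a # V"] aR VR by simp
        then show ?thesis using 2(2) lz U(3) by simp
      next
        case 3
        \<comment> \<open>The letter s' moves past a to the front, where it is an involutory prefix
          different from a.\<close>
        have s': "s' \<in> R" using 3(1) JR by blast
        have "x = a \<otimes> (s' \<otimes> wp U)" using z(2) U(2) aR UR s by (simp add: m_assoc flip: 3(3))
        also have "\<dots> = (a \<otimes> s') \<otimes> wp U" using aR UR s' by (simp add: m_assoc)
        also have "\<dots> = s' \<otimes> z" unfolding 3(2)[symmetric] using U(2) aR UR s' by (simp add: m_assoc)
        finally have "s' \<otimes> x = z" using s' z by simp
        then have "len x = len s' + len (s' \<otimes> x)" using lz s' by simp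
        then have "s' = a" using good R_involution[OF s'] by blast
        then show ?thesis using 3(1) R(2) by simp
      qed
    qed
  qed
qed

lemma wp_commute_letter:
  assumes "s \<in> R" "set ws \<subseteq> R" "\<And>t. t \<in> set ws \<Longrightarrow> t \<otimes> s = s \<otimes> t"
  shows "wp ws \<otimes> s = s \<otimes> wp ws"
  using assms(2,3)
proof (induction ws)
  case (Cons t ws)
  have t: "t \<in> R" "set ws \<subseteq> R" "t \<otimes> s = s \<otimes> t" "wp ws \<otimes> s = s \<otimes> wp ws" using Cons by auto
  have "wp (t # ws) \<otimes> s = t \<otimes> (wp ws \<otimes> s)" using t(1,2) assms(1) by (simp add: m_assoc)
  also have "\<dots> = (t \<otimes> s) \<otimes> wp ws" unfolding t(4) using t(1,2) assms(1) by (simp add: m_assoc)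
  also have "\<dots> = s \<otimes> wp (t # ws)" unfolding t(3) using t(1,2) assms(1) by (simp add: m_assoc)
  finally show ?case .
qed (use assms(1) in simp)

lemma wp_commute_words:
  assumes "set us \<subseteq> R" "set ws \<subseteq> R" "\<And>s t. s \<in> set us \<Longrightarrow> t \<in> set ws \<Longrightarrow> s \<otimes> t = t \<otimes> s"
  shows "wp us \<otimes> wp ws = wp ws \<otimes> wp us"
  using assms(1,3)
proof (induction us)
  case (Cons s us)
  have s: "s \<in> R" "set us \<subseteq> R" "wp us \<otimes> wp ws = wp ws \<otimes> wp us" using Cons by auto
  have c: "wp ws \<otimes> s = s \<otimes> wp ws"
    by (rule wp_commute_letter[OF s(1) assms(2)]) (use Cons.prems(2)[of s] in simp)
  have "wp (s # us) \<otimes> wp ws = s \<otimes> (wp us \<otimes> wp ws)" using s(1,2) assms(2) by (simp add: m_assoc)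
  also have "\<dots> = (s \<otimes> wp ws) \<otimes> wp us" unfolding s(3) using s(1,2) assms(2) by (simp add: m_assoc)
  also have "\<dots> = wp ws \<otimes> wp (s # us)" unfolding c[symmetric] using s(1,2) assms(2) by (simp add: m_assoc)
  finally show ?case .
qed (use assms(2) in simp)

text \<open>Serves nodes a whose removal disconnects the diagram: letters of J and K commute, so
  extensions and splittings can be carried out on each side separately.\<close>

lemma strands_product:
  assumes st: "strands a J \<U>" "strands a K \<V>" and a: "a \<in> R"
    and comm: "\<And>s t. s \<in> J \<Longrightarrow> t \<in> K \<Longrightarrow> s \<otimes> t = t \<otimes> s"
  shows "strands a (J \<union> K) {U @ V | U V. U \<in> \<U> \<and> V \<in> \<V>}"
  unfolding strands_def
proof (intro conjI ballI)
  have JR: "J \<subseteq> R" "K \<subseteq> R" using st by (auto simp: strands_def)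
  then show "J \<union> K \<subseteq> R" by blast
  have "[] \<in> \<U>" "[] \<in> \<V>" using st by (auto simp: strands_def)
  then show "[] \<in> {U @ V | U V. U \<in> \<U> \<and> V \<in> \<V>}" by blast
  fix UV assume "UV \<in> {U @ V | U V. U \<in> \<U> \<and> V \<in> \<V>}"
  then obtain U V where UV: "UV = U @ V" "U \<in> \<U>" "V \<in> \<V>" by blast
  have sub: "set U \<subseteq> J" "set V \<subseteq> K" using st UV(2,3) unfolding strands_def by blast+
  then show "set UV \<subseteq> J \<union> K" using UV(1) by auto
  have R: "set U \<subseteq> R" "set V \<subseteq> R" using sub JR by auto
  have cw: "wp us \<otimes> wp vs = wp vs \<otimes> wp us" if "set us \<subseteq> J" "set vs \<subseteq> K" for us vs
  proof (rule wp_commute_words)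
    show "set us \<subseteq> R" "set vs \<subseteq> R" using that JR by blast+
    show "s \<otimes> t = t \<otimes> s" if "s \<in> set us" "t \<in> set vs" for s t
      using comm that \<open>set us \<subseteq> J\<close> \<open>set vs \<subseteq> K\<close> by blast
  qed
  have cl: "wp us \<otimes> s = s \<otimes> wp us" if "set us \<subseteq> J" "s \<in> K" for us s
    using cw[of us "[s]"] that JR by auto
  have cl': "wp vs \<otimes> s = s \<otimes> wp vs" if "set vs \<subseteq> K" "s \<in> J" for vs s
    using cw[of "[s]" vs] that JR by auto
  show "\<exists>U1 U2. set U1 \<subseteq> J \<union> K \<and> set U2 \<subseteq> J \<union> K \<and> length U1 + length U2 = length UV \<and>
     wp UV = wp U1 \<otimes> wp U2 \<and> wp U1 \<otimes> wp U1 = \<one> \<and> wp U2 \<otimes> a = a \<otimes> wp U2"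
  proof -
    obtain U1 U2 where u: "set U1 \<subseteq> J" "set U2 \<subseteq> J" "length U1 + length U2 = length U"
        "wp U = wp U1 \<otimes> wp U2" "wp U1 \<otimes> wp U1 = \<one>" "wp U2 \<otimes> a = a \<otimes> wp U2"
      using st(1) UV(2) unfolding strands_def by blast
    obtain V1 V2 where v: "set V1 \<subseteq> K" "set V2 \<subseteq> K" "length V1 + length V2 = length V"
        "wp V = wp V1 \<otimes> wp V2" "wp V1 \<otimes> wp V1 = \<one>" "wp V2 \<otimes> a = a \<otimes> wp V2"
      using st(2) UV(3) unfolding strands_def by blast
    have ur: "set U1 \<subseteq> R" "set U2 \<subseteq> R" "set V1 \<subseteq> R" "set V2 \<subseteq> R" using u v JR by auto
    then have cc: "wp U1 \<in> carrier W" "wp U2 \<in> carrier W" "wp V1 \<in> carrier W" "wp V2 \<in> carrier W" by auto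
    have ac: "a \<in> carrier W" using a by simp
    have "wp UV = wp U1 \<otimes> (wp U2 \<otimes> wp V1) \<otimes> wp V2"
      using UV(1) R u(4) v(4) cc by (simp add: m_assoc)
    also have "\<dots> = wp (U1 @ V1) \<otimes> wp (U2 @ V2)"
      unfolding cw[OF u(2) v(1)] using ur cc by (simp add: m_assoc)
    finally have 1: "wp UV = wp (U1 @ V1) \<otimes> wp (U2 @ V2)" .
    have "wp (U1 @ V1) \<otimes> wp (U1 @ V1) = wp U1 \<otimes> (wp V1 \<otimes> wp U1) \<otimes> wp V1"
      using ur cc by (simp add: m_assoc)
    also have "\<dots> = (wp U1 \<otimes> wp U1) \<otimes> (wp V1 \<otimes> wp V1)"
      unfolding cw[OF u(1) v(1), symmetric] using cc by (simp add: m_assoc)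
    finally have 2: "wp (U1 @ V1) \<otimes> wp (U1 @ V1) = \<one>" using u(5) v(5) by simp
    have "wp (U2 @ V2) \<otimes> a = wp U2 \<otimes> (wp V2 \<otimes> a)" using ur cc ac by (simp add: m_assoc)
    also have "\<dots> = (wp U2 \<otimes> a) \<otimes> wp V2" unfolding v(6) using cc ac by (simp add: m_assoc)
    also have "\<dots> = a \<otimes> wp (U2 @ V2)" unfolding u(6) using ur cc ac by (simp add: m_assoc)
    finally have 3: "wp (U2 @ V2) \<otimes> a = a \<otimes> wp (U2 @ V2)" .
    show ?thesis
      using 1 2 3 u(1-3) v(1-3) UV(1) by (intro exI[of _ "U1 @ V1"] exI[of _ "U2 @ V2"] conjI) auto
  qed
  fix s assume "s \<in> J \<union> K"
  then consider "s \<in> J" | "s \<in> K" by blast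
  then show "(\<exists>Z\<in>{U @ V | U V. U \<in> \<U> \<and> V \<in> \<V>}. length Z = Suc (length UV) \<and> wp Z = wp UV \<otimes> s) \<or>
      (\<exists>Z. set Z \<subseteq> J \<union> K \<and> length Z \<le> length UV \<and> wp Z = wp UV \<otimes> s) \<or>
      (\<exists>s'\<in>J \<union> K. s' \<otimes> a = a \<otimes> s' \<and> wp UV \<otimes> s = s' \<otimes> wp UV)"
  proof cases
    case 1
    have sR: "s \<in> R" using 1 JR by blast
    have "wp UV \<otimes> s = wp U \<otimes> (wp V \<otimes> s)" using UV(1) R sR by (simp add: m_assoc)
    then have e: "wp UV \<otimes> s = (wp U \<otimes> s) \<otimes> wp V"
      unfolding cl'[OF sub(2) 1] using R sR by (simp add: m_assoc)
    from 1 consider Z where "Z \<in> \<U>" "length Z = Suc (length U)" "wp Z = wp U \<otimes> s"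
      | Z where "set Z \<subseteq> J" "length Z \<le> length U" "wp Z = wp U \<otimes> s"
      | s' where "s' \<in> J" "s' \<otimes> a = a \<otimes> s'" "wp U \<otimes> s = s' \<otimes> wp U"
      using st(1) UV(2) unfolding strands_def by blast
    then show ?thesis
    proof cases
      case Z: 1
      have "set Z \<subseteq> R" using st(1) Z(1) JR unfolding strands_def by blast
      then have "wp (Z @ V) = wp UV \<otimes> s" using e Z(3) R by simp
      then show ?thesis using Z UV by (intro disjI1 bexI[of _ "Z @ V"]) auto
    next
      case Z: 2
      have "set Z \<subseteq> R" using Z(1) JR by blast
      then have "wp (Z @ V) = wp UV \<otimes> s" using e Z(3) R by simp
      then show ?thesis using Z UV sub by (intro disjI2 disjI1 exI[of _ "Z @ V"]) auto
    next
      case Z: 3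
      have "s' \<in> R" using Z(1) JR by blast
      then have "wp UV \<otimes> s = s' \<otimes> wp UV" unfolding e Z(3) using UV(1) R by (simp add: m_assoc)
      then show ?thesis using Z by blast
    qed
  next
    case 2
    have sR: "s \<in> R" using 2 JR by blast
    have e: "wp UV \<otimes> s = wp U \<otimes> (wp V \<otimes> s)" using UV(1) R sR by (simp add: m_assoc)
    from 2 consider Z where "Z \<in> \<V>" "length Z = Suc (length V)" "wp Z = wp V \<otimes> s"
      | Z where "set Z \<subseteq> K" "length Z \<le> length V" "wp Z = wp V \<otimes> s"
      | s' where "s' \<in> K" "s' \<otimes> a = a \<otimes> s'" "wp V \<otimes> s = s' \<otimes> wp V"
      using st(2) UV(3) unfolding strands_def by blast
    then show ?thesis
    proof cases
      case Z: 1
      have "set Z \<subseteq> R" using st(2) Z(1) JR unfolding strands_def by blast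
      then have "wp (U @ Z) = wp UV \<otimes> s" using e Z(3) R by simp
      then show ?thesis using Z UV by (intro disjI1 bexI[of _ "U @ Z"]) auto
    next
      case Z: 2
      have "set Z \<subseteq> R" using Z(1) JR by blast
      then have "wp (U @ Z) = wp UV \<otimes> s" using e Z(3) R by simp
      then show ?thesis using Z UV sub by (intro disjI2 disjI1 exI[of _ "U @ Z"]) auto
    next
      case Z: 3
      have s': "s' \<in> R" using Z(1) JR by blast
      have "wp UV \<otimes> s = (wp U \<otimes> s') \<otimes> wp V" unfolding e Z(3) using R s' by (simp add: m_assoc)
      then have "wp UV \<otimes> s = s' \<otimes> wp UV"
        unfolding cl[OF sub(1) Z(1)] using UV(1) R s' by (simp add: m_assoc)
      then show ?thesis using Z by blast
    qed
  qed
qed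

end

section \<open>Strand families\<close>

context finite_coxeter
begin

definition advance :: "'a \<Rightarrow> 'a set \<Rightarrow> 'a list set \<Rightarrow> 'a list \<Rightarrow> 'a \<Rightarrow> bool" where
  "advance a J \<U> U s \<longleftrightarrow> (\<exists>V\<in>\<U>. length V = Suc (length U) \<and> wp V = wp U \<otimes> s) \<or>
     (\<exists>V. set V \<subseteq> J \<and> length V \<le> length U \<and> wp V = wp U \<otimes> s) \<or>
     (\<exists>s'\<in>J. s' \<otimes> a = a \<otimes> s' \<and> wp U \<otimes> s = s' \<otimes> wp U)"

definition folds :: "'a \<Rightarrow> 'a set \<Rightarrow> 'a list \<Rightarrow> bool" where
  "folds a J U \<longleftrightarrow> (\<exists>U1 U2. set U1 \<subseteq> J \<and> set U2 \<subseteq> J \<and> length U1 + length U2 = length U \<and>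
     wp U = wp U1 \<otimes> wp U2 \<and> wp U1 \<otimes> wp U1 = \<one> \<and> wp U2 \<otimes> a = a \<otimes> wp U2)"

lemma strandsI:
  assumes "J \<subseteq> R" "[] \<in> \<U>" "\<And>U. U \<in> \<U> \<Longrightarrow> set U \<subseteq> J"
    "\<And>U s. U \<in> \<U> \<Longrightarrow> s \<in> J \<Longrightarrow> advance a J \<U> U s" "\<And>U. U \<in> \<U> \<Longrightarrow> folds a J U"
  shows "strands a J \<U>"
  using assms unfolding strands_def advance_def folds_def by blast

lemma advance_grow: "V \<in> \<U> \<Longrightarrow> length V = Suc (length U) \<Longrightarrow> wp V = wp U \<otimes> s \<Longrightarrow> advance a J \<U> U s"
  unfolding advance_def by blast

lemma advance_drop: "set V \<subseteq> J \<Longrightarrow> length V \<le> length U \<Longrightarrow> wp V = wp U \<otimes> s \<Longrightarrow> advance a J \<U> U s"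
  unfolding advance_def by blast

lemma advance_pull: "s' \<in> J \<Longrightarrow> s' \<otimes> a = a \<otimes> s' \<Longrightarrow> wp U \<otimes> s = s' \<otimes> wp U \<Longrightarrow> advance a J \<U> U s"
  unfolding advance_def by blast

lemma foldsI:
  assumes "set U1 \<subseteq> J" "set U2 \<subseteq> J" "J \<subseteq> R" "a \<in> R" "length U1 + length U2 = length U"
    "wp U = wp U1 \<otimes> wp U2" "wp U1 \<otimes> wp U1 = \<one>" "\<And>s. s \<in> set U2 \<Longrightarrow> s \<otimes> a = a \<otimes> s"
  shows "folds a J U"
proof -
  have "wp U2 \<otimes> a = a \<otimes> wp U2" by (rule wp_commute_letter) (use assms in auto)
  then show ?thesis unfolding folds_def using assms by blast
qed

text \<open>The letter s passes \<open>vs\<close>, is turned by \<open>s t s = t s t\<close> into a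
  letter t on the left, and this passes \<open>us\<close>.\<close>

lemma wp_shift:
  assumes R: "set us \<subseteq> R" "s \<in> R" "t \<in> R" "set vs \<subseteq> R" and braid: "s \<otimes> (t \<otimes> s) = t \<otimes> (s \<otimes> t)"
    and us: "\<And>u. u \<in> set us \<Longrightarrow> u \<otimes> t = t \<otimes> u" and vs: "\<And>v. v \<in> set vs \<Longrightarrow> v \<otimes> s = s \<otimes> v"
  shows "wp (us @ [s, t] @ vs) \<otimes> s = t \<otimes> wp (us @ [s, t] @ vs)"
proof -
  have 1: "wp vs \<otimes> s = s \<otimes> wp vs" by (rule wp_commute_letter) (use R vs in auto)
  have 2: "wp us \<otimes> t = t \<otimes> wp us" by (rule wp_commute_letter) (use R us in auto)
  have "wp (us @ [s, t] @ vs) \<otimes> s = wp us \<otimes> (s \<otimes> (t \<otimes> (wp vs \<otimes> s)))" using R by (simp add: m_assoc)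
  also have "\<dots> = wp us \<otimes> ((s \<otimes> (t \<otimes> s)) \<otimes> wp vs)" unfolding 1 using R by (simp add: m_assoc)
  also have "\<dots> = (wp us \<otimes> t) \<otimes> (s \<otimes> (t \<otimes> wp vs))" unfolding braid using R by (simp add: m_assoc)
  also have "\<dots> = t \<otimes> wp (us @ [s, t] @ vs)" unfolding 2 using R by (simp add: m_assoc)
  finally show ?thesis .
qed

text \<open>The relations of adjacent transpositions in the symmetric group on k + 1 points; for i =
  j the commuting clause is trivial.\<close>

definition braid_path :: "(nat \<Rightarrow> 'a) \<Rightarrow> nat \<Rightarrow> bool" where
  "braid_path p k \<longleftrightarrow> p ` {1..k} \<subseteq> R \<and> (\<forall>i\<in>{1..k}. \<forall>j\<in>{1..k}.
     if i = Suc j \<or> j = Suc i then p i \<otimes> (p j \<otimes> p i) = p j \<otimes> (p i \<otimes> p j) else p i \<otimes> p j = p j \<otimes> p i)"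

definition seg :: "(nat \<Rightarrow> 'a) \<Rightarrow> nat \<Rightarrow> nat \<Rightarrow> 'a list" where
  "seg p i j = map p [i..<Suc j]"

lemma set_seg: "set (seg p i j) = p ` {i..j}"
  by (simp only: seg_def set_map set_upt atLeastLessThanSuc_atLeastAtMost)

lemma length_seg: "length (seg p i j) = Suc j - i"
  by (simp add: seg_def del: upt_Suc)

lemma seg_empty: "j < i \<Longrightarrow> seg p i j = []"
  by (simp add: seg_def)

lemma seg_append: "i \<le> Suc m \<Longrightarrow> m \<le> j \<Longrightarrow> seg p i j = seg p i m @ seg p (Suc m) j"
proof -
  assume a: "i \<le> Suc m" "m \<le> j"
  have "[i..<Suc j] = [i..<Suc m] @ [Suc m..<Suc j]"
    using upt_add_eq_append[of i "Suc m" "Suc j - Suc m"] a by (simp del: upt_Suc)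
  then show ?thesis unfolding seg_def map_append[symmetric] by simp
qed

lemma seg_single: "seg p i i = [p i]"
  by (simp add: seg_def)

lemma seg_snoc: "i \<le> Suc j \<Longrightarrow> seg p i (Suc j) = seg p i j @ [p (Suc j)]"
  using seg_append[of i j "Suc j" p] seg_single[of p "Suc j"] by simp

lemma seg_Cons: "i \<le> j \<Longrightarrow> seg p i j = p i # seg p (Suc i) j"
  using seg_append[of i i j p] seg_single[of p i] by simp

lemma seg_R: "braid_path p k \<Longrightarrow> 1 \<le> i \<Longrightarrow> j \<le> k \<Longrightarrow> set (seg p i j) \<subseteq> R"
  unfolding set_seg braid_path_def by (auto simp: image_subset_iff)

lemma path_R: "braid_path p k \<Longrightarrow> 1 \<le> i \<Longrightarrow> i \<le> k \<Longrightarrow> p i \<in> R"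
  unfolding braid_path_def by (auto simp: image_subset_iff)

lemma path_commute:
  "braid_path p k \<Longrightarrow> i \<in> {1..k} \<Longrightarrow> j \<in> {1..k} \<Longrightarrow> i \<noteq> Suc j \<Longrightarrow> j \<noteq> Suc i \<Longrightarrow> p i \<otimes> p j = p j \<otimes> p i"
  unfolding braid_path_def by (metis (no_types, lifting))

lemma path_braid:
  "braid_path p k \<Longrightarrow> i \<in> {1..k} \<Longrightarrow> j \<in> {1..k} \<Longrightarrow> i = Suc j \<or> j = Suc i \<Longrightarrow>
    p i \<otimes> (p j \<otimes> p i) = p j \<otimes> (p i \<otimes> p j)"
  unfolding braid_path_def by (metis (no_types, lifting))

lemma seg_commute:
  assumes "braid_path p k" "1 \<le> i" "j \<le> k" "s \<in> {1..k}" "s < i - 1 \<or> Suc j < s"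
  shows "wp (seg p i j) \<otimes> p s = p s \<otimes> wp (seg p i j)"
proof (rule wp_commute_letter)
  show "p s \<in> R" using path_R assms by simp
  show "set (seg p i j) \<subseteq> R" using seg_R assms by simp
  show "t \<otimes> p s = p s \<otimes> t" if t: "t \<in> set (seg p i j)" for t
  proof -
    obtain m where "t = p m" "m \<in> {i..j}" using t by (auto simp: set_seg)
    then show ?thesis using path_commute[OF assms(1), of m s] assms by auto
  qed
qed

text \<open>As with a long cycle and adjacent transpositions: the product along the path conjugates
  each generator to the next one.\<close>

lemma seg_shift:
  assumes p: "braid_path p k" and i: "1 \<le> i" "i \<le> s" "s < j" "j \<le> k"
  shows "wp (seg p i j) \<otimes> p s = p (Suc s) \<otimes> wp (seg p i j)"
proof -
  have "seg p i j = seg p i (s - 1) @ seg p s j"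
    using seg_append[of i "s - 1" j p] i by simp
  then have e: "seg p i j = seg p i (s - 1) @ [p s, p (Suc s)] @ seg p (Suc (Suc s)) j"
    using seg_Cons[of s j p] seg_Cons[of "Suc s" j p] i by simp
  show ?thesis unfolding e
  proof (rule wp_shift)
    show "set (seg p i (s - 1)) \<subseteq> R" "set (seg p (Suc (Suc s)) j) \<subseteq> R"
      using seg_R[OF p] i by auto
    show "p s \<in> R" "p (Suc s) \<in> R" using path_R[OF p] i by auto
    show "p s \<otimes> (p (Suc s) \<otimes> p s) = p (Suc s) \<otimes> (p s \<otimes> p (Suc s))"
      using path_braid[OF p] i by auto
    show "u \<otimes> p (Suc s) = p (Suc s) \<otimes> u" if "u \<in> set (seg p i (s - 1))" for u
      using that path_commute[OF p, of _ "Suc s"] i by (auto simp: set_seg)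
    show "u \<otimes> p s = p s \<otimes> u" if "u \<in> set (seg p (Suc (Suc s)) j)" for u
      using that path_commute[OF p, of _ s] i by (auto simp: set_seg)
  qed
qed

lemma rev_seg_shift:
  assumes p: "braid_path p k" and i: "1 \<le> i" "i \<le> s" "s < j" "j \<le> k"
  shows "wp (rev (seg p i j)) \<otimes> p (Suc s) = p s \<otimes> wp (rev (seg p i j))"
proof -
  have R: "set (seg p i j) \<subseteq> R" "p s \<in> R" "p (Suc s) \<in> R" using seg_R[OF p] path_R[OF p] i by auto
  define x where "x = wp (seg p i j)"
  have x: "x \<in> carrier W" using R by (simp add: x_def)
  have "x \<otimes> p s = p (Suc s) \<otimes> x" unfolding x_def by (rule seg_shift[OF p i])
  then have "inv x \<otimes> (x \<otimes> p s) \<otimes> inv x = inv x \<otimes> (p (Suc s) \<otimes> x) \<otimes> inv x" by simp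
  then have "inv x \<otimes> p (Suc s) = p s \<otimes> inv x" using x R by (simp add: m_assoc)
  then show ?thesis using R by (simp add: wp_rev x_def)
qed

text \<open>The node a is attached at \<open>p 1\<close>. In the symmetric group on k + 1 points the
  initial segments are the shortest coset representatives for a point stabiliser. A letter extends
  the segment, cancels, moves to the front with index raised by one, or commutes, according to its
  position relative to the end m; in a splitting only \<open>p 1\<close> may fail to commute with
  a.\<close>

lemma strands_path:
  assumes p: "braid_path p k" and a: "a \<in> R" and comm: "\<And>j. j \<in> {2..k} \<Longrightarrow> p j \<otimes> a = a \<otimes> p j"
  shows "strands a (p ` {1..k}) {seg p 1 m | m. m \<le> k}"
proof (rule strandsI)
  show JR: "p ` {1..k} \<subseteq> R" using p by (simp add: braid_path_def)
  show "[] \<in> {seg p 1 m | m. m \<le> k}" using seg_empty[of 0 1 p] by force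
  fix U assume "U \<in> {seg p 1 m | m. m \<le> k}"
  then obtain m where m: "U = seg p 1 m" "m \<le> k" by blast
  show UJ: "set U \<subseteq> p ` {1..k}" using m by (auto simp: set_seg)
  have UR: "set U \<subseteq> R" using UJ JR by blast
  show "folds a (p ` {1..k}) U"
  proof (cases "m = 0")
    case True
    show ?thesis by (rule foldsI[of "[]" _ "[]"]) (use True m JR a in \<open>auto simp: seg_empty\<close>)
  next
    case False
    then have "U = [p 1] @ seg p 2 m" using m seg_Cons[of 1 m p] by (simp add: numeral_2_eq_2)
    moreover have "p 1 \<in> R" "set (seg p 2 m) \<subseteq> R" using path_R[OF p, of 1] seg_R[OF p, of 2 m] False m by auto
    moreover have "set (seg p 2 m) \<subseteq> p ` {1..k}" "p 1 \<in> p ` {1..k}" using False m by (auto simp: set_seg)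
    moreover have "s \<otimes> a = a \<otimes> s" if "s \<in> set (seg p 2 m)" for s
      using that comm m by (auto simp: set_seg)
    ultimately show ?thesis by (intro foldsI[of "[p 1]" _ "seg p 2 m"]) (use JR a in auto)
  qed
  fix s assume "s \<in> p ` {1..k}"
  then obtain j where j: "s = p j" "j \<in> {1..k}" by blast
  have sR: "s \<in> R" using j JR by blast
  consider "j = Suc m" | "j = m" | "j < m" | "Suc m < j" by linarith
  then show "advance a (p ` {1..k}) {seg p 1 m | m. m \<le> k} U s"
  proof cases
    case 1
    then have "seg p 1 (Suc m) = U @ [s]" using seg_snoc[of 1 m p] m j by simp
    moreover have "seg p 1 (Suc m) \<in> {seg p 1 m | m. m \<le> k}" using 1 j by auto
    ultimately show ?thesis
      by (intro advance_grow[of "seg p 1 (Suc m)"]) (use UR sR in simp_all)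
  next
    case 2
    then obtain m' where m': "m = Suc m'" using j by (cases m) auto
    have U: "U = seg p 1 m' @ [s]" using seg_snoc[of 1 m' p] m' 2 m j by simp
    show ?thesis
      by (rule advance_drop[of "seg p 1 m'"]) (use U UR UJ sR in \<open>auto simp: m_assoc\<close>)
  next
    case 3
    show ?thesis
      by (rule advance_pull[of "p (Suc j)"])
        (use seg_shift[OF p, of 1 j m] 3 j m comm[of "Suc j"] in auto)
  next
    case 4
    show ?thesis
      by (rule advance_pull[of s]) (use seg_commute[OF p, of 1 m j] 4 j m comm[of j] in auto)
  qed
qed

text \<open>Here a is attached at \<open>p 2\<close>. In the symmetric group on k + 1 points the
  words are the k (k + 1) / 2 shortest coset representatives for the stabiliser of a pair of points.
  The empty word arises from m = 1 and q = 0, as \<open>seg p 2 1\<close> is empty.\<close>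

lemma strands_two_rows:
  assumes p: "braid_path p k" and k: "1 \<le> k" and a: "a \<in> R"
    and comm: "\<And>j. j \<in> {1..k} \<Longrightarrow> j \<noteq> 2 \<Longrightarrow> p j \<otimes> a = a \<otimes> p j"
  shows "strands a (p ` {1..k}) {seg p 2 m @ seg p 1 q | m q. q < m \<and> m \<le> k}" (is "strands a ?J ?\<U>")
proof (rule strandsI)
  show JR: "?J \<subseteq> R" using p by (simp add: braid_path_def)
  have "[] = seg p 2 1 @ seg p 1 0" by (simp add: seg_empty)
  moreover have "(0::nat) < 1" by simp
  ultimately show "[] \<in> ?\<U>" using k by blast
  fix U assume "U \<in> ?\<U>"
  then obtain m q where m: "U = seg p 2 m @ seg p 1 q" "q < m" "m \<le> k" by blast
  have seg_in: "set (seg p i j) \<subseteq> ?J" if "1 \<le> i" "j \<le> k" for i j using that by (auto simp: set_seg)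
  have seg_inR: "set (seg p i j) \<subseteq> R" if "1 \<le> i" "j \<le> k" for i j using seg_in[OF that] JR by blast
  have pR: "p j \<in> R" if "1 \<le> j" "j \<le> k" for j using path_R[OF p that] .
  show UJ: "set U \<subseteq> ?J" using m seg_in[of 2 m] seg_in[of 1 q] by simp
  have UR: "set U \<subseteq> R" using UJ JR by blast
  have R2: "set (seg p 2 m) \<subseteq> R" and R1: "set (seg p 1 q) \<subseteq> R" using seg_inR m by auto
  have cseg: "s \<otimes> a = a \<otimes> s" if "s \<in> set (seg p 3 j)" "j \<le> k" for s j
    using that comm by (auto simp: set_seg)
  show "folds a ?J U"
  proof -
    consider "m = 1" | "m \<ge> 2" "q \<le> 1" | "m \<ge> 3" "q \<ge> 2" using m by linarith
    then show ?thesis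
    proof cases
      case 1
      show ?thesis by (rule foldsI[of "[]" _ "[]"]) (use 1 m JR a in \<open>auto simp: seg_empty\<close>)
    next
      case 2
      have e: "U = [p 2] @ (seg p 3 m @ seg p 1 q)" using m 2 seg_Cons[of 2 m p] by simp
      have "s \<otimes> a = a \<otimes> s" if "s \<in> set (seg p 3 m @ seg p 1 q)" for s
        using that cseg[of s m] m 2 comm by (auto simp: set_seg)
      moreover have "set (seg p 3 m @ seg p 1 q) \<subseteq> R" "p 2 \<in> R" using UR e by auto
      ultimately show ?thesis
        by (intro foldsI[of "[p 2]" _ "seg p 3 m @ seg p 1 q"]) (use UJ e JR a in auto)
    next
      case 3
      \<comment> \<open>Both occurrences of \<open>p 2\<close> are gathered in the front block p2 p3
        p1 p2, a conjugate of \<open>p 3 \<otimes> p 1\<close> and so of square 1; all other letters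
        have index at least 3 and commute with a.\<close>
      have r: "p 1 \<in> R" "p 2 \<in> R" "p 3 \<in> R" "set (seg p 4 m) \<subseteq> R" "set (seg p 3 q) \<subseteq> R"
        using 3 m pR[of 1] pR[of 2] pR[of 3] seg_inR[of 4 m] seg_inR[of 3 q] by simp_all
      have e1: "seg p 2 m = [p 2, p 3] @ seg p 4 m"
        using 3 seg_Cons[of 2 m p] seg_Cons[of 3 m p] by simp
      have e2: "seg p 1 q = [p 1, p 2] @ seg p 3 q"
        using 3 seg_Cons[of 1 q p] seg_Cons[of 2 q p] by (simp add: numeral_2_eq_2 numeral_3_eq_3)
      have c1: "wp (seg p 4 m) \<otimes> p 1 = p 1 \<otimes> wp (seg p 4 m)" "wp (seg p 4 m) \<otimes> p 2 = p 2 \<otimes> wp (seg p 4 m)"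
        using seg_commute[OF p, of 4 m 1] seg_commute[OF p, of 4 m 2] 3 m by auto
      have c4: "wp (seg p 4 m) \<otimes> (p 1 \<otimes> (p 2 \<otimes> z)) = p 1 \<otimes> (p 2 \<otimes> (wp (seg p 4 m) \<otimes> z))"
        if z: "z \<in> carrier W" for z
      proof -
        have "wp (seg p 4 m) \<otimes> (p 1 \<otimes> (p 2 \<otimes> z)) = (wp (seg p 4 m) \<otimes> p 1) \<otimes> (p 2 \<otimes> z)"
          using z r by (simp add: m_assoc)
        also have "\<dots> = p 1 \<otimes> ((wp (seg p 4 m) \<otimes> p 2) \<otimes> z)" unfolding c1(1) using z r by (simp add: m_assoc)
        finally show ?thesis unfolding c1(2) using z r by (simp add: m_assoc)
      qed
      have e: "wp U = wp [p 2, p 3, p 1, p 2] \<otimes> wp (seg p 4 m @ seg p 3 q)"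
        unfolding m(1) e1 e2 using r c4[of "wp (seg p 3 q)"] by (simp add: m_assoc)
      have p31: "p 3 \<otimes> p 1 = p 1 \<otimes> p 3" using path_commute[OF p, of 3 1] 3 m by simp
      have inv4: "wp [p 2, p 3, p 1, p 2] \<otimes> wp [p 2, p 3, p 1, p 2] = \<one>"
      proof -
        have "wp [p 2, p 3, p 1, p 2] \<otimes> wp [p 2, p 3, p 1, p 2] = p 2 \<otimes> (p 3 \<otimes> ((p 1 \<otimes> p 3) \<otimes> (p 1 \<otimes> p 2)))"
          using r by (simp add: m_assoc)
        also have "\<dots> = \<one>" unfolding p31[symmetric] using r by (simp add: m_assoc)
        finally show ?thesis .
      qed
      have sub4: "set (seg p 4 m @ seg p 3 q) \<subseteq> ?J" using seg_in m by auto
      have "s \<otimes> a = a \<otimes> s" if "s \<in> set (seg p 4 m @ seg p 3 q)" for s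
        using that m comm by (auto simp: set_seg)
      moreover have "length U = 4 + length (seg p 4 m @ seg p 3 q)"
        unfolding m(1) e1 e2 by simp
      moreover have "{p 1, p 2, p 3} \<subseteq> ?J" using 3 m by auto
      ultimately show ?thesis
        by (intro foldsI[of "[p 2, p 3, p 1, p 2]" _ "seg p 4 m @ seg p 3 q"])
          (use e inv4 sub4 JR a in auto)
    qed
  qed
  fix s assume "s \<in> ?J"
  then obtain j where j: "s = p j" "j \<in> {1..k}" by blast
  have sR: "s \<in> R" using j JR by blast
  have U_s: "wp U \<otimes> s = wp (seg p 2 m) \<otimes> (wp (seg p 1 q) \<otimes> p j)"
    using m R1 R2 sR j by (simp add: m_assoc)
  consider "j > Suc m" | "j = Suc m" | "j = Suc q" "Suc q < m" | "j = q" | "j < q"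
    | "Suc q < j" "j < m" | "j = m" "Suc q < m" | "j = m" "Suc q = m"
    using m by linarith
  then show "advance a ?J ?\<U> U s"
  proof cases
    case 1
    have "wp U \<otimes> s = (wp (seg p 2 m) \<otimes> p j) \<otimes> wp (seg p 1 q)"
      using U_s seg_commute[OF p, of 1 q j] 1 m j R1 R2 sR by (simp add: m_assoc)
    also have "\<dots> = s \<otimes> wp U"
      using seg_commute[OF p, of 2 m j] 1 m j R1 R2 sR by (simp add: m_assoc)
    finally show ?thesis by (intro advance_pull[of s]) (use 1 j m comm[of j] in auto)
  next
    case 2
    have "wp U \<otimes> s = (wp (seg p 2 m) \<otimes> p j) \<otimes> wp (seg p 1 q)"
      using U_s seg_commute[OF p, of 1 q j] 2 m j R1 R2 sR by (simp add: m_assoc)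
    moreover have "seg p 2 (Suc m) = seg p 2 m @ [p j]" using 2 m seg_snoc[of 2 m p] by simp
    ultimately have "wp (seg p 2 (Suc m) @ seg p 1 q) = wp U \<otimes> s" using R1 R2 sR j by (simp add: m_assoc)
    moreover have "seg p 2 (Suc m) @ seg p 1 q \<in> ?\<U>" using 2 m j by force
    ultimately show ?thesis
      by (intro advance_grow[of "seg p 2 (Suc m) @ seg p 1 q"]) (use m 2 in \<open>auto simp: length_seg\<close>)
  next
    case 3
    have "seg p 1 (Suc q) = seg p 1 q @ [s]" using 3 j seg_snoc[of 1 q p] by simp
    then have "wp (seg p 2 m @ seg p 1 (Suc q)) = wp U \<otimes> s" using R1 R2 sR m by (simp add: m_assoc)
    moreover have "seg p 2 m @ seg p 1 (Suc q) \<in> ?\<U>" using 3 m by blast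
    ultimately show ?thesis
      by (intro advance_grow[of "seg p 2 m @ seg p 1 (Suc q)"]) (use m in \<open>auto simp: length_seg\<close>)
  next
    case 4
    then obtain q' where q': "q = Suc q'" using j by (cases q) auto
    then have "seg p 1 q = seg p 1 q' @ [s]" using 4 j seg_snoc[of 1 q' p] by simp
    then have "U = (seg p 2 m @ seg p 1 q') @ [s]" using m by simp
    then show ?thesis
      by (intro advance_drop[of "seg p 2 m @ seg p 1 q'"]) (use UR UJ sR in \<open>auto simp: m_assoc\<close>)
  next
    case 5
    have "wp U \<otimes> s = (wp (seg p 2 m) \<otimes> p (Suc j)) \<otimes> wp (seg p 1 q)"
      using U_s seg_shift[OF p, of 1 j q] 5 m j R1 R2 pR[of "Suc j"] by (simp add: m_assoc)
    also have "\<dots> = p (Suc (Suc j)) \<otimes> wp U"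
      using seg_shift[OF p, of 2 "Suc j" m] 5 m j R1 R2 pR[of "Suc (Suc j)"] by (simp add: m_assoc)
    finally show ?thesis
      by (intro advance_pull[of "p (Suc (Suc j))"]) (use 5 j m comm[of "Suc (Suc j)"] in auto)
  next
    case 6
    have "wp U \<otimes> s = (wp (seg p 2 m) \<otimes> p j) \<otimes> wp (seg p 1 q)"
      using U_s seg_commute[OF p, of 1 q j] 6 m j R1 R2 sR by (simp add: m_assoc)
    also have "\<dots> = p (Suc j) \<otimes> wp U"
      using seg_shift[OF p, of 2 j m] 6 m j R1 R2 pR[of "Suc j"] by (simp add: m_assoc)
    finally show ?thesis
      by (intro advance_pull[of "p (Suc j)"]) (use 6 j m comm[of "Suc j"] in auto)
  next
    case 7
    then obtain m' where m': "m = Suc m'" "m' \<ge> 1" using m by (cases m) auto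
    have e: "seg p 2 m = seg p 2 m' @ [s]" using m' 7 j seg_snoc[of 2 m' p] by simp
    have "wp U \<otimes> s = (wp (seg p 2 m) \<otimes> p j) \<otimes> wp (seg p 1 q)"
      using U_s seg_commute[OF p, of 1 q j] 7 m j R1 R2 sR by (simp add: m_assoc)
    also have "\<dots> = wp (seg p 2 m' @ seg p 1 q)" using e R1 R2 j by (simp add: m_assoc)
    finally show ?thesis
      by (intro advance_drop[of "seg p 2 m' @ seg p 1 q"]) (use UJ e m in auto)
  next
    case 8
    have p1: "p 1 \<in> R" using pR k by simp
    have e1: "seg p 1 m = p 1 # seg p 2 m" using m seg_Cons[of 1 m p] by (simp add: numeral_2_eq_2)
    have e2: "seg p 1 m = seg p 1 q @ [s]" using 8 j seg_snoc[of 1 q p] by auto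
    \<comment> \<open>Repeated shifting moves \<open>seg p 1 i\<close> through
      \<open>seg p 1 m\<close> with every index raised by one. For q + 1 = m this rearranges the two
      rows so that \<open>p 1\<close> comes to the front.\<close>
    have sh: "wp (seg p 1 m) \<otimes> wp (seg p 1 i) = wp (seg p 2 (Suc i)) \<otimes> wp (seg p 1 m)" if "i < m" for i
      using that
    proof (induction i)
      case 0
      show ?case using seg_inR[of 1 m] m by (simp add: seg_empty)
    next
      case (Suc i)
      have r: "set (seg p 1 m) \<subseteq> R" "set (seg p 1 i) \<subseteq> R" "set (seg p 2 (Suc i)) \<subseteq> R" "p (Suc i) \<in> R"
          "p (Suc (Suc i)) \<in> R"
        using Suc.prems m seg_inR[of 1 m] seg_inR[of 1 i] seg_inR[of 2 "Suc i"] pR[of "Suc i"] pR[of "Suc (Suc i)"]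
        by simp_all
      have f: "seg p 1 (Suc i) = seg p 1 i @ [p (Suc i)]"
        "seg p 2 (Suc (Suc i)) = seg p 2 (Suc i) @ [p (Suc (Suc i))]"
        using seg_snoc[of 1 i p] seg_snoc[of 2 "Suc i" p] by auto
      have "wp (seg p 1 m) \<otimes> wp (seg p 1 (Suc i)) = (wp (seg p 1 m) \<otimes> wp (seg p 1 i)) \<otimes> p (Suc i)"
        unfolding f using r by (simp add: m_assoc)
      also have "\<dots> = wp (seg p 2 (Suc i)) \<otimes> (wp (seg p 1 m) \<otimes> p (Suc i))"
        using Suc.IH Suc.prems r by (simp add: m_assoc)
      also have "\<dots> = wp (seg p 2 (Suc (Suc i))) \<otimes> wp (seg p 1 m)"
        unfolding f using seg_shift[OF p, of 1 "Suc i" m] Suc.prems m r by (simp add: m_assoc)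
      finally show ?case .
    qed
    have "wp U \<otimes> s = wp (seg p 2 m) \<otimes> wp (seg p 1 m)" using m e2 R1 R2 sR by (simp add: m_assoc)
    also have "\<dots> = wp (seg p 1 m) \<otimes> wp (seg p 1 q)" using sh[of q] 8 m by auto
    also have "\<dots> = p 1 \<otimes> wp U" unfolding e1 using m R1 R2 p1 by (simp add: m_assoc)
    finally show ?thesis by (intro advance_pull[of "p 1"]) (use m comm[of 1] in auto)
  qed
qed

end

context finite_coxeter
begin

text \<open>The path \<open>p 1, ..., p h\<close> ends in a fork b, d as in type D, and a is
  attached at \<open>p 1\<close>. The 2h + 4 words trace the orbit of a coordinate vector under even
  signed permutations: along the path, through b or d, through both, and back along the
  path.\<close>

lemma strands_fork:
  assumes pb: "braid_path (p(Suc h := b)) (Suc h)" and pd: "braid_path (p(Suc h := d)) (Suc h)"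
    and h: "1 \<le> h" and bd: "b \<otimes> d = d \<otimes> b" and a: "a \<in> R"
    and comm: "\<And>j. j \<in> {2..h} \<Longrightarrow> p j \<otimes> a = a \<otimes> p j" "b \<otimes> a = a \<otimes> b" "d \<otimes> a = a \<otimes> d"
  shows "strands a (p ` {1..h} \<union> {b, d})
    ({seg p 1 m | m. m \<le> h} \<union> {seg p 1 h @ [b], seg p 1 h @ [d]} \<union>
     {seg p 1 h @ [b, d] @ rev (seg p j h) | j. 1 \<le> j \<and> j \<le> Suc h})" (is "strands a ?J ?\<U>")
proof -
  have seg_b: "seg (p(Suc h := b)) i j = seg p i j" "seg (p(Suc h := d)) i j = seg p i j" if "j \<le> h" for i j
    using that by (auto simp: seg_def simp del: upt_Suc)
  have seg_b': "seg (p(Suc h := b)) 1 (Suc h) = seg p 1 h @ [b]" "seg (p(Suc h := d)) 1 (Suc h) = seg p 1 h @ [d]"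
    using seg_snoc[of 1 h "p(Suc h := b)"] seg_snoc[of 1 h "p(Suc h := d)"] seg_b[of h 1] h by auto
  have b: "b \<in> R" and d: "d \<in> R" using path_R[OF pb, of "Suc h"] path_R[OF pd, of "Suc h"] by auto
  have p: "braid_path p h"
    unfolding braid_path_def
  proof (intro conjI ballI)
    show "p ` {1..h} \<subseteq> R"
      using path_R[OF pb] by (auto simp: fun_upd_def split: if_splits) (metis Suc_n_not_le_n le_SucI)
    fix i j assume ij: "i \<in> {1..h}" "j \<in> {1..h}"
    then have e: "(p(Suc h := b)) i = p i" "(p(Suc h := b)) j = p j" by auto
    show "if i = Suc j \<or> j = Suc i then p i \<otimes> (p j \<otimes> p i) = p j \<otimes> (p i \<otimes> p j) else p i \<otimes> p j = p j \<otimes> p i"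
      using path_braid[OF pb, of i j] path_commute[OF pb, of i j] ij unfolding e by auto
  qed
  have c_b: "wp (seg p 1 j) \<otimes> b = b \<otimes> wp (seg p 1 j)" "wp (seg p 1 j) \<otimes> d = d \<otimes> wp (seg p 1 j)" if "j < h" for j
    using seg_commute[OF pb, of 1 j "Suc h"] seg_commute[OF pd, of 1 j "Suc h"] that by (auto simp: seg_b)
  have seg_in: "set (seg p i j) \<subseteq> ?J" if "1 \<le> i" "j \<le> h" for i j using that by (auto simp: set_seg)
  have pR: "p j \<in> R" if "1 \<le> j" "j \<le> h" for j using path_R[OF p that] .
  have seg_inR: "set (seg p i j) \<subseteq> R" if "1 \<le> i" "j \<le> h" for i j using seg_R[OF p that] .
  have cb1: "p j \<otimes> b = b \<otimes> p j" "p j \<otimes> d = d \<otimes> p j" if "1 \<le> j" "j < h" for j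
    using path_commute[OF pb, of j "Suc h"] path_commute[OF pd, of j "Suc h"] that by auto
  have shift_b: "wp (seg p 1 h @ [b]) \<otimes> p j = p (Suc j) \<otimes> wp (seg p 1 h @ [b])"
    "wp (seg p 1 h @ [d]) \<otimes> p j = p (Suc j) \<otimes> wp (seg p 1 h @ [d])" if "1 \<le> j" "j < h" for j
    using seg_shift[OF pb, of 1 j "Suc h"] seg_shift[OF pd, of 1 j "Suc h"] that seg_b' by auto
  have shift_h: "wp (seg p 1 h @ [b]) \<otimes> p h = b \<otimes> wp (seg p 1 h @ [b])"
    "wp (seg p 1 h @ [d]) \<otimes> p h = d \<otimes> wp (seg p 1 h @ [d])"
    using seg_shift[OF pb, of 1 h "Suc h"] seg_shift[OF pd, of 1 h "Suc h"] h seg_b' by auto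
  define x where "x = wp (seg p 1 h)"
  have x: "x \<in> carrier W" "set (seg p 1 h) \<subseteq> R" using seg_inR[of 1 h] h by (auto simp: x_def)
  have x_shift: "x \<otimes> p j = p (Suc j) \<otimes> x" if "1 \<le> j" "j < h" for j
    unfolding x_def using seg_shift[OF p, of 1 j h] that by simp
  have xb: "x \<otimes> (b \<otimes> p h) = b \<otimes> (x \<otimes> b)" "x \<otimes> (d \<otimes> p h) = d \<otimes> (x \<otimes> d)"
    using shift_h x b d pR[of h] h by (auto simp: x_def m_assoc)
  have JR: "?J \<subseteq> R" using p b d by (auto simp: braid_path_def)
  show ?thesis
  proof (rule strandsI)
    show "?J \<subseteq> R" by (rule JR)
    show "[] \<in> ?\<U>" using seg_empty[of 0 1 p] by force
    fix U assume U: "U \<in> ?\<U>"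
    then show UJ: "set U \<subseteq> ?J"
    proof -
      have "set (seg p 1 m) \<subseteq> ?J" if "m \<le> h" for m using seg_in[of 1 m] that by simp
      moreover have "set (seg p j h) \<subseteq> ?J" if "1 \<le> j" for j using seg_in[of j h] that by simp
      ultimately show ?thesis using U by fastforce
    qed
    then have UR: "set U \<subseteq> R" using JR by blast
    have ca: "s \<otimes> a = a \<otimes> s" if "s \<in> ?J" "s \<noteq> p 1" for s
    proof -
      have "s = b \<or> s = d \<or> (\<exists>j\<in>{2..h}. s = p j)" using that by (force simp: le_eq_less_or_eq)
      then show ?thesis using comm by auto
    qed
    have ca': "p j \<otimes> a = a \<otimes> p j" if "2 \<le> j" "j \<le> h" for j using comm(1) that by simp
    show "folds a ?J U"
    proof -
      consider "U = []" | U' where "U = p 1 # U'" "\<And>s. s \<in> set U' \<Longrightarrow> s \<otimes> a = a \<otimes> s"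
        | "U = seg p 1 h @ [b, d] @ rev (seg p 1 h)"
      proof -
        have s1: "seg p 1 m = p 1 # seg p 2 m" if "1 \<le> m" for m
          using seg_Cons[of 1 m p] that by (simp add: numeral_2_eq_2)
        have c2: "s \<otimes> a = a \<otimes> s" if "s \<in> set (seg p 2 m)" "m \<le> h" for s m
          using that comm(1) by (auto simp: set_seg)
        have cj: "s \<otimes> a = a \<otimes> s" if "s \<in> set (seg p j h)" "2 \<le> j" for s j
          using that comm(1) by (auto simp: set_seg)
        from U consider m where "U = seg p 1 m" "m \<le> h" | "U = seg p 1 h @ [b]" | "U = seg p 1 h @ [d]"
          | j where "U = seg p 1 h @ [b, d] @ rev (seg p j h)" "1 \<le> j" by blast
        then show thesis
        proof cases
          case (1 m)
          show thesis
          proof (cases "m = 0")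
            case True
            then show thesis using that(1) 1 by (simp add: seg_empty)
          next
            case False
            show thesis by (rule that(2)[of "seg p 2 m"]) (use 1 False s1[of m] c2 in auto)
          qed
        next
          case 2
          show thesis by (rule that(2)[of "seg p 2 h @ [b]"]) (use 2 h s1[of h] c2[of _ h] comm in auto)
        next
          case 3
          show thesis by (rule that(2)[of "seg p 2 h @ [d]"]) (use 3 h s1[of h] c2[of _ h] comm in auto)
        next
          case (4 j)
          show thesis
          proof (cases "j = 1")
            case True
            then show thesis using that(3) 4 by simp
          next
            case False
            show thesis
              by (rule that(2)[of "seg p 2 h @ [b, d] @ rev (seg p j h)"])
                (use 4 False h s1[of h] c2[of _ h] cj[of _ j] comm in auto)
          qed
        qed
      qed
      then show ?thesis
      proof cases
        case 1
        show ?thesis by (rule foldsI[of "[]" _ "[]"]) (use 1 JR a in auto)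
      next
        case (2 U')
        show ?thesis by (rule foldsI[of "[p 1]" _ U']) (use 2 UJ UR JR a in auto)
      next
        case 3
        \<comment> \<open>The full word is the conjugate of bd by the ascending part, and bd squares
          to 1.\<close>
        have "wp U = x \<otimes> (b \<otimes> (d \<otimes> inv x))" using 3 x b d by (simp add: x_def wp_rev)
        then have "wp U \<otimes> wp U = x \<otimes> (b \<otimes> ((d \<otimes> b) \<otimes> (d \<otimes> inv x)))"
          using x b d by (simp add: m_assoc inv_solve_left)
        also have "\<dots> = \<one>" unfolding bd[symmetric] using x b d by (simp add: m_assoc)
        finally show ?thesis by (intro foldsI[of U _ "[]"]) (use UJ UR JR a in auto)
      qed
    qed
    fix s assume s: "s \<in> ?J"
    then have sR: "s \<in> R" using JR by blast
    from U consider m where "U = seg p 1 m" "m < h" | "U = seg p 1 h" | "U = seg p 1 h @ [b]" | "U = seg p 1 h @ [d]"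
      | j where "U = seg p 1 h @ [b, d] @ rev (seg p j h)" "1 \<le> j" "j \<le> Suc h"
      using le_neq_implies_less by blast
    then show "advance a ?J ?\<U> U s"
    proof cases
      case (1 m)
      consider "s = b" | "s = d" | j where "s = p j" "1 \<le> j" "j \<le> h" using s by auto
      then show ?thesis
      proof cases
        case s: 1
        show ?thesis by (rule advance_pull[of b]) (use s 1 c_b comm in auto)
      next
        case s: 2
        show ?thesis by (rule advance_pull[of d]) (use s 1 c_b comm in auto)
      next
        case (3 j)
        consider "j = Suc m" | "j = m" | "j < m" | "Suc m < j" by linarith
        then show ?thesis
        proof cases
          case j: 1
          have "seg p 1 (Suc m) \<in> ?\<U>" using 1 by (intro UnI1) auto
          moreover have "seg p 1 (Suc m) = U @ [s]" using seg_snoc[of 1 m p] 1 j 3 by simp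
          ultimately show ?thesis by (intro advance_grow[of "seg p 1 (Suc m)"]) (use UR sR in simp_all)
        next
          case j: 2
          then obtain m' where m': "m = Suc m'" using 3 by (cases m) auto
          have e: "U = seg p 1 m' @ [s]" using seg_snoc[of 1 m' p] m' j 3 1 by simp
          show ?thesis by (rule advance_drop[of "seg p 1 m'"]) (use e UJ UR sR in \<open>auto simp: m_assoc\<close>)
        next
          case j: 3
          show ?thesis by (rule advance_pull[of "p (Suc j)"])
            (use seg_shift[OF p, of 1 j m] j 3 1 ca'[of "Suc j"] in auto)
        next
          case j: 4
          show ?thesis by (rule advance_pull[of s]) (use seg_commute[OF p, of 1 m j] j 3 1 ca'[of j] in auto)
        qed
      qed
    next
      case 2
      consider "s = b" | "s = d" | "s = p h" | j where "s = p j" "1 \<le> j" "j < h"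
        using s by (force simp: le_eq_less_or_eq)
      then show ?thesis
      proof cases
        case s: 1
        show ?thesis by (rule advance_grow[of "seg p 1 h @ [b]"]) (use s 2 UR b in auto)
      next
        case s: 2
        show ?thesis by (rule advance_grow[of "seg p 1 h @ [d]"]) (use s 2 UR d in auto)
      next
        case s: 3
        then obtain m' where m': "h = Suc m'" using h by (cases h) auto
        have e: "U = seg p 1 m' @ [s]" using seg_snoc[of 1 m' p] m' s 2 by simp
        show ?thesis by (rule advance_drop[of "seg p 1 m'"]) (use e UJ UR sR in \<open>auto simp: m_assoc\<close>)
      next
        case (4 j)
        show ?thesis by (rule advance_pull[of "p (Suc j)"])
          (use seg_shift[OF p, of 1 j h] 4 2 ca'[of "Suc j"] in auto)
      qed
    next
      case 3
      consider "s = b" | "s = d" | "s = p h" | j where "s = p j" "1 \<le> j" "j < h"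
        using s by (force simp: le_eq_less_or_eq)
      then show ?thesis
      proof cases
        case s: 1
        show ?thesis by (rule advance_drop[of "seg p 1 h"]) (use s 3 UJ UR b in \<open>auto simp: m_assoc\<close>)
      next
        case s: 2
        have "seg p 1 h @ [b, d] @ rev (seg p (Suc h) h) \<in> ?\<U>" by (intro UnI2) force
        then show ?thesis
          by (rule advance_grow) (use s 3 UR d in \<open>auto simp: m_assoc seg_empty\<close>)
      next
        case s: 3
        show ?thesis by (rule advance_pull[of b]) (use s 3 shift_h comm in auto)
      next
        case (4 j)
        show ?thesis by (rule advance_pull[of "p (Suc j)"]) (use shift_b[of j] 4 3 ca'[of "Suc j"] in auto)
      qed
    next
      case 4
      consider "s = b" | "s = d" | "s = p h" | j where "s = p j" "1 \<le> j" "j < h"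
        using s by (force simp: le_eq_less_or_eq)
      then show ?thesis
      proof cases
        case s: 1
        have "seg p 1 h @ [b, d] @ rev (seg p (Suc h) h) \<in> ?\<U>" by (intro UnI2) force
        then show ?thesis
          by (rule advance_grow) (use s 4 UR b d bd in \<open>auto simp: m_assoc seg_empty\<close>)
      next
        case s: 2
        show ?thesis by (rule advance_drop[of "seg p 1 h"]) (use s 4 UJ UR d in \<open>auto simp: m_assoc\<close>)
      next
        case s: 3
        show ?thesis by (rule advance_pull[of d]) (use s 4 shift_h comm in auto)
      next
        case j: (4 j)
        show ?thesis by (rule advance_pull[of "p (Suc j)"]) (use shift_b[of j] j 4 ca'[of "Suc j"] in auto)
      qed
    next
      case (5 j)
      define y where "y = wp (rev (seg p j h))"
      have jR: "set (seg p j h) \<subseteq> R" using 5 seg_inR[of j h] by simp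
      have y: "y \<in> carrier W" using jR by (simp add: y_def)
      have wU: "wp U = x \<otimes> (b \<otimes> (d \<otimes> y))" using 5 x jR b d by (simp add: x_def y_def)
      consider "s = b" "j \<le> h" | "s = d" "j \<le> h" | "s = b" "j = Suc h" | "s = d" "j = Suc h"
        | i where "s = p i" "1 \<le> i" "i \<le> h" "i = j" | i where "s = p i" "1 \<le> i" "i \<le> h" "Suc i = j"
        | i where "s = p i" "1 \<le> i" "i \<le> h" "Suc i < j" | i where "s = p i" "1 \<le> i" "i \<le> h" "j < i"
      proof -
        have "s = b \<or> s = d \<or> (\<exists>i. s = p i \<and> 1 \<le> i \<and> i \<le> h)" using s by auto
        moreover have "j \<le> h \<or> j = Suc h" using 5 by linarith
        moreover have "i = j \<or> Suc i = j \<or> Suc i < j \<or> j < i" for i by linarith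
        ultimately show thesis using that by blast
      qed
      then show ?thesis
      proof cases
        case s: 1
        have J: "seg p j h = seg p j (h - 1) @ [p h]" using seg_snoc[of j "h - 1" p] s(2) h by simp
        define z where "z = wp (rev (seg p j (h - 1)))"
        have zR: "set (seg p j (h - 1)) \<subseteq> R" using seg_inR[of j "h - 1"] 5 by simp
        have z: "z \<in> carrier W" using zR by (simp add: z_def)
        have yz: "y = p h \<otimes> z" unfolding y_def J using zR pR[of h] h by (simp add: z_def)
        have zb: "z \<otimes> b = b \<otimes> z" unfolding z_def
          by (rule wp_commute_letter) (use zR b cb1 5 in \<open>auto simp: set_seg\<close>)
        have br: "b \<otimes> (p h \<otimes> b) = p h \<otimes> (b \<otimes> p h)" using path_braid[OF pb, of "Suc h" h] h by simp
        have hR: "p h \<in> R" using pR h by simp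
        \<comment> \<open>The final b passes z, undergoes the braid relation at \<open>p h\<close>,
          and emerges in front as d: crossing the fork exchanges b and d.\<close>
        have "wp U \<otimes> s = x \<otimes> ((b \<otimes> d) \<otimes> (p h \<otimes> (z \<otimes> b)))"
          unfolding wU yz s(1) using x b d z hR by (simp add: m_assoc)
        also have "\<dots> = x \<otimes> (d \<otimes> ((b \<otimes> (p h \<otimes> b)) \<otimes> z))"
          unfolding zb bd using x b d z hR by (simp add: m_assoc)
        also have "\<dots> = (x \<otimes> (d \<otimes> p h)) \<otimes> (b \<otimes> (p h \<otimes> z))"
          unfolding br using x b d z hR by (simp add: m_assoc)
        also have "\<dots> = d \<otimes> (x \<otimes> ((d \<otimes> b) \<otimes> (p h \<otimes> z)))"
          unfolding xb using x b d z hR by (simp add: m_assoc)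
        also have "\<dots> = d \<otimes> wp U" unfolding wU yz bd[symmetric] using x b d z hR by (simp add: m_assoc)
        finally show ?thesis by (intro advance_pull[of d]) (use comm in auto)
      next
        case s: 2
        have J: "seg p j h = seg p j (h - 1) @ [p h]" using seg_snoc[of j "h - 1" p] s(2) h by simp
        define z where "z = wp (rev (seg p j (h - 1)))"
        have zR: "set (seg p j (h - 1)) \<subseteq> R" using seg_inR[of j "h - 1"] 5 by simp
        have z: "z \<in> carrier W" using zR by (simp add: z_def)
        have yz: "y = p h \<otimes> z" unfolding y_def J using zR pR[of h] h by (simp add: z_def)
        have zd: "z \<otimes> d = d \<otimes> z" unfolding z_def
          by (rule wp_commute_letter) (use zR d cb1 5 in \<open>auto simp: set_seg\<close>)
        have br: "d \<otimes> (p h \<otimes> d) = p h \<otimes> (d \<otimes> p h)" using path_braid[OF pd, of "Suc h" h] h by simp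
        have hR: "p h \<in> R" using pR h by simp
        have "wp U \<otimes> s = x \<otimes> (b \<otimes> (d \<otimes> (p h \<otimes> (z \<otimes> d))))"
          unfolding wU yz s(1) using x b d z hR by (simp add: m_assoc)
        also have "\<dots> = x \<otimes> (b \<otimes> ((d \<otimes> (p h \<otimes> d)) \<otimes> z))"
          unfolding zd using x b d z hR by (simp add: m_assoc)
        also have "\<dots> = (x \<otimes> (b \<otimes> p h)) \<otimes> (d \<otimes> (p h \<otimes> z))"
          unfolding br using x b d z hR by (simp add: m_assoc)
        also have "\<dots> = b \<otimes> wp U" unfolding xb wU yz using x b d z hR by (simp add: m_assoc)
        finally show ?thesis by (intro advance_pull[of b]) (use comm in auto)
      next
        case s: 3
        have "wp U = x \<otimes> (b \<otimes> d)" unfolding wU y_def s(2) using x b d by (simp add: seg_empty)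
        then have "wp U \<otimes> s = wp (seg p 1 h @ [d])"
          unfolding bd s(1) using x b d by (simp add: x_def m_assoc)
        then show ?thesis by (intro advance_drop[of "seg p 1 h @ [d]"]) (use 5 UJ in auto)
      next
        case s: 4
        have "wp U = x \<otimes> (b \<otimes> d)" unfolding wU y_def s(2) using x b d by (simp add: seg_empty)
        then have "wp U \<otimes> s = wp (seg p 1 h @ [b])"
          unfolding s(1) using x b d by (simp add: x_def m_assoc)
        then show ?thesis by (intro advance_drop[of "seg p 1 h @ [b]"]) (use 5 UJ in auto)
      next
        case s: (5 i)
        have e: "seg p j h = p i # seg p (Suc j) h" using s seg_Cons[of j h p] by simp
        have "U = (seg p 1 h @ [b, d] @ rev (seg p (Suc j) h)) @ [s]" unfolding 5(1) e using s by simp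
        then show ?thesis
          by (intro advance_drop[of "seg p 1 h @ [b, d] @ rev (seg p (Suc j) h)"])
            (use UJ UR sR in \<open>auto simp: m_assoc\<close>)
      next
        case s: (6 i)
        have e: "seg p i h = p i # seg p j h" using s seg_Cons[of i h p] by simp
        have V: "seg p 1 h @ [b, d] @ rev (seg p i h) \<in> ?\<U>" using s by (intro UnI2) force
        have e': "seg p 1 h @ [b, d] @ rev (seg p i h) = U @ [s]" unfolding 5(1) e using s by simp
        have "wp (U @ [s]) = wp U \<otimes> s" using UR sR by simp
        then show ?thesis by (intro advance_grow[OF V]) (simp_all only: e' length_append_singleton)
      next
        case s: (7 i)
        have iR: "p i \<in> R" "p (Suc i) \<in> R" using pR s 5 by auto
        have ci: "b \<otimes> p i = p i \<otimes> b" "d \<otimes> p i = p i \<otimes> d" using cb1[of i] s 5 by simp_all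
        have xi: "x \<otimes> p i = p (Suc i) \<otimes> x" using x_shift[of i] s 5 by simp
        have "y \<otimes> p i = p i \<otimes> y" unfolding y_def
        proof (rule wp_commute_letter)
          show "p i \<in> R" "set (rev (seg p j h)) \<subseteq> R" using iR jR by auto
          show "t \<otimes> p i = p i \<otimes> t" if t: "t \<in> set (rev (seg p j h))" for t
            using t s 5 path_commute[OF p, of _ i] by (auto simp: set_seg)
        qed
        then have "wp U \<otimes> s = x \<otimes> (b \<otimes> ((d \<otimes> p i) \<otimes> y))"
          unfolding wU s(1) using x b d y iR by (simp add: m_assoc)
        also have "\<dots> = x \<otimes> ((b \<otimes> p i) \<otimes> (d \<otimes> y))"
          unfolding ci(2) using x b d y iR by (simp add: m_assoc)
        also have "\<dots> = (x \<otimes> p i) \<otimes> (b \<otimes> (d \<otimes> y))"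
          unfolding ci(1) using x b d y iR by (simp add: m_assoc)
        also have "\<dots> = p (Suc i) \<otimes> wp U"
          unfolding xi wU using x b d y iR by (simp add: m_assoc)
        finally show ?thesis
          by (intro advance_pull[of "p (Suc i)"]) (use s 5 ca'[of "Suc i"] in auto)
      next
        case s: (8 i)
        then obtain i' where i': "i = Suc i'" "1 \<le> i'" using 5 by (cases i) auto
        have iR: "p i \<in> R" "p i' \<in> R" using pR s i' by auto
        have ci: "b \<otimes> p i' = p i' \<otimes> b" "d \<otimes> p i' = p i' \<otimes> d" using cb1[of i'] s i' by simp_all
        have xi: "x \<otimes> p i' = p i \<otimes> x" using x_shift[of i'] s i' by simp
        \<comment> \<open>The descending part lowers the index by one and the ascending part raises
          it again, so the letter comes out unchanged.\<close>
        have "y \<otimes> p i = p i' \<otimes> y" unfolding y_def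
          using rev_seg_shift[OF p, of j i' h] s 5 i' by simp
        then have "wp U \<otimes> s = x \<otimes> (b \<otimes> ((d \<otimes> p i') \<otimes> y))"
          unfolding wU s(1) using x b d y iR by (simp add: m_assoc)
        also have "\<dots> = x \<otimes> ((b \<otimes> p i') \<otimes> (d \<otimes> y))"
          unfolding ci(2) using x b d y iR by (simp add: m_assoc)
        also have "\<dots> = (x \<otimes> p i') \<otimes> (b \<otimes> (d \<otimes> y))"
          unfolding ci(1) using x b d y iR by (simp add: m_assoc)
        also have "\<dots> = p i \<otimes> wp U"
          unfolding xi wU using x b d y iR by (simp add: m_assoc)
        finally show ?thesis
          by (intro advance_pull[of "p i"]) (use s i' 5 ca'[of i] in auto)
      qed
    qed
  qed
qed

end

text \<open>
  For the two maximal parabolic subgroups of \<open>E\<^sub>6\<close> not covered by the families above, the strand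
  families are given by certificates: each word comes with the positions at which commutations,
  braid relations and cancellations bring it into the required shape.
\<close>

fun move :: "(nat \<times> nat) list \<Rightarrow> nat \<Rightarrow> nat list \<Rightarrow> nat list" where
  "move E (Suc i) (x # ws) = x # move E i ws"
| "move E 0 (x # y # ws) =
    (if x = y then ws
     else if List.member E (x, y) then
       (case ws of [] \<Rightarrow> x # y # ws | z # vs \<Rightarrow> if z = x then y # x # y # vs else x # y # ws)
     else y # x # ws)"
| "move E 0 [x] = [x]"
| "move E i [] = []"

definition moves :: "(nat \<times> nat) list \<Rightarrow> nat list \<Rightarrow> nat list \<Rightarrow> nat list" where
  "moves E is ws = fold (move E) is ws"

definition free :: "(nat \<times> nat) list \<Rightarrow> nat \<Rightarrow> nat \<Rightarrow> bool" where
  "free E a s \<longleftrightarrow> \<not> List.member E (s, a)"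

text \<open>The three disjuncts certify those of \<open>advance\<close>, with V the rewritten
  word.\<close>

definition check_step ::
    "(nat \<times> nat) list \<Rightarrow> nat \<Rightarrow> nat list \<Rightarrow> nat list list \<Rightarrow> nat list \<Rightarrow> nat \<Rightarrow> nat list \<Rightarrow> bool" where
  "check_step E a J Us U s is = (let V = moves E is (U @ [s]) in
     list_all (List.member J) V \<and>
     (length V = Suc (length U) \<and> List.member Us V \<or> length V \<le> length U \<or>
      (case V of [] \<Rightarrow> False | s' # U' \<Rightarrow> U' = U \<and> free E a s')))"

definition check_fold :: "(nat \<times> nat) list \<Rightarrow> nat \<Rightarrow> nat list \<Rightarrow> nat list \<Rightarrow> nat \<Rightarrow> nat list \<Rightarrow> nat list \<Rightarrow> bool" where
  "check_fold E a J U k is js = (let V = moves E is U; V1 = take k V; V2 = drop k V in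
     length V = length U \<and> list_all (List.member J) V \<and> moves E js (V1 @ V1) = [] \<and> list_all (free E a) V2)"

text \<open>In each row \<open>iss\<close> holds one list of positions per letter of J, in the order
  of J; \<open>is\<close> rearranges the word for the splitting, k is the length of its involutory
  part, and \<open>js\<close> cancels the square of that part.\<close>

definition check :: "(nat \<times> nat) list \<Rightarrow> nat \<Rightarrow> nat list \<Rightarrow>
    (nat list \<times> nat list list \<times> nat \<times> nat list \<times> nat list) list \<Rightarrow> bool" where
  "check E a J cs \<longleftrightarrow> (let Us = map fst cs in List.member Us [] \<and>
     list_all (\<lambda>(U, iss, k, is, js). list_all (List.member J) U \<and> length iss = length J \<and>
       list_all (\<lambda>(s, is). check_step E a J Us U s is) (zip J iss) \<and> check_fold E a J U k is js) cs)"

context labelled_coxeter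
begin

definition wr :: "nat list \<Rightarrow> 'a" where
  "wr ws = wp (map r ws)"

definition graph :: "(nat \<times> nat) list \<Rightarrow> bool" where
  "graph E \<longleftrightarrow> (\<forall>i\<in>{1..n}. \<forall>j\<in>{1..n}. i \<noteq> j \<longrightarrow> M i j = (if (i, j) \<in> set E then 3 else 2))"

lemma map_r_R: "set ws \<subseteq> {1..n} \<Longrightarrow> set (map r ws) \<subseteq> R"
  using R_eq by auto

lemma graph_commute:
  "graph E \<Longrightarrow> i \<in> {1..n} \<Longrightarrow> j \<in> {1..n} \<Longrightarrow> (i, j) \<notin> set E \<Longrightarrow> r i \<otimes> r j = r j \<otimes> r i"
  by (cases "i = j", simp) (rule ord_2_commute; use ord_r[of i j] r_R in \<open>auto simp: graph_def\<close>)

lemma graph_braid: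
  "graph E \<Longrightarrow> i \<in> {1..n} \<Longrightarrow> j \<in> {1..n} \<Longrightarrow> i \<noteq> j \<Longrightarrow> (i, j) \<in> set E \<Longrightarrow>
    r i \<otimes> (r j \<otimes> r i) = r j \<otimes> (r i \<otimes> r j)"
  by (rule ord_3_braid; use ord_r[of i j] r_R in \<open>auto simp: graph_def\<close>)

lemma move_correct:
  assumes "graph E"
  shows "set ws \<subseteq> {1..n} \<Longrightarrow> set (move E i ws) \<subseteq> {1..n} \<and> wr (move E i ws) = wr ws"
  using assms
proof (induction E i ws rule: move.induct[case_names Suc zero single nil])
  case (Suc E' i x ws)
  then show ?case using map_r_R[of ws] map_r_R[of "move E' i ws"] by (auto simp: wr_def)
next
  case (zero E' x y ws)
  have E: "graph E'" by (rule zero.prems)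
  have xy: "x \<in> {1..n}" "y \<in> {1..n}" "set ws \<subseteq> {1..n}" using zero.prems by auto
  have R: "r x \<in> R" "r y \<in> R" "set (map r ws) \<subseteq> R" using xy map_r_R by auto
  consider "x = y" | "x \<noteq> y" "(x, y) \<notin> set E'" | "x \<noteq> y" "(x, y) \<in> set E'" by blast
  then show ?case
  proof cases
    case 1
    then show ?thesis using xy R by (simp add: wr_def)
  next
    case 2
    have "r y \<otimes> (r x \<otimes> wp (map r ws)) = (r y \<otimes> r x) \<otimes> wp (map r ws)" using R by (simp add: m_assoc)
    also have "\<dots> = r x \<otimes> (r y \<otimes> wp (map r ws))"
      unfolding graph_commute[OF E xy(1,2) 2(2), symmetric] using R by (simp add: m_assoc)
    finally show ?thesis using 2 xy by (simp add: wr_def)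
  next
    case 3
    show ?thesis
    proof (cases ws)
      case Nil
      then show ?thesis using 3 xy by (simp add: wr_def)
    next
      case (Cons z vs)
      show ?thesis
      proof (cases "z = x")
        case True
        have vR: "set (map r vs) \<subseteq> R" using R Cons by simp
        have "r y \<otimes> (r x \<otimes> (r y \<otimes> wp (map r vs))) = (r y \<otimes> (r x \<otimes> r y)) \<otimes> wp (map r vs)"
          using R vR by (simp add: m_assoc)
        also have "\<dots> = r x \<otimes> (r y \<otimes> (r x \<otimes> wp (map r vs)))"
          unfolding graph_braid[OF E xy(1,2) 3, symmetric] using R vR by (simp add: m_assoc)
        finally show ?thesis using 3 xy Cons True by (simp add: wr_def)
      next
        case False
        then show ?thesis using 3 xy Cons by (simp add: wr_def)
      qed
    qed
  qed
qed (auto simp: wr_def)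

lemma moves_correct:
  assumes E: "graph E"
  shows "set ws \<subseteq> {1..n} \<Longrightarrow> set (moves E is ws) \<subseteq> {1..n} \<and> wr (moves E is ws) = wr ws"
proof (induction "is" arbitrary: ws)
  case (Cons i "is")
  then show ?case using move_correct[OF E, of ws i] by (simp add: moves_def)
qed (simp add: moves_def)

lemma strands_check:
  assumes E: "graph E" and J: "set J \<subseteq> {1..n}" and a: "a \<in> {1..n}" and c: "check E a J cs"
  shows "strands (r a) (r ` set J) (map r ` fst ` set cs)"
proof (rule strandsI)
  show "r ` set J \<subseteq> R" using J r_R by blast
  have "[] \<in> fst ` set cs" using c by (simp add: check_def Let_def)
  then show "[] \<in> map r ` fst ` set cs" by force
  fix V assume "V \<in> map r ` fst ` set cs"
  then obtain U iss k "is" js where U: "V = map r U" "(U, iss, k, is, js) \<in> set cs" by auto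
  then have ck: "set U \<subseteq> set J" "length iss = length J"
      "\<And>s is. (s, is) \<in> set (zip J iss) \<Longrightarrow> check_step E a J (map fst cs) U s is" "check_fold E a J U k is js"
    using c by (auto simp: check_def Let_def list_all_iff)
  show VJ: "set V \<subseteq> r ` set J" using U ck by auto
  have Un: "set U \<subseteq> {1..n}" using ck(1) J by blast
  have free: "r s \<otimes> r a = r a \<otimes> r s" if "s \<in> set J" "free E a s" for s
    using graph_commute[OF E, of s a] that J a by (auto simp: free_def)
  have sub: "set (map r V) \<subseteq> r ` set J" if "set V \<subseteq> set J" for V using that by auto
  show "folds (r a) (r ` set J) V"
  proof -
    define T where "T = moves E is U"
    have T: "length T = length U" "set T \<subseteq> set J" "moves E js (take k T @ take k T) = []"
        "\<And>s. s \<in> set (drop k T) \<Longrightarrow> free E a s"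
      using ck(4) by (auto simp: check_fold_def Let_def T_def list_all_iff)
    have TJ: "set (take k T) \<subseteq> set J" "set (drop k T) \<subseteq> set J"
      using T(2) by (auto dest: in_set_takeD in_set_dropD)
    have Tn: "set (take k T) \<subseteq> {1..n}" "set (drop k T) \<subseteq> {1..n}" using TJ J by auto
    have app: "wr (us @ vs) = wr us \<otimes> wr vs" if "set us \<subseteq> {1..n}" "set vs \<subseteq> {1..n}" for us vs
      using map_r_R that by (simp add: wr_def)
    have "wr U = wr T" using moves_correct[OF E Un] by (simp add: T_def)
    also have "T = take k T @ drop k T" by simp
    finally have 1: "wr U = wr (take k T) \<otimes> wr (drop k T)" using app Tn by metis
    have "wr (take k T @ take k T) = wr []"
      using moves_correct[OF E, of "take k T @ take k T" js] Tn T(3) by simp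
    then have 2: "wr (take k T) \<otimes> wr (take k T) = \<one>" using app[OF Tn(1) Tn(1)] by (simp add: wr_def)
    show ?thesis
    proof (rule foldsI)
      show "set (map r (take k T)) \<subseteq> r ` set J" "set (map r (drop k T)) \<subseteq> r ` set J" using TJ by auto
      show "r ` set J \<subseteq> R" "r a \<in> R" using J a r_R by auto
      show "length (map r (take k T)) + length (map r (drop k T)) = length V" using T(1) U(1) by simp
      show "wp V = wp (map r (take k T)) \<otimes> wp (map r (drop k T))" using 1 U(1) by (simp only: wr_def)
      show "wp (map r (take k T)) \<otimes> wp (map r (take k T)) = \<one>" using 2 by (simp only: wr_def)
      show "s \<otimes> r a = r a \<otimes> s" if "s \<in> set (map r (drop k T))" for s
        using that T(4) TJ(2) free by auto
    qed
  qed
  fix s assume "s \<in> r ` set J"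
  then obtain j where j: "s = r j" "j \<in> set J" by blast
  then obtain i where "i < length J" "J ! i = j" by (auto simp: in_set_conv_nth)
  then have "(j, iss ! i) \<in> set (zip J iss)" using ck(2) by (auto simp: set_zip)
  then have st: "check_step E a J (map fst cs) U j (iss ! i)" by (rule ck(3))
  define T where "T = moves E (iss ! i) (U @ [j])"
  have T: "set T \<subseteq> set J" "length T = Suc (length U) \<and> T \<in> fst ` set cs \<or> length T \<le> length U \<or>
      (case T of [] \<Rightarrow> False | s' # U' \<Rightarrow> U' = U \<and> free E a s')"
    using st by (auto simp: check_step_def Let_def T_def list_all_iff)
  have "wr T = wr (U @ [j])" using moves_correct[OF E, of "U @ [j]"] Un j J by (auto simp: T_def)
  then have wT: "wp (map r T) = wp V \<otimes> s"
    using U(1) j map_r_R[OF Un] r_R[of j] J by (auto simp: wr_def)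
  from T(2) show "advance (r a) (r ` set J) (map r ` fst ` set cs) V s"
  proof (elim disjE)
    assume "length T = Suc (length U) \<and> T \<in> fst ` set cs"
    then show ?thesis by (intro advance_grow[of "map r T"]) (use U wT in auto)
  next
    assume "length T \<le> length U"
    then show ?thesis by (intro advance_drop[of "map r T"]) (use U wT sub[OF T(1)] in auto)
  next
    assume "case T of [] \<Rightarrow> False | s' # U' \<Rightarrow> U' = U \<and> free E a s'"
    then obtain s' where s': "T = s' # U" "free E a s'" by (cases T) auto
    then show ?thesis by (intro advance_pull[of "r s'"]) (use free[of s'] T(1) wT U in auto)
  qed
qed

end

definition "edges_E6 = [(1, 3), (3, 1), (2, 4), (4, 2), (3, 4), (4, 3), (4, 5), (5, 4), (5, 6), (6, 5::nat)]"

text \<open>The letters 2, ..., 6 generate type D5, and those commuting with node 1 generate type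
  A4, so there are 1920 / 120 = 16 shortest coset representatives, one per row.\<close>

definition cert_E6_1 :: "(nat list \<times> nat list list \<times> nat \<times> nat list \<times> nat list) list" where
  "cert_E6_1 =
[
   ([], [[], [], [], [], []], 0, [], []),
   ([3], [[0], [0], [], [0], [0]], 1, [], [0]),
   ([3, 4], [[], [0], [1], [], [1, 0]], 1, [], [0]),
   ([3, 4, 2], [[2], [2, 0], [1, 0], [2], [2, 1, 0]], 1, [], [0]),
   ([3, 4, 5], [[], [2, 0], [1, 0], [2], []], 1, [], [0]),
   ([3, 4, 5, 2], [[3], [3, 2, 0], [], [2, 3], [3]], 1, [], [0]),
   ([3, 4, 5, 2, 4], [[3, 1, 0], [], [4], [2, 3, 1, 0, 3], [4, 3]], 1, [], [0]),
   ([3, 4, 5, 2, 4, 3], [[5, 3, 1, 0], [5], [4, 3, 2, 0], [2, 5, 3, 1, 0, 3], [5, 4, 3]], 6, [], [8, 5, 4, 3, 2, 1, 0]),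
   ([3, 4, 5, 6], [[], [3, 2, 0], [3, 1, 0], [2, 1, 0], [3]], 1, [], [0]),
   ([3, 4, 5, 6, 2], [[4], [4, 3, 2, 0], [], [4, 2, 1, 0], [3, 4]], 1, [], [0]),
   ([3, 4, 5, 6, 2, 4], [[4, 3, 1, 0], [], [5], [], [3, 4, 5]], 1, [], [0]),
   ([3, 4, 5, 6, 2, 4, 3], [[6, 4, 3, 1, 0], [6], [5, 4, 3, 2, 0], [6], [3, 4, 5, 6]], 6, [3, 4, 5], [8, 5, 4, 3, 2, 1, 0]),
   ([3, 4, 5, 6, 2, 4, 5], [[6, 4, 3, 1, 0], [], [5, 4, 2, 1, 0], [6], [3, 2, 4, 5, 3, 1, 0, 3, 5, 4]], 1, [], [0]),
   ([3, 4, 5, 6, 2, 4, 5, 3], [[7, 6, 4, 3, 1, 0], [7], [], [6, 7], [3, 2, 4, 7, 5, 3, 1, 0, 3, 5, 4]], 6, [3, 4, 6, 5], [8, 5, 4, 3, 2, 1, 0]),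
   ([3, 4, 5, 6, 2, 4, 5, 3, 4], [[], [7, 5, 4, 2, 1, 0], [8], [6, 7, 5, 4, 3, 2, 0, 7], [3, 2, 4, 8, 7, 5, 3, 1, 0, 3, 5, 4]], 6, [3, 4, 6, 5], [8, 5, 4, 3, 2, 1, 0]),
   ([3, 4, 5, 6, 2, 4, 5, 3, 4, 2], [[9], [9, 7, 5, 4, 2, 1, 0], [8, 7, 6, 4, 3, 1, 0], [6, 9, 7, 5, 4, 3, 2, 0, 7], [3, 2, 4, 9, 8, 7, 5, 3, 1, 0, 3, 5, 4]], 6, [3, 4, 6, 5], [8, 5, 4, 3, 2, 1, 0])]"

text \<open>Type A5 on the letters 1, 3, 4, 5, 6, with the subgroup of type A2 x A2 on 1, 3 and 5, 6
  commuting with node 2: 720 / 36 = 20 rows.\<close>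

definition cert_E6_2 :: "(nat list \<times> nat list list \<times> nat \<times> nat list \<times> nat list) list" where
  "cert_E6_2 =
[
   ([], [[], [], [], [], []], 0, [], []),
   ([4], [[0], [], [0], [], [0]], 1, [], [0]),
   ([4, 3], [[], [1], [0], [1], [1, 0]], 1, [], [0]),
   ([4, 3, 1], [[2], [1, 0], [2, 0], [2, 1], [2, 1, 0]], 1, [], [0]),
   ([4, 5], [[1, 0], [], [0], [1], []], 1, [], [0]),
   ([4, 5, 3], [[], [2], [], [1, 2], [2]], 1, [], [0]),
   ([4, 5, 3, 1], [[3], [2, 1, 0], [3], [1, 2, 3], [3, 2]], 1, [], [0]),
   ([4, 5, 3, 4], [[], [2, 0], [3], [1, 2, 0, 2], [3, 2]], 4, [], [5, 3, 2, 1, 0]),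
   ([4, 5, 3, 4, 1], [[4], [], [3, 4], [1, 4, 2, 0, 2], [4, 3, 2]], 4, [], [5, 3, 2, 1, 0]),
   ([4, 5, 3, 4, 1, 3], [[4, 2, 0], [5], [3, 4, 2, 1, 0, 4], [1, 5, 4, 2, 0, 2], [5, 4, 3, 2]], 4, [], [5, 3, 2, 1, 0]),
   ([4, 5, 6], [[2, 1, 0], [], [2, 0], [1, 0], [2]], 1, [], [0]),
   ([4, 5, 6, 3], [[], [3], [], [3, 1, 0], [2, 3]], 1, [], [0]),
   ([4, 5, 6, 3, 1], [[4], [3, 2, 1, 0], [4], [4, 3, 1, 0], [2, 3, 4]], 1, [], [0]),
   ([4, 5, 6, 3, 4], [[], [3, 2, 0], [4], [], [2, 3, 4]], 4, [2, 3], [5, 3, 2, 1, 0]),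
   ([4, 5, 6, 3, 4, 1], [[5], [], [4, 5], [5], [2, 3, 4, 5]], 4, [2, 3], [5, 3, 2, 1, 0]),
   ([4, 5, 6, 3, 4, 1, 3], [[5, 3, 2, 0], [6], [4, 5, 3, 2, 1, 0, 5], [6, 5], [2, 3, 4, 5, 6]], 4, [2, 3], [5, 3, 2, 1, 0]),
   ([4, 5, 6, 3, 4, 5], [[], [5, 3, 2, 0], [4, 3, 1, 0], [5], [2, 1, 3, 4, 2, 0, 2, 4, 3]], 4, [2, 3], [5, 3, 2, 1, 0]),
   ([4, 5, 6, 3, 4, 5, 1], [[6], [], [6, 4, 3, 1, 0], [5, 6], [2, 1, 3, 6, 4, 2, 0, 2, 4, 3]], 4, [2, 3], [5, 3, 2, 1, 0]),
   ([4, 5, 6, 3, 4, 5, 1, 3], [[6, 5, 3, 2, 0], [7], [], [5, 6, 7], [2, 1, 3, 7, 6, 4, 2, 0, 2, 4, 3]], 4, [2, 3], [5, 3, 2, 1, 0]),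
   ([4, 5, 6, 3, 4, 5, 1, 3, 4], [[8, 6, 5, 3, 2, 0], [7, 6, 4, 3, 1, 0], [8], [5, 4, 6, 7, 5, 3, 2, 1, 0, 5, 7, 6], [2, 1, 3, 8, 7, 6, 4, 2, 0, 2, 4, 3]], 9, [], [11, 10, 12, 14, 13, 12, 11, 15, 14, 8, 7, 6, 5, 4, 3, 2, 1, 0])]"


lemma check_E6_1: "check edges_E6 1 [2, 3, 4, 5, 6] cert_E6_1"
  by code_simp

lemma check_E6_2: "check edges_E6 2 [1, 3, 4, 5, 6] cert_E6_2"
  by code_simp

section \<open>Pendant elements by type\<close>

context finite_coxeter
begin

text \<open>Inverting and applying \<delta> turns the last letter into a first letter of x, which is
  an involutory prefix and hence a.\<close>

lemma good_last:
  assumes g: "good a x" and x: "\<delta> x = inv x" "x = wp ws" "set ws \<subseteq> R" "length ws = len x" "ws \<noteq> []"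
  shows "last ws = \<delta> a"
proof -
  define s where "s = last ws"
  define z where "z = wp (butlast ws)"
  have ws: "ws = butlast ws @ [s]" using x(5) by (simp add: s_def)
  have R: "set (butlast ws) \<subseteq> R" "s \<in> R" using x(3,5) by (auto simp: s_def dest: in_set_butlastD)
  have z: "z \<in> carrier W" "x = z \<otimes> s"
    using R x(2) wp_append[of "butlast ws" "[s]"] ws by (auto simp: z_def)
  have "len z \<le> length ws - 1" using len_le[OF R(1)] by (simp add: z_def)
  moreover have "len x \<le> len z + 1" using len_mult_le[OF z(1), of s] R z(2) by simp
  moreover have "length ws \<noteq> 0" using x(5) by simp
  ultimately have lz: "len x = len z + 1" using x(4) by linarith
  have xc: "x \<in> carrier W" using z R by simp
  have "x = \<delta> (\<delta> x)" using xc by simp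
  also have "\<dots> = \<delta> s \<otimes> \<delta> (inv z)"
    unfolding x(1) unfolding z(2) using z(1) R(2) by (simp add: inv_mult_group w0_conj_mult)
  finally have xe: "x = \<delta> s \<otimes> \<delta> (inv z)" .
  have "\<delta> s \<otimes> x = \<delta> s \<otimes> (\<delta> s \<otimes> \<delta> (inv z))" by (rule arg_cong[OF xe])
  then have "\<delta> s \<otimes> x = \<delta> (inv z)" using R(2) z(1) by simp
  then have "len x = len (\<delta> s) + len (\<delta> s \<otimes> x)" using lz z R by simp
  then have "\<delta> s = a" using g R_involution[of "\<delta> s"] w0_conj_R[OF R(2)] unfolding good_def by blast
  then show ?thesis using R(2) by (auto simp: s_def)
qed

text \<open>By \<open>good_last\<close> the word ends in a, but a occurs only at its
  beginning.\<close>

lemma good_fixed: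
  assumes st: "strands a J \<U>" and R: "R = insert a J" "a \<notin> J"
    and g: "good a x" and x: "\<delta> x = inv x" and a: "\<delta> a = a"
  shows "x = a"
proof -
  obtain U where U: "U \<in> \<U>" "x = wp (a # U)" "length (a # U) = len x"
    using good_strands[OF st R g] by blast
  have UJ: "set U \<subseteq> J" using st U(1) unfolding strands_def by blast
  have sub: "set (a # U) \<subseteq> R" using UJ R(1) by auto
  have "last (a # U) = a" using good_last[OF g x U(2) sub U(3)] a by simp
  then have "U = []" using UJ R(2) by (metis last_ConsR last_in_set subsetD)
  then show ?thesis using U(2) R(1) by simp
qed

text \<open>The words U and V commute, so either can be written last, and each nonempty one has to
  end in \<open>\<delta> a\<close>.\<close>

lemma good_two_ends:
  assumes st: "strands a J \<U>" "strands a K \<V>" and R: "R = insert a (J \<union> K)" "a \<notin> J \<union> K"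
    and comm: "\<And>s t. s \<in> J \<Longrightarrow> t \<in> K \<Longrightarrow> s \<otimes> t = t \<otimes> s"
    and g: "good a x" and x: "\<delta> x = inv x"
  shows "\<exists>U\<in>\<U>. \<exists>V\<in>\<V>. x = wp (a # U @ V) \<and> length (a # U @ V) = len x \<and>
    last (a # U) \<in> {a, \<delta> a} \<and> last (a # V) \<in> {a, \<delta> a} \<and> (U = [] \<longrightarrow> V = [] \<longrightarrow> \<delta> a = a)"
proof -
  have aR: "a \<in> R" using R by simp
  obtain U V where U: "U \<in> \<U>" "V \<in> \<V>" "x = wp (a # U @ V)" "length (a # U @ V) = len x"
    using good_strands[OF strands_product[OF st aR comm] R g] by auto
  have UJ: "set U \<subseteq> J" "set V \<subseteq> K" using st U(1,2) unfolding strands_def by blast+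
  then have UR: "set U \<subseteq> R" "set V \<subseteq> R" using R by auto
  have "wp U \<otimes> wp V = wp V \<otimes> wp U"
  proof (rule wp_commute_words[OF UR])
    show "s \<otimes> t = t \<otimes> s" if "s \<in> set U" "t \<in> set V" for s t using comm that UJ by blast
  qed
  then have x': "x = wp (a # V @ U)" using U(3) UR by simp
  have 1: "last (a # U @ V) = \<delta> a" by (rule good_last[OF g x U(3)]) (use UR aR U(4) in auto)
  have 2: "last (a # V @ U) = \<delta> a" by (rule good_last[OF g x x']) (use UR aR U(4) in auto)
  show ?thesis
    by (rule bexI[OF bexI[OF _ U(2)] U(1)]) (use U 1 2 in \<open>auto split: if_splits\<close>)
qed

lemma chainI: "distinct ws \<Longrightarrow> set ws \<subseteq> R \<Longrightarrow> successively (\<lambda>s t. s \<otimes> t \<noteq> t \<otimes> s) ws \<Longrightarrow> chain ws"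
  by (auto simp: chain_def successively_append_iff)

text \<open>Every generator is a left descent of w0, whereas a chain has only one.\<close>

lemma chain_neq_w0:
  assumes "chain (a # ws)" "t \<in> R" "t \<noteq> a"
  shows "wp (a # ws) \<noteq> w0"
proof
  assume w: "wp (a # ws) = w0"
  have "len (t \<otimes> w0) < len w0" using len_mult_w0[of t] assms(2) by simp
  then have "t = hd (a # ws)" using chain_left_descent[OF assms(1,2)] w by metis
  then show False using assms(3) by simp
qed

end

context labelled_coxeter
begin

lemma commute_label: "i \<in> {1..n} \<Longrightarrow> j \<in> {1..n} \<Longrightarrow> M i j = 2 \<Longrightarrow> r i \<otimes> r j = r j \<otimes> r i"
  by (rule ord_2_commute) (simp_all add: ord_r)

lemma noncommute_label:
  assumes "i \<in> {1..n}" "j \<in> {1..n}" "i \<noteq> j" "M i j \<noteq> 2"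
  shows "r i \<otimes> r j \<noteq> r j \<otimes> r i"
proof
  assume "r i \<otimes> r j = r j \<otimes> r i"
  then have "ord (r i \<otimes> r j) = 2" using assms by (intro ord_commuting_R) (simp_all add: r_eq_iff)
  then show False using ord_r[OF assms(1,2)] assms(4) by simp
qed

lemma braid_path_label:
  assumes f: "\<And>j. j \<in> {1..k} \<Longrightarrow> f j \<in> {1..n}"
    and M: "\<And>i j. i \<in> {1..k} \<Longrightarrow> j \<in> {1..k} \<Longrightarrow> i \<noteq> j \<Longrightarrow>
      M (f i) (f j) = (if i = Suc j \<or> j = Suc i then 3 else 2)"
  shows "braid_path (\<lambda>j. r (f j)) k"
  unfolding braid_path_def
proof (intro conjI ballI)
  show "(\<lambda>j. r (f j)) ` {1..k} \<subseteq> R" using f r_R by blast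
  fix i j assume ij: "i \<in> {1..k}" "j \<in> {1..k}"
  have o: "ord (r (f i) \<otimes> r (f j)) = M (f i) (f j)" using ord_r f ij by simp
  have R: "r (f i) \<in> R" "r (f j) \<in> R" using f ij r_R by blast+
  consider "i = Suc j \<or> j = Suc i" | "i \<noteq> j" "\<not> (i = Suc j \<or> j = Suc i)" | "i = j" by blast
  then show "if i = Suc j \<or> j = Suc i then r (f i) \<otimes> (r (f j) \<otimes> r (f i)) = r (f j) \<otimes> (r (f i) \<otimes> r (f j))
    else r (f i) \<otimes> r (f j) = r (f j) \<otimes> r (f i)"
  proof cases
    case 1
    then have "i \<noteq> j" by auto
    then have "ord (r (f i) \<otimes> r (f j)) = 3" using M[OF ij] o 1 by simp
    then show ?thesis using ord_3_braid[OF R] 1 by (simp only: if_True)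
  next
    case 2
    then have "ord (r (f i) \<otimes> r (f j)) = 2" using M[OF ij] o by simp
    then have "r (f i) \<otimes> r (f j) = r (f j) \<otimes> r (f i)" by (rule ord_2_commute[OF R])
    then show ?thesis using 2 by (simp only: if_False)
  qed simp
qed

lemma r_e_image: "j \<in> {1..n} \<Longrightarrow> r i = \<delta> (r j) \<Longrightarrow> i \<in> {1..n} \<Longrightarrow> i = e j"
  using r_eq_iff[of i "e j"] r_e[of j] e_in[of j] by simp

text \<open>
  Since \<open>\<delta>\<close> reverses the words in \<open>I\<close>, passing from \<open>x\<close> to \<open>inv x\<close> in \<open>pendants_eq\<close> only permutes them.
\<close>

lemma pendants_words:
  assumes n: "n \<ge> 2"
    and fwd: "\<And>a x. a \<in> {1..n} \<Longrightarrow> good (r a) x \<Longrightarrow> \<delta> x = inv x \<Longrightarrow> \<exists>ks\<in>I. x = wr ks"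
    and bwd: "\<And>ks. ks \<in> I \<Longrightarrow> ks \<noteq> [] \<and> distinct ks \<and> set ks \<subseteq> {1..n} \<and>
      successively (\<lambda>i j. M i j \<noteq> 2) ks \<and> map e ks = rev ks"
    and rev: "\<And>ks. ks \<in> I \<Longrightarrow> rev ks \<in> I"
  shows "pendants W R = {w0 \<otimes> wr ks | ks. ks \<in> I}"
proof -
  have word: "wr ks \<in> carrier W" "\<delta> (wr ks) = inv (wr ks)" "wr ks \<noteq> w0" "\<exists>a\<in>R. good a (wr ks)"
      "inv (wr ks) = wr (rev ks)" if ks: "ks \<in> I" for ks
  proof -
    note k = bwd[OF ks]
    have R: "set (map r ks) \<subseteq> R" using map_r_R k by blast
    show "wr ks \<in> carrier W" using R by (simp add: wr_def)
    show i: "inv (wr ks) = wr (rev ks)" using R by (simp add: wr_def wp_rev flip: rev_map)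
    have "\<delta> (r i) = r (e i)" if "i \<in> set ks" for i using k that by (subst r_e) auto
    then have "map \<delta> (map r ks) = map r (map e ks)" by simp
    then show "\<delta> (wr ks) = inv (wr ks)" unfolding i using w0_conj_wp[OF R] k by (simp add: wr_def)
    have "chain (map r ks)"
    proof (rule chainI[OF _ R])
      show "distinct (map r ks)" using k bij by (auto simp: distinct_map bij_betw_def intro: inj_on_subset)
      have "successively (\<lambda>i j. r i \<otimes> r j \<noteq> r j \<otimes> r i) ks"
        unfolding successively_conv_nth
      proof (intro allI impI)
        fix i assume i: "Suc i < length ks"
        have "ks ! i \<noteq> ks ! Suc i" using k i by (simp add: nth_eq_iff_index_eq)
        moreover have "M (ks ! i) (ks ! Suc i) \<noteq> 2" using k i by (simp add: successively_conv_nth)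
        moreover have "ks ! i \<in> set ks" "ks ! Suc i \<in> set ks" using i by simp_all
        then have "ks ! i \<in> {1..n}" "ks ! Suc i \<in> {1..n}" using k by blast+
        ultimately show "r (ks ! i) \<otimes> r (ks ! Suc i) \<noteq> r (ks ! Suc i) \<otimes> r (ks ! i)"
          by (intro noncommute_label)
      qed
      then show "successively (\<lambda>s t. s \<otimes> t \<noteq> t \<otimes> s) (map r ks)" by (simp add: successively_map)
    qed
    moreover obtain l ls where l: "ks = l # ls" using k by (cases ks) auto
    ultimately have c: "chain (r l # map r ls)" by simp
    have ln: "l \<in> {1..n}" using k l by simp
    have "good (r l) (wr ks)" using good_chain[OF c] l by (simp add: wr_def)
    then show "\<exists>a\<in>R. good a (wr ks)" using r_R[OF ln] by blast
    define t :: nat where "t = (if l = 1 then 2 else 1)"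
    have "t \<in> {1..n}" "t \<noteq> l" using n by (auto simp: t_def)
    then have "r t \<in> R" "r t \<noteq> r l" using ln by (auto simp: r_eq_iff)
    then show "wr ks \<noteq> w0" using chain_neq_w0[OF c] l by (simp add: wr_def)
  qed
  have "x \<in> wr ` I" if "a \<in> R" "good a x" "\<delta> x = inv x" for a x
    using that fwd R_eq by force
  then have "{x \<in> carrier W. \<delta> x = inv x \<and> x \<noteq> w0 \<and> (\<exists>a\<in>R. good a x)} = wr ` I"
    using word by blast
  then have "pendants W R = (\<lambda>x. w0 \<otimes> inv x) ` wr ` I" unfolding pendants_eq by blast
  also have "\<dots> = (\<lambda>ks. w0 \<otimes> wr (rev ks)) ` I" unfolding image_image using word by (intro image_cong) auto
  also have "\<dots> = (\<lambda>ks. w0 \<otimes> wr ks) ` I"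
  proof -
    have "rev ` I = I" using rev by (force simp: image_iff)
    then show ?thesis by (metis image_image)
  qed
  finally show ?thesis by blast
qed

section \<open>Type A and type I2(m) with m odd\<close>

lemma seg_up: "r k # seg (\<lambda>j. r (k + j)) 1 m = map r [k..<Suc (k + m)]"
proof (induction m)
  case (Suc m)
  have "r k # seg (\<lambda>j. r (k + j)) 1 (Suc m) = (r k # seg (\<lambda>j. r (k + j)) 1 m) @ [r (k + Suc m)]"
    using seg_snoc[of 1 m "\<lambda>j. r (k + j)"] by simp
  then show ?case unfolding Suc by simp
qed (simp add: seg_empty)

lemma seg_down: "m \<le> k \<Longrightarrow> r k # seg (\<lambda>j. r (k - j)) 1 m = map r (rev [k - m..<Suc k])"
proof (induction m)
  case (Suc m)
  have "[k - Suc m..<Suc k] = (k - Suc m) # [k - m..<Suc k]"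
    using Suc.prems upt_conv_Cons[of "k - Suc m" "Suc k"] by (simp add: Suc_diff_Suc del: upt_Suc)
  moreover have "r k # seg (\<lambda>j. r (k - j)) 1 (Suc m) = (r k # seg (\<lambda>j. r (k - j)) 1 m) @ [r (k - Suc m)]"
    using seg_snoc[of 1 m "\<lambda>j. r (k - j)"] by simp
  ultimately show ?case using Suc by (simp del: upt_Suc)
qed (simp add: seg_empty)

lemma last_seg: "1 \<le> m \<Longrightarrow> last (x # seg p 1 m) = p m"
  using seg_snoc[of 1 "m - 1" p] by simp

text \<open>On either side of k a nonempty stretch has to end at \<open>n + 1 - k\<close>. This
  label cannot be both above and below k, so only one side is used; if none is, k is the middle
  label.\<close>

lemma good_type_A:
  assumes M: "M = type_A" and k: "k \<in> {1..n}" and g: "good (r k) x" and x: "\<delta> x = inv x"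
  shows "\<exists>i\<in>{1..(n + 1) div 2}. x = wr [i..<Suc (n + 1 - i)] \<or> x = wr (rev [i..<Suc (n + 1 - i)])"
proof -
  have A: "M i j = (if i = Suc j \<or> j = Suc i then 3 else 2)" if "i \<noteq> j" for i j
    using that by (auto simp: M type_A_def sym_matrix_def min_def max_def)
  define up down where "up j = r (k + j)" and "down j = r (k - j)" for j
  have fn: "up = (\<lambda>j. r (k + j))" "down = (\<lambda>j. r (k - j))" by (simp_all add: up_def down_def fun_eq_iff)
  have pu: "braid_path up (n - k)" unfolding up_def by (rule braid_path_label) (use k A in auto)
  have pd: "braid_path down (k - 1)" unfolding down_def by (rule braid_path_label) (use k A in auto)
  have su: "strands (r k) (up ` {1..n - k}) {seg up 1 m | m. m \<le> n - k}"
    by (rule strands_path[OF pu]) (use k A in \<open>auto simp: up_def intro!: commute_label\<close>)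
  have sd: "strands (r k) (down ` {1..k - 1}) {seg down 1 m | m. m \<le> k - 1}"
    by (rule strands_path[OF pd]) (use k A in \<open>auto simp: down_def intro!: commute_label\<close>)
  have ups: "up ` {1..n - k} = r ` {k + 1..n}"
  proof (intro equalityI subsetI)
    fix s assume "s \<in> r ` {k + 1..n}"
    then obtain i where "s = r i" "i \<in> {k + 1..n}" by blast
    then show "s \<in> up ` {1..n - k}" by (intro image_eqI[of _ _ "i - k"]) (auto simp: up_def)
  qed (auto simp: up_def)
  have downs: "down ` {1..k - 1} = r ` {1..k - 1}"
  proof (intro equalityI subsetI)
    fix s assume "s \<in> r ` {1..k - 1}"
    then obtain i where "s = r i" "i \<in> {1..k - 1}" by blast
    then show "s \<in> down ` {1..k - 1}" by (intro image_eqI[of _ _ "k - i"]) (auto simp: down_def)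
  next
    fix s assume "s \<in> down ` {1..k - 1}"
    then obtain i where "s = r (k - i)" "i \<in> {1..k - 1}" unfolding down_def by blast
    then show "s \<in> r ` {1..k - 1}" by (intro image_eqI[of _ _ "k - i"]) auto
  qed
  have split: "{1..n} = insert k ({k + 1..n} \<union> {1..k - 1})" using k by auto
  have R: "R = insert (r k) (up ` {1..n - k} \<union> down ` {1..k - 1})"
    unfolding ups downs R_eq split by (simp add: image_Un)
  have nin: "r k \<notin> up ` {1..n - k} \<union> down ` {1..k - 1}"
    unfolding ups downs using k by (auto simp: r_eq_iff)
  have comm: "s \<otimes> t = t \<otimes> s" if st: "s \<in> up ` {1..n - k}" "t \<in> down ` {1..k - 1}" for s t
  proof -
    obtain i j where ij: "s = r i" "i \<in> {k + 1..n}" "t = r j" "j \<in> {1..k - 1}"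
      using st unfolding ups downs by blast
    then have "M i j = 2" using A[of i j] k by auto
    then show ?thesis unfolding ij(1,3) by (intro commute_label) (use ij k in auto)
  qed
  obtain U V where UV: "U \<in> {seg up 1 m | m. m \<le> n - k}" "V \<in> {seg down 1 m | m. m \<le> k - 1}"
      "x = wp (r k # U @ V)" "last (r k # U) \<in> {r k, \<delta> (r k)}" "last (r k # V) \<in> {r k, \<delta> (r k)}"
      "U = [] \<longrightarrow> V = [] \<longrightarrow> \<delta> (r k) = r k"
    using good_two_ends[OF su sd R nin comm g x] by blast
  obtain m q where m: "U = seg up 1 m" "m \<le> n - k" and q: "V = seg down 1 q" "q \<le> k - 1" using UV(1,2) by blast
  have e: "e k = n + 1 - k" by (rule e_type_A[OF M k])
  have m': "m = 0 \<or> k + m = n + 1 - k"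
  proof (cases "m = 0")
    case False
    then have "r (k + m) \<in> {r k, \<delta> (r k)}" using UV(4) last_seg[of m "r k" up] m by (simp add: up_def)
    moreover have "r (k + m) \<noteq> r k" using False m k r_eq_iff[of "k + m" k] by auto
    ultimately have "k + m = e k" using m k False by (intro r_e_image) auto
    then show ?thesis using e by simp
  qed simp
  have q': "q = 0 \<or> k - q = n + 1 - k"
  proof (cases "q = 0")
    case False
    then have "r (k - q) \<in> {r k, \<delta> (r k)}" using UV(5) last_seg[of q "r k" down] q by (simp add: down_def)
    moreover have kq: "k - q \<in> {1..n}" "k - q \<noteq> k" using False q k by auto
    then have "r (k - q) \<noteq> r k" using r_eq_iff[OF kq(1) k] by simp
    ultimately have "k - q = e k" using q k False by (intro r_e_image) auto
    then show ?thesis using e by simp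
  qed simp
  have mq: "m = 0 \<or> q = 0" using m' q' by auto
  have mid: "k = n + 1 - k" if "m = 0" "q = 0"
    using UV(6) that m q fixed_iff[OF k] e by (simp add: seg_empty)
  show ?thesis
  proof (cases "q = 0")
    case True
    have "x = wp (r k # seg (\<lambda>j. r (k + j)) 1 m)" using UV(3) m q True unfolding fn by (simp add: seg_empty)
    then have "x = wr [k..<Suc (k + m)]" unfolding seg_up wr_def .
    moreover have "k + m = n + 1 - k" using m' mid True by auto
    moreover have "k \<in> {1..(n + 1) div 2}" using k calculation(2) by auto
    ultimately show ?thesis by (intro bexI[of _ k]) simp_all
  next
    case False
    have "x = wp (r k # seg (\<lambda>j. r (k - j)) 1 q)" using UV(3) m q False mq unfolding fn by (simp add: seg_empty)
    then have "x = wr (rev [k - q..<Suc k])" using seg_down[of q k] q by (simp only: wr_def)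
    moreover have "k - q = n + 1 - k" using q' False by blast
    moreover have "n + 1 - k \<in> {1..(n + 1) div 2}" "k = n + 1 - (n + 1 - k)" using k calculation(2) by auto
    ultimately show ?thesis by (intro bexI[of _ "n + 1 - k"]) simp_all
  qed
qed

lemma pendants_type_A:
  assumes M: "M = type_A" and n: "n \<ge> 2"
  shows "pendants W R = (\<Union>i \<in> {1..nat \<lceil>real n / 2\<rceil>}.
    {w0 \<otimes> ascending W r i (n + 1 - i), w0 \<otimes> descending W r (n + 1 - i) i})"
proof -
  have J: "nat \<lceil>real n / 2\<rceil> = (n + 1) div 2"
  proof (cases "even n")
    case True
    then obtain m where "n = 2 * m" by blast
    then show ?thesis by simp
  next
    case False
    then obtain m where m: "n = 2 * m + 1" using oddE by blast
    have "\<lceil>real n / 2\<rceil> = int m + 1" unfolding m by (rule ceiling_unique) (auto simp: field_simps)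
    then show ?thesis using m by simp
  qed
  define I where "I = (\<Union>i \<in> {1..(n + 1) div 2}. {[i..<Suc (n + 1 - i)], rev [i..<Suc (n + 1 - i)]})"
  have "pendants W R = {w0 \<otimes> wr ks | ks. ks \<in> I}"
  proof (rule pendants_words[OF n])
    show "\<exists>ks\<in>I. x = wr ks" if "a \<in> {1..n}" "good (r a) x" "\<delta> x = inv x" for a x
      using good_type_A[OF M that] unfolding I_def by blast
    show "rev ks \<in> I" if ks: "ks \<in> I" for ks
    proof -
      obtain i where "i \<in> {1..(n + 1) div 2}" "ks = [i..<Suc (n + 1 - i)] \<or> ks = rev [i..<Suc (n + 1 - i)]"
        using ks unfolding I_def by blast
      then have "i \<in> {1..(n + 1) div 2}" "rev ks = [i..<Suc (n + 1 - i)] \<or> rev ks = rev [i..<Suc (n + 1 - i)]"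
  by (simp_all del: upt_Suc) (elim disjE; simp del: upt_Suc)
      then show ?thesis unfolding I_def by blast
    qed
    have base: "ks \<noteq> [] \<and> distinct ks \<and> set ks \<subseteq> {1..n} \<and>
        successively (\<lambda>i j. M i j \<noteq> 2 \<and> M j i \<noteq> 2) ks \<and> map e ks = rev ks"
      if i: "i \<in> {1..(n + 1) div 2}" and ks: "ks = [i..<Suc (n + 1 - i)]" for i ks
    proof (intro conjI)
      have in_n: "i \<ge> 1" "n + 1 - i \<le> n" "i \<le> n + 1 - i" using i by auto
      show "ks \<noteq> []" "distinct ks" using ks in_n by auto
      show "set ks \<subseteq> {1..n}" using ks in_n by auto
      show "successively (\<lambda>i j. M i j \<noteq> 2 \<and> M j i \<noteq> 2) ks"
        unfolding successively_conv_nth ks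
        by (auto simp: M type_A_def sym_matrix_def simp del: upt_Suc)
      show "map e ks = rev ks"
      proof (rule nth_equalityI)
        fix j assume "j < length (map e ks)"
        then have j: "j < Suc (n + 1 - i) - i" using ks by (simp del: upt_Suc)
        then have "map e ks ! j = n + 1 - (i + j)"
          using ks in_n e_type_A[OF M, of "i + j"] by (simp del: upt_Suc)
        moreover have "rev ks ! j = i + (Suc (n + 1 - i) - i - Suc j)"
          using ks j by (simp add: rev_nth del: upt_Suc)
        ultimately show "map e ks ! j = rev ks ! j" using j in_n by auto
      qed (simp add: ks)
    qed
    show "ks \<noteq> [] \<and> distinct ks \<and> set ks \<subseteq> {1..n} \<and> successively (\<lambda>i j. M i j \<noteq> 2) ks \<and> map e ks = rev ks"
      if ks: "ks \<in> I" for ks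
    proof -
      obtain i ls where i: "i \<in> {1..(n + 1) div 2}" "ls = [i..<Suc (n + 1 - i)]" "ks = ls \<or> ks = rev ls"
        using ks unfolding I_def by blast
      note b = base[OF i(1,2)]
      from i(3) show ?thesis
      proof
        assume "ks = ls"
        then show ?thesis using b by (auto elim!: successively_mono)
      next
        assume "ks = rev ls"
        moreover have "map e (rev ls) = rev (rev ls)" using b by (simp flip: rev_map)
        ultimately show ?thesis using b by (auto simp: successively_rev elim!: successively_mono)
      qed
    qed
  qed
  then show ?thesis unfolding J I_def ascending_def descending_def wr_def by blast
qed

text \<open>When J consists of the other reflection alone, the family contains just the empty word
  and that letter, whatever m is. So x is a generator or a product of both; the first is excluded
  since \<open>e\<close> has no fixed label.\<close>

lemma pendants_type_I2_odd:
  assumes M: "M = type_I2 m" and n: "n = 2" and m: "odd m" "m \<ge> 3"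
  shows "pendants W R = {w0 \<otimes> r 1 \<otimes> r 2, w0 \<otimes> r 2 \<otimes> r 1}"
proof -
  have e: "e 1 = 2" "e 2 = 1" using e_type_I2_odd[OF M n m] by blast+
  have main: "x = wr [i, j]" if ij: "{1..2} = {i, j}" "i \<noteq> j" and g: "good (r i) x" and x: "\<delta> x = inv x" for i j x
  proof -
    have i: "i \<in> {1..n}" "j \<in> {1..n}" using ij(1) n by auto
    have R: "r i \<in> R" "r j \<in> R" "r i \<noteq> r j" using i ij(2) r_eq_iff by auto
    have p: "braid_path (\<lambda>_. r j) 1" using R by (auto simp: braid_path_def)
    have st: "strands (r i) ((\<lambda>_. r j) ` {1..1::nat}) {seg (\<lambda>_. r j) 1 m | m. m \<le> 1}"
      by (rule strands_path[OF p]) (use R in auto)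
    have RR: "R = insert (r i) ((\<lambda>_. r j) ` {1..1::nat})" unfolding R_eq n ij(1) by simp
    have nin: "r i \<notin> (\<lambda>_. r j) ` {1..1::nat}" using R(3) by simp
    obtain U where U: "U \<in> {seg (\<lambda>_. r j) 1 m | m. m \<le> 1}" "x = wp (r i # U)" "length (r i # U) = len x"
      using good_strands[OF st RR nin g] by blast
    from U(1) have "U = [] \<or> U = [r j]" by (auto simp: le_Suc_eq seg_empty seg_single)
    moreover have "U \<noteq> []"
    proof
      assume "U = []"
      then have "set (r i # U) \<subseteq> R" using R(1) by simp
      then have "r i = \<delta> (r i)" using good_last[OF g x U(2) _ U(3)] \<open>U = []\<close> by simp
      then have ie: "i = e i" using i by (intro r_e_image) auto
      have "i = 1 \<or> i = 2" using i n by auto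
      then show False
      proof
        assume "i = 1"
        then show False using ie e(1) by simp
      next
        assume "i = 2"
        then show False using ie e(2) by simp
      qed
    qed
    ultimately show ?thesis using U(2) by (simp add: wr_def)
  qed
  have "pendants W R = {w0 \<otimes> wr ks | ks. ks \<in> {[1, 2], [2, 1]}}"
  proof (rule pendants_words)
    show "\<exists>ks\<in>{[1, 2], [2, 1]}. x = wr ks" if "a \<in> {1..n}" "good (r a) x" "\<delta> x = inv x" for a x
    proof -
      have "a = 1 \<or> a = 2" using that(1) n by auto
      then show ?thesis using main[of 1 2 x] main[of 2 1 x] that by fastforce
    qed
  qed (use n m e in \<open>auto simp: M type_I2_def sym_matrix_def\<close>)
  also have "\<dots> = (\<lambda>ks. w0 \<otimes> wr ks) ` {[1, 2], [2, 1]}" by blast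
  also have "\<dots> = {w0 \<otimes> wr [1, 2], w0 \<otimes> wr [2, 1]}" by (simp only: image_insert image_empty)
  finally have *: "pendants W R = {w0 \<otimes> wr [1, 2], w0 \<otimes> wr [2, 1]}" .
  have "w0 \<otimes> wr [1, 2] = w0 \<otimes> r 1 \<otimes> r 2" "w0 \<otimes> wr [2, 1] = w0 \<otimes> r 2 \<otimes> r 1"
    using n by (simp_all add: wr_def m_assoc)
  then show ?thesis unfolding * by (simp only:)
qed

end

section \<open>Type D with n odd\<close>

context labelled_coxeter
begin

lemma strands_path_label:
  assumes a: "a \<in> {1..n}" and f: "\<And>j. j \<in> {1..k} \<Longrightarrow> f j \<in> {1..n}"
    and M: "\<And>i j. i \<in> {1..k} \<Longrightarrow> j \<in> {1..k} \<Longrightarrow> i \<noteq> j \<Longrightarrow>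
      M (f i) (f j) = (if i = Suc j \<or> j = Suc i then 3 else 2)"
    and Ma: "\<And>j. j \<in> {2..k} \<Longrightarrow> M (f j) a = 2"
  shows "strands (r a) (r ` f ` {1..k}) {seg (\<lambda>j. r (f j)) 1 m | m. m \<le> k}"
proof -
  have "strands (r a) ((\<lambda>j. r (f j)) ` {1..k}) {seg (\<lambda>j. r (f j)) 1 m | m. m \<le> k}"
  proof (rule strands_path)
    show "braid_path (\<lambda>j. r (f j)) k" by (rule braid_path_label[OF f M])
    show "r a \<in> R" using a by simp
    show "r (f j) \<otimes> r a = r a \<otimes> r (f j)" if "j \<in> {2..k}" for j
      using that f[of j] a Ma by (intro commute_label) auto
  qed
  then show ?thesis by (simp only: image_image)
qed

lemma strands_two_rows_label:
  assumes a: "a \<in> {1..n}" and k: "1 \<le> k" and f: "\<And>j. j \<in> {1..k} \<Longrightarrow> f j \<in> {1..n}"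
    and M: "\<And>i j. i \<in> {1..k} \<Longrightarrow> j \<in> {1..k} \<Longrightarrow> i \<noteq> j \<Longrightarrow>
      M (f i) (f j) = (if i = Suc j \<or> j = Suc i then 3 else 2)"
    and Ma: "\<And>j. j \<in> {1..k} \<Longrightarrow> j \<noteq> 2 \<Longrightarrow> M (f j) a = 2"
  shows "strands (r a) (r ` f ` {1..k})
    {seg (\<lambda>j. r (f j)) 2 m @ seg (\<lambda>j. r (f j)) 1 q | m q. q < m \<and> m \<le> k}"
proof -
  have "strands (r a) ((\<lambda>j. r (f j)) ` {1..k})
    {seg (\<lambda>j. r (f j)) 2 m @ seg (\<lambda>j. r (f j)) 1 q | m q. q < m \<and> m \<le> k}"
  proof (rule strands_two_rows[OF _ k])
    show "braid_path (\<lambda>j. r (f j)) k" by (rule braid_path_label[OF f M])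
    show "r a \<in> R" using a by simp
    show "r (f j) \<otimes> r a = r a \<otimes> r (f j)" if "j \<in> {1..k}" "j \<noteq> 2" for j
      using that f[of j] a Ma by (intro commute_label) auto
  qed
  then show ?thesis by (simp only: image_image)
qed

lemma strands_product_label:
  assumes st: "strands (r a) (r ` A) \<U>" "strands (r a) (r ` B) \<V>" and a: "a \<in> {1..n}"
    and AB: "A \<subseteq> {1..n}" "B \<subseteq> {1..n}" "\<And>i j. i \<in> A \<Longrightarrow> j \<in> B \<Longrightarrow> M i j = 2"
  shows "strands (r a) (r ` (A \<union> B)) {U @ V | U V. U \<in> \<U> \<and> V \<in> \<V>}"
proof -
  have "s \<otimes> t = t \<otimes> s" if st: "s \<in> r ` A" "t \<in> r ` B" for s t
  proof -
    obtain i j where ij: "s = r i" "i \<in> A" "t = r j" "j \<in> B" using st by blast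
    show ?thesis unfolding ij(1,3) by (rule commute_label) (use ij AB in auto)
  qed
  then show ?thesis unfolding image_Un by (intro strands_product[OF st]) (use a in simp)
qed

lemma good_fixed_label:
  assumes st: "strands (r a) (r ` A) \<U>" and A: "{1..n} = insert a A" "a \<notin> A"
    and g: "good (r a) x" "\<delta> x = inv x" "e a = a"
  shows "x = wr [a]"
proof -
  have a: "a \<in> {1..n}" using A by blast
  have "x = r a"
  proof (rule good_fixed[OF st _ _ g(1,2)])
    show "R = insert (r a) (r ` A)" unfolding R_eq A(1) by simp
    show "r a \<notin> r ` A"
    proof
      assume "r a \<in> r ` A"
      then obtain i where "i \<in> A" "r a = r i" by blast
      moreover have "i \<in> {1..n}" using \<open>i \<in> A\<close> A(1) by blast
      ultimately show False using r_eq_iff[OF a] A(2) by blast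
    qed
    show "\<delta> (r a) = r a" using g(3) fixed_iff[OF a] by simp
  qed
  then show ?thesis using a by (simp add: wr_def)
qed

lemma good_strands_label:
  assumes st: "strands (r a) (r ` A) \<U>" and A: "{1..n} = insert a A" "a \<notin> A"
    and g: "good (r a) x" and x: "\<delta> x = inv x"
  shows "\<exists>U\<in>\<U>. x = wp (r a # U) \<and> length (r a # U) = len x \<and> last (r a # U) = r (e a)"
proof -
  have a: "a \<in> {1..n}" using A by blast
  have R: "R = insert (r a) (r ` A)" unfolding R_eq A(1) by simp
  have nin: "r a \<notin> r ` A"
  proof
    assume "r a \<in> r ` A"
    then obtain i where "i \<in> A" "r a = r i" by blast
    moreover have "i \<in> {1..n}" using \<open>i \<in> A\<close> A(1) by blast
    ultimately show False using r_eq_iff[OF a] A(2) by blast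
  qed
  obtain U where U: "U \<in> \<U>" "x = wp (r a # U)" "length (r a # U) = len x"
    using good_strands[OF st R nin g] by blast
  have "set U \<subseteq> r ` A" using st U(1) unfolding strands_def by blast
  then have sub: "set (r a # U) \<subseteq> R" using R by auto
  have "last (r a # U) = \<delta> (r a)" using good_last[OF g x U(2) sub U(3)] by simp
  then have "last (r a # U) = r (e a)" unfolding r_e[OF a] .
  then show ?thesis using U by blast
qed

lemma type_D_eq:
  assumes M: "M = type_D n" and n: "n \<ge> 4" and ij: "i \<in> {1..n}" "j \<in> {1..n}" "i \<noteq> j"
  shows "M i j = (if i < n \<and> j < n \<and> (i = Suc j \<or> j = Suc i) \<or> i = n - 2 \<and> j = n \<or> j = n - 2 \<and> i = n
    then 3 else 2)"
  using ij n by (auto simp: M type_D_def sym_matrix_def min_def max_def)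

lemma type_D_tail:
  assumes M: "M = type_D n" and n: "n \<ge> 4" and ij: "i \<in> {1..n - 1}" "j \<in> {1..n - 1}" "i \<noteq> j"
  shows "M i j = (if i = Suc j \<or> j = Suc i then 3 else 2)"
proof -
  have "i \<in> {1..n}" "j \<in> {1..n}" "i < n" "j < n" using ij n by auto
  then show ?thesis using type_D_eq[OF M n, of i j] ij(3) by simp
qed

lemma type_D_spin:
  assumes M: "M = type_D n" and n: "n \<ge> 4" and u: "u = n - 1 \<or> u = n" and v: "v \<in> {1..n - 2}"
  shows "M u v = (if v = n - 2 then 3 else 2)" "M v u = (if v = n - 2 then 3 else 2)"
proof -
  obtain m where m: "n = m + 4" using n le_Suc_ex by (metis add.commute)
  have uv: "u \<in> {1..n}" "v \<in> {1..n}" "u \<noteq> v" using u v m by auto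
  show "M u v = (if v = n - 2 then 3 else 2)"
    unfolding type_D_eq[OF M n uv] using u v m by auto
  show "M v u = (if v = n - 2 then 3 else 2)"
    unfolding type_D_eq[OF M n uv(2,1) uv(3)[symmetric]] using u v m by auto
qed

text \<open>Such labels are fixed by \<open>e\<close>, so any strand family yields the claim: above
  a lies a fork, or two single nodes if a = n - 2, and below a lies a path.\<close>

lemma good_type_D_path:
  assumes M: "M = type_D n" and n: "n \<ge> 4" "odd n" and a: "a \<in> {1..n - 2}"
    and g: "good (r a) x" and x: "\<delta> x = inv x"
  shows "x = wr [a]"
proof -
  note D = type_D_eq[OF M n(1)]
  have an: "a \<in> {1..n}" using a by auto
  have "\<exists>\<U>. strands (r a) (r ` {a + 1..n}) \<U>"
  proof (cases "a = n - 2")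
    case True
    have s: "strands (r a) (r ` (\<lambda>_. c) ` {1..1::nat}) {seg (\<lambda>_. r c) 1 m | m. m \<le> 1}" if "c \<in> {1..n}" for c
      by (rule strands_path_label) (use an that in auto)
    have "strands (r a) (r ` ((\<lambda>_. n - 1) ` {1..1::nat} \<union> (\<lambda>_. n) ` {1..1::nat}))
      {U @ V | U V. U \<in> {seg (\<lambda>_. r (n - 1)) 1 m | m. m \<le> 1} \<and> V \<in> {seg (\<lambda>_. r n) 1 m | m. m \<le> 1}}"
      by (rule strands_product_label[OF s s an]) (use n D[of "n - 1" n] in auto)
    moreover have "(\<lambda>_. n - 1) ` {1..1::nat} \<union> (\<lambda>_. n) ` {1..1::nat} = {a + 1..n}" using True n by auto
    ultimately show ?thesis by metis
  next
    case False
    define h where "h = n - 2 - a"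
    define p where "p j = r (a + j)" for j
    have h: "1 \<le> h" "a + h = n - 2" using False a by (auto simp: h_def)
    have pb: "braid_path (\<lambda>j. r (a + j)) (Suc h)"
    proof (rule braid_path_label)
      show "a + j \<in> {1..n}" if "j \<in> {1..Suc h}" for j using that h n by auto
      show "M (a + i) (a + j) = (if i = Suc j \<or> j = Suc i then 3 else 2)"
        if "i \<in> {1..Suc h}" "j \<in> {1..Suc h}" "i \<noteq> j" for i j
        using that D[of "a + i" "a + j"] h n by auto
    qed
    have pd: "braid_path (\<lambda>j. r (((\<lambda>j. a + j)(Suc h := n)) j)) (Suc h)"
    proof (rule braid_path_label)
      show "((\<lambda>j. a + j)(Suc h := n)) j \<in> {1..n}" if "j \<in> {1..Suc h}" for j using that h n by auto
      fix i j assume ij: "i \<in> {1..Suc h}" "j \<in> {1..Suc h}" "i \<noteq> j"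
      have r: "a + m \<in> {1..n}" "a + m < n - 1" if "m \<in> {1..h}" for m using that h n by auto
      have "i \<le> Suc h" "j \<le> Suc h" using ij by simp_all
      then consider "i = Suc h" "j \<in> {1..h}" | "j = Suc h" "i \<in> {1..h}" | "i \<in> {1..h}" "j \<in> {1..h}"
        using ij by (auto simp: le_Suc_eq)
      then show "M (((\<lambda>j. a + j)(Suc h := n)) i) (((\<lambda>j. a + j)(Suc h := n)) j) =
        (if i = Suc j \<or> j = Suc i then 3 else 2)"
      proof cases
        case 1
        have "M n (a + j) = (if a + j = n - 2 then 3 else 2)"
          using r[OF 1(2)] n by (subst D) auto
        moreover have "a + j = n - 2 \<longleftrightarrow> Suc h = Suc j" using h by auto
        ultimately show ?thesis using 1 by auto
      next
        case 2
        have "M (a + i) n = (if a + i = n - 2 then 3 else 2)"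
          using r[OF 2(2)] n by (subst D) auto
        moreover have "a + i = n - 2 \<longleftrightarrow> Suc h = Suc i" using h by auto
        ultimately show ?thesis using 2 by auto
      next
        case 3
        have "M (a + i) (a + j) = (if i = Suc j \<or> j = Suc i then 3 else 2)"
          using r[OF 3(1)] r[OF 3(2)] ij n by (subst D) auto
        then show ?thesis using 3 by auto
      qed
    qed
    have e1: "p(Suc h := r (n - 1)) = (\<lambda>j. r (a + j))"
    proof -
      have nn: "n - 1 = a + Suc h" using h n by auto
      show ?thesis unfolding nn by (auto simp: p_def fun_eq_iff)
    qed
    have e2: "p(Suc h := r n) = (\<lambda>j. r (((\<lambda>j. a + j)(Suc h := n)) j))" by (auto simp: p_def fun_eq_iff)
    have c: "r i \<otimes> r j = r j \<otimes> r i" if "i \<in> {1..n}" "j \<in> {1..n}" "M i j = 2" for i j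
      by (rule commute_label[OF that])
    have nn: "n - 1 \<in> {1..n}" "n \<in> {1..n}" "n - 1 \<noteq> n" "n - 1 \<noteq> a" "n \<noteq> a" using n h by auto
    have M2: "M (n - 1) n = 2" "M (n - 1) a = 2" "M n a = 2"
      unfolding D[OF nn(1,2,3)] D[OF nn(1) an nn(4)] D[OF nn(2) an nn(5)] using n h by auto
    have "strands (r a) (p ` {1..h} \<union> {r (n - 1), r n})
      ({seg p 1 m | m. m \<le> h} \<union> {seg p 1 h @ [r (n - 1)], seg p 1 h @ [r n]} \<union>
       {seg p 1 h @ [r (n - 1), r n] @ rev (seg p j h) | j. 1 \<le> j \<and> j \<le> Suc h})"
    proof (rule strands_fork)
      show "braid_path (p(Suc h := r (n - 1))) (Suc h)" unfolding e1 by (rule pb)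
      show "braid_path (p(Suc h := r n)) (Suc h)" unfolding e2 by (rule pd)
      show "r (n - 1) \<otimes> r n = r n \<otimes> r (n - 1)" by (rule c[OF nn(1,2) M2(1)])
      show "p j \<otimes> r a = r a \<otimes> p j" if "j \<in> {2..h}" for j
      proof -
        have hj: "a + j \<in> {1..n}" "a + j \<noteq> a" using that h n by auto
        have "M (a + j) a = 2" unfolding D[OF hj(1) an hj(2)] using that h n by auto
        then show ?thesis unfolding p_def by (rule c[OF hj(1) an])
      qed
      show "r (n - 1) \<otimes> r a = r a \<otimes> r (n - 1)" by (rule c[OF nn(1) an M2(2)])
      show "r n \<otimes> r a = r a \<otimes> r n" by (rule c[OF nn(2) an M2(3)])
      show "1 \<le> h" by (rule h(1))
      show "r a \<in> R" using an by simp
    qed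
    moreover have "p ` {1..h} \<union> {r (n - 1), r n} = r ` {a + 1..n}"
    proof (intro equalityI subsetI)
      fix s assume "s \<in> r ` {a + 1..n}"
      then obtain i where i: "s = r i" "i \<in> {a + 1..n}" by blast
      show "s \<in> p ` {1..h} \<union> {r (n - 1), r n}"
      proof (cases "i \<le> n - 2")
        case True
        then have "s = p (i - a)" "i - a \<in> {1..h}" using i h by (auto simp: p_def)
        then show ?thesis by blast
      next
        case False
        then have "i = n - 1 \<or> i = n" using i by auto
        then show ?thesis using i by blast
      qed
    next
      fix s assume "s \<in> p ` {1..h} \<union> {r (n - 1), r n}"
      then consider j where "s = r (a + j)" "j \<in> {1..h}" | "s = r (n - 1)" | "s = r n" by (auto simp: p_def)
      then show "s \<in> r ` {a + 1..n}"
      proof cases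
        case (1 j)
        then show ?thesis using h n by (intro image_eqI[of _ _ "a + j"]) auto
      qed (use h n in auto)
    qed
    ultimately show ?thesis by metis
  qed
  then obtain \<U> where up: "strands (r a) (r ` {a + 1..n}) \<U>" by blast
  have down: "strands (r a) (r ` (\<lambda>j. a - j) ` {1..a - 1}) {seg (\<lambda>j. r (a - j)) 1 m | m. m \<le> a - 1}"
  proof (rule strands_path_label[OF an])
    show "M (a - i) (a - j) = (if i = Suc j \<or> j = Suc i then 3 else 2)"
      if "i \<in> {1..a - 1}" "j \<in> {1..a - 1}" "i \<noteq> j" for i j
    proof -
      have h: "a - i \<in> {1..n - 1}" "a - j \<in> {1..n - 1}" "a - i \<noteq> a - j" using that a by auto
      have "a - i = Suc (a - j) \<or> a - j = Suc (a - i) \<longleftrightarrow> i = Suc j \<or> j = Suc i" using that by auto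
      then show ?thesis using type_D_tail[OF M n(1) h] by simp
    qed
    show "M (a - j) a = 2" if "j \<in> {2..a - 1}" for j
    proof -
      have h: "a - j \<in> {1..n - 1}" "a \<in> {1..n - 1}" "a - j \<noteq> a" using that a by auto
      have "\<not> (a - j = Suc a \<or> a = Suc (a - j))" using that by auto
      then show ?thesis using type_D_tail[OF M n(1) h] by simp
    qed
  qed (use a in auto)
  have im: "(\<lambda>j. a - j) ` {1..a - 1} = {1..a - 1}"
  proof (intro equalityI subsetI)
    show "i \<in> (\<lambda>j. a - j) ` {1..a - 1}" if "i \<in> {1..a - 1}" for i
      using that by (intro image_eqI[of _ _ "a - i"]) auto
  qed auto
  have st: "strands (r a) (r ` ({a + 1..n} \<union> {1..a - 1}))
    {U @ V | U V. U \<in> \<U> \<and> V \<in> {seg (\<lambda>j. r (a - j)) 1 m | m. m \<le> a - 1}}"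
  proof (rule strands_product_label[OF up down[unfolded im] an])
    show "M i j = 2" if "i \<in> {a + 1..n}" "j \<in> {1..a - 1}" for i j
    proof -
      have h: "i \<in> {1..n}" "j \<in> {1..n}" "i \<noteq> j" using that a by auto
      have "j < n - 2" "j + 1 < i" using that a by auto
      then show ?thesis unfolding D[OF h] by auto
    qed
  qed (use a in auto)
  show ?thesis by (rule good_fixed_label[OF st _ _ g x]) (use a e_type_D_odd(3)[OF M n a] in auto)
qed

text \<open>Removing c leaves the path c', n - 2, n - 3, ..., 1, to whose second node c was
  attached: the situation of \<open>strands_two_rows\<close>. The word must end in c', the first
  node of this path, so q = 1; and m = 2, since otherwise \<open>p m\<close> commutes with
  \<open>p 1\<close> and could be written last.\<close>

lemma good_type_D_spin:
  assumes M: "M = type_D n" and n: "n \<ge> 4" "odd n" and c: "{c, c'} = {n - 1, n}" "c \<noteq> c'" "e c = c'"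
    and g: "good (r c) x" and x: "\<delta> x = inv x"
  shows "x = wr [c, n - 2, c']"
proof -
  note D = type_D_eq[OF M n(1)]
  have cc: "c = n - 1 \<and> c' = n \<or> c = n \<and> c' = n - 1" using c by (auto simp: doubleton_eq_iff)
  have cn: "c \<in> {1..n}" "c' \<in> {1..n}" "c > n - 2" "c' > n - 2" using cc n by auto
  define f where "f j = (if j = 1 then c' else n - j)" for j
  define p where "p j = r (f j)" for j
  have f_in: "f j \<in> {1..n}" if "j \<in> {1..n - 1}" for j using that cn by (auto simp: f_def)
  have Mf: "M (f i) (f j) = (if i = Suc j \<or> j = Suc i then 3 else 2)"
    if ij: "i \<in> {1..n - 1}" "j \<in> {1..n - 1}" "i \<noteq> j" for i j
  proof -
    have c'u: "c' = n - 1 \<or> c' = n" using cc by blast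
    have v: "n - k \<in> {1..n - 2}" "n - k = n - 2 \<longleftrightarrow> k = 2" if "k \<in> {1..n - 1}" "k \<noteq> 1" for k
      using that by auto
    consider "i = 1" "j \<noteq> 1" | "j = 1" "i \<noteq> 1" | "i \<noteq> 1" "j \<noteq> 1" using ij by blast
    then show ?thesis
    proof cases
      case 1
      then have "M (f i) (f j) = (if j = 2 then 3 else 2)"
        using type_D_spin(1)[OF M n(1) c'u v(1)[OF ij(2)]] v(2)[OF ij(2)] by (simp add: f_def)
      moreover have "j = 2 \<longleftrightarrow> i = Suc j \<or> j = Suc i" using 1 ij by auto
      ultimately show ?thesis by simp
    next
      case 2
      then have "M (f i) (f j) = (if i = 2 then 3 else 2)"
        using type_D_spin(2)[OF M n(1) c'u v(1)[OF ij(1)]] v(2)[OF ij(1)] by (simp add: f_def)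
      moreover have "i = 2 \<longleftrightarrow> i = Suc j \<or> j = Suc i" using 2 ij by auto
      ultimately show ?thesis by simp
    next
      case 3
      have h: "n - i \<in> {1..n - 1}" "n - j \<in> {1..n - 1}" "n - i \<noteq> n - j" using ij by auto
      have "n - i = Suc (n - j) \<or> n - j = Suc (n - i) \<longleftrightarrow> i = Suc j \<or> j = Suc i" using ij by auto
      then show ?thesis using type_D_tail[OF M n(1) h] 3 by (simp add: f_def)
    qed
  qed
  have Mfc: "M (f j) c = 2" if j: "j \<in> {1..n - 1}" "j \<noteq> 2" for j
  proof (cases "j = 1")
    case True
    obtain m where m: "n = m + 4" using n(1) le_Suc_ex by (metis add.commute)
    have "M c' c = 2" unfolding D[OF cn(2,1) c(2)[symmetric]] using cc m by auto
    then show ?thesis using True by (simp add: f_def)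
  next
    case False
    have v: "n - j \<in> {1..n - 2}" "n - j \<noteq> n - 2" using j False by auto
    have "c = n - 1 \<or> c = n" using cc by blast
    then show ?thesis using type_D_spin(2)[OF M n(1) _ v(1)] v(2) False by (simp add: f_def)
  qed
  have st: "strands (r c) (r ` f ` {1..n - 1}) {seg p 2 m @ seg p 1 q | m q. q < m \<and> m \<le> n - 1}"
    unfolding p_def by (rule strands_two_rows_label[OF cn(1) _ f_in Mf Mfc]) (use n in auto)
  have img: "{1..n} = insert c (f ` {1..n - 1})"
  proof (intro equalityI subsetI)
    fix i assume i: "i \<in> {1..n}"
    consider "i = c" | "i = c'" | "i \<le> n - 2" using i cc by fastforce
    then show "i \<in> insert c (f ` {1..n - 1})"
    proof cases
      case 2
      then show ?thesis using n by (intro insertI2 image_eqI[of _ _ 1]) (auto simp: f_def)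
    next
      case 3
      then show ?thesis using i n by (intro insertI2 image_eqI[of _ _ "n - i"]) (auto simp: f_def)
    qed simp
  qed (use f_in cn in auto)
  have nin: "c \<notin> f ` {1..n - 1}" using cn c(2) by (auto simp: f_def)
  obtain U where U: "U \<in> {seg p 2 m @ seg p 1 q | m q. q < m \<and> m \<le> n - 1}" "x = wp (r c # U)"
      "length (r c # U) = len x" "last (r c # U) = r (e c)"
    using good_strands_label[OF st img nin g x] by blast
  obtain m q where m: "U = seg p 2 m @ seg p 1 q" "q < m" "m \<le> n - 1" using U(1) by blast
  have R: "set (seg p i j) \<subseteq> R" if "1 \<le> i" "j \<le> n - 1" for i j
    using that f_in r_R by (auto simp: set_seg p_def)
  have rc: "r c \<in> R" using cn by simp
  have p1: "r c' = p 1" by (simp add: p_def f_def)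
  have p_eq: "i = 1" if "p i = p 1" "i \<in> {1..n - 1}" for i
  proof -
    have "f i = f 1" using that f_in[of i] f_in[of 1] n r_eq_iff[of "f i" "f 1"] by (simp add: p_def)
    then show ?thesis using that(2) cn by (auto simp: f_def split: if_splits)
  qed
  have lst: "last (r c # U) = p 1" using U(4) c(3) p1 by simp
  have ps: "seg p i m = seg p i (m - 1) @ [p m]" if "1 \<le> m" "i \<le> m" for i m
    using seg_snoc[of i "m - 1" p] that by simp
  have q1: "q = 1"
  proof (cases "q = 0")
    case True
    show ?thesis
    proof (cases "m = 1")
      case m1: True
      then have "r c = p 1" using lst m True by (simp add: seg_empty)
      then show ?thesis unfolding p1[symmetric] using cn c(2) r_eq_iff[of c c'] by auto
    next
      case False
      then have "p m = p 1" using lst m True ps[of m 2] by (simp add: seg_empty)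
      then have "m = 1" using m by (intro p_eq) auto
      then show ?thesis using False by blast
    qed
  next
    case False
    then have "p q = p 1" using lst m ps[of q 1] by simp
    then show ?thesis using m False by (intro p_eq) auto
  qed
  have m2: "m = 2"
  proof (rule ccontr)
    assume "m \<noteq> 2"
    then have m3: "m \<ge> 3" using m(2) q1 by simp
    have U': "U = seg p 2 (m - 1) @ [p m, p 1]" using m(1) q1 m3 ps[of m 2] by (simp add: seg_single)
    have pm: "p m \<in> R" "p 1 \<in> R" "set (seg p 2 (m - 1)) \<subseteq> R"
      using f_in[of m] f_in[of 1] m m3 R[of 2 "m - 1"] by (auto simp: p_def)
    have "p m \<otimes> p 1 = p 1 \<otimes> p m"
      unfolding p_def by (rule commute_label) (use f_in[of m] f_in[of 1] m m3 Mf[of m 1] in auto)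
    then have x': "x = wp (r c # seg p 2 (m - 1) @ [p 1, p m])" using U(2) U' pm rc by simp
    have "last (r c # seg p 2 (m - 1) @ [p 1, p m]) = \<delta> (r c)"
      by (rule good_last[OF g x x']) (use pm rc U(3) U' in auto)
    then have "p m = p 1" using r_e[OF cn(1)] c(3) p1 by simp
    then show False using p_eq[of m] m m3 by auto
  qed
  have "U = [p 2, p 1]" using m(1) q1 m2 by (simp add: seg_single)
  then have "x = wp [r c, r (n - 2), r c']" using U(2) unfolding p1 by (simp add: p_def f_def)
  then show ?thesis by (simp add: wr_def)
qed

lemma pendants_type_D_odd:
  assumes M: "M = type_D n" and n: "n \<ge> 4" "odd n"
  shows "pendants W R = {w0 \<otimes> r i | i. i \<in> {1..n - 2}} \<union>
    {w0 \<otimes> r n \<otimes> r (n - 2) \<otimes> r (n - 1), w0 \<otimes> r (n - 1) \<otimes> r (n - 2) \<otimes> r n}"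
proof -
  note D = type_D_eq[OF M n(1)] and e = e_type_D_odd[OF M n]
  define I where "I = (\<lambda>i. [i]) ` {1..n - 2} \<union> {[n, n - 2, n - 1], [n - 1, n - 2, n]}"
  have "pendants W R = {w0 \<otimes> wr ks | ks. ks \<in> I}"
  proof (rule pendants_words)
    show "n \<ge> 2" using n by simp
    show "\<exists>ks\<in>I. x = wr ks" if a: "a \<in> {1..n}" "good (r a) x" "\<delta> x = inv x" for a x
    proof -
      consider "a \<in> {1..n - 2}" | "a = n - 1" | "a = n" using a(1) by fastforce
      then show ?thesis
      proof cases
        case 1
        then show ?thesis using good_type_D_path[OF M n 1 a(2,3)] unfolding I_def by blast
      next
        case 2
        then have "x = wr [n - 1, n - 2, n]" using good_type_D_spin[OF M n, of "n - 1" n x] e(1) a n by simp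
        then show ?thesis unfolding I_def by blast
      next
        case 3
        then have "x = wr [n, n - 2, n - 1]"
          using good_type_D_spin[OF M n, of n "n - 1" x] e(2) a n by (simp add: insert_commute)
        then show ?thesis unfolding I_def by blast
      qed
    qed
    show "rev ks \<in> I" if "ks \<in> I" for ks using that by (auto simp: I_def)
    have M3: "M n (n - 2) = 3" "M (n - 2) n = 3" "M (n - 1) (n - 2) = 3" "M (n - 2) (n - 1) = 3"
      using n D[of n "n - 2"] D[of "n - 2" n] D[of "n - 1" "n - 2"] D[of "n - 2" "n - 1"] by auto
    have e2: "e (n - 2) = n - 2" using e(3)[of "n - 2"] n by simp
    have w: "ks \<noteq> [] \<and> distinct ks \<and> set ks \<subseteq> {1..n} \<and>
        successively (\<lambda>i j. M i j \<noteq> 2) ks \<and> map e ks = rev ks"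
      if "ks = [n, n - 2, n - 1] \<or> ks = [n - 1, n - 2, n]" for ks
    proof -
      have "Suc 0 \<le> n - 2" "Suc 0 \<le> n - Suc 0" using n by auto
      then show ?thesis using that n M3 e(1,2) e2 by auto
    qed
    show "ks \<noteq> [] \<and> distinct ks \<and> set ks \<subseteq> {1..n} \<and>
        successively (\<lambda>i j. M i j \<noteq> 2) ks \<and> map e ks = rev ks" if ks: "ks \<in> I" for ks
    proof -
      consider i where "ks = [i]" "i \<in> {1..n - 2}" | "ks = [n, n - 2, n - 1] \<or> ks = [n - 1, n - 2, n]"
        using ks unfolding I_def by blast
      then show ?thesis
      proof cases
        case (1 i)
        then show ?thesis using e(3)[of i] by auto
      next
        case 2
        then show ?thesis by (rule w)
      qed
    qed
  qed
  also have "\<dots> = (\<lambda>ks. w0 \<otimes> wr ks) ` I" by blast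
  also have "\<dots> = (\<lambda>i. w0 \<otimes> wr [i]) ` {1..n - 2} \<union> {w0 \<otimes> wr [n, n - 2, n - 1], w0 \<otimes> wr [n - 1, n - 2, n]}"
    by (simp add: I_def image_Un image_image)
  finally have *: "pendants W R = (\<lambda>i. w0 \<otimes> wr [i]) ` {1..n - 2} \<union>
    {w0 \<otimes> wr [n, n - 2, n - 1], w0 \<otimes> wr [n - 1, n - 2, n]}" .
  have "(\<lambda>i. w0 \<otimes> wr [i]) ` {1..n - 2} = {w0 \<otimes> r i | i. i \<in> {1..n - 2}}"
    unfolding Setcompr_eq_image by (rule image_cong) (auto simp: wr_def)
  moreover have "r n \<in> R" "r (n - 1) \<in> R" "r (n - 2) \<in> R" using n by (auto intro!: r_R)
  then have "w0 \<otimes> wr [n, n - 2, n - 1] = w0 \<otimes> r n \<otimes> r (n - 2) \<otimes> r (n - 1)"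
    "w0 \<otimes> wr [n - 1, n - 2, n] = w0 \<otimes> r (n - 1) \<otimes> r (n - 2) \<otimes> r n"
    by (simp_all add: wr_def m_assoc)
  ultimately show ?thesis unfolding * by (simp only:)
qed

end

section \<open>Type E6\<close>

context labelled_coxeter
begin

lemma graph_E6:
  assumes M: "M = type_E" and n: "n = 6"
  shows "graph edges_E6"
  unfolding graph_def
proof (intro ballI impI)
  fix i j assume "i \<in> {1..n}" "j \<in> {1..n}" "i \<noteq> j"
  then show "M i j = (if (i, j) \<in> set edges_E6 then 3 else 2)"
    unfolding n interval_6 M by (elim disjE) (simp_all add: type_E_def sym_matrix_def edges_E6_def)
qed

lemma type_E6_set: "n = 6 \<Longrightarrow> {1..n} = {1, 2, 3, 4, 5, 6}"
  by auto

lemma good_E6_2: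
  assumes M: "M = type_E" and n: "n = 6" and g: "good (r 2) x" and x: "\<delta> x = inv x"
  shows "x = wr [2]"
proof -
  have st: "strands (r 2) (r ` set [1, 3, 4, 5, 6]) (map r ` fst ` set cert_E6_2)"
    by (rule strands_check[OF graph_E6[OF M n] _ _ check_E6_2]) (use n in auto)
  show ?thesis by (rule good_fixed_label[OF st _ _ g x]) (use type_E6_set[OF n] e_type_E6[OF M n] in auto)
qed

text \<open>Three path families, one for each arm at the centre, are multiplied; node 4 is fixed by
  \<open>e\<close>.\<close>

lemma good_E6_4:
  assumes M: "M = type_E" and n: "n = 6" and g: "good (r 4) x" and x: "\<delta> x = inv x"
  shows "x = wr [4]"
proof -
  have iv2: "j \<in> {1..2} \<longleftrightarrow> j = 1 \<or> j = 2" for j :: nat by auto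
  have a: "4 \<in> {1..n}" using n by simp
  have s2: "strands (r 4) (r ` (\<lambda>_. 2) ` {1..1::nat}) {seg (\<lambda>_. r 2) 1 m | m. m \<le> 1}"
    by (rule strands_path_label) (use n in auto)
  define f :: "nat \<Rightarrow> nat" where "f j = (if j = 1 then 3 else 1)" for j
  define h :: "nat \<Rightarrow> nat" where "h j = (if j = 1 then 5 else 6)" for j
  have sf: "strands (r 4) (r ` f ` {1..2}) {seg (\<lambda>j. r (f j)) 1 m | m. m \<le> 2}"
    by (rule strands_path_label) (use n in \<open>auto simp: f_def iv2 M type_E_def sym_matrix_def\<close>)
  have sh: "strands (r 4) (r ` h ` {1..2}) {seg (\<lambda>j. r (h j)) 1 m | m. m \<le> 2}"
    by (rule strands_path_label) (use n in \<open>auto simp: h_def iv2 M type_E_def sym_matrix_def\<close>)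
  have im: "f ` {1..2} = {3, 1}" "h ` {1..2} = {5, 6}" "(\<lambda>_. 2) ` {1..1::nat} = {2::nat}"
  proof -
    have "{1..2::nat} = {1, 2}" by auto
    then show "f ` {1..2} = {3, 1}" "h ` {1..2} = {5, 6}" by (auto simp: f_def h_def)
  qed simp
  have c1: "M i j = 2" if "i \<in> {2}" "j \<in> {3, 1}" for i j
    using that by (auto simp: M type_E_def sym_matrix_def)
  have c2: "M i j = 2" if "i \<in> {2} \<union> {3, 1}" "j \<in> {5, 6}" for i j
    using that by (elim UnE insertE emptyE) (simp_all add: M type_E_def sym_matrix_def)
  have sub: "{2} \<subseteq> {1..n}" "{3, 1} \<subseteq> {1..n}" "{2} \<union> {3, 1} \<subseteq> {1..n}" "{5, 6} \<subseteq> {1..n}" using n by auto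
  note st = strands_product_label[OF strands_product_label[OF s2[unfolded im] sf[unfolded im] a sub(1,2) c1]
    sh[unfolded im] a sub(3,4) c2]
  show ?thesis by (rule good_fixed_label[OF st _ _ g x]) (use type_E6_set[OF n] e_type_E6[OF M n] in auto)
qed

lemma good_E6_1:
  assumes M: "M = type_E" and n: "n = 6" and g: "good (r 1) x" and x: "\<delta> x = inv x"
  shows "x = wr [1, 3, 4, 5, 6]"
proof -
  have st: "strands (r 1) (r ` set [2, 3, 4, 5, 6]) (map r ` fst ` set cert_E6_1)"
    by (rule strands_check[OF graph_E6[OF M n] _ _ check_E6_1]) (use n in auto)
  have A: "{1..n} = insert 1 (set [2, 3, 4, 5, 6])" "1 \<notin> set [2, 3, 4, 5, 6::nat]"
    using type_E6_set[OF n] by simp_all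
  obtain U where U: "U \<in> map r ` fst ` set cert_E6_1" "x = wp (r 1 # U)" "last (r 1 # U) = r (e 1)"
    using good_strands_label[OF st A g x] by blast
  from U(1) obtain V where V: "V \<in> fst ` set cert_E6_1" "U = map r V" by blast
  \<comment> \<open>By inspection of the certificate: only one of its words ends in 6, the image of
    node 1 under \<open>e\<close>.\<close>
  have all: "set V \<subseteq> {1..6} \<and> (last (1 # V) = 6 \<longrightarrow> V = [3, 4, 5, 6])"
    using V(1) unfolding cert_E6_1_def by (elim imageE) auto
  have lm: "last (map r (1 # V)) = r (last (1 # V))" by (rule last_map) simp
  have "r (last (1 # V)) = r 6"
    using U(3) unfolding lm[symmetric] V(2) e_type_E6(1)[OF M n] by (simp only: list.map)
  moreover have "last (1 # V) \<in> {1..n}" using all last_in_set[of "1 # V"] n by auto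
  ultimately have "last (1 # V) = 6" using r_eq_iff[of "last (1 # V)" 6] n by simp
  then show ?thesis using all U(2) V(2) by (simp add: wr_def)
qed

text \<open>Removing node 3 leaves node 1 and the path 2, 4, 5, 6, to whose second node 3 was
  attached. The last letter must be \<open>r 5\<close>, which leaves two words; the longer one is
  excluded by its support.\<close>

lemma good_E6_3:
  assumes M: "M = type_E" and n: "n = 6" and g: "good (r 3) x" and x: "\<delta> x = inv x"
  shows "x = wr [3, 4, 5]"
proof -
  have iv4: "j \<in> {1..4} \<longleftrightarrow> j = 1 \<or> j = 2 \<or> j = 3 \<or> j = 4" for j :: nat by auto
  have a: "3 \<in> {1..n}" using n by simp
  have s1: "strands (r 3) (r ` (\<lambda>_. 1) ` {1..1::nat}) {seg (\<lambda>_. r 1) 1 m | m. m \<le> 1}"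
    by (rule strands_path_label) (use n in auto)
  define f :: "nat \<Rightarrow> nat" where "f j = (if j = 1 then 2 else j + 2)" for j
  define p where "p j = r (f j)" for j
  have sf: "strands (r 3) (r ` f ` {1..4}) {seg p 2 m @ seg p 1 q | m q. q < m \<and> m \<le> 4}"
    unfolding p_def
  proof (rule strands_two_rows_label[OF a])
    show "M (f i) (f j) = (if i = Suc j \<or> j = Suc i then 3 else 2)"
      if "i \<in> {1..4}" "j \<in> {1..4}" "i \<noteq> j" for i j
      using that unfolding iv4 M by (elim disjE) (simp_all add: f_def type_E_def sym_matrix_def)
    show "M (f j) 3 = 2" if "j \<in> {1..4}" "j \<noteq> 2" for j
      using that unfolding iv4 M by (elim disjE) (simp_all add: f_def type_E_def sym_matrix_def)
  qed (auto simp: f_def n)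
  have "{1..4::nat} = {1, 2, 3, 4}" by auto
  then have im: "f ` {1..4} = {2, 4, 5, 6}" "(\<lambda>_. 1) ` {1..1::nat} = {1::nat}" by (auto simp: f_def)
  have R: "r i \<in> R" if "i \<in> {1..6}" for i using that n by simp
  have ne: "r i \<noteq> r j" if "i \<in> {1..6}" "j \<in> {1..6}" "i \<noteq> j" for i j using r_eq_iff[of i j] that n by simp
  have d3: "\<delta> (r 3) = r 5" using r_e[OF a] e_type_E6(3)[OF M n] by simp
  obtain U V where UV: "U \<in> {seg (\<lambda>_. r 1) 1 m | m. m \<le> 1}" "V \<in> {seg p 2 m @ seg p 1 q | m q. q < m \<and> m \<le> 4}"
      "x = wp (r 3 # U @ V)" "length (r 3 # U @ V) = len x"
      "last (r 3 # U) \<in> {r 3, r 5}" "last (r 3 # V) \<in> {r 3, r 5}" "U = [] \<longrightarrow> V = [] \<longrightarrow> r 5 = r 3"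
  proof -
    have comm: "s \<otimes> t = t \<otimes> s" if st: "s \<in> r ` {1}" "t \<in> r ` {2, 4, 5, 6}" for s t
    proof -
      obtain j where j: "s = r 1" "t = r j" "j \<in> {2, 4, 5, 6}" using st by blast
      show ?thesis unfolding j(1,2)
        by (rule commute_label) (use j(3) n in \<open>auto simp: M type_E_def sym_matrix_def\<close>)
    qed
    have Req: "R = insert (r 3) (r ` {1} \<union> r ` {2, 4, 5, 6})"
      unfolding R_eq type_E6_set[OF n] by (simp add: insert_commute)
    have "r 3 \<notin> r ` {1} \<union> r ` {2, 4, 5, 6}"
      using ne[of 3 1] ne[of 3 2] ne[of 3 4] ne[of 3 5] ne[of 3 6] by auto
    from good_two_ends[OF s1[unfolded im] sf[unfolded im] Req this comm g x] show thesis
      unfolding d3 using that by blast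
  qed
  have "U = [] \<or> U = [r 1]" using UV(1) by (auto simp: le_Suc_eq seg_empty seg_single)
  then have U: "U = []" using UV(5) ne[of 1 3] ne[of 1 5] by auto
  obtain m q where m: "V = seg p 2 m @ seg p 1 q" "q < m" "m \<le> 4" using UV(2) by blast
  have s2: "seg p 2 1 = []" "seg p 2 2 = [r 4]" "seg p 2 3 = [r 4, r 5]" "seg p 2 4 = [r 4, r 5, r 6]"
    and s1': "seg p 1 0 = []" "seg p 1 1 = [r 2]" "seg p 1 2 = [r 2, r 4]" "seg p 1 3 = [r 2, r 4, r 5]"
    by (simp_all add: seg_def p_def f_def eval_nat_numeral)
  have p3: "i = 3" if i: "p i \<in> {r 3, r 5}" "i \<in> {1..4}" for i
  proof -
    have fi: "f i \<in> {1..6}" using i(2) by (auto simp: f_def)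
    have "f i = 3 \<or> f i = 5" using i(1) ne[OF fi, of 3] ne[OF fi, of 5] unfolding p_def by force
    then show ?thesis by (auto simp: f_def split: if_splits)
  qed
  have V: "V = [r 4, r 5] \<or> V = [r 4, r 5, r 6, r 2, r 4, r 5]"
  proof (cases "q = 0")
    case True
    show ?thesis
    proof (cases "m = 1")
      case m1: True
      have "V = []" unfolding m(1) True m1 by (simp add: seg_empty)
      then show ?thesis using UV(7) U ne[of 5 3] by simp
    next
      case False
      have "seg p 2 m = seg p 2 (m - 1) @ [p m]" using seg_snoc[of 2 "m - 1" p] False m(2) by simp
      then have "last (r 3 # V) = p m" unfolding m(1) True by (simp add: seg_empty)
      then have "m = 3" using UV(6) m(2,3) by (intro p3) auto
      then show ?thesis unfolding m(1) True by (simp only: s2 s1') simp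
    qed
  next
    case False
    have "seg p 1 q = seg p 1 (q - 1) @ [p q]" using seg_snoc[of 1 "q - 1" p] False by simp
    then have "last (r 3 # V) = p q" unfolding m(1) by simp
    then have q: "q = 3" using UV(6) m(2,3) False by (intro p3) auto
    then have "m = 4" using m(2,3) by simp
    then show ?thesis unfolding m(1) q by (simp only: s2 s1') simp
  qed
  from V show ?thesis
  proof
    assume "V = [r 4, r 5]"
    then show ?thesis using UV(3) U by (simp add: wr_def)
  next
    assume V: "V = [r 4, r 5, r 6, r 2, r 4, r 5]"
    define ws where "ws = [r 3, r 4, r 5, r 6, r 2, r 4, r 5]"
    have ws: "x = wp ws" "length ws = len x" "set ws \<subseteq> R" using UV(3,4) V U R by (auto simp: ws_def)
    have xc: "x \<in> carrier W" using ws by simp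
    have dR: "set (map \<delta> ws) \<subseteq> R" using ws(3) by auto
    \<comment> \<open>\<open>map \<delta> ws\<close> and \<open>rev ws\<close> are reduced words of
      the same element, so the former uses only letters of the latter; but \<delta> turns
      \<open>r 6\<close> into \<open>r 1\<close>, which is absent from \<open>ws\<close>.\<close>
    have "wp (map \<delta> ws) = wp (rev ws)" using x ws w0_conj_wp[OF ws(3)] by (simp add: wp_rev)
    moreover have "length (map \<delta> ws) = len (wp (map \<delta> ws))"
      using ws w0_conj_wp[OF ws(3)] len_w0_conj[OF xc] by simp
    ultimately have "set (map \<delta> ws) \<subseteq> set (rev ws)"
      using in_parabolic_of_reduced[of "rev ws" "set (rev ws)" "map \<delta> ws"] ws(3) dR by simp
    moreover have "r 1 \<in> set (map \<delta> ws)" using r_e[of 6] e_type_E6(6)[OF M n] n by (simp add: ws_def)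
    ultimately have "r 1 \<in> set ws" by auto
    then show ?thesis
      using ne[of 1 3] ne[of 1 4] ne[of 1 5] ne[of 1 6] ne[of 1 2] by (simp add: ws_def del: One_nat_def)
  qed
qed

text \<open>Relabelling along the symmetry of the diagram reduces the nodes 5 and 6 to the nodes 3
  and 1.\<close>

lemma good_type_E6:
  assumes M: "M = type_E" and n: "n = 6" and a: "a \<in> {1..n}" and g: "good (r a) x" and x: "\<delta> x = inv x"
  shows "\<exists>ks\<in>{[2], [4], [5, 4, 3], [3, 4, 5], [6, 5, 4, 3, 1], [1, 3, 4, 5, 6]}. x = wr ks"
proof -
  define f :: "nat \<Rightarrow> nat" where "f i = (if i = 1 then 6 else if i = 3 then 5 else if i = 5 then 3
    else if i = 6 then 1 else i)" for i
  interpret flip: labelled_coxeter W R w0 "\<lambda>i. r (f i)" n M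
  proof
    have "bij_betw f {1..n} {1..n}"
      by (rule bij_betw_byWitness[where f' = f]) (auto simp: f_def n)
    then show "bij_betw (\<lambda>i. r (f i)) {1..n} R" using bij_betw_trans[OF _ bij] by (simp add: comp_def)
    show "labelled_type W (\<lambda>i. r (f i)) n M" unfolding labelled_type_def
    proof (intro ballI)
      fix i j assume ij: "i \<in> {1..n}" "j \<in> {1..n}"
      then have "f i \<in> {1..n}" "f j \<in> {1..n}" by (auto simp: f_def n)
      moreover have "M (f i) (f j) = M i j"
        using ij unfolding n interval_6 M by (elim disjE) (simp_all add: f_def type_E_def sym_matrix_def)
      ultimately show "ord (r (f i) \<otimes> r (f j)) = M i j" using ord_r by simp
    qed
  qed
  have f: "f 1 = 6" "f 3 = 5" "f 4 = 4" "f 5 = 3" "f 6 = 1" by (simp_all add: f_def)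
  consider "a = 1" | "a = 2" | "a = 3" | "a = 4" | "a = 5" | "a = 6" using a n interval_6[of a] by blast
  then show ?thesis
  proof cases
    case 1
    have "x = wr [1, 3, 4, 5, 6]" by (rule good_E6_1[OF M n g[unfolded 1] x])
    then show ?thesis by blast
  next
    case 2
    have "x = wr [2]" by (rule good_E6_2[OF M n g[unfolded 2] x])
    then show ?thesis by blast
  next
    case 3
    have "x = wr [3, 4, 5]" by (rule good_E6_3[OF M n g[unfolded 3] x])
    then show ?thesis by blast
  next
    case 4
    have "x = wr [4]" by (rule good_E6_4[OF M n g[unfolded 4] x])
    then show ?thesis by blast
  next
    case 5
    have "good (r (f 3)) x" using g unfolding f 5 .
    then have "x = flip.wr [3, 4, 5]" by (rule flip.good_E6_3[OF M n _ x])
    then have "x = wr [5, 4, 3]" unfolding flip.wr_def wr_def list.map f .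
    then show ?thesis by blast
  next
    case 6
    have "good (r (f 1)) x" using g unfolding f 6 .
    then have "x = flip.wr [1, 3, 4, 5, 6]" by (rule flip.good_E6_1[OF M n _ x])
    then have "x = wr [6, 5, 4, 3, 1]" unfolding flip.wr_def wr_def list.map f .
    then show ?thesis by blast
  qed
qed

lemma pendants_type_E6:
  assumes M: "M = type_E" and n: "n = 6"
  shows "pendants W R =
    {w0 \<otimes> r 2, w0 \<otimes> r 4, w0 \<otimes> r 5 \<otimes> r 4 \<otimes> r 3, w0 \<otimes> r 3 \<otimes> r 4 \<otimes> r 5,
     w0 \<otimes> r 6 \<otimes> r 5 \<otimes> r 4 \<otimes> r 3 \<otimes> r 1, w0 \<otimes> r 1 \<otimes> r 3 \<otimes> r 4 \<otimes> r 5 \<otimes> r 6}"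
proof -
  define I :: "nat list set" where "I = {[2], [4], [5, 4, 3], [3, 4, 5], [6, 5, 4, 3, 1], [1, 3, 4, 5, 6]}"
  have "pendants W R = {w0 \<otimes> wr ks | ks. ks \<in> I}"
  proof (rule pendants_words)
    show "\<exists>ks\<in>I. x = wr ks" if "a \<in> {1..n}" "good (r a) x" "\<delta> x = inv x" for a x
      using good_type_E6[OF M n that] unfolding I_def .
    show "ks \<noteq> [] \<and> distinct ks \<and> set ks \<subseteq> {1..n} \<and>
        successively (\<lambda>i j. M i j \<noteq> 2) ks \<and> map e ks = rev ks" if "ks \<in> I" for ks
      using that e_type_E6[OF M n] n unfolding I_def
      by (elim insertE) (simp_all add: M type_E_def sym_matrix_def)
    show "rev ks \<in> I" if "ks \<in> I" for ks using that by (auto simp: I_def)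
  qed (use n in simp)
  also have "\<dots> = (\<lambda>ks. w0 \<otimes> wr ks) ` I" by blast
  also have "\<dots> = {w0 \<otimes> wr [2], w0 \<otimes> wr [4], w0 \<otimes> wr [5, 4, 3], w0 \<otimes> wr [3, 4, 5],
      w0 \<otimes> wr [6, 5, 4, 3, 1], w0 \<otimes> wr [1, 3, 4, 5, 6]}"
    by (simp only: I_def image_insert image_empty)
  finally have *: "pendants W R = {w0 \<otimes> wr [2], w0 \<otimes> wr [4], w0 \<otimes> wr [5, 4, 3], w0 \<otimes> wr [3, 4, 5],
      w0 \<otimes> wr [6, 5, 4, 3, 1], w0 \<otimes> wr [1, 3, 4, 5, 6]}" .
  have R: "r 1 \<in> R" "r 2 \<in> R" "r 3 \<in> R" "r 4 \<in> R" "r 5 \<in> R" "r 6 \<in> R" using n by simp_all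
  have "wr [2] = r 2" "wr [4] = r 4" "w0 \<otimes> wr [5, 4, 3] = w0 \<otimes> r 5 \<otimes> r 4 \<otimes> r 3"
    "w0 \<otimes> wr [3, 4, 5] = w0 \<otimes> r 3 \<otimes> r 4 \<otimes> r 5"
    "w0 \<otimes> wr [6, 5, 4, 3, 1] = w0 \<otimes> r 6 \<otimes> r 5 \<otimes> r 4 \<otimes> r 3 \<otimes> r 1"
    "w0 \<otimes> wr [1, 3, 4, 5, 6] = w0 \<otimes> r 1 \<otimes> r 3 \<otimes> r 4 \<otimes> r 5 \<otimes> r 6"
    using R by (simp_all add: wr_def m_assoc)
  then show ?thesis unfolding * by (simp only:)
qed

section \<open>Types with central longest element, and the combined result\<close>

lemma central_types:
  shows "M = type_B n \<Longrightarrow> n \<ge> 2 \<Longrightarrow> w0 \<in> center W"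
    and "M = type_D n \<Longrightarrow> n \<ge> 4 \<Longrightarrow> even n \<Longrightarrow> w0 \<in> center W"
    and "M = type_F \<Longrightarrow> n = 4 \<Longrightarrow> w0 \<in> center W"
    and "M = type_H \<Longrightarrow> n = 3 \<or> n = 4 \<Longrightarrow> w0 \<in> center W"
    and "M = type_E \<Longrightarrow> n = 7 \<or> n = 8 \<Longrightarrow> w0 \<in> center W"
    and "M = type_I2 m \<Longrightarrow> n = 2 \<Longrightarrow> even m \<Longrightarrow> w0 \<in> center W"
  unfolding central_iff
  using e_type_B e_type_D_even e_type_F e_type_H e_type_E78 e_type_I2_even by blast+

lemma noncentral_types:
  shows "M = type_A \<Longrightarrow> n \<ge> 2 \<Longrightarrow> w0 \<notin> center W"
    and "M = type_D n \<Longrightarrow> n \<ge> 4 \<Longrightarrow> odd n \<Longrightarrow> w0 \<notin> center W"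
    and "M = type_E \<Longrightarrow> n = 6 \<Longrightarrow> w0 \<notin> center W"
    and "M = type_I2 m \<Longrightarrow> n = 2 \<Longrightarrow> odd m \<Longrightarrow> m \<ge> 3 \<Longrightarrow> w0 \<notin> center W"
proof -
  have *: "w0 \<notin> center W" if "i \<in> {1..n}" "e i \<noteq> i" for i unfolding central_iff using that by blast
  show "w0 \<notin> center W" if "M = type_A" "n \<ge> 2"
    using *[of 1] e_type_A[OF that(1), of 1] that by simp
  show "w0 \<notin> center W" if "M = type_D n" "n \<ge> 4" "odd n"
    using *[of n] e_type_D_odd(2)[OF that] that by simp
  show "w0 \<notin> center W" if "M = type_E" "n = 6"
    using *[of 6] e_type_E6(6)[OF that] that by simp
  show "w0 \<notin> center W" if "M = type_I2 m" "n = 2" "odd m" "m \<ge> 3"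
    using *[of 2] e_type_I2_odd(2)[OF that] that by simp
qed

end

lemma (in finite_coxeter) has_typeE:
  assumes "has_type W R n M"
  obtains q where "labelled_coxeter W R w0 q n M"
proof -
  obtain q where "bij_betw q {1..n} R" "labelled_type W q n M" using assms unfolding has_type_def by blast
  then have "labelled_coxeter W R w0 q n M" by unfold_locales
  then show thesis by (rule that)
qed

text \<open>Besides the listed types the classification leaves only A, D with n odd, E6 and I2(m)
  with m odd, and in each of these w0 moves some label.\<close>

lemma (in finite_coxeter) central_iff_has_type:
  assumes irr: "irreducible_coxeter W R" and n: "card R = n" "n \<ge> 2"
  shows "w0 \<in> center W \<longleftrightarrow>
    has_type W R n (type_B n) \<or>
    (n \<ge> 4 \<and> even n \<and> has_type W R n (type_D n)) \<or>
    has_type W R 4 type_F \<or>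
    has_type W R 3 type_H \<or>
    has_type W R 4 type_H \<or>
    has_type W R 7 type_E \<or>
    has_type W R 8 type_E \<or>
    (\<exists>m. m \<ge> 3 \<and> even m \<and> has_type W R 2 (type_I2 m))" (is "?L \<longleftrightarrow> ?R")
proof
  note C = labelled_coxeter.central_types
  assume ?R
  then show ?L
  proof (elim disjE conjE exE)
    show ?L if "has_type W R n (type_B n)"
      by (rule has_typeE[OF that]) (erule C(1)[OF _ HOL.refl n(2)])
    show ?L if "n \<ge> 4" "even n" "has_type W R n (type_D n)"
      by (rule has_typeE[OF that(3)]) (erule C(2)[OF _ HOL.refl that(1,2)])
    show ?L if "has_type W R 4 type_F"
      by (rule has_typeE[OF that]) (erule C(3)[OF _ HOL.refl HOL.refl])
    show ?L if "has_type W R 3 type_H"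
      by (rule has_typeE[OF that]) (erule C(4)[OF _ HOL.refl disjI1[OF HOL.refl]])
    show ?L if "has_type W R 4 type_H"
      by (rule has_typeE[OF that]) (erule C(4)[OF _ HOL.refl disjI2[OF HOL.refl]])
    show ?L if "has_type W R 7 type_E"
      by (rule has_typeE[OF that]) (erule C(5)[OF _ HOL.refl disjI1[OF HOL.refl]])
    show ?L if "has_type W R 8 type_E"
      by (rule has_typeE[OF that]) (erule C(5)[OF _ HOL.refl disjI2[OF HOL.refl]])
    show ?L if "m \<ge> 3" "even m" "has_type W R 2 (type_I2 m)" for m
      by (rule has_typeE[OF that(3)]) (erule C(6)[OF _ HOL.refl HOL.refl that(2)])
  qed
next
  note N = labelled_coxeter.noncentral_types
  assume L: ?L
  have "\<not> has_type W R n type_A"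
  proof
    assume "has_type W R n type_A"
    then obtain q where q: "labelled_coxeter W R w0 q n type_A" by (rule has_typeE)
    show False using N(1)[OF q HOL.refl n(2)] L by (rule notE)
  qed
  moreover have "even n" if n4: "n \<ge> 4" "has_type W R n (type_D n)"
  proof (rule ccontr)
    assume odd: "odd n"
    obtain q where q: "labelled_coxeter W R w0 q n (type_D n)" using n4(2) by (rule has_typeE)
    show False using N(2)[OF q HOL.refl n4(1) odd] L by (rule notE)
  qed
  moreover have "\<not> has_type W R 6 type_E"
  proof
    assume "has_type W R 6 type_E"
    then obtain q where q: "labelled_coxeter W R w0 q 6 type_E" by (rule has_typeE)
    show False using N(3)[OF q HOL.refl HOL.refl] L by (rule notE)
  qed
  moreover have "even m" if m3: "m \<ge> 3" "has_type W R 2 (type_I2 m)" for m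
  proof (rule ccontr)
    assume odd: "odd m"
    obtain q where q: "labelled_coxeter W R w0 q 2 (type_I2 m)" using m3(2) by (rule has_typeE)
    show False using N(4)[OF q HOL.refl HOL.refl odd m3(1)] L by (rule notE)
  qed
  ultimately show ?R using has_type_cases[OF irr] unfolding n(1) by blast
qed

theorem theorem1p6:
  fixes W :: "('a, 'b) monoid_scheme" (structure)
    and R :: "'a set" and r :: "nat \<Rightarrow> 'a" and n :: nat and w0 :: 'a
  assumes "coxeter_system W R"
    and "finite (carrier W)"
    and "irreducible_coxeter W R"
    and "n \<ge> 2"
    and "bij_betw r {1..n} R"
    and "longest_element W R w0"
  shows
    "(w0 \<in> center W \<longleftrightarrow>
        has_type W R n (type_B n) \<or>
        (n \<ge> 4 \<and> even n \<and> has_type W R n (type_D n)) \<or>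
        has_type W R 4 type_F \<or>
        has_type W R 3 type_H \<or>
        has_type W R 4 type_H \<or>
        has_type W R 7 type_E \<or>
        has_type W R 8 type_E \<or>
        (\<exists>m. m \<ge> 3 \<and> even m \<and> has_type W R 2 (type_I2 m))) \<and>
     (w0 \<in> center W \<longrightarrow> pendants W R = {w0 \<otimes> s | s. s \<in> R}) \<and>
     (labelled_type W r n type_A \<longrightarrow>
        pendants W R = (\<Union>i \<in> {1..nat \<lceil>real n / 2\<rceil>}.
          {w0 \<otimes> ascending W r i (n + 1 - i), w0 \<otimes> descending W r (n + 1 - i) i})) \<and>
     (n \<ge> 4 \<and> odd n \<and> labelled_type W r n (type_D n) \<longrightarrow>
        pendants W R = {w0 \<otimes> r i | i. i \<in> {1..n - 2}} \<union>
          {w0 \<otimes> r n \<otimes> r (n - 2) \<otimes> r (n - 1), w0 \<otimes> r (n - 1) \<otimes> r (n - 2) \<otimes> r n}) \<and>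
     (n = 6 \<and> labelled_type W r 6 type_E \<longrightarrow>
        pendants W R =
          {w0 \<otimes> r 2, w0 \<otimes> r 4, w0 \<otimes> r 5 \<otimes> r 4 \<otimes> r 3, w0 \<otimes> r 3 \<otimes> r 4 \<otimes> r 5,
           w0 \<otimes> r 6 \<otimes> r 5 \<otimes> r 4 \<otimes> r 3 \<otimes> r 1, w0 \<otimes> r 1 \<otimes> r 3 \<otimes> r 4 \<otimes> r 5 \<otimes> r 6}) \<and>
     (\<forall>m. n = 2 \<and> odd m \<and> m \<ge> 5 \<and> labelled_type W r 2 (type_I2 m) \<longrightarrow>
        pendants W R = {w0 \<otimes> r 1 \<otimes> r 2, w0 \<otimes> r 2 \<otimes> r 1})"
proof -
  interpret finite_coxeter W R w0 using assms(1,2,6) by unfold_locales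
  have labelled: "labelled_coxeter W R w0 r n M" if "labelled_type W r n M" for M
    using assms(5) that by unfold_locales
  have n: "card R = n" using bij_betw_same_card[OF assms(5)] by simp
  have two: "\<exists>t\<in>R. t \<noteq> s" if "s \<in> R" for s
  proof (rule ccontr)
    assume "\<not> (\<exists>t\<in>R. t \<noteq> s)"
    then have "R = {s}" using that by blast
    then show False using n assms(4) by simp
  qed
  show ?thesis
  proof (intro conjI impI allI)
    show "w0 \<in> center W \<longleftrightarrow>
        has_type W R n (type_B n) \<or>
        (n \<ge> 4 \<and> even n \<and> has_type W R n (type_D n)) \<or>
        has_type W R 4 type_F \<or>
        has_type W R 3 type_H \<or>
        has_type W R 4 type_H \<or>
        has_type W R 7 type_E \<or>
        has_type W R 8 type_E \<or>
        (\<exists>m. m \<ge> 3 \<and> even m \<and> has_type W R 2 (type_I2 m))"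
      by (rule central_iff_has_type[OF assms(3) n assms(4)])
    show "pendants W R = {w0 \<otimes> s | s. s \<in> R}" if "w0 \<in> center W"
      by (rule pendants_central[OF that two])
    show "pendants W R = (\<Union>i \<in> {1..nat \<lceil>real n / 2\<rceil>}.
        {w0 \<otimes> ascending W r i (n + 1 - i), w0 \<otimes> descending W r (n + 1 - i) i})"
      if "labelled_type W r n type_A"
      by (rule labelled_coxeter.pendants_type_A[OF labelled[OF that] HOL.refl assms(4)])
    show "pendants W R = {w0 \<otimes> r i | i. i \<in> {1..n - 2}} \<union>
        {w0 \<otimes> r n \<otimes> r (n - 2) \<otimes> r (n - 1), w0 \<otimes> r (n - 1) \<otimes> r (n - 2) \<otimes> r n}"
      if "n \<ge> 4 \<and> odd n \<and> labelled_type W r n (type_D n)"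
      by (rule labelled_coxeter.pendants_type_D_odd[OF labelled HOL.refl]) (use that in auto)
    show "pendants W R =
        {w0 \<otimes> r 2, w0 \<otimes> r 4, w0 \<otimes> r 5 \<otimes> r 4 \<otimes> r 3, w0 \<otimes> r 3 \<otimes> r 4 \<otimes> r 5,
         w0 \<otimes> r 6 \<otimes> r 5 \<otimes> r 4 \<otimes> r 3 \<otimes> r 1, w0 \<otimes> r 1 \<otimes> r 3 \<otimes> r 4 \<otimes> r 5 \<otimes> r 6}"
      if "n = 6 \<and> labelled_type W r 6 type_E"
      by (rule labelled_coxeter.pendants_type_E6[OF labelled HOL.refl]) (use that in auto)
    show "pendants W R = {w0 \<otimes> r 1 \<otimes> r 2, w0 \<otimes> r 2 \<otimes> r 1}"
      if "n = 2 \<and> odd m \<and> m \<ge> 5 \<and> labelled_type W r 2 (type_I2 m)" for m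
      by (rule labelled_coxeter.pendants_type_I2_odd[OF labelled HOL.refl]) (use that in auto)
  qed
qed

end
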